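(* Let $\Bbbk$ be a field of characteristic $0$, $A$ a finitely presented associative unital $\Bbbk$-algebra, $V$ a finite-dimensional $\Bbbk$-vector space such that the representation scheme $\mathrm{Rep}(A,V)$ is nonempty, and $\mathfrak g=\mathfrak{gl}(V)$. The evaluation map induces the following canonical morphisms of complexes: $$\big(H_\bullet(A,A),\ \mathsf B\big)\ \xrightarrow{\ \mathrm{ev}\ }\ \big(\Omega^\bullet_{\mathrm{basic}}(\mathrm{Rep}(A,V)),\ d_{DR}\circ(\mathsf N+1)\big),$$ $$\big(\mathrm{DR}_t^\bullet A,\ \mathsf d+i_\Delta\big)\ \xrightarrow{\ \mathrm{ev}\ }\ \big(\Omega^\bullet(\mathrm{Rep}(A,V),\mathfrak g)^{\mathfrak g},\ d_{DR}+d_{\mathfrak g}\big).$$ Here $\mathsf N$ is multiplication by $n$ on $n$-forms, so the differential in the first target is $(n+1)\,d_{DR}$ on $n$-forms.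
   Context: **Representation scheme.** $\mathrm{Rep}(A,V)$ is the affine scheme with $\mathrm{Rep}(A,V)(S)=\mathrm{Hom}_{\mathrm{alg}}(A,S\otimes\mathrm{End}\,V)$ for commutative algebras $S$. Each $a\in A$ gives a tautological function $\hat a\in\mathrm{End}(V)\otimes\Bbbk[\mathrm{Rep}(A,V)]$, $\hat a(\rho)=\rho(a)$. $G=GL(V)$ acts on $\mathrm{Rep}(A,V)$ by conjugation; for $x\in\mathfrak g=\mathrm{End}(V)$ the corresponding vector field $\vec x$ satisfies $\vec x(\hat a)=[x,\hat a]$. $\Omega^\bullet(\mathrm{Rep}(A,V))$ is the algebra of (commutative) Kähler differential forms with de Rham differential $d_{DR}$. A form $\omega$ is basic if $L_{\vec x}\omega=0$ and $i_{\vec x}\omega=0$ for all $x\in\mathfrak g$; basic forms constitute $\Omega^\bullet_{\mathrm{basic}}$. **Equivariant de Rham complex.** $\Omega^\bullet(\mathrm{Rep}(A,V),\mathfrak g)=\Omega^\bullet(\mathrm{Rep}(A,V))\otimes\Bbbk[\mathfrak g]$, with linear functions on $\mathfrak g$ in degree $2$; $\mathfrak g$ acts diagonally (through the conjugation action of $G$ on $\mathrm{Rep}(A,V)$ and the adjoint action on $\mathfrak g$). Put $d_{\mathfrak g}(\omega\otimes f)=\sum_r(i_{\vec e_r}\omega)\otimes(e_r^*f)$ for dual bases $\{e_r\},\{e_r^*\}$ of $\mathfrak g,\mathfrak g^*$, and let $d_{DR}$ act on the first factor. **Noncommutative side.** $\Omega^\bullet A=T_A(\Omega^1A)$, with $\Omega^1A=\ker(A\otimes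 A\to A)$ and $\mathsf d a=1\otimes a-a\otimes1$, is the DG algebra of noncommutative forms. $\Omega_tA=(\Omega A)*\Bbbk[t]$ (free product), with $|t|=2$, $\mathsf d t=0$; $\mathrm{DR}_tA=\Omega_tA/[\Omega_tA,\Omega_tA]$ (supercommutators), with the total grading. $i_\Delta$ is the odd (super)derivation of $\Omega_tA$ with $i_\Delta(a)=0$, $i_\Delta(t)=0$, $i_\Delta(\mathsf d a)=ta-at$ for $a\in A$; it descends to $\mathrm{DR}_tA$, where $(\mathsf d+i_\Delta)^2=0$. **Evaluation.** $\mathrm{ev}_\Omega:\Omega_tA\to\mathrm{End}(V)\otimes\Omega^\bullet(\mathrm{Rep}(A,V))\otimes\Bbbk[\mathfrak g]$ is the DG algebra homomorphism with $a\mapsto\hat a$, $\mathsf d a\mapsto d_{DR}\hat a$, and $t\mapsto\hat t$, the canonical element $\mathrm{Id}\in\mathfrak g\otimes\mathfrak g^*\subset\mathrm{End}(V)\otimes\Bbbk[\mathfrak g]$. Composing it with the trace $\mathrm{Tr}$ on $\mathrm{End}(V)$ gives a map that descends to $\mathrm{DR}_tA$ and has $\mathfrak g$-invariant values; this is the map $\mathrm{ev}$ in the second line. **Hochschild side.** $H_\bullet(A,A)$ is the homology of $(\Omega^\bullet A,\mathsf b)$, $\mathsf b(\alpha\,\mathsf d a)=(-1)^{\deg\alpha}[\alpha,a]$, $\mathsf b|_{\Omega^0A}=0$. The differential $\mathsf B$ on $H_\bullet(A,A)$ is induced by Connes' operator $\mathsf B(a_0\,\mathsf d a_1\cdots\mathsf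 d a_n)=\sum_{i=0}^n(-1)^{ni}\mathsf d a_i\cdots\mathsf d a_n\,\mathsf d a_0\cdots\mathsf d a_{i-1}$. Sending the class of a $\mathsf b$-cycle to its class in $\mathrm{DR}^\bullet A=\Omega A/[\Omega A,\Omega A]\subset\mathrm{DR}_tA$ identifies $H_\bullet(A,A)$ with the kernel of $i_\Delta$ on $\mathrm{DR}^\bullet A$; the first map is the restriction of $\mathrm{ev}$ to this kernel. *)

theory Defs
  imports Complex_Main "HOL.Hull" "HOL-Library.Poly_Mapping"
begin

text \<open>
  Conventions. Every algebra below is a quotient of a free object which is an honest type:
  a free associative algebra \<open>'x word \<Rightarrow>\<^sub>0 'k\<close> or a polynomial ring \<open>('x \<Rightarrow>\<^sub>0 nat) \<Rightarrow>\<^sub>0 'k\<close>.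
  An element of the quotient is given by a representative, and two representatives are
  equal in the quotient iff their difference lies in the ideal of relations. A generator family
  that should be indexed by a subset of a type is indexed by the whole type, and the superfluous
  generators are put into the ideal of relations.
\<close>

subsection \<open>Free algebras and their quotients\<close>

datatype 'x word = Word (letters: "'x list")

instantiation word :: (type) monoid_add
begin

definition zero_word :: "'a word" where
  "0 = Word []"

definition plus_word :: "'a word \<Rightarrow> 'a word \<Rightarrow> 'a word" where
  "u + v = Word (letters u @ letters v)"

instance
  by standard (simp_all add: zero_word_def plus_word_def)

end

type_synonym ('k, 'x) free_alg = "'x word \<Rightarrow>\<^sub>0 'k"

definition gen :: "'x \<Rightarrow> ('k::zero_neq_one, 'x) free_alg" where
  "gen x = Poly_Mapping.single (Word [x]) 1"

definition pscale :: "'k::mult_zero \<Rightarrow> ('x \<Rightarrow>\<^sub>0 'k) \<Rightarrow> ('x \<Rightarrow>\<^sub>0 'k)" where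
  "pscale c p = Poly_Mapping.map ((*) c) p"

text \<open>The linear extension of \<open>f\<close> to the vector space with basis \<open>'x\<close>; \<open>s\<close> is the scalar
  multiplication of the target.\<close>

definition lin_ext :: "('k::zero \<Rightarrow> 'b \<Rightarrow> 'b) \<Rightarrow> ('x \<Rightarrow> 'b::comm_monoid_add) \<Rightarrow> ('x \<Rightarrow>\<^sub>0 'k) \<Rightarrow> 'b" where
  "lin_ext s f p = (\<Sum>x\<in>Poly_Mapping.keys p. s (Poly_Mapping.lookup p x) (f x))"

definition is_ideal :: "'r::ring_1 set \<Rightarrow> bool" where
  "is_ideal I \<longleftrightarrow> 0 \<in> I \<and> (\<forall>p\<in>I. \<forall>q\<in>I. p + q \<in> I) \<and> (\<forall>p\<in>I. \<forall>u. u * p \<in> I \<and> p * u \<in> I)"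

definition ideal_of :: "'r::ring_1 set \<Rightarrow> 'r set" where
  "ideal_of R = is_ideal hull R"

definition hom_part :: "('x \<Rightarrow> nat) \<Rightarrow> nat \<Rightarrow> ('k::zero, 'x) free_alg set" where
  "hom_part deg n = {p. \<forall>w\<in>Poly_Mapping.keys p. sum_list (map deg (letters w)) = n}"

text \<open>The superderivation of degree \<open>e\<close> of a graded free algebra with prescribed values \<open>D\<close>
  on the generators.\<close>

fun word_der :: "nat \<Rightarrow> ('x \<Rightarrow> nat) \<Rightarrow> ('x \<Rightarrow> ('k::field, 'x) free_alg) \<Rightarrow> 'x list \<Rightarrow> ('k, 'x) free_alg" where
  "word_der e deg D [] = 0"
| "word_der e deg D (x # w) =
     D x * Poly_Mapping.single (Word w) 1 + (- 1) ^ (e * deg x) * (gen x * word_der e deg D w)"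

definition superder :: "nat \<Rightarrow> ('x \<Rightarrow> nat) \<Rightarrow> ('x \<Rightarrow> ('k::field, 'x) free_alg) \<Rightarrow> ('k, 'x) free_alg \<Rightarrow> ('k, 'x) free_alg" where
  "superder e deg D = lin_ext pscale (\<lambda>w. word_der e deg D (letters w))"

definition pvar :: "'x \<Rightarrow> ('x \<Rightarrow>\<^sub>0 nat) \<Rightarrow>\<^sub>0 'r::zero_neq_one" where
  "pvar x = Poly_Mapping.single (Poly_Mapping.single x 1) 1"

text \<open>The derivation of a polynomial ring that kills the coefficients and has prescribed values
  \<open>D\<close> on the variables.\<close>

definition poly_der :: "('x \<Rightarrow> (('x \<Rightarrow>\<^sub>0 nat) \<Rightarrow>\<^sub>0 'r)) \<Rightarrow> (('x \<Rightarrow>\<^sub>0 nat) \<Rightarrow>\<^sub>0 'r::ring_1) \<Rightarrow> (('x \<Rightarrow>\<^sub>0 nat) \<Rightarrow>\<^sub>0 'r)" where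
  "poly_der D p = (\<Sum>m\<in>Poly_Mapping.keys p. \<Sum>x\<in>Poly_Mapping.keys m.
     Poly_Mapping.single (m - Poly_Mapping.single x 1)
       (of_nat (Poly_Mapping.lookup m x) * Poly_Mapping.lookup p m) * D x)"


subsection \<open>Complexes of subquotients\<close>

text \<open>The degree \<open>n\<close> part of the complex is \<open>cyc C n / nul C n\<close>, and the differential on it is
  induced by \<open>dif C n\<close>.\<close>

record ('k, 'x) sq_complex =
  scl :: "'k \<Rightarrow> 'x \<Rightarrow> 'x"
  cyc :: "nat \<Rightarrow> 'x set"
  nul :: "nat \<Rightarrow> 'x set"
  dif :: "nat \<Rightarrow> 'x \<Rightarrow> 'x"

definition is_complex :: "('k::field, 'x::ab_group_add) sq_complex \<Rightarrow> bool" where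
  "is_complex C \<longleftrightarrow> vector_space (scl C) \<and>
     (\<forall>n. module.subspace (scl C) (cyc C n) \<and> module.subspace (scl C) (nul C n) \<and>
        nul C n \<subseteq> cyc C n \<and>
        Vector_Spaces.linear (scl C) (scl C) (dif C n) \<and>
        dif C n ` cyc C n \<subseteq> cyc C (Suc n) \<and> dif C n ` nul C n \<subseteq> nul C (Suc n) \<and>
        (\<forall>z\<in>cyc C n. dif C (Suc n) (dif C n z) \<in> nul C (Suc (Suc n))))"

text \<open>\<open>f\<close> induces a morphism of complexes (of degree 0).\<close>

definition induces_morphism ::
    "('k::field, 'x::ab_group_add) sq_complex \<Rightarrow> ('k, 'y::ab_group_add) sq_complex \<Rightarrow> ('x \<Rightarrow> 'y) \<Rightarrow> bool" where
  "induces_morphism C D f \<longleftrightarrow> is_complex C \<and> is_complex D \<and> Vector_Spaces.linear (scl C) (scl D) f \<and>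
     (\<forall>n. f ` cyc C n \<subseteq> cyc D n \<and> f ` nul C n \<subseteq> nul D n \<and>
        (\<forall>z\<in>cyc C n. f (dif C n z) - dif D n (f z) \<in> nul D (Suc n)))"


subsection \<open>The algebra \<open>A\<close>\<close>

text \<open>The sort \<open>{ring, monoid_mult}\<close> is that of unital rings, the zero ring included.\<close>

locale assoc_algebra = vector_space s
  for s :: "'k::field \<Rightarrow> 'a::{ring, monoid_mult} \<Rightarrow> 'a" +
  assumes scale_mult_left: "s c (x * y) = s c x * y"
    and scale_mult_right: "s c (x * y) = x * s c y"

text \<open>\<open>A\<close> is the algebra on generators \<open>x\<^sub>0, \<dots>, x\<^bsub>m-1\<^esub>\<close> (sent to \<open>g 0, \<dots>, g (m - 1)\<close>) with the
  finite set \<open>R\<close> of relations; the generators \<open>x\<^sub>i\<close> with \<open>i \<ge> m\<close> are superfluous.\<close>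

definition finitely_presented :: "('k::field \<Rightarrow> 'a::{ring, monoid_mult} \<Rightarrow> 'a) \<Rightarrow> bool" where
  "finitely_presented s \<longleftrightarrow>
     (\<exists>(m::nat) (g::nat \<Rightarrow> 'a) (R::('k, nat) free_alg set).
        let \<phi> = lin_ext s (\<lambda>w. prod_list (map g (letters w)))
        in finite R \<and> surj \<phi> \<and> {p. \<phi> p = 0} = ideal_of (R \<union> {gen i | i. m \<le> i}))"


subsection \<open>Noncommutative differential forms\<close>

text \<open>\<open>A \<otimes> A\<close> is the vector space with basis \<open>A \<times> A\<close> modulo \<open>tensor_rel\<close>.\<close>

type_synonym ('k, 'a) tens = "('a \<times> 'a) \<Rightarrow>\<^sub>0 'k"

definition tensor :: "'a \<Rightarrow> 'a \<Rightarrow> ('k::zero_neq_one, 'a) tens" where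
  "tensor u v = Poly_Mapping.single (u, v) 1"

definition tensor_rel :: "('k::field \<Rightarrow> 'a::ring \<Rightarrow> 'a) \<Rightarrow> ('k, 'a) tens set" where
  "tensor_rel s = module.span pscale
     ({tensor (u + u') v - tensor u v - tensor u' v | u u' v. True} \<union>
      {tensor u (v + v') - tensor u v - tensor u v' | u v v'. True} \<union>
      {tensor (s c u) v - pscale c (tensor u v) | c u v. True} \<union>
      {tensor u (s c v) - pscale c (tensor u v) | c u v. True})"

text \<open>Representatives of elements of \<open>\<Omega>\<^sup>1 A = ker (A \<otimes> A \<rightarrow> A)\<close>, and the bimodule structure.\<close>

definition Omega1 :: "('k::field \<Rightarrow> 'a::{ring, monoid_mult} \<Rightarrow> 'a) \<Rightarrow> ('k, 'a) tens set" where
  "Omega1 s = {p. lin_ext s (\<lambda>(u, v). u * v) p = 0}"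

definition lact :: "'a::{ring, monoid_mult} \<Rightarrow> ('k::field, 'a) tens \<Rightarrow> ('k, 'a) tens" where
  "lact a = lin_ext pscale (\<lambda>(u, v). tensor (a * u) v)"

definition ract :: "('k::field, 'a) tens \<Rightarrow> 'a::{ring, monoid_mult} \<Rightarrow> ('k, 'a) tens" where
  "ract p a = lin_ext pscale (\<lambda>(u, v). tensor u (v * a)) p"

definition dtens :: "'a::{ring, monoid_mult} \<Rightarrow> ('k::field, 'a) tens" where
  "dtens a = tensor 1 a - tensor a 1"

datatype ('a, 'm) nc_gen = Alg 'a | Form 'm

type_synonym ('k, 'a) nc_forms = "('k, ('a, ('k, 'a) tens) nc_gen) free_alg"

primrec nc_deg :: "('a, 'm) nc_gen \<Rightarrow> nat" where
  "nc_deg (Alg a) = 0"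
| "nc_deg (Form p) = 1"

text \<open>\<open>\<Omega> A = T\<^sub>A(\<Omega>\<^sup>1 A)\<close>: the algebra generated by the elements of \<open>A\<close> and of the bimodule
  \<open>\<Omega>\<^sup>1 A\<close>, with the relations that hold in \<open>A\<close> and in \<open>\<Omega>\<^sup>1 A\<close>. The last line discards
  the generators \<open>Form p\<close> where \<open>p\<close> does not represent an element of \<open>\<Omega>\<^sup>1 A\<close>.\<close>

definition nc_rel :: "('k::field \<Rightarrow> 'a::{ring, monoid_mult} \<Rightarrow> 'a) \<Rightarrow> ('k, 'a) nc_forms set" where
  "nc_rel s =
     {gen (Alg (a + b)) - gen (Alg a) - gen (Alg b) | a b. True} \<union>
     {gen (Alg (s c a)) - pscale c (gen (Alg a)) | c a. True} \<union>
     {gen (Alg (a * b)) - gen (Alg a) * gen (Alg b) | a b. True} \<union>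
     {gen (Alg 1) - 1} \<union>
     {gen (Form (p + q)) - gen (Form p) - gen (Form q) | p q. p \<in> Omega1 s \<and> q \<in> Omega1 s} \<union>
     {gen (Form (pscale c p)) - pscale c (gen (Form p)) | c p. p \<in> Omega1 s} \<union>
     {gen (Form (lact a p)) - gen (Alg a) * gen (Form p) | a p. p \<in> Omega1 s} \<union>
     {gen (Form (ract p a)) - gen (Form p) * gen (Alg a) | a p. p \<in> Omega1 s} \<union>
     {gen (Form p) | p. p \<in> tensor_rel s} \<union>
     {gen (Form p) | p. p \<notin> Omega1 s}"

definition nc_ideal :: "('k::field \<Rightarrow> 'a::{ring, monoid_mult} \<Rightarrow> 'a) \<Rightarrow> ('k, 'a) nc_forms set" where
  "nc_ideal s = ideal_of (nc_rel s)"

text \<open>An element \<open>p = \<Sum> u \<otimes> v\<close> of \<open>\<Omega>\<^sup>1 A\<close> equals \<open>\<Sum> u dv\<close>, since \<open>\<Sum> u v = 0\<close>. Hence a derivation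
  or homomorphism with given values on \<open>a\<close> and \<open>da\<close> is determined on \<open>p\<close>; \<open>form_ext\<close> gives its
  value there from the values on the products \<open>u dv\<close>.\<close>

definition form_ext ::
    "('k::field \<Rightarrow> 'a::{ring, monoid_mult} \<Rightarrow> 'a) \<Rightarrow> ('k \<Rightarrow> 'b \<Rightarrow> 'b) \<Rightarrow> ('a \<Rightarrow> 'a \<Rightarrow> 'b::comm_monoid_add) \<Rightarrow> ('k, 'a) tens \<Rightarrow> 'b" where
  "form_ext s t f p = (if p \<in> Omega1 s then lin_ext t (\<lambda>(u, v). f u v) p else 0)"

abbreviation nc_d :: "'a::{ring, monoid_mult} \<Rightarrow> ('k::field, 'a) nc_forms" where
  "nc_d a \<equiv> gen (Form (dtens a))"

primrec nc_d_gen :: "('k::field \<Rightarrow> 'a::{ring, monoid_mult} \<Rightarrow> 'a) \<Rightarrow> ('a, ('k, 'a) tens) nc_gen \<Rightarrow> ('k, 'a) nc_forms" where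
  "nc_d_gen s (Alg a) = nc_d a"
| "nc_d_gen s (Form p) = form_ext s pscale (\<lambda>u v. nc_d u * nc_d v) p"


subsection \<open>Hochschild homology with Connes' operator\<close>

abbreviation nc_part :: "nat \<Rightarrow> ('k::field, 'a) nc_forms set" where
  "nc_part n \<equiv> hom_part nc_deg n"

definition is_hochschild_b ::
    "('k::field \<Rightarrow> 'a::{ring, monoid_mult} \<Rightarrow> 'a) \<Rightarrow> (('k, 'a) nc_forms \<Rightarrow> ('k, 'a) nc_forms) \<Rightarrow> bool" where
  "is_hochschild_b s b \<longleftrightarrow> Vector_Spaces.linear pscale pscale b \<and> b ` nc_ideal s \<subseteq> nc_ideal s \<and>
     (\<forall>n. b ` nc_part (Suc n) \<subseteq> nc_part n) \<and>
     b ` nc_part 0 \<subseteq> nc_ideal s \<and>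
     (\<forall>n. \<forall>\<alpha>\<in>nc_part n. \<forall>a.
        b (\<alpha> * nc_d a) - (- 1) ^ n * (\<alpha> * gen (Alg a) - gen (Alg a) * \<alpha>) \<in> nc_ideal s)"

text \<open>The word \<open>a # as\<close> stands for \<open>a\<^sub>0 da\<^sub>1 \<dots> da\<^sub>n\<close> with \<open>n = length as\<close>.\<close>

definition is_connes_B ::
    "('k::field \<Rightarrow> 'a::{ring, monoid_mult} \<Rightarrow> 'a) \<Rightarrow> (('k, 'a) nc_forms \<Rightarrow> ('k, 'a) nc_forms) \<Rightarrow> bool" where
  "is_connes_B s B \<longleftrightarrow> Vector_Spaces.linear pscale pscale B \<and> B ` nc_ideal s \<subseteq> nc_ideal s \<and>
     (\<forall>n. B ` nc_part n \<subseteq> nc_part (Suc n)) \<and>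
     (\<forall>a as. B (gen (Alg a) * prod_list (map nc_d as)) -
        (\<Sum>i\<le>length as. (- 1) ^ (length as * i) * prod_list (map nc_d (rotate i (a # as)))) \<in> nc_ideal s)"

text \<open>The formulas determine \<open>b\<close> and \<open>B\<close> as operators on the quotient \<open>\<Omega> A\<close>; the choice is only
  among lifts of these to representatives.\<close>

definition hochschild_b :: "('k::field \<Rightarrow> 'a::{ring, monoid_mult} \<Rightarrow> 'a) \<Rightarrow> ('k, 'a) nc_forms \<Rightarrow> ('k, 'a) nc_forms" where
  "hochschild_b s = (SOME b. is_hochschild_b s b)"

definition connes_B :: "('k::field \<Rightarrow> 'a::{ring, monoid_mult} \<Rightarrow> 'a) \<Rightarrow> ('k, 'a) nc_forms \<Rightarrow> ('k, 'a) nc_forms" where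
  "connes_B s = (SOME B. is_connes_B s B)"

definition hochschild_complex ::
    "('k::field \<Rightarrow> 'a::{ring, monoid_mult} \<Rightarrow> 'a) \<Rightarrow> ('k, ('k, 'a) nc_forms) sq_complex" where
  "hochschild_complex s = \<lparr>
     scl = pscale,
     cyc = (\<lambda>n. {z \<in> nc_part n. hochschild_b s z \<in> nc_ideal s}),
     nul = (\<lambda>n. {z \<in> nc_part n. \<exists>y\<in>nc_part (Suc n). z - hochschild_b s y \<in> nc_ideal s}),
     dif = (\<lambda>n. connes_B s)\<rparr>"


subsection \<open>The extended noncommutative de Rham complex\<close>

text \<open>In \<open>\<Omega>\<^sub>t A = (\<Omega> A) * k[t]\<close> the generator \<open>t\<close> is \<open>None\<close>.\<close>

type_synonym ('k, 'a) nct_forms = "('k, ('a, ('k, 'a) tens) nc_gen option) free_alg"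

definition nct_deg :: "('a, 'm) nc_gen option \<Rightarrow> nat" where
  "nct_deg = case_option 2 nc_deg"

definition nct_emb :: "('k::field, 'a) nc_forms \<Rightarrow> ('k, 'a) nct_forms" where
  "nct_emb = lin_ext pscale (\<lambda>w. Poly_Mapping.single (Word (map Some (letters w))) 1)"

definition nct_ideal :: "('k::field \<Rightarrow> 'a::{ring, monoid_mult} \<Rightarrow> 'a) \<Rightarrow> ('k, 'a) nct_forms set" where
  "nct_ideal s = ideal_of (nct_emb ` nc_rel s)"

abbreviation nct_part :: "nat \<Rightarrow> ('k::field, 'a) nct_forms set" where
  "nct_part n \<equiv> hom_part nct_deg n"

definition nct_differential ::
    "('k::field \<Rightarrow> 'a::{ring, monoid_mult} \<Rightarrow> 'a) \<Rightarrow> ('k, 'a) nct_forms \<Rightarrow> ('k, 'a) nct_forms" where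
  "nct_differential s = superder 1 nct_deg (case_option 0 (\<lambda>g. nct_emb (nc_d_gen s g)))"

text \<open>By \<open>i\<^sub>\<Delta> a = 0\<close> and \<open>i\<^sub>\<Delta>(dv) = t v - v t\<close> the value on \<open>u dv\<close> is \<open>u (t v - v t)\<close>.\<close>

definition i_Delta_gen ::
    "('k::field \<Rightarrow> 'a::{ring, monoid_mult} \<Rightarrow> 'a) \<Rightarrow> ('a, ('k, 'a) tens) nc_gen \<Rightarrow> ('k, 'a) nct_forms" where
  "i_Delta_gen s g = (case g of
       Alg a \<Rightarrow> 0
     | Form p \<Rightarrow> form_ext s pscale
         (\<lambda>u v. gen (Some (Alg u)) * (gen None * gen (Some (Alg v)) - gen (Some (Alg v)) * gen None)) p)"

definition i_Delta ::
    "('k::field \<Rightarrow> 'a::{ring, monoid_mult} \<Rightarrow> 'a) \<Rightarrow> ('k, 'a) nct_forms \<Rightarrow> ('k, 'a) nct_forms" where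
  "i_Delta s = superder 1 nct_deg (case_option 0 (i_Delta_gen s))"

definition supercommutators :: "('k::field, 'a) nct_forms set" where
  "supercommutators = module.span pscale
     {u * v - (- 1) ^ (m * n) * (v * u) | u v m n. u \<in> nct_part m \<and> v \<in> nct_part n}"

definition DRt_complex ::
    "('k::field \<Rightarrow> 'a::{ring, monoid_mult} \<Rightarrow> 'a) \<Rightarrow> ('k, ('k, 'a) nct_forms) sq_complex" where
  "DRt_complex s = \<lparr>
     scl = pscale,
     cyc = nct_part,
     nul = (\<lambda>n. {p \<in> nct_part n. \<exists>q\<in>nct_ideal s. p - q \<in> supercommutators}),
     dif = (\<lambda>n p. nct_differential s p + i_Delta s p)\<rparr>"


subsection \<open>The representation scheme\<close>

text \<open>The vector space \<open>V\<close> is given with a finite basis \<open>Bs\<close>, and \<open>End V \<otimes> S\<close> is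
  identified with the \<open>Bs \<times> Bs\<close> matrices over \<open>S\<close>. The coordinate ring of \<open>Rep(A,V)\<close> is generated by the
  entries \<open>(a, i, j)\<close> of the matrices \<open>\<hat>a\<close>, subject to the relations saying that \<open>a \<mapsto> \<hat>a\<close> is an
  algebra homomorphism.\<close>

type_synonym ('k, 'a, 'v) coord_ring = "(('a \<times> 'v \<times> 'v) \<Rightarrow>\<^sub>0 nat) \<Rightarrow>\<^sub>0 'k"

definition rep_ideal ::
    "('k::field \<Rightarrow> 'a::{ring, monoid_mult} \<Rightarrow> 'a) \<Rightarrow> 'v set \<Rightarrow> ('k, 'a, 'v) coord_ring set" where
  "rep_ideal s Bs = ideal_of
     ({pvar (a + b, i, j) - pvar (a, i, j) - pvar (b, i, j) | a b i j. i \<in> Bs \<and> j \<in> Bs} \<union>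
      {pvar (s c a, i, j) - pscale c (pvar (a, i, j)) | c a i j. i \<in> Bs \<and> j \<in> Bs} \<union>
      {pvar (a * b, i, j) - (\<Sum>l\<in>Bs. pvar (a, i, l) * pvar (b, l, j)) | a b i j. i \<in> Bs \<and> j \<in> Bs} \<union>
      {pvar (1, i, j) - (if i = j then 1 else 0) | i j. i \<in> Bs \<and> j \<in> Bs} \<union>
      {pvar (a, i, j) | a i j. \<not> (i \<in> Bs \<and> j \<in> Bs)})"

text \<open>The scheme with coordinate ring \<open>P / J\<close> is nonempty iff \<open>1 \<notin> J\<close>.\<close>

definition rep_scheme_nonempty :: "('k::field \<Rightarrow> 'a::{ring, monoid_mult} \<Rightarrow> 'a) \<Rightarrow> 'v set \<Rightarrow> bool" where
  "rep_scheme_nonempty s Bs \<longleftrightarrow> (1 :: ('k, 'a, 'v) coord_ring) \<notin> rep_ideal s Bs"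

definition is_alg_hom :: "('k \<Rightarrow> 'r \<Rightarrow> 'r) \<Rightarrow> ('k \<Rightarrow> 's \<Rightarrow> 's) \<Rightarrow> ('r::{plus, times, one} \<Rightarrow> 's::{plus, times, one}) \<Rightarrow> bool" where
  "is_alg_hom s t \<phi> \<longleftrightarrow> \<phi> 1 = 1 \<and> (\<forall>p q. \<phi> (p + q) = \<phi> p + \<phi> q \<and> \<phi> (p * q) = \<phi> p * \<phi> q) \<and>
     (\<forall>c p. \<phi> (s c p) = t c (\<phi> p))"

text \<open>Algebra homomorphisms from \<open>A\<close> to the \<open>Bs \<times> Bs\<close> matrices over \<open>S\<close>.\<close>

definition is_matrix_rep ::
    "('k \<Rightarrow> 'a::{ring, monoid_mult} \<Rightarrow> 'a) \<Rightarrow> ('k \<Rightarrow> 's \<Rightarrow> 's::{comm_ring, comm_monoid_mult}) \<Rightarrow> 'v set \<Rightarrow> ('a \<Rightarrow> 'v \<Rightarrow> 'v \<Rightarrow> 's) \<Rightarrow> bool" where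
  "is_matrix_rep s t Bs \<rho> \<longleftrightarrow>
     (\<forall>a b i j. \<rho> (a + b) i j = \<rho> a i j + \<rho> b i j) \<and>
     (\<forall>c a i j. \<rho> (s c a) i j = t c (\<rho> a i j)) \<and>
     (\<forall>a b. \<forall>i\<in>Bs. \<forall>j\<in>Bs. \<rho> (a * b) i j = (\<Sum>l\<in>Bs. \<rho> a i l * \<rho> b l j)) \<and>
     (\<forall>i\<in>Bs. \<forall>j\<in>Bs. \<rho> 1 i j = (if i = j then 1 else 0)) \<and>
     (\<forall>a i j. \<not> (i \<in> Bs \<and> j \<in> Bs) \<longrightarrow> \<rho> a i j = 0)"

lemma pscale_single: "pscale c (Poly_Mapping.single m d) = Poly_Mapping.single m (c * d)"
  for c :: "'k::field"
  unfolding pscale_def by (transfer, auto simp: when_def fun_eq_iff)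

lemma lookup_pscale: "Poly_Mapping.lookup (pscale c p) m = c * Poly_Mapping.lookup p m"
  for c :: "'k::field"
  unfolding pscale_def by (transfer, auto simp: when_def)

lemma pscale_add: "pscale c (p + q) = pscale c p + pscale c q" for c :: "'k::field"
  by (rule poly_mapping_eqI) (simp add: lookup_pscale lookup_add distrib_left)

lemma poly_mapping_induct_single_add:
  fixes p :: "'x \<Rightarrow>\<^sub>0 'b::comm_monoid_add"
  assumes single: "\<And>x c. P (Poly_Mapping.single x c)" and add: "\<And>p q. P p \<Longrightarrow> P q \<Longrightarrow> P (p + q)"
  shows "P p"
proof -
  have "P (\<Sum>x\<in>K. Poly_Mapping.single x (Poly_Mapping.lookup p x))" if "finite K" for K
    using that
  proof (induction K)
    case empty
    then show ?case using single[of undefined 0] by simp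
  qed (simp add: single add)
  moreover have "(\<Sum>x\<in>Poly_Mapping.keys p. Poly_Mapping.single x (Poly_Mapping.lookup p x)) = p"
    by (rule poly_mapping_eqI) (auto simp: lookup_sum lookup_single when_def sum.delta in_keys_iff)
  ultimately show ?thesis by (metis finite_keys)
qed

context vector_space begin

lemma lin_ext_superset:
  "finite K \<Longrightarrow> Poly_Mapping.keys p \<subseteq> K \<Longrightarrow> lin_ext scale f p = (\<Sum>x\<in>K. scale (Poly_Mapping.lookup p x) (f x))"
  unfolding lin_ext_def by (rule sum.mono_neutral_left) (auto simp: in_keys_iff)

lemma lin_ext_add: "lin_ext scale f (p + q) = lin_ext scale f p + lin_ext scale f q"
proof -
  let ?K = "Poly_Mapping.keys p \<union> Poly_Mapping.keys q"
  show ?thesis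
    using lin_ext_superset[of ?K "p + q" f] lin_ext_superset[of ?K p f] lin_ext_superset[of ?K q f]
      Poly_Mapping.keys_add[of p q]
    by (simp add: lookup_add scale_left_distrib sum.distrib)
qed

lemma lin_ext_pscale: "lin_ext scale f (pscale c p) = scale c (lin_ext scale f p)"
  using lin_ext_superset[of "Poly_Mapping.keys p" "pscale c p" f]
  by (auto simp: lin_ext_def lookup_pscale in_keys_iff scale_sum_right subset_iff)

lemma lin_ext_single: "lin_ext scale f (Poly_Mapping.single x c) = scale c (f x)"
  using lin_ext_superset[of "{x}" "Poly_Mapping.single x c" f] by simp

end

lemma alg_hom_ext:
  fixes \<phi> \<psi> :: "(('x \<Rightarrow>\<^sub>0 nat) \<Rightarrow>\<^sub>0 'k::field) \<Rightarrow> 's::{plus, times, one}"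
  assumes "is_alg_hom pscale t \<phi>" "is_alg_hom pscale t \<psi>" "\<And>x. \<phi> (pvar x) = \<psi> (pvar x)"
  shows "\<phi> = \<psi>"
proof -
  have power: "\<phi> (Poly_Mapping.single (Poly_Mapping.single x k) 1) = \<psi> (Poly_Mapping.single (Poly_Mapping.single x k) 1)" for x k
  proof (induction k)
    case 0
    then show ?case using assms by (simp add: is_alg_hom_def)
  next
    case (Suc k)
    have "Poly_Mapping.single (Poly_Mapping.single x (Suc k)) (1::'k) =
        pvar x * Poly_Mapping.single (Poly_Mapping.single x k) 1"
      unfolding pvar_def mult_single by (simp flip: single_add)
    then show ?case using assms Suc by (simp add: is_alg_hom_def)
  qed
  have monom: "\<phi> (Poly_Mapping.single m 1) = \<psi> (Poly_Mapping.single m 1)" for m :: "'x \<Rightarrow>\<^sub>0 nat"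
  proof (induction m rule: poly_mapping_induct_single_add)
    case (1 k v)
    show ?case by (rule power)
  next
    case (2 f g)
    have "Poly_Mapping.single (f + g) (1::'k) = Poly_Mapping.single f 1 * Poly_Mapping.single g 1"
      by (simp add: mult_single)
    then show ?case using assms 2 by (simp add: is_alg_hom_def)
  qed
  have "\<phi> p = \<psi> p" for p
  proof (induction p rule: poly_mapping_induct_single_add)
    case (1 k v)
    have "Poly_Mapping.single k v = pscale v (Poly_Mapping.single k 1)"
      by (simp add: pscale_single)
    then show ?case using assms monom by (simp add: is_alg_hom_def)
  next
    case (2 f g)
    then show ?case using assms by (simp add: is_alg_hom_def)
  qed
  then show ?thesis by blast
qed

lemma alg_hom_exists:
  fixes t :: "'k::field \<Rightarrow> 's \<Rightarrow> 's::{comm_ring, comm_monoid_mult}" and f :: "'x \<Rightarrow> 's"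
  assumes "assoc_algebra t"
  obtains \<phi> :: "(('x \<Rightarrow>\<^sub>0 nat) \<Rightarrow>\<^sub>0 'k) \<Rightarrow> 's"
  where "is_alg_hom pscale t \<phi>" "\<And>x. \<phi> (pvar x) = f x"
proof -
  interpret t: assoc_algebra t by fact
  define M where "M m = (\<Prod>x\<in>Poly_Mapping.keys m. f x ^ Poly_Mapping.lookup m x)" for m :: "'x \<Rightarrow>\<^sub>0 nat"
  define \<phi> where "\<phi> = lin_ext t M"
  have M_superset: "M m = (\<Prod>x\<in>K. f x ^ Poly_Mapping.lookup m x)"
    if "finite K" "Poly_Mapping.keys m \<subseteq> K" for m K
    unfolding M_def using that by (intro prod.mono_neutral_left) (auto simp: in_keys_iff)
  have M_add: "M (m + n) = M m * M n" for m n
  proof -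
    let ?K = "Poly_Mapping.keys m \<union> Poly_Mapping.keys n"
    show ?thesis
      using M_superset[of ?K "m + n"] M_superset[of ?K m] M_superset[of ?K n]
        Poly_Mapping.keys_add[of m n]
      by (simp add: lookup_add power_add prod.distrib)
  qed
  have M0: "M 0 = 1" by (simp add: M_def)
  have add: "\<phi> (p + q) = \<phi> p + \<phi> q" for p q by (simp add: \<phi>_def t.lin_ext_add)
  have scale: "\<phi> (pscale c p) = t c (\<phi> p)" for c p by (simp add: \<phi>_def t.lin_ext_pscale)
  have single: "\<phi> (Poly_Mapping.single m c) = t c (M m)" for m c by (simp add: \<phi>_def t.lin_ext_single)
  have mult1: "\<phi> (Poly_Mapping.single m c * q) = \<phi> (Poly_Mapping.single m c) * \<phi> q" for m c q
  proof (induction q rule: poly_mapping_induct_single_add)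
    case (1 k v)
    show ?case
      by (simp add: mult_single single M_add flip: t.scale_mult_left t.scale_mult_right)
  next
    case (2 g h)
    then show ?case by (simp add: distrib_left add)
  qed
  have mult: "\<phi> (p * q) = \<phi> p * \<phi> q" for p q
  proof (induction p rule: poly_mapping_induct_single_add)
    case (1 k v)
    show ?case by (rule mult1)
  next
    case (2 g h)
    then show ?case by (simp add: distrib_right add)
  qed
  have one: "\<phi> 1 = 1" using single[of 0 1] by (simp add: M0)
  have var: "\<phi> (pvar x) = f x" for x
    unfolding pvar_def single by (simp add: M_def)
  show ?thesis
    by (rule that[of \<phi>]) (simp_all add: is_alg_hom_def one add mult scale var)
qed

lemma ideal_of_base: "x \<in> R \<Longrightarrow> x \<in> ideal_of R"
  unfolding ideal_of_def by (rule hull_inc)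

text \<open>The functor of points of \<open>Rep(A,V)\<close>: \<open>Hom(k[Rep(A,V)], S) = Hom(A, S \<otimes> End V)\<close>.\<close>

lemma rep_ideal_represents:
  fixes s :: "'k::field \<Rightarrow> 'a::{ring, monoid_mult} \<Rightarrow> 'a"
    and t :: "'k \<Rightarrow> 's \<Rightarrow> 's::{comm_ring, comm_monoid_mult}"
    and Bs :: "'v set"
  assumes t: "assoc_algebra t"
  shows "bij_betw (\<lambda>\<phi> a i j. \<phi> (pvar (a, i, j)))
    {\<phi>. is_alg_hom pscale t \<phi> \<and> \<phi> ` rep_ideal s Bs \<subseteq> {0}} {\<rho>. is_matrix_rep s t Bs \<rho>}"
proof -
  let ?F = "\<lambda>\<phi> a i j. \<phi> (pvar (a, i, j))"
  interpret t: assoc_algebra t by fact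
  have hom0: "\<phi> 0 = 0" and hom_diff: "\<phi> (p - q) = \<phi> p - \<phi> q" and hom_sum: "\<phi> (sum g I) = (\<Sum>l\<in>I. \<phi> (g l))"
    if h: "is_alg_hom pscale t \<phi>" for \<phi> :: "('k, 'a, 'v) coord_ring \<Rightarrow> 's" and p q and g :: "'v \<Rightarrow> _" and I
  proof -
    have a: "\<phi> (p + q) = \<phi> p + \<phi> q" for p q using h by (simp add: is_alg_hom_def)
    show z: "\<phi> 0 = 0" using a[of 0 0] by simp
    show "\<phi> (p - q) = \<phi> p - \<phi> q" using a[of "p - q" q] by (simp add: algebra_simps)
    show "\<phi> (sum g I) = (\<Sum>l\<in>I. \<phi> (g l))"
      by (induction I rule: infinite_finite_induct) (simp_all add: z a)
  qed
  have rep: "is_matrix_rep s t Bs (?F \<phi>)"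
    if h: "is_alg_hom pscale t \<phi>" and J: "\<phi> ` rep_ideal s Bs \<subseteq> {0}" for \<phi>
  proof -
    have rel: "\<phi> p = 0" if "p \<in> rep_ideal s Bs" for p using J that by blast
    note r = rel[unfolded rep_ideal_def, OF ideal_of_base]
    have junk: "\<phi> (pvar (a, i, j)) = 0" if "\<not> (i \<in> Bs \<and> j \<in> Bs)" for a i j
      by (rule r) (use that in blast)
    have "\<phi> (pvar (a + b, i, j)) = \<phi> (pvar (a, i, j)) + \<phi> (pvar (b, i, j))" for a b i j
    proof (cases "i \<in> Bs \<and> j \<in> Bs")
      case True
      have "\<phi> (pvar (a + b, i, j) - pvar (a, i, j) - pvar (b, i, j)) = 0"
        by (rule r) (use True in blast)
      then show ?thesis using h by (simp add: hom_diff[OF h] is_alg_hom_def algebra_simps)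
    qed (simp add: junk)
    moreover have "\<phi> (pvar (s c a, i, j)) = t c (\<phi> (pvar (a, i, j)))" for c a i j
    proof (cases "i \<in> Bs \<and> j \<in> Bs")
      case True
      have "\<phi> (pvar (s c a, i, j) - pscale c (pvar (a, i, j))) = 0"
        by (rule r) (use True in blast)
      moreover have "\<phi> (pscale c (pvar (a, i, j))) = t c (\<phi> (pvar (a, i, j)))"
        using h by (simp add: is_alg_hom_def)
      ultimately show ?thesis by (simp add: hom_diff[OF h])
    qed (simp add: junk)
    moreover have "\<phi> (pvar (a * b, i, j)) = (\<Sum>l\<in>Bs. \<phi> (pvar (a, i, l)) * \<phi> (pvar (b, l, j)))"
      if "i \<in> Bs" "j \<in> Bs" for a b i j
    proof -
      have "\<phi> (pvar (a * b, i, j) - (\<Sum>l\<in>Bs. pvar (a, i, l) * pvar (b, l, j))) = 0"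
        by (rule r) (use that in blast)
      moreover have "\<phi> (p * q) = \<phi> p * \<phi> q" for p q using h by (simp add: is_alg_hom_def)
      ultimately show ?thesis by (simp add: hom_diff[OF h] hom_sum[OF h])
    qed
    moreover have "\<phi> (pvar (1, i, j)) = (if i = j then 1 else 0)" if "i \<in> Bs" "j \<in> Bs" for i j
    proof -
      have "\<phi> (pvar (1, i, j) - (if i = j then 1 else 0)) = 0"
        by (rule r) (use that in blast)
      moreover have "\<phi> 1 = 1" using h by (simp add: is_alg_hom_def)
      ultimately show ?thesis by (simp add: hom_diff[OF h] hom0[OF h] split: if_splits)
    qed
    ultimately show ?thesis unfolding is_matrix_rep_def using junk by blast
  qed
  have surj: "\<exists>\<phi>. is_alg_hom pscale t \<phi> \<and> \<phi> ` rep_ideal s Bs \<subseteq> {0} \<and> ?F \<phi> = \<rho>"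
    if \<rho>: "is_matrix_rep s t Bs \<rho>" for \<rho>
  proof -
    obtain \<phi> where h: "is_alg_hom pscale t \<phi>" and v: "\<And>x. \<phi> (pvar x) = (case x of (a, i, j) \<Rightarrow> \<rho> a i j)"
      using alg_hom_exists[OF t] by metis
    have v': "\<phi> (pvar (a, i, j)) = \<rho> a i j" for a i j by (simp add: v)
    have m: "\<phi> (p * q) = \<phi> p * \<phi> q" "\<phi> (pscale c p) = t c (\<phi> p)" "\<phi> 1 = 1" "\<phi> (p + q) = \<phi> p + \<phi> q" for p q c
      using h by (simp_all add: is_alg_hom_def)
    have "rep_ideal s Bs \<subseteq> {p. \<phi> p = 0}"
      unfolding rep_ideal_def ideal_of_def
    proof (rule hull_minimal)
      show "is_ideal {p. \<phi> p = 0}" by (simp add: is_ideal_def hom0[OF h] m)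
    qed (use \<rho> in \<open>auto simp: is_matrix_rep_def hom_diff[OF h] hom_sum[OF h] hom0[OF h] m v'\<close>)
    then show ?thesis using h v' by blast
  qed
  have "inj_on ?F {\<phi>. is_alg_hom pscale t \<phi> \<and> \<phi> ` rep_ideal s Bs \<subseteq> {0}}"
  proof (rule inj_onI)
    fix \<phi> \<psi> assume "\<phi> \<in> {\<phi>. is_alg_hom pscale t \<phi> \<and> \<phi> ` rep_ideal s Bs \<subseteq> {0}}"
      "\<psi> \<in> {\<phi>. is_alg_hom pscale t \<phi> \<and> \<phi> ` rep_ideal s Bs \<subseteq> {0}}" "?F \<phi> = ?F \<psi>"
    then show "\<phi> = \<psi>" by (intro alg_hom_ext[of t]) (auto simp: fun_eq_iff)
  qed
  then show ?thesis unfolding bij_betw_def using rep surj by auto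
qed

definition is_endo :: "('k::field \<Rightarrow> 'v::ab_group_add \<Rightarrow> 'v) \<Rightarrow> ('v \<Rightarrow> 'v) \<Rightarrow> bool" where
  "is_endo sV x \<longleftrightarrow> Vector_Spaces.linear sV sV x"

definition entry :: "('k::field \<Rightarrow> 'v::ab_group_add \<Rightarrow> 'v) \<Rightarrow> 'v set \<Rightarrow> ('v \<Rightarrow> 'v) \<Rightarrow> 'v \<Rightarrow> 'v \<Rightarrow> 'k" where
  "entry sV Bs x i j = (if i \<in> Bs \<and> j \<in> Bs then module.representation sV Bs (x j) i else 0)"

definition elem_endo :: "('k::field \<Rightarrow> 'v::ab_group_add \<Rightarrow> 'v) \<Rightarrow> 'v set \<Rightarrow> 'v \<Rightarrow> 'v \<Rightarrow> 'v \<Rightarrow> 'v" where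
  "elem_endo sV Bs i j v = sV (module.representation sV Bs v j) i"

text \<open>The \<open>(i, j)\<close> entry of the commutator \<open>[x, M]\<close>.\<close>

definition bracket ::
    "('k::field \<Rightarrow> 'v::ab_group_add \<Rightarrow> 'v) \<Rightarrow> 'v set \<Rightarrow> ('k \<Rightarrow> 'r \<Rightarrow> 'r) \<Rightarrow> ('v \<Rightarrow> 'v) \<Rightarrow> ('v \<Rightarrow> 'v \<Rightarrow> 'r::ab_group_add) \<Rightarrow> 'v \<Rightarrow> 'v \<Rightarrow> 'r" where
  "bracket sV Bs sc x M i j =
     (\<Sum>l\<in>Bs. sc (entry sV Bs x i l) (M l j) - sc (entry sV Bs x l j) (M i l))"

definition rep_vec ::
    "('k::field \<Rightarrow> 'v::ab_group_add \<Rightarrow> 'v) \<Rightarrow> 'v set \<Rightarrow> ('v \<Rightarrow> 'v) \<Rightarrow> ('k, 'a, 'v) coord_ring \<Rightarrow> ('k, 'a, 'v) coord_ring" where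
  "rep_vec sV Bs x = poly_der (\<lambda>(a, i, j). bracket sV Bs pscale x (\<lambda>k l. pvar (a, k, l)) i j)"


subsection \<open>Differential forms on the representation scheme\<close>

datatype 'p kd_gen = Fn 'p | Df 'p

primrec kd_deg :: "'p kd_gen \<Rightarrow> nat" where
  "kd_deg (Fn p) = 0"
| "kd_deg (Df p) = 1"

text \<open>For a commutative algebra \<open>P / J\<close>, the ideal of relations presenting the exterior algebra of
  its module of Kaehler differentials. In characteristic 0 the last line says that 1-forms square
  to zero.\<close>

definition kaehler_ideal ::
    "(('y::comm_monoid_add) \<Rightarrow>\<^sub>0 'k::field_char_0) set \<Rightarrow> ('k, ('y \<Rightarrow>\<^sub>0 'k) kd_gen) free_alg set" where
  "kaehler_ideal J = ideal_of
     ({gen (Fn (p + q)) - gen (Fn p) - gen (Fn q) | p q. True} \<union>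
      {gen (Fn (pscale c p)) - pscale c (gen (Fn p)) | c p. True} \<union>
      {gen (Fn (p * q)) - gen (Fn p) * gen (Fn q) | p q. True} \<union>
      {gen (Fn 1) - 1} \<union>
      {gen (Fn p) | p. p \<in> J} \<union>
      {gen (Df (p + q)) - gen (Df p) - gen (Df q) | p q. True} \<union>
      {gen (Df (pscale c p)) - pscale c (gen (Df p)) | c p. True} \<union>
      {gen (Df (p * q)) - gen (Fn p) * gen (Df q) - gen (Fn q) * gen (Df p) | p q. True} \<union>
      {gen (Df p) | p. p \<in> J} \<union>
      {gen (Fn p) * gen (Df q) - gen (Df q) * gen (Fn p) | p q. True} \<union>
      {gen (Df p) * gen (Df q) + gen (Df q) * gen (Df p) | p q. True})"

type_synonym ('k, 'a, 'v) rep_forms = "('k, ('k, 'a, 'v) coord_ring kd_gen) free_alg"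

definition rep_forms_ideal ::
    "('k::field_char_0 \<Rightarrow> 'a::{ring, monoid_mult} \<Rightarrow> 'a) \<Rightarrow> 'v set \<Rightarrow> ('k, 'a, 'v) rep_forms set" where
  "rep_forms_ideal s Bs = kaehler_ideal (rep_ideal s Bs)"

definition d_DR :: "('k::field, 'a, 'v) rep_forms \<Rightarrow> ('k, 'a, 'v) rep_forms" where
  "d_DR = superder 1 kd_deg (case_kd_gen (\<lambda>p. gen (Df p)) (\<lambda>p. 0))"

definition rep_contract ::
    "('k::field \<Rightarrow> 'v::ab_group_add \<Rightarrow> 'v) \<Rightarrow> 'v set \<Rightarrow> ('v \<Rightarrow> 'v) \<Rightarrow> ('k, 'a, 'v) rep_forms \<Rightarrow> ('k, 'a, 'v) rep_forms" where
  "rep_contract sV Bs x = superder 1 kd_deg (case_kd_gen (\<lambda>p. 0) (\<lambda>p. gen (Fn (rep_vec sV Bs x p))))"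

definition rep_lie ::
    "('k::field \<Rightarrow> 'v::ab_group_add \<Rightarrow> 'v) \<Rightarrow> 'v set \<Rightarrow> ('v \<Rightarrow> 'v) \<Rightarrow> ('k, 'a, 'v) rep_forms \<Rightarrow> ('k, 'a, 'v) rep_forms" where
  "rep_lie sV Bs x = superder 0 kd_deg
     (case_kd_gen (\<lambda>p. gen (Fn (rep_vec sV Bs x p))) (\<lambda>p. gen (Df (rep_vec sV Bs x p))))"

definition basic_forms ::
    "('k::field_char_0 \<Rightarrow> 'a::{ring, monoid_mult} \<Rightarrow> 'a) \<Rightarrow> ('k \<Rightarrow> 'v::ab_group_add \<Rightarrow> 'v) \<Rightarrow> 'v set \<Rightarrow> nat \<Rightarrow>
      ('k, 'a, 'v) rep_forms set" where
  "basic_forms s sV Bs n = {\<omega> \<in> hom_part kd_deg n. \<forall>x. is_endo sV x \<longrightarrow>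
     rep_lie sV Bs x \<omega> \<in> rep_forms_ideal s Bs \<and> rep_contract sV Bs x \<omega> \<in> rep_forms_ideal s Bs}"


subsection \<open>The equivariant de Rham complex\<close>

text \<open>\<open>\<Omega>(Rep(A,V)) \<otimes> k[g]\<close> is the polynomial ring over \<open>\<Omega>(Rep(A,V))\<close> in the linear coordinates
  \<open>(i, j)\<close> of \<open>g = End V\<close>; \<open>pvar (i, j)\<close> with \<open>i\<close>, \<open>j\<close> in the basis is the coordinate dual to
  \<open>elem_endo sV Bs i j\<close>. A form \<open>\<omega>\<close> is identified with \<open>\<omega> \<otimes> 1\<close>, the constant polynomial.\<close>

type_synonym ('k, 'a, 'v) eq_forms = "(('v \<times> 'v) \<Rightarrow>\<^sub>0 nat) \<Rightarrow>\<^sub>0 ('k, 'a, 'v) rep_forms"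

definition escale :: "'k::field \<Rightarrow> ('k, 'a, 'v) eq_forms \<Rightarrow> ('k, 'a, 'v) eq_forms" where
  "escale c p = Poly_Mapping.map (pscale c) p"

definition econst :: "('k::field, 'a, 'v) rep_forms \<Rightarrow> ('k, 'a, 'v) eq_forms" where
  "econst \<omega> = Poly_Mapping.single 0 \<omega>"

definition eq_part :: "'v set \<Rightarrow> nat \<Rightarrow> ('k::field, 'a, 'v) eq_forms set" where
  "eq_part Bs n = {p. \<forall>m\<in>Poly_Mapping.keys p. Poly_Mapping.keys m \<subseteq> Bs \<times> Bs \<and>
     (\<forall>w\<in>Poly_Mapping.keys (Poly_Mapping.lookup p m).
        sum_list (map kd_deg (letters w)) + 2 * (\<Sum>v\<in>Poly_Mapping.keys m. Poly_Mapping.lookup m v) = n)}"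

definition eq_zero ::
    "('k::field_char_0 \<Rightarrow> 'a::{ring, monoid_mult} \<Rightarrow> 'a) \<Rightarrow> 'v set \<Rightarrow> ('k, 'a, 'v) eq_forms set" where
  "eq_zero s Bs = {p. \<forall>m. Poly_Mapping.lookup p m \<in> rep_forms_ideal s Bs}"

definition d_g ::
    "('k::field \<Rightarrow> 'v::ab_group_add \<Rightarrow> 'v) \<Rightarrow> 'v set \<Rightarrow> ('k, 'a, 'v) eq_forms \<Rightarrow> ('k, 'a, 'v) eq_forms" where
  "d_g sV Bs p = (\<Sum>i\<in>Bs. \<Sum>j\<in>Bs.
     Poly_Mapping.map (rep_contract sV Bs (elem_endo sV Bs i j)) p * pvar (i, j))"

text \<open>The diagonal action of \<open>x\<close>. On \<open>k[g]\<close> it is the derivation along the vector field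
  \<open>y \<mapsto> [x, y]\<close>, in agreement with the convention \<open>\<hat>a \<mapsto> [x, \<hat>a]\<close> on the representation scheme.\<close>

definition eq_lie ::
    "('k::field \<Rightarrow> 'v::ab_group_add \<Rightarrow> 'v) \<Rightarrow> 'v set \<Rightarrow> ('v \<Rightarrow> 'v) \<Rightarrow> ('k, 'a, 'v) eq_forms \<Rightarrow> ('k, 'a, 'v) eq_forms" where
  "eq_lie sV Bs x p = Poly_Mapping.map (rep_lie sV Bs x) p +
     poly_der (\<lambda>(i, j). bracket sV Bs escale x (\<lambda>k l. pvar (k, l)) i j) p"

definition basic_complex ::
    "('k::field_char_0 \<Rightarrow> 'a::{ring, monoid_mult} \<Rightarrow> 'a) \<Rightarrow> ('k \<Rightarrow> 'v::ab_group_add \<Rightarrow> 'v) \<Rightarrow> 'v set \<Rightarrow>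
      ('k, ('k, 'a, 'v) eq_forms) sq_complex" where
  "basic_complex s sV Bs = \<lparr>
     scl = escale,
     cyc = (\<lambda>n. econst ` basic_forms s sV Bs n),
     nul = (\<lambda>n. econst ` (hom_part kd_deg n \<inter> rep_forms_ideal s Bs)),
     dif = (\<lambda>n p. escale (of_nat (n + 1)) (Poly_Mapping.map d_DR p))\<rparr>"

definition equivariant_complex ::
    "('k::field_char_0 \<Rightarrow> 'a::{ring, monoid_mult} \<Rightarrow> 'a) \<Rightarrow> ('k \<Rightarrow> 'v::ab_group_add \<Rightarrow> 'v) \<Rightarrow> 'v set \<Rightarrow>
      ('k, ('k, 'a, 'v) eq_forms) sq_complex" where
  "equivariant_complex s sV Bs = \<lparr>
     scl = escale,
     cyc = (\<lambda>n. {p \<in> eq_part Bs n. \<forall>x. is_endo sV x \<longrightarrow> eq_lie sV Bs x p \<in> eq_zero s Bs}),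
     nul = (\<lambda>n. eq_part Bs n \<inter> eq_zero s Bs),
     dif = (\<lambda>n p. Poly_Mapping.map d_DR p + d_g sV Bs p)\<rparr>"


subsection \<open>Evaluation\<close>

definition rep_hat :: "'a \<Rightarrow> 'v \<Rightarrow> 'v \<Rightarrow> ('k::field, 'a, 'v) rep_forms" where
  "rep_hat a i j = gen (Fn (pvar (a, i, j)))"

definition ev_gen ::
    "('k::field \<Rightarrow> 'a::{ring, monoid_mult} \<Rightarrow> 'a) \<Rightarrow> 'v set \<Rightarrow> ('a, ('k, 'a) tens) nc_gen option \<Rightarrow> 'v \<Rightarrow> 'v \<Rightarrow> ('k, 'a, 'v) eq_forms" where
  "ev_gen s Bs g i j = (case g of
       None \<Rightarrow> pvar (i, j)
     | Some (Alg a) \<Rightarrow> econst (rep_hat a i j)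
     | Some (Form p) \<Rightarrow>
         form_ext s escale (\<lambda>u v. econst (\<Sum>l\<in>Bs. rep_hat u i l * d_DR (rep_hat v l j))) p)"

primrec ev_word ::
    "('k::field \<Rightarrow> 'a::{ring, monoid_mult} \<Rightarrow> 'a) \<Rightarrow> 'v set \<Rightarrow> ('a, ('k, 'a) tens) nc_gen option list \<Rightarrow> 'v \<Rightarrow> 'v \<Rightarrow> ('k, 'a, 'v) eq_forms" where
  "ev_word s Bs [] = (\<lambda>i j. if i = j then 1 else 0)"
| "ev_word s Bs (g # w) = (\<lambda>i j. \<Sum>l\<in>Bs. ev_gen s Bs g i l * ev_word s Bs w l j)"

definition ev_Omega ::
    "('k::field \<Rightarrow> 'a::{ring, monoid_mult} \<Rightarrow> 'a) \<Rightarrow> 'v set \<Rightarrow> ('k, 'a) nct_forms \<Rightarrow> 'v \<Rightarrow> 'v \<Rightarrow> ('k, 'a, 'v) eq_forms" where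
  "ev_Omega s Bs p i j = lin_ext escale (\<lambda>w. ev_word s Bs (letters w) i j) p"

definition ev ::
    "('k::field \<Rightarrow> 'a::{ring, monoid_mult} \<Rightarrow> 'a) \<Rightarrow> 'v set \<Rightarrow> ('k, 'a) nct_forms \<Rightarrow> ('k, 'a, 'v) eq_forms" where
  "ev s Bs p = (\<Sum>i\<in>Bs. ev_Omega s Bs p i i)"

end

theory Submission
  imports Defs
begin

text \<open>Both morphisms rest on the same observation: \<open>ev\<close> intertwines superderivations of \<open>\<Omega>\<^sub>t A\<close> with
  superderivations of matrices of forms on \<open>Rep(A, V)\<close>, so the identities have to be checked on the generators
  \<open>a\<close>, \<open>da\<close> and \<open>t\<close> only. There \<open>i\<^sub>\<Delta> (da) = ta - at\<close> matches the contraction of \<open>d \<hat>a\<close> with the vector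
  field of the generic matrix \<open>Y = \<hat>t\<close>. On the right-hand side \<open>(d + d\<^sub>g)\<^sup>2\<close> is the Lie derivative along \<open>Y\<close>; it
  vanishes on invariants because the coadjoint part of the action of \<open>Y\<close> involves \<open>[Y, Y] = 0\<close>.

  For the Hochschild complex let \<open>\<kappa> = 1 - b d - d b\<close> be Karoubi's operator. It rotates forms cyclically, hence
  is the identity modulo supercommutators in positive degree, and \<open>B = \<Sum>\<^sub>i \<kappa>\<^sup>i d\<close> is \<open>(n + 1) d\<close> on \<open>n\<close>-forms there.
  Moreover \<open>i\<^sub>\<Delta> z = - t \<Sum>\<^sub>j b \<kappa>\<^sup>j z\<close> modulo supercommutators, where \<open>j\<close> runs below the degree of \<open>z\<close>; since \<open>b\<close>
  commutes with \<open>\<kappa>\<close>, a Hochschild cycle is annihilated by \<open>i\<^sub>\<Delta>\<close> and therefore evaluates to a basic form.\<close>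


section \<open>Congruence modulo subgroups and ideals\<close>

text \<open>Elements of quotients are given by representatives, so an identity is a congruence and
  an operator descends once it maps the ideal into itself. The delicate point is the Hochschild
  complex. The formulas for \<open>b\<close> and \<open>B\<close> prescribe values on a spanning
  family only, and \<open>Omega A\<close> is presented here by generators and relations, without a
  basis of forms \<open>a_0 da_1 ... da_n\<close>; that operators with these values exist on the
  quotient has to come from elsewhere. It comes from derivations, which exist for any values on the
  generators and preserve the ideal as soon as they map the relations into it. Thus \<open>d\<close>
  and \<open>i_Delta\<close> descend, \<open>b\<close> is cut out of \<open>i_Delta\<close> as a
  piece of the part linear in \<open>t\<close> (\<open>hb\<close>), and \<open>B\<close> is
  assembled from \<open>d\<close> and \<open>b\<close> through Karoubi's operator
  (\<open>cB\<close>). Spanning then suffices to see that the operators chosen in the statement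
  agree with \<open>hb\<close> and \<open>cB\<close> modulo the ideal, so every later identity is
  proved for the constructed operators. That \<open>B\<close> is a differential on homology rests on
  \<open>b B + B b = 0\<close>, which follows by telescoping from
  \<open>b d + d b = 1 - \<kappa>\<close> and the identity
  \<open>\<kappa>^n = 1 + b \<kappa>^n d\<close> on \<open>n\<close>-forms.\<close>

definition cong_mod :: "'r::ab_group_add \<Rightarrow> 'r set \<Rightarrow> 'r \<Rightarrow> bool" ("(_/ \<approx>\<^bsub>_\<^esub> _)" [51, 0, 51] 50)
  where "x \<approx>\<^bsub>I\<^esub> y \<longleftrightarrow> x - y \<in> I"

locale add_subgroup =
  fixes I :: "'r::ab_group_add set"
  assumes zero_mem: "0 \<in> I" and diff_mem: "x \<in> I \<Longrightarrow> y \<in> I \<Longrightarrow> x - y \<in> I"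
begin

lemma minus_mem: "x \<in> I \<Longrightarrow> - x \<in> I"
  using diff_mem[OF zero_mem] by simp

lemma add_mem: "x \<in> I \<Longrightarrow> y \<in> I \<Longrightarrow> x + y \<in> I"
  using diff_mem[OF _ minus_mem, of x y] by simp

lemma sum_mem: "(\<And>i. i \<in> S \<Longrightarrow> f i \<in> I) \<Longrightarrow> sum f S \<in> I"
  by (induction S rule: infinite_finite_induct) (auto intro: zero_mem add_mem)

lemma refl: "x \<approx>\<^bsub>I\<^esub> x"
  by (simp add: cong_mod_def zero_mem)

lemma sym: "x \<approx>\<^bsub>I\<^esub> y \<Longrightarrow> y \<approx>\<^bsub>I\<^esub> x"
  using minus_mem[of "x - y"] by (simp add: cong_mod_def)

lemma trans [trans]: "x \<approx>\<^bsub>I\<^esub> y \<Longrightarrow> y \<approx>\<^bsub>I\<^esub> z \<Longrightarrow> x \<approx>\<^bsub>I\<^esub> z"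
  using add_mem[of "x - y" "y - z"] by (simp add: cong_mod_def)

lemma add: "x \<approx>\<^bsub>I\<^esub> y \<Longrightarrow> x' \<approx>\<^bsub>I\<^esub> y' \<Longrightarrow> x + x' \<approx>\<^bsub>I\<^esub> y + y'"
  using add_mem[of "x - y" "x' - y'"] by (simp add: cong_mod_def algebra_simps)

lemma minus: "x \<approx>\<^bsub>I\<^esub> y \<Longrightarrow> - x \<approx>\<^bsub>I\<^esub> - y"
  using minus_mem[of "x - y"] by (simp add: cong_mod_def)

lemma diff: "x \<approx>\<^bsub>I\<^esub> y \<Longrightarrow> x' \<approx>\<^bsub>I\<^esub> y' \<Longrightarrow> x - x' \<approx>\<^bsub>I\<^esub> y - y'"
  using add[OF _ minus, of x y x' y'] by simp

lemma sum: "(\<And>i. i \<in> S \<Longrightarrow> f i \<approx>\<^bsub>I\<^esub> g i) \<Longrightarrow> sum f S \<approx>\<^bsub>I\<^esub> sum g S"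
  using sum_mem[of S "\<lambda>i. f i - g i"] by (simp add: cong_mod_def sum_subtractf)

lemma zero_iff: "x \<approx>\<^bsub>I\<^esub> 0 \<longleftrightarrow> x \<in> I"
  by (simp add: cong_mod_def)

lemma mem_cong: "x \<approx>\<^bsub>I\<^esub> y \<Longrightarrow> x \<in> I \<longleftrightarrow> y \<in> I"
  using trans sym by (metis zero_iff)

text \<open>For goals that follow from known congruences up to ring algebra: the equation between
  differences that remains is left to the simplifier.\<close>

lemma cong_of_diff: "a \<approx>\<^bsub>I\<^esub> b \<Longrightarrow> x - y = a - b \<Longrightarrow> x \<approx>\<^bsub>I\<^esub> y"
  by (simp add: cong_mod_def)

lemma cong_of_diff2: "a \<approx>\<^bsub>I\<^esub> b \<Longrightarrow> c \<approx>\<^bsub>I\<^esub> d \<Longrightarrow> x - y = (a - b) + (c - d) \<Longrightarrow> x \<approx>\<^bsub>I\<^esub> y"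
  by (simp add: cong_mod_def add_mem)

lemma cong_of_diff3: "a \<approx>\<^bsub>I\<^esub> b \<Longrightarrow> c \<approx>\<^bsub>I\<^esub> d \<Longrightarrow> e \<approx>\<^bsub>I\<^esub> f \<Longrightarrow> x - y = (a - b) + (c - d) + (e - f) \<Longrightarrow> x \<approx>\<^bsub>I\<^esub> y"
  by (simp add: cong_mod_def add_mem)

end

lemma sign_left_commute: "a * ((- 1) ^ n * b) = (- 1) ^ n * (a * b)" for a b :: "'r::ring_1"
  by (cases "even n") auto

lemma sign_mem: "add_subgroup I \<Longrightarrow> x \<in> I \<Longrightarrow> (- 1) ^ n * x \<in> I" for x :: "'r::ring_1"
  by (cases "even n") (simp_all add: add_subgroup.minus_mem)

lemma cong_mod_sign: "add_subgroup I \<Longrightarrow> x \<approx>\<^bsub>I\<^esub> y \<Longrightarrow> (- 1) ^ n * x \<approx>\<^bsub>I\<^esub> (- 1) ^ n * y" for x :: "'r::ring_1"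
  unfolding cong_mod_def right_diff_distrib[symmetric] by (rule sign_mem)

lemma sign_mult_sign: "(- 1) ^ m * ((- 1) ^ n * x) = (- 1) ^ (m + n) * x" for x :: "'r::ring_1"
  by (simp add: power_add mult.assoc)

locale two_sided_ideal =
  fixes I :: "'r::ring_1 set"
  assumes ideal: "is_ideal I"
begin

lemma mult_left_mem: "x \<in> I \<Longrightarrow> u * x \<in> I"
  and mult_right_mem: "x \<in> I \<Longrightarrow> x * u \<in> I"
  using ideal by (auto simp: is_ideal_def)

sublocale add_subgroup I
proof
  show "0 \<in> I" using ideal by (simp add: is_ideal_def)
  fix x y assume "x \<in> I" "y \<in> I"
  moreover have "- 1 * y \<in> I" using \<open>y \<in> I\<close> by (rule mult_left_mem)
  ultimately have "x + - y \<in> I" using ideal unfolding is_ideal_def by (metis mult_minus1)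
  then show "x - y \<in> I" by simp
qed

lemma mult_left: "x \<approx>\<^bsub>I\<^esub> y \<Longrightarrow> u * x \<approx>\<^bsub>I\<^esub> u * y"
  using mult_left_mem[of "x - y" u] by (simp add: cong_mod_def right_diff_distrib)

lemma mult_right: "x \<approx>\<^bsub>I\<^esub> y \<Longrightarrow> x * u \<approx>\<^bsub>I\<^esub> y * u"
  using mult_right_mem[of "x - y" u] by (simp add: cong_mod_def left_diff_distrib)

lemma mult: "x \<approx>\<^bsub>I\<^esub> y \<Longrightarrow> x' \<approx>\<^bsub>I\<^esub> y' \<Longrightarrow> x * x' \<approx>\<^bsub>I\<^esub> y * y'"
  using mult_left mult_right trans by blast

end

lemma is_ideal_ideal_of: "is_ideal (ideal_of R)"
  unfolding ideal_of_def by (rule hull_in) (auto simp: is_ideal_def)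

lemma two_sided_ideal_ideal_of: "two_sided_ideal (ideal_of R)"
  by unfold_locales (rule is_ideal_ideal_of)

text \<open>The predicate \<open>P\<close> need not be stable under multiplication: the elements
  \<open>p\<close> all of whose multiples \<open>u * p * v\<close> satisfy \<open>P\<close> form an
  ideal, which contains \<open>R\<close> by the base case. The conclusion is the instance
  \<open>u = v = 1\<close>.\<close>

lemma ideal_of_induct [consumes 1, case_names base zero add]:
  assumes "p \<in> ideal_of R"
    and "\<And>u r v. r \<in> R \<Longrightarrow> P (u * r * v)"
    and "P 0" and "\<And>p q. P p \<Longrightarrow> P q \<Longrightarrow> P (p + q)"
  shows "P p"
proof -
  have "ideal_of R \<subseteq> {p. \<forall>u v. P (u * p * v)}"
    unfolding ideal_of_def
  proof (rule hull_minimal)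
    show "R \<subseteq> {p. \<forall>u v. P (u * p * v)}" using assms(2) by blast
    show "is_ideal {p. \<forall>u v. P (u * p * v)}"
      unfolding is_ideal_def using assms(3,4)
      by (auto simp: distrib_left distrib_right) (metis mult.assoc)+
  qed
  then have "P (1 * p * 1)" using assms(1) by blast
  then show ?thesis by simp
qed


section \<open>Linear maps on poly mappings\<close>

lemma linear_iff_additive:
  "Vector_Spaces.linear s t f \<longleftrightarrow> vector_space s \<and> vector_space t \<and>
    (\<forall>x y. f (x + y) = f x + f y) \<and> (\<forall>c x. f (s c x) = t c (f x))"
  by (auto simp: Vector_Spaces.linear_def module_hom_def module_hom_axioms_def vector_space_def module_def)

lemma linear_add: "Vector_Spaces.linear s t f \<Longrightarrow> f (x + y) = f x + f y"
  and linear_scale: "Vector_Spaces.linear s t f \<Longrightarrow> f (s c x) = t c (f x)"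
  by (simp_all add: linear_iff_additive)

lemma linear_0: "Vector_Spaces.linear s t f \<Longrightarrow> f 0 = 0"
  using linear_add[of s t f 0 0] by simp

lemma linear_diff: "Vector_Spaces.linear s t f \<Longrightarrow> f (x - y) = f x - f y"
  using linear_add[of s t f "x - y" y] by (simp add: algebra_simps)

lemma linear_minus: "Vector_Spaces.linear s t f \<Longrightarrow> f (- x) = - f x"
  using linear_diff[of s t f 0 x] by (simp add: linear_0)

lemma linear_sum: "Vector_Spaces.linear s t f \<Longrightarrow> f (sum g S) = (\<Sum>i\<in>S. f (g i))"
  by (induction S rule: infinite_finite_induct) (simp_all add: linear_add linear_0)

lemma linear_sign: "Vector_Spaces.linear s t f \<Longrightarrow> f ((- 1) ^ n * x) = (- 1) ^ n * f x"
  for f :: "'r::ring_1 \<Rightarrow> 's::ring_1"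
  by (cases "even n") (simp_all add: linear_minus)

lemma linear_cong_mod:
  "Vector_Spaces.linear s t f \<Longrightarrow> (\<And>z. z \<in> I \<Longrightarrow> f z \<in> J) \<Longrightarrow> x \<approx>\<^bsub>I\<^esub> y \<Longrightarrow> f x \<approx>\<^bsub>J\<^esub> f y"
  by (simp add: cong_mod_def flip: linear_diff)

lemma linear_compose: "Vector_Spaces.linear s t f \<Longrightarrow> Vector_Spaces.linear t u g \<Longrightarrow> Vector_Spaces.linear s u (\<lambda>x. g (f x))"
  by (simp add: linear_iff_additive)

lemma vector_space_pscale: "vector_space (pscale :: 'k::field \<Rightarrow> ('x \<Rightarrow>\<^sub>0 'k) \<Rightarrow> _)"
  by unfold_locales (auto intro!: poly_mapping_eqI simp: lookup_pscale lookup_add algebra_simps)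

interpretation pscale: vector_space "pscale :: 'k::field \<Rightarrow> ('x \<Rightarrow>\<^sub>0 'k) \<Rightarrow> _"
  by (rule vector_space_pscale)

lemma linear_pscaleI:
  "(\<And>x y. f (x + y) = f x + f y) \<Longrightarrow> (\<And>c x. f (pscale c x) = pscale c (f x)) \<Longrightarrow> Vector_Spaces.linear pscale pscale f"
  for f :: "('x \<Rightarrow>\<^sub>0 'k::field) \<Rightarrow> ('y \<Rightarrow>\<^sub>0 'k)"
  by (simp add: linear_iff_additive vector_space_pscale)

lemma (in vector_space) linear_lin_ext: "Vector_Spaces.linear pscale scale (lin_ext scale f)"
  by (simp add: linear_iff_additive vector_space_pscale vector_space_axioms lin_ext_add lin_ext_pscale)

lemma pscale_conv_mult: "pscale c p = Poly_Mapping.single 0 c * p"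
  for p :: "'x::monoid_add \<Rightarrow>\<^sub>0 'k::field"
  by (induction p rule: poly_mapping_induct_single_add)
    (simp_all add: pscale_single mult_single pscale_add distrib_left)

lemma single_0_commute: "Poly_Mapping.single 0 c * p = p * Poly_Mapping.single 0 c"
  for p :: "'x::monoid_add \<Rightarrow>\<^sub>0 'k::field"
  by (induction p rule: poly_mapping_induct_single_add)
    (simp_all add: mult_single distrib_left distrib_right mult.commute)

lemma pscale_mult_left: "pscale c p * q = pscale c (p * q)"
  and pscale_mult_right: "p * pscale c q = pscale c (p * q)"
  for p q :: "'x::monoid_add \<Rightarrow>\<^sub>0 'k::field"
  by (simp add: pscale_conv_mult mult.assoc)
    (metis pscale_conv_mult single_0_commute mult.assoc)

lemma ideal_pscale: "two_sided_ideal I \<Longrightarrow> x \<in> I \<Longrightarrow> pscale c x \<in> I"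
  for I :: "('x::monoid_add \<Rightarrow>\<^sub>0 'k::field) set"
  by (simp add: pscale_conv_mult two_sided_ideal.mult_left_mem)

lemma cong_mod_pscale: "two_sided_ideal I \<Longrightarrow> x \<approx>\<^bsub>I\<^esub> y \<Longrightarrow> pscale c x \<approx>\<^bsub>I\<^esub> pscale c y"
  for I :: "('x::monoid_add \<Rightarrow>\<^sub>0 'k::field) set"
  by (simp add: pscale_conv_mult two_sided_ideal.mult_left)

text \<open>The base case concerns only terms of \<open>p\<close> itself, so a restriction on the
  support of \<open>p\<close>, such as homogeneity, can be used there.\<close>

lemma keys_induct [case_names single zero add]:
  fixes p :: "'x \<Rightarrow>\<^sub>0 'b::comm_monoid_add"
  assumes "\<And>x. x \<in> Poly_Mapping.keys p \<Longrightarrow> P (Poly_Mapping.single x (Poly_Mapping.lookup p x))"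
    and "P 0" and "\<And>p q. P p \<Longrightarrow> P q \<Longrightarrow> P (p + q)"
  shows "P p"
proof -
  have "P (\<Sum>x\<in>K. Poly_Mapping.single x (Poly_Mapping.lookup p x))" if "K \<subseteq> Poly_Mapping.keys p" for K
    using that by (induction K rule: infinite_finite_induct) (auto intro: assms)
  moreover have "(\<Sum>x\<in>Poly_Mapping.keys p. Poly_Mapping.single x (Poly_Mapping.lookup p x)) = p"
    by (rule poly_mapping_eqI) (auto simp: lookup_sum lookup_single when_def sum.delta in_keys_iff)
  ultimately show ?thesis by (metis subset_refl)
qed


section \<open>Free algebras and superderivations\<close>

abbreviation word_deg :: "('x \<Rightarrow> nat) \<Rightarrow> 'x list \<Rightarrow> nat" where
  "word_deg deg w \<equiv> sum_list (map deg w)"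

definition wmon :: "'x list \<Rightarrow> ('k::field, 'x) free_alg" where
  "wmon w = Poly_Mapping.single (Word w) 1"

lemma wmon_Nil: "wmon [] = 1"
  by (simp add: wmon_def flip: zero_word_def)

lemma wmon_append: "wmon (u @ v) = wmon u * wmon v"
  by (simp add: wmon_def mult_single plus_word_def)

lemma wmon_Cons: "wmon (x # w) = gen x * wmon w"
  using wmon_append[of "[x]" w] by (simp add: wmon_def gen_def)

lemma gen_conv_wmon: "gen x = wmon [x]"
  by (simp add: wmon_def gen_def)

lemma single_conv_wmon: "Poly_Mapping.single w c = pscale c (wmon (letters w))"
  by (simp add: wmon_def pscale_single)

lemma free_alg_induct [case_names wmon scale add]:
  assumes "\<And>w. P (wmon w)" and "\<And>c p. P p \<Longrightarrow> P (pscale c p)" and "\<And>p q. P p \<Longrightarrow> P q \<Longrightarrow> P (p + q)"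
  shows "P p"
  by (induction p rule: poly_mapping_induct_single_add) (auto simp: single_conv_wmon assms)

text \<open>The zero case cannot be obtained from scaling by 0, since there may be no word of degree
  \<open>n\<close> at all.\<close>

lemma hom_part_induct [consumes 1, case_names wmon scale zero add]:
  fixes p :: "('k::field, 'x) free_alg"
  assumes "p \<in> hom_part deg n"
    and "\<And>w. word_deg deg w = n \<Longrightarrow> P (wmon w)" and "\<And>c p. P p \<Longrightarrow> P (pscale c p)"
    and "P 0" and "\<And>p q. P p \<Longrightarrow> P q \<Longrightarrow> P (p + q)"
  shows "P p"
  using assms(1) by (intro keys_induct[of p P]) (auto simp: single_conv_wmon hom_part_def intro: assms(2-))

lemma hom_part_0: "0 \<in> hom_part deg n"
  by (simp add: hom_part_def)

lemma hom_part_add: "p \<in> hom_part deg n \<Longrightarrow> q \<in> hom_part deg n \<Longrightarrow> p + q \<in> hom_part deg n"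
  using Poly_Mapping.keys_add[of p q] by (auto simp: hom_part_def)

lemma hom_part_pscale: "p \<in> hom_part deg n \<Longrightarrow> pscale c p \<in> hom_part deg n" for c :: "'k::field"
  by (auto simp: hom_part_def in_keys_iff lookup_pscale)

lemma hom_part_minus: "p \<in> hom_part deg n \<Longrightarrow> - p \<in> hom_part deg n" for p :: "('k::field, 'x) free_alg"
  by (auto simp: hom_part_def)

lemma hom_part_diff: "p \<in> hom_part deg n \<Longrightarrow> q \<in> hom_part deg n \<Longrightarrow> p - q \<in> hom_part deg n"
  for p :: "('k::field, 'x) free_alg"
  using hom_part_add[OF _ hom_part_minus, of p deg n q] by simp

lemma hom_part_sign: "p \<in> hom_part deg n \<Longrightarrow> (- 1) ^ m * p \<in> hom_part deg n" for p :: "('k::field, 'x) free_alg"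
  by (cases "even m") (auto intro: hom_part_minus)

lemma hom_part_sum: "(\<And>i. i \<in> S \<Longrightarrow> f i \<in> hom_part deg n) \<Longrightarrow> sum f S \<in> hom_part deg n"
  by (induction S rule: infinite_finite_induct) (auto intro: hom_part_0 hom_part_add)

lemma hom_part_wmon: "wmon w \<in> hom_part deg n \<longleftrightarrow> word_deg deg w = n"
  by (simp add: hom_part_def wmon_def)

lemma hom_part_gen: "(gen x :: ('k::field, 'x) free_alg) \<in> hom_part deg n \<longleftrightarrow> deg x = n"
  by (simp add: gen_conv_wmon hom_part_wmon)

lemma hom_part_1: "(1 :: ('k::field, 'x) free_alg) \<in> hom_part deg 0"
  using hom_part_wmon[of "[]" deg 0] by (simp add: wmon_Nil)

lemma hom_part_mult:
  "p \<in> hom_part deg m \<Longrightarrow> q \<in> hom_part deg n \<Longrightarrow> p * q \<in> hom_part deg (m + n)"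
  for p q :: "('k::field, 'x) free_alg"
proof (induction p rule: hom_part_induct)
  case (wmon w)
  from wmon(2,1) show ?case
    by (induction q rule: hom_part_induct)
      (auto simp: distrib_left pscale_mult_right hom_part_wmon simp flip: wmon_append
        intro: hom_part_0 hom_part_add hom_part_pscale)
qed (auto simp: distrib_right pscale_mult_left intro: hom_part_0 hom_part_add hom_part_pscale)

lemma linear_hom_partI:
  fixes f :: "('k::field, 'x) free_alg \<Rightarrow> ('k, 'y) free_alg"
  assumes "Vector_Spaces.linear pscale pscale f" "\<And>w. word_deg deg w = n \<Longrightarrow> f (wmon w) \<in> hom_part deg' m"
    "p \<in> hom_part deg n"
  shows "f p \<in> hom_part deg' m"
  using assms(3)
  by (induction p rule: hom_part_induct)
    (auto simp: linear_add[OF assms(1)] linear_scale[OF assms(1)] linear_0[OF assms(1)] assms(2)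
      intro: hom_part_0 hom_part_add hom_part_pscale)

text \<open>Signs depend on degrees modulo 2 only. With parities, \<open>n + 1\<close> can stand for
  the degree \<open>n - 1\<close> of a contraction, and degree 0 is no exception.\<close>

definition parity_part :: "('x \<Rightarrow> nat) \<Rightarrow> nat \<Rightarrow> ('k::zero, 'x) free_alg set" where
  "parity_part deg n = {p. \<forall>w\<in>Poly_Mapping.keys p. even (word_deg deg (letters w)) = even n}"

lemma hom_part_parity: "p \<in> hom_part deg n \<Longrightarrow> p \<in> parity_part deg n"
  by (auto simp: hom_part_def parity_part_def)

lemma parity_part_induct [consumes 1, case_names hom zero add]:
  fixes p :: "('k::field, 'x) free_alg"
  assumes "p \<in> parity_part deg n"
    and "\<And>p m. p \<in> hom_part deg m \<Longrightarrow> even m = even n \<Longrightarrow> P p"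
    and "P 0" and "\<And>p q. P p \<Longrightarrow> P q \<Longrightarrow> P (p + q)"
  shows "P p"
  using assms(1)
  by (intro keys_induct[of p P])
    (auto simp: single_conv_wmon parity_part_def intro: assms(3,4) assms(2)[OF hom_part_pscale[OF iffD2[OF hom_part_wmon]]])

lemma parity_part_0: "0 \<in> parity_part deg n"
  by (simp add: parity_part_def)

lemma parity_part_add: "p \<in> parity_part deg n \<Longrightarrow> q \<in> parity_part deg n \<Longrightarrow> p + q \<in> parity_part deg n"
  using Poly_Mapping.keys_add[of p q] by (auto simp: parity_part_def)

lemma parity_part_even: "even m = even n \<Longrightarrow> parity_part deg m = parity_part deg n"
  by (auto simp: parity_part_def)

definition superderivation :: "('x \<Rightarrow> nat) \<Rightarrow> nat \<Rightarrow> (('k::field, 'x) free_alg \<Rightarrow> ('k, 'x) free_alg) \<Rightarrow> bool" where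
  "superderivation deg e E \<longleftrightarrow> Vector_Spaces.linear pscale pscale E \<and>
     (\<forall>n u v. u \<in> hom_part deg n \<longrightarrow> E (u * v) = E u * v + (- 1) ^ (e * n) * (u * E v))"

lemma superderivation_linear: "superderivation deg e E \<Longrightarrow> Vector_Spaces.linear pscale pscale E"
  by (simp add: superderivation_def)

lemma superderivation_mult:
  fixes E :: "('k::field, 'x) free_alg \<Rightarrow> ('k, 'x) free_alg"
  assumes E: "superderivation deg e E" and u: "u \<in> parity_part deg n"
  shows "E (u * v) = E u * v + (- 1) ^ (e * n) * (u * E v)"
  using u
proof (induction u rule: parity_part_induct)
  case (hom p m)
  moreover have "(- 1) ^ (e * m) = ((- 1) ^ (e * n) :: ('k, 'x) free_alg)"
    using hom(2) by (cases "even e"; cases "even n") (auto simp: minus_one_power_iff)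
  ultimately show ?case using E by (simp add: superderivation_def)
qed (simp_all add: linear_0[OF superderivation_linear[OF E]] linear_add[OF superderivation_linear[OF E]] distrib_left distrib_right)

lemma superderivation_hom: "superderivation deg e E \<Longrightarrow> u \<in> hom_part deg n \<Longrightarrow>
    E (u * v) = E u * v + (- 1) ^ (e * n) * (u * E v)"
  by (simp add: superderivation_def)

lemma superderivation_1: "superderivation deg e E \<Longrightarrow> E 1 = 0"
  using superderivation_hom[OF _ hom_part_1, of deg e E 1] by simp

lemma superderivationI:
  fixes E :: "('k::field, 'x) free_alg \<Rightarrow> ('k, 'x) free_alg"
  assumes lin: "Vector_Spaces.linear pscale pscale E"
    and "\<And>u v. E (wmon u * wmon v) = E (wmon u) * wmon v + (- 1) ^ (e * word_deg deg u) * (wmon u * E (wmon v))"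
  shows "superderivation deg e E"
  unfolding superderivation_def
proof (intro conjI allI impI)
  fix n :: nat and u v :: "('k, 'x) free_alg" assume "u \<in> hom_part deg n"
  then show "E (u * v) = E u * v + (- 1) ^ (e * n) * (u * E v)"
  proof (induction u rule: hom_part_induct)
    case (wmon w)
    then show ?case
      by (induction v rule: free_alg_induct)
        (auto simp: assms(2) distrib_left linear_add[OF lin] linear_scale[OF lin] pscale_mult_right pscale_add)
  qed (auto simp: linear_0[OF lin] linear_add[OF lin] linear_scale[OF lin] pscale_mult_left pscale_mult_right
      pscale_add distrib_left distrib_right)
qed (rule lin)

lemma linear_superder: "Vector_Spaces.linear pscale pscale (superder e deg D)"
  unfolding superder_def by (rule pscale.linear_lin_ext)

lemma superder_wmon: "superder e deg D (wmon w) = word_der e deg D w"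
  unfolding superder_def wmon_def by (simp add: pscale.lin_ext_single)

lemma superder_gen: "superder e deg D (gen x) = D x"
  by (simp add: gen_conv_wmon superder_wmon wmon_Nil flip: wmon_def)

lemma superderivation_superder: "superderivation deg e (superder e deg D)"
proof (rule superderivationI[OF linear_superder])
  fix u v
  have "word_der e deg D (u @ v) = word_der e deg D u * wmon v + (- 1) ^ (e * word_deg deg u) * (wmon u * word_der e deg D v)"
    by (induction u)
      (simp_all add: wmon_Nil wmon_append wmon_Cons distrib_left distrib_right power_add mult.assoc
        sign_left_commute[where a = "gen x" for x]
        flip: wmon_def)
  then show "superder e deg D (wmon u * wmon v) = superder e deg D (wmon u) * wmon v +
      (- 1) ^ (e * word_deg deg u) * (wmon u * superder e deg D (wmon v))"
    by (simp add: superder_wmon flip: wmon_append)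
qed

text \<open>\<open>k\<close> and \<open>l\<close> make room for superderivations that lower the degree: the degree changes by
  \<open>k - l\<close>.\<close>

lemma superderivation_hom_part:
  assumes E: "superderivation deg e E" and gen: "\<And>x m. deg x + k = m + l \<Longrightarrow> E (gen x) \<in> hom_part deg m"
    and low: "\<And>x. deg x + k < l \<Longrightarrow> E (gen x) = 0"
    and p: "p \<in> hom_part deg n" and m: "n + k = m + l"
  shows "E p \<in> hom_part deg m"
proof (rule linear_hom_partI[OF superderivation_linear[OF E] _ p])
  fix w assume "word_deg deg w = n"
  then show "E (wmon w) \<in> hom_part deg m"
    using m
  proof (induction w arbitrary: n m)
    case Nil
    then show ?case by (simp add: wmon_Nil superderivation_1[OF E] hom_part_0)
  next
    case (Cons x w)
    have "gen x * E (wmon w) \<in> hom_part deg m"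
    proof (cases "word_deg deg w + k < l")
      \<comment> \<open>Every letter of \<open>w\<close> then has too small a degree as well, so
        \<open>E\<close> annihilates all of them and hence the word.\<close>
      case True
      have "E (wmon w) = 0" using True
        by (induction w) (auto simp: wmon_Nil wmon_Cons superderivation_1[OF E] low
            superderivation_hom[OF E, of "gen _", OF iffD2[OF hom_part_gen]])
      then show ?thesis by (simp add: hom_part_0)
    next
      case False
      then obtain m' where m': "word_deg deg w + k = m' + l"
        by (metis add.commute le_iff_add not_less)
      have "gen x * E (wmon w) \<in> hom_part deg (deg x + m')"
        by (rule hom_part_mult[OF _ Cons.IH[OF refl m']]) (simp add: hom_part_gen)
      moreover have "deg x + m' = m" using m' Cons.prems by simp
      ultimately show ?thesis by simp
    qed
    moreover have "E (gen x) * wmon w \<in> hom_part deg m"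
    proof (cases "deg x + k < l")
      case True
      then show ?thesis by (simp add: low hom_part_0)
    next
      case False
      then obtain m' where m': "deg x + k = m' + l"
        by (metis add.commute le_iff_add not_less)
      have "E (gen x) * wmon w \<in> hom_part deg (m' + word_deg deg w)"
        by (rule hom_part_mult[OF gen[OF m']]) (simp add: hom_part_wmon)
      moreover have "m' + word_deg deg w = m" using m' Cons.prems by simp
      ultimately show ?thesis by simp
    qed
    ultimately show ?case
      by (simp add: wmon_Cons superderivation_hom[OF E, of "gen _", OF iffD2[OF hom_part_gen]] hom_part_add hom_part_sign)
  qed
qed

lemma superderivation_add:
  "superderivation deg e E \<Longrightarrow> superderivation deg e F \<Longrightarrow> superderivation deg e (\<lambda>p. E p + F p)"
  unfolding superderivation_def linear_iff_additive
  by (simp add: algebra_simps pscale_add)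

lemma superderivation_diff:
  "superderivation deg e E \<Longrightarrow> superderivation deg e F \<Longrightarrow> superderivation deg e (\<lambda>p. E p - F p)"
  unfolding superderivation_def linear_iff_additive
  by (simp add: algebra_simps pscale.scale_right_diff_distrib)

lemma superderivation_pscale:
  "superderivation deg e E \<Longrightarrow> superderivation deg e (\<lambda>p. pscale c (E p))"
  unfolding superderivation_def linear_iff_additive
  by (simp add: pscale_add pscale_mult_left pscale_mult_right mult.commute)

lemma superderivation_sum:
  "(\<And>i. i \<in> S \<Longrightarrow> superderivation deg e (E i)) \<Longrightarrow> superderivation deg e (\<lambda>p. \<Sum>i\<in>S. E i p)"
proof (induction S rule: infinite_finite_induct)
  case (insert x F)
  then show ?case by (simp add: superderivation_add)
qed (simp_all add: superderivation_def linear_iff_additive vector_space_pscale)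

text \<open>The mixed terms \<open>E u * F v\<close> and \<open>F u * E v\<close> arise from both
  compositions and cancel, because \<open>E\<close> and \<open>F\<close> shift the parity by
  \<open>e\<close> and \<open>f\<close>.\<close>

lemma superderivation_bracket:
  fixes E F :: "('k::field, 'x) free_alg \<Rightarrow> ('k, 'x) free_alg"
  assumes E: "superderivation deg e E" and F: "superderivation deg f F"
    and Ep: "\<And>n p. p \<in> hom_part deg n \<Longrightarrow> E p \<in> parity_part deg (n + e)"
    and Fp: "\<And>n p. p \<in> hom_part deg n \<Longrightarrow> F p \<in> parity_part deg (n + f)"
  shows "superderivation deg (e + f) (\<lambda>p. E (F p) - (- 1) ^ (e * f) * F (E p))"
proof -
  note lin = linear_compose[OF superderivation_linear superderivation_linear]
  have "E (F (u * v)) - (- 1) ^ (e * f) * F (E (u * v)) = (E (F u) - (- 1) ^ (e * f) * F (E u)) * v +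
      (- 1) ^ ((e + f) * n) * (u * (E (F v) - (- 1) ^ (e * f) * F (E v)))"
    if u: "u \<in> hom_part deg n" for n u v
    unfolding superderivation_hom[OF E u] superderivation_hom[OF F u]
      linear_add[OF superderivation_linear[OF E]] linear_add[OF superderivation_linear[OF F]]
      linear_sign[OF superderivation_linear[OF E]] linear_sign[OF superderivation_linear[OF F]]
      superderivation_hom[OF E u] superderivation_hom[OF F u]
      superderivation_mult[OF E Fp[OF u]] superderivation_mult[OF F Ep[OF u]]
    by (cases "even e"; cases "even f"; cases "even n") (simp_all add: minus_one_power_iff algebra_simps)
  then show ?thesis
    unfolding superderivation_def using lin[OF E F] lin[OF F E]
    by (auto simp: linear_iff_additive algebra_simps pscale.scale_right_diff_distrib pscale_mult_right)
qed

text \<open>Half the bracket of \<open>E\<close> with itself. The direct computation avoids dividing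
  by 2: the two mixed terms have opposite signs.\<close>

lemma superderivation_square:
  assumes E: "superderivation deg 1 E"
    and Ep: "\<And>n p. p \<in> hom_part deg n \<Longrightarrow> E p \<in> parity_part deg (n + 1)"
  shows "superderivation deg 0 (\<lambda>p. E (E p))"
proof -
  have "E (E (u * v)) = E (E u) * v + u * E (E v)"
    if u: "u \<in> hom_part deg n" for n u v
    unfolding superderivation_hom[OF E u]
      linear_add[OF superderivation_linear[OF E]] linear_sign[OF superderivation_linear[OF E]]
      superderivation_hom[OF E u] superderivation_mult[OF E Ep[OF u]]
    by (cases "even n") (simp_all add: algebra_simps)
  then show ?thesis
    unfolding superderivation_def using linear_compose[OF superderivation_linear[OF E] superderivation_linear[OF E]]
    by simp
qed

text \<open>Applied to the difference of two superderivations, this reduces an identity modulo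
  \<open>I\<close> to the generators. Stability of \<open>I\<close> under \<open>E\<close> is not
  asked for, because only values of \<open>E\<close> need to lie in \<open>I\<close>.\<close>

lemma superderivation_mem_ideal:
  assumes E: "superderivation deg e E" and I: "two_sided_ideal I" and gen: "\<And>x. E (gen x) \<in> I"
  shows "E p \<in> I"
proof -
  interpret two_sided_ideal I by fact
  note lin = superderivation_linear[OF E]
  have "E (wmon w) \<in> I" for w
  proof (induction w)
    case (Cons x w)
    have "E (wmon (x # w)) = E (gen x) * wmon w + (- 1) ^ (e * deg x) * (gen x * E (wmon w))"
      unfolding wmon_Cons by (rule superderivation_hom[OF E]) (simp add: hom_part_gen)
    then show ?case using Cons gen by (simp add: add_mem mult_left_mem mult_right_mem)
  qed (simp add: wmon_Nil superderivation_1[OF E] zero_mem)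
  then show ?thesis
    by (induction p rule: free_alg_induct)
      (auto simp: linear_add[OF lin] linear_scale[OF lin] intro: add_mem ideal_pscale[OF I])
qed

lemma two_sided_ideal_zero: "two_sided_ideal {0}"
  by unfold_locales (simp add: is_ideal_def)

lemma superderivation_eqI:
  assumes "superderivation deg e E" "superderivation deg e F" "\<And>x. E (gen x) = F (gen x)"
  shows "E p = F p"
  using superderivation_mem_ideal[OF superderivation_diff[OF assms(1,2)] two_sided_ideal_zero, of p] assms(3) by simp

text \<open>Homogeneity of the relations makes the Leibniz rule applicable to \<open>r * v\<close>;
  the left factor \<open>u\<close> is split into words for the same reason.\<close>

lemma superderivation_ideal_of:
  assumes E: "superderivation deg e E"
    and hom: "\<And>r. r \<in> R \<Longrightarrow> \<exists>n. r \<in> hom_part deg n"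
    and rel: "\<And>r. r \<in> R \<Longrightarrow> E r \<in> ideal_of R"
    and p: "p \<in> ideal_of R"
  shows "E p \<in> ideal_of R"
proof -
  interpret two_sided_ideal "ideal_of R" by (rule two_sided_ideal_ideal_of)
  note lin = superderivation_linear[OF E]
  show ?thesis
    using p
  proof (induction p rule: ideal_of_induct)
    case (base u r v)
    obtain n where "r \<in> hom_part deg n" using hom[OF base] by blast
    then have rv: "E (r * v) \<in> ideal_of R"
      using base by (simp add: superderivation_hom[OF E] add_mem mult_left_mem mult_right_mem rel ideal_of_base)
    show ?case
    proof (induction u rule: free_alg_induct)
      case (wmon w)
      have "E (wmon w * (r * v)) = E (wmon w) * (r * v) + (- 1) ^ (e * word_deg deg w) * (wmon w * E (r * v))"
        by (rule superderivation_hom[OF E]) (simp add: hom_part_wmon)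
      then show ?case
        using base rv by (simp add: mult.assoc add_mem mult_left_mem mult_right_mem ideal_of_base)
    qed (simp_all add: distrib_right linear_add[OF lin] pscale_mult_left linear_scale[OF lin] add_mem
        ideal_pscale[OF two_sided_ideal_axioms])
  qed (simp_all add: linear_0[OF lin] linear_add[OF lin] zero_mem add_mem)
qed


section \<open>Noncommutative differential forms\<close>

lemma lin_ext_linear:
  assumes f: "Vector_Spaces.linear s t f"
  shows "f (lin_ext s g p) = lin_ext t (\<lambda>x. f (g x)) p"
  by (simp add: lin_ext_def linear_sum[OF f] linear_scale[OF f])

lemma (in add_subgroup) lin_ext_mem:
  "(\<And>c z. z \<in> I \<Longrightarrow> s c z \<in> I) \<Longrightarrow> (\<And>x. x \<in> Poly_Mapping.keys p \<Longrightarrow> f x \<in> I) \<Longrightarrow> lin_ext s f p \<in> I"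
  unfolding lin_ext_def by (rule sum_mem) blast

lemma cong_mod_lin_ext:
  assumes "vector_space s" "add_subgroup I" "\<And>c z. z \<in> I \<Longrightarrow> s c z \<in> I" "\<And>x. f x \<approx>\<^bsub>I\<^esub> g x"
  shows "lin_ext s f p \<approx>\<^bsub>I\<^esub> lin_ext s g p"
proof -
  interpret vector_space s by fact
  interpret add_subgroup I by fact
  have "lin_ext s f p - lin_ext s g p = lin_ext s (\<lambda>x. f x - g x) p"
    by (simp add: lin_ext_def sum_subtractf scale_right_diff_distrib)
  then show ?thesis using assms(3,4) unfolding cong_mod_def by (simp add: lin_ext_mem)
qed

text \<open>For maps on \<open>A\<close> that become linear only in a quotient, such as
  \<open>x \<mapsto> tensor x 1\<close> modulo \<open>tensor_rel s\<close>.\<close>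

lemma cong_mod_linear_lin_ext:
  assumes s: "vector_space s" and t: "vector_space t" and I: "add_subgroup I" "\<And>c z. z \<in> I \<Longrightarrow> t c z \<in> I"
    and add: "\<And>x y. f (x + y) \<approx>\<^bsub>I\<^esub> f x + f y" and scale: "\<And>c x. f (s c x) \<approx>\<^bsub>I\<^esub> t c (f x)"
  shows "f (lin_ext s g p) \<approx>\<^bsub>I\<^esub> lin_ext t (\<lambda>x. f (g x)) p"
proof -
  interpret s: vector_space s by fact
  interpret t: vector_space t by fact
  interpret add_subgroup I by fact
  show ?thesis
  proof (induction p rule: poly_mapping_induct_single_add)
    case (1 x c)
    show ?case by (simp add: s.lin_ext_single t.lin_ext_single scale)
  next
    case (2 p q)
    have "f (lin_ext s g p + lin_ext s g q) \<approx>\<^bsub>I\<^esub> f (lin_ext s g p) + f (lin_ext s g q)" by (rule local.assms(5))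
    also have "\<dots> \<approx>\<^bsub>I\<^esub> lin_ext t (\<lambda>x. f (g x)) p + lin_ext t (\<lambda>x. f (g x)) q" by (rule local.add[OF 2])
    finally show ?case by (simp add: s.lin_ext_add t.lin_ext_add)
  qed
qed

lemma (in vector_space) lin_ext_diff: "lin_ext scale f (p - q) = lin_ext scale f p - lin_ext scale f q"
  by (rule linear_diff[OF linear_lin_ext])

lemma (in vector_space) lin_ext_tensor: "lin_ext scale f (tensor u v) = f (u, v)"
  by (simp add: tensor_def lin_ext_single)

lemma (in vector_space) lin_ext_dtens: "lin_ext scale f (dtens a) = f (1, a) - f (a, 1)"
  by (simp add: dtens_def lin_ext_diff lin_ext_tensor)

lemmas lin_ext_simps = pscale.lin_ext_dtens pscale.lin_ext_diff pscale.lin_ext_tensor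
  pscale.lin_ext_add pscale.lin_ext_pscale pscale.lin_ext_single

lemma lact_simps:
  "lact a (p + q) = lact a p + lact a q" "lact a (p - q) = lact a p - lact a q"
  "lact a (pscale c p) = pscale c (lact a p)" "lact a (tensor u v) = tensor (a * u) v"
  by (simp_all add: lact_def lin_ext_simps)

lemma ract_simps:
  "ract (p + q) a = ract p a + ract q a" "ract (p - q) a = ract p a - ract q a"
  "ract (pscale c p) a = pscale c (ract p a)" "ract (tensor u v) a = tensor u (v * a)"
  by (simp_all add: ract_def lin_ext_simps)

lemma tensor_induct [case_names tensor scale add]:
  fixes p :: "('k::field, 'a) tens"
  assumes "\<And>u v. P (tensor u v)" and "\<And>c p. P p \<Longrightarrow> P (pscale c p)" and "\<And>p q. P p \<Longrightarrow> P q \<Longrightarrow> P (p + q)"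
  shows "P p"
proof (induction p rule: poly_mapping_induct_single_add)
  case (1 x c)
  have "Poly_Mapping.single x c = pscale c (tensor (fst x) (snd x))"
    by (simp add: tensor_def pscale_single)
  then show ?case using assms(1,2) by simp
qed (rule assms(3))

context assoc_algebra
begin

lemma lin_ext_mult_lact: "lin_ext s (\<lambda>(u, v). u * v) (lact a p) = a * lin_ext s (\<lambda>(u, v). u * v) p"
  by (induction p rule: tensor_induct)
    (simp_all add: lact_simps lin_ext_tensor lin_ext_add lin_ext_pscale scale_mult_right distrib_left mult.assoc)

lemma lin_ext_mult_ract: "lin_ext s (\<lambda>(u, v). u * v) (ract p a) = lin_ext s (\<lambda>(u, v). u * v) p * a"
  by (induction p rule: tensor_induct)
    (simp_all add: ract_simps lin_ext_tensor lin_ext_add lin_ext_pscale scale_mult_left distrib_right mult.assoc)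

lemma Omega1_closed:
  "p \<in> Omega1 s \<Longrightarrow> q \<in> Omega1 s \<Longrightarrow> p + q \<in> Omega1 s"
  "p \<in> Omega1 s \<Longrightarrow> q \<in> Omega1 s \<Longrightarrow> p - q \<in> Omega1 s"
  "p \<in> Omega1 s \<Longrightarrow> pscale c p \<in> Omega1 s"
  "p \<in> Omega1 s \<Longrightarrow> lact a p \<in> Omega1 s" "p \<in> Omega1 s \<Longrightarrow> ract p a \<in> Omega1 s"
  by (simp_all add: Omega1_def lin_ext_add lin_ext_pscale lin_ext_diff lin_ext_mult_lact lin_ext_mult_ract)

lemma Omega1_dtens: "dtens a \<in> Omega1 s"
  by (simp add: Omega1_def dtens_def lin_ext_diff lin_ext_tensor)

lemma tensor_rel_Omega1: "p \<in> tensor_rel s \<Longrightarrow> p \<in> Omega1 s"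
proof -
  have "pscale.subspace (Omega1 s)"
    unfolding pscale.subspace_def using Omega1_closed(1,3) Omega1_closed(2)[OF Omega1_dtens[of 1] Omega1_dtens[of 1]] by auto
  then have "tensor_rel s \<subseteq> Omega1 s"
    unfolding tensor_rel_def
    by (intro pscale.span_minimal)
      (auto simp: Omega1_def lin_ext_add lin_ext_pscale lin_ext_diff lin_ext_tensor
        distrib_left distrib_right simp flip: scale_mult_left scale_mult_right)
  then show "p \<in> tensor_rel s \<Longrightarrow> p \<in> Omega1 s" by blast
qed

lemma tensor_relI:
  "tensor (u + u') v - tensor u v - tensor u' v \<in> tensor_rel s"
  "tensor u (v + v') - tensor u v - tensor u v' \<in> tensor_rel s"
  "tensor (s c u) v - pscale c (tensor u v) \<in> tensor_rel s"
  "tensor u (s c v) - pscale c (tensor u v) \<in> tensor_rel s"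
  unfolding tensor_rel_def by (rule pscale.span_base, blast)+

lemma add_subgroup_tensor_rel: "add_subgroup (tensor_rel s)"
  unfolding tensor_rel_def by unfold_locales (rule pscale.span_zero pscale.span_diff; assumption)+

lemma tensor_rel_pscale: "p \<in> tensor_rel s \<Longrightarrow> pscale c p \<in> tensor_rel s"
  unfolding tensor_rel_def by (rule pscale.span_scale)

sublocale nc: two_sided_ideal "nc_ideal s"
  unfolding nc_ideal_def by (rule two_sided_ideal_ideal_of)

sublocale nct: two_sided_ideal "nct_ideal s"
  unfolding nct_ideal_def by (rule two_sided_ideal_ideal_of)

lemma nc_relI: "r \<in> nc_rel s \<Longrightarrow> r \<in> nc_ideal s"
  unfolding nc_ideal_def by (rule ideal_of_base)

lemma nc_Alg:
  "gen (Alg (a + b)) \<approx>\<^bsub>nc_ideal s\<^esub> gen (Alg a) + gen (Alg b)"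
  "gen (Alg (s c a)) \<approx>\<^bsub>nc_ideal s\<^esub> pscale c (gen (Alg a))"
  "gen (Alg (a * b)) \<approx>\<^bsub>nc_ideal s\<^esub> gen (Alg a) * gen (Alg b)"
  "gen (Alg 1) \<approx>\<^bsub>nc_ideal s\<^esub> 1"
  unfolding cong_mod_def diff_diff_eq[symmetric] by (rule nc_relI, unfold nc_rel_def, blast)+

lemma nc_Form:
  "p \<in> Omega1 s \<Longrightarrow> q \<in> Omega1 s \<Longrightarrow> gen (Form (p + q)) \<approx>\<^bsub>nc_ideal s\<^esub> gen (Form p) + gen (Form q)"
  "p \<in> Omega1 s \<Longrightarrow> gen (Form (pscale c p)) \<approx>\<^bsub>nc_ideal s\<^esub> pscale c (gen (Form p))"
  "p \<in> Omega1 s \<Longrightarrow> gen (Form (lact a p)) \<approx>\<^bsub>nc_ideal s\<^esub> gen (Alg a) * gen (Form p)"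
  "p \<in> Omega1 s \<Longrightarrow> gen (Form (ract p a)) \<approx>\<^bsub>nc_ideal s\<^esub> gen (Form p) * gen (Alg a)"
  unfolding cong_mod_def diff_diff_eq[symmetric] by (rule nc_relI, unfold nc_rel_def, blast)+

lemma nc_Form_0:
  "p \<in> tensor_rel s \<Longrightarrow> gen (Form p) \<approx>\<^bsub>nc_ideal s\<^esub> 0" "p \<notin> Omega1 s \<Longrightarrow> gen (Form p) \<approx>\<^bsub>nc_ideal s\<^esub> 0"
  unfolding cong_mod_def diff_zero by (rule nc_relI, unfold nc_rel_def, blast)+

lemma nc_Form_cong:
  assumes "q \<in> Omega1 s" "p - q \<in> tensor_rel s"
  shows "gen (Form p) \<approx>\<^bsub>nc_ideal s\<^esub> gen (Form q)"
proof -
  have "gen (Form (q + (p - q))) \<approx>\<^bsub>nc_ideal s\<^esub> gen (Form q) + gen (Form (p - q))"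
    by (intro nc_Form(1) assms(1) tensor_rel_Omega1[OF assms(2)])
  also have "\<dots> \<approx>\<^bsub>nc_ideal s\<^esub> gen (Form q) + 0"
    by (intro nc.add nc.refl nc_Form_0 assms)
  finally show ?thesis by simp
qed

lemma nc_pscale: "x \<approx>\<^bsub>nc_ideal s\<^esub> y \<Longrightarrow> pscale c x \<approx>\<^bsub>nc_ideal s\<^esub> pscale c y"
  by (rule cong_mod_pscale[OF nc.two_sided_ideal_axioms])

lemma nct_pscale: "x \<approx>\<^bsub>nct_ideal s\<^esub> y \<Longrightarrow> pscale c x \<approx>\<^bsub>nct_ideal s\<^esub> pscale c y"
  by (rule cong_mod_pscale[OF nct.two_sided_ideal_axioms])

lemma nc_d_add: "nc_d (a + b) \<approx>\<^bsub>nc_ideal s\<^esub> nc_d a + nc_d b"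
proof -
  interpret r: add_subgroup "tensor_rel s" by (rule add_subgroup_tensor_rel)
  have *: "dtens (a + b) - (dtens a + dtens b :: ('k, 'a) tens) =
      (tensor 1 (a + b) - tensor 1 a - tensor 1 b) - (tensor (a + b) 1 - tensor a 1 - tensor b 1)"
    by (simp add: dtens_def)
  have "nc_d (a + b) \<approx>\<^bsub>nc_ideal s\<^esub> gen (Form (dtens a + dtens b))"
    by (intro nc_Form_cong Omega1_closed Omega1_dtens) (simp only: *, rule r.diff_mem[OF tensor_relI(2) tensor_relI(1)])
  also have "\<dots> \<approx>\<^bsub>nc_ideal s\<^esub> nc_d a + nc_d b"
    by (intro nc_Form Omega1_dtens)
  finally show ?thesis .
qed

lemma nc_d_scale: "nc_d (s c a) \<approx>\<^bsub>nc_ideal s\<^esub> pscale c (nc_d a)"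
proof -
  interpret r: add_subgroup "tensor_rel s" by (rule add_subgroup_tensor_rel)
  have *: "dtens (s c a) - pscale c (dtens a :: ('k, 'a) tens) =
      (tensor 1 (s c a) - pscale c (tensor 1 a)) - (tensor (s c a) 1 - pscale c (tensor a 1))"
    by (simp add: dtens_def pscale.scale_right_diff_distrib)
  have "nc_d (s c a) \<approx>\<^bsub>nc_ideal s\<^esub> gen (Form (pscale c (dtens a)))"
    by (intro nc_Form_cong Omega1_closed Omega1_dtens) (simp only: *, rule r.diff_mem[OF tensor_relI(4) tensor_relI(3)])
  also have "\<dots> \<approx>\<^bsub>nc_ideal s\<^esub> pscale c (nc_d a)"
    by (intro nc_Form Omega1_dtens)
  finally show ?thesis .
qed

lemma nc_d_mult: "nc_d (a * b) \<approx>\<^bsub>nc_ideal s\<^esub> nc_d a * gen (Alg b) + gen (Alg a) * nc_d b"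
proof -
  have "(dtens (a * b) :: ('k, 'a) tens) = ract (dtens a) b + lact a (dtens b)"
    by (simp add: dtens_def ract_simps lact_simps)
  then have "nc_d (a * b) \<approx>\<^bsub>nc_ideal s\<^esub> gen (Form (ract (dtens a) b)) + gen (Form (lact a (dtens b)))"
    using nc_Form(1)[OF Omega1_closed(5)[OF Omega1_dtens] Omega1_closed(4)[OF Omega1_dtens], of a b a b] by simp
  also have "\<dots> \<approx>\<^bsub>nc_ideal s\<^esub> nc_d a * gen (Alg b) + gen (Alg a) * nc_d b"
    by (intro nc.add nc_Form Omega1_dtens)
  finally show ?thesis .
qed

text \<open>Already the representative \<open>dtens 1 = tensor 1 1 - tensor 1 1\<close> is
  zero.\<close>

lemma nc_d_1: "nc_d 1 \<approx>\<^bsub>nc_ideal s\<^esub> 0"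
  using add_subgroup.zero_mem[OF add_subgroup_tensor_rel] by (intro nc_Form_0) (simp add: dtens_def)

text \<open>In \<open>\<Omega>\<^sup>1 A\<close> one has \<open>\<Sum> u \<otimes> v = \<Sum> u dv + \<Sum> uv \<otimes> 1 = \<Sum> u dv\<close>.\<close>

lemma nc_Form_expand:
  assumes p: "p \<in> Omega1 s"
  shows "gen (Form p) \<approx>\<^bsub>nc_ideal s\<^esub> lin_ext pscale (\<lambda>(u, v). gen (Alg u) * nc_d v) p"
proof -
  interpret r: add_subgroup "tensor_rel s" by (rule add_subgroup_tensor_rel)
  have "lin_ext pscale (\<lambda>(u, v). tensor (u * v) 1) p \<approx>\<^bsub>tensor_rel s\<^esub> tensor (lin_ext s (\<lambda>(u, v). u * v) p) 1"
    by (rule r.sym, rule r.trans, rule cong_mod_linear_lin_ext[where t = pscale and f = "\<lambda>x. tensor x 1"])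
      (auto simp: vector_space_axioms vector_space_pscale r.add_subgroup_axioms tensor_rel_pscale cong_mod_def case_prod_unfold
        r.zero_mem tensor_relI simp flip: diff_diff_eq)
  also have "\<dots> = tensor 0 1" using p by (simp add: Omega1_def)
  also have "\<dots> \<approx>\<^bsub>tensor_rel s\<^esub> 0"
    using r.minus_mem[OF tensor_relI(1)[of 0 0 1]] by (simp add: cong_mod_def)
  finally have *: "lin_ext pscale (\<lambda>(u, v). tensor (u * v) 1) p \<in> tensor_rel s" by (simp add: r.zero_iff)
  have eq: "p = lin_ext pscale (\<lambda>(u, v). lact u (dtens v)) p + lin_ext pscale (\<lambda>(u, v). tensor (u * v) 1) p"
    for p :: "('k, 'a) tens"
  proof (induction p rule: tensor_induct)
    case (tensor u v)
    show ?case by (simp add: lin_ext_simps lact_simps dtens_def)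
  next
    case (scale c p)
    show ?case by (subst scale) (simp add: lin_ext_simps pscale_add)
  next
    case (add p q)
    show ?case by (subst add(1), subst add(2)) (simp add: lin_ext_simps)
  qed
  have r: "p - lin_ext pscale (\<lambda>(u, v). lact u (dtens v)) p \<in> tensor_rel s"
    using * eq[of p] by (metis add_diff_cancel_left')
  have L: "lin_ext pscale (\<lambda>(u, v). lact u (dtens v)) p \<in> Omega1 s" for p :: "('k, 'a) tens"
    by (induction p rule: tensor_induct) (auto simp: lin_ext_simps intro: Omega1_closed Omega1_dtens)
  have F: "gen (Form (lin_ext pscale (\<lambda>(u, v). lact u (dtens v)) p)) \<approx>\<^bsub>nc_ideal s\<^esub>
      lin_ext pscale (\<lambda>(u, v). gen (Alg u) * nc_d v) p" for p :: "('k, 'a) tens"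
  proof (induction p rule: tensor_induct)
    case (scale c p)
    then show ?case unfolding lin_ext_simps using nc.trans[OF nc_Form(2)[OF L] nc_pscale] by blast
  next
    case (add p q)
    then show ?case unfolding lin_ext_simps using nc.trans[OF nc_Form(1)[OF L L] nc.add] by blast
  qed (simp add: lin_ext_simps nc_Form Omega1_dtens)
  show ?thesis by (rule nc.trans[OF nc_Form_cong[OF L r] F])
qed

end

subsection \<open>The embedding of forms into extended forms\<close>

lemma linear_nct_emb: "Vector_Spaces.linear pscale pscale nct_emb"
  unfolding nct_emb_def by (rule pscale.linear_lin_ext)

lemmas nct_emb_linear = linear_add[OF linear_nct_emb] linear_diff[OF linear_nct_emb] linear_scale[OF linear_nct_emb]
  linear_0[OF linear_nct_emb] linear_minus[OF linear_nct_emb]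

lemma nct_emb_wmon: "nct_emb (wmon w) = wmon (map Some w)"
  by (simp add: nct_emb_def wmon_def pscale.lin_ext_single pscale_single)

lemma nct_emb_mult: "nct_emb (p * q) = nct_emb p * nct_emb q"
proof (induction p rule: free_alg_induct)
  case (wmon u)
  show ?case
    by (induction q rule: free_alg_induct)
      (simp_all add: nct_emb_wmon distrib_left nct_emb_linear pscale_mult_right flip: wmon_append)
qed (simp_all add: distrib_right nct_emb_linear pscale_mult_left)

lemma nct_emb_1: "nct_emb 1 = 1"
  using nct_emb_wmon[of "[]"] by (simp add: wmon_Nil)

lemma nct_emb_gen: "nct_emb (gen x :: ('k::field, 'a) nc_forms) = gen (Some x)"
  by (simp add: gen_conv_wmon nct_emb_wmon)

lemma nct_emb_hom_part: "p \<in> nc_part n \<Longrightarrow> nct_emb p \<in> nct_part n"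
  by (rule linear_hom_partI[OF linear_nct_emb])
    (auto simp: nct_emb_wmon hom_part_wmon nct_deg_def comp_def)

lemmas nct_emb_simps = nct_emb_linear nct_emb_mult nct_emb_1 nct_emb_gen

lemma nct_emb_ideal: "p \<in> nc_ideal s \<Longrightarrow> nct_emb p \<in> nct_ideal s"
proof -
  interpret two_sided_ideal "nct_ideal s" unfolding nct_ideal_def by (rule two_sided_ideal_ideal_of)
  show "p \<in> nc_ideal s \<Longrightarrow> nct_emb p \<in> nct_ideal s"
    unfolding nc_ideal_def
  proof (induction p rule: ideal_of_induct)
    case (base u r v)
    then have "nct_emb r \<in> nct_ideal s" unfolding nct_ideal_def by (intro ideal_of_base) simp
    then show ?case by (simp add: nct_emb_mult mult_left_mem mult_right_mem)
  qed (simp_all add: nct_emb_linear zero_mem add_mem)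
qed

lemma nct_emb_cong: "p \<approx>\<^bsub>nc_ideal s\<^esub> q \<Longrightarrow> nct_emb p \<approx>\<^bsub>nct_ideal s\<^esub> nct_emb q"
  by (rule linear_cong_mod[OF linear_nct_emb nct_emb_ideal])

lemma nc_rel_hom: "r \<in> nc_rel s \<Longrightarrow> \<exists>n. r \<in> nc_part n"
proof -
  have A: "gen (Alg a) \<in> nc_part 0" and F: "gen (Form p) \<in> nc_part 1" for a p
    by (simp_all add: hom_part_gen)
  have AF: "gen (Alg a) * gen (Form p) \<in> nc_part 1" and FA: "gen (Form p) * gen (Alg a) \<in> nc_part 1" for a p
    using hom_part_mult[OF A F, of a p] hom_part_mult[OF F A, of p a] by simp_all
  have AA: "gen (Alg a) * gen (Alg b) \<in> nc_part 0" for a b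
    using hom_part_mult[OF A A, of a b] by simp
  show "r \<in> nc_rel s \<Longrightarrow> \<exists>n. r \<in> nc_part n"
    unfolding nc_rel_def
    by (elim UnE CollectE exE conjE singletonE; simp only:;
        ((rule exI[of _ 0], (intro hom_part_diff hom_part_pscale hom_part_1 A AA; fail)) |
         (rule exI[of _ 1], (intro hom_part_diff hom_part_pscale F AF FA; fail))))
qed

lemma nct_rel_hom: "r \<in> nct_emb ` nc_rel s \<Longrightarrow> \<exists>n. r \<in> nct_part n"
  using nc_rel_hom nct_emb_hom_part by blast


subsection \<open>Superderivations of the extended forms\<close>

abbreviation nct_Alg :: "'a \<Rightarrow> ('k::field, 'a) nct_forms" where
  "nct_Alg a \<equiv> gen (Some (Alg a))"

abbreviation nct_d :: "'a::{ring, monoid_mult} \<Rightarrow> ('k::field, 'a) nct_forms" where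
  "nct_d a \<equiv> gen (Some (Form (dtens a)))"

abbreviation nct_t :: "('k::field, 'a) nct_forms" where
  "nct_t \<equiv> gen None"

context assoc_algebra
begin

lemmas nct_Alg = nc_Alg[THEN nct_emb_cong, unfolded nct_emb_simps]
lemmas nct_d_add = nc_d_add[THEN nct_emb_cong, unfolded nct_emb_simps]
lemmas nct_d_scale = nc_d_scale[THEN nct_emb_cong, unfolded nct_emb_simps]
lemmas nct_d_mult = nc_d_mult[THEN nct_emb_cong, unfolded nct_emb_simps]
lemmas nct_d_1 = nc_d_1[THEN nct_emb_cong, unfolded nct_emb_simps]

lemma nct_Form_expand:
  "p \<in> Omega1 s \<Longrightarrow> gen (Some (Form p)) \<approx>\<^bsub>nct_ideal s\<^esub> lin_ext pscale (\<lambda>(u, v). nct_Alg u * nct_d v) p"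
  using nct_emb_cong[OF nc_Form_expand]
  by (simp add: nct_emb_simps lin_ext_linear[OF linear_nct_emb] case_prod_unfold)

text \<open>The values on the generators of a superderivation with \<open>a \<mapsto> \<delta> a\<close> and \<open>da \<mapsto> \<epsilon> a\<close>; the last
  condition is what \<open>d(ab) = da b + a db\<close> demands.\<close>

lemma superderivation_nct_ideal:
  fixes E :: "('k, 'a) nct_forms \<Rightarrow> ('k, 'a) nct_forms" and \<epsilon> :: "'a \<Rightarrow> ('k, 'a) nct_forms"
  defines "\<delta> \<equiv> \<lambda>a. E (nct_Alg a)"
  assumes E: "superderivation nct_deg 1 E"
    and \<delta>_add: "\<And>a b. \<delta> (a + b) \<approx>\<^bsub>nct_ideal s\<^esub> \<delta> a + \<delta> b"
    and \<delta>_scale: "\<And>c a. \<delta> (s c a) \<approx>\<^bsub>nct_ideal s\<^esub> pscale c (\<delta> a)"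
    and \<delta>_mult: "\<And>a b. \<delta> (a * b) \<approx>\<^bsub>nct_ideal s\<^esub> \<delta> a * nct_Alg b + nct_Alg a * \<delta> b"
    and \<epsilon>_add: "\<And>a b. \<epsilon> (a + b) \<approx>\<^bsub>nct_ideal s\<^esub> \<epsilon> a + \<epsilon> b"
    and \<epsilon>_scale: "\<And>c a. \<epsilon> (s c a) \<approx>\<^bsub>nct_ideal s\<^esub> pscale c (\<epsilon> a)"
    and \<epsilon>_mult: "\<And>a b. \<epsilon> (a * b) \<approx>\<^bsub>nct_ideal s\<^esub>
        \<epsilon> a * nct_Alg b + nct_Alg a * \<epsilon> b + \<delta> a * nct_d b - nct_d a * \<delta> b"
    and Form: "\<And>p. E (gen (Some (Form p))) = form_ext s pscale (\<lambda>u v. \<delta> u * nct_d v + nct_Alg u * \<epsilon> v) p"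
    and p: "p \<in> nct_ideal s"
  shows "E p \<in> nct_ideal s"
proof -
  let ?I = "nct_ideal s"
  define f where "f u v = \<delta> u * nct_d v + nct_Alg u * \<epsilon> v" for u v
  define \<Phi> where "\<Phi> = lin_ext pscale (\<lambda>(u, v). f u v)"
  define \<Psi> :: "('k, 'a) tens \<Rightarrow> ('k, 'a) nct_forms" where "\<Psi> = lin_ext pscale (\<lambda>(u, v). nct_Alg u * nct_d v)"
  note lin = superderivation_linear[OF E]
  have \<Phi>_simps: "\<Phi> (p + q) = \<Phi> p + \<Phi> q" "\<Phi> (p - q) = \<Phi> p - \<Phi> q" "\<Phi> (pscale c p) = pscale c (\<Phi> p)" "\<Phi> (tensor u v) = f u v"
    for p q c u v by (simp_all add: \<Phi>_def lin_ext_simps)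
  have \<Psi>_simps: "\<Psi> (p + q) = \<Psi> p + \<Psi> q" "\<Psi> (p - q) = \<Psi> p - \<Psi> q" "\<Psi> (pscale c p) = pscale c (\<Psi> p)" "\<Psi> (tensor u v) = nct_Alg u * nct_d v"
    for p q c u v by (simp_all add: \<Psi>_def lin_ext_simps)
  have \<Psi>: "gen (Some (Form p)) \<approx>\<^bsub>?I\<^esub> \<Psi> p" if "p \<in> Omega1 s" for p
    unfolding \<Psi>_def by (rule nct_Form_expand[OF that])
  have EF: "E (gen (Some (Form p))) = \<Phi> p" if "p \<in> Omega1 s" for p
    using that by (simp add: Form form_ext_def \<Phi>_def f_def)
  have f_add_left: "f (u + u') v \<approx>\<^bsub>?I\<^esub> f u v + f u' v" for u u' v
    using nct.add[OF nct.mult_right[OF \<delta>_add] nct.mult_right[OF nct_Alg(1)], of u u' "nct_d v" u u' "\<epsilon> v"]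
    by (simp add: f_def algebra_simps)
  have f_add_right: "f u (v + v') \<approx>\<^bsub>?I\<^esub> f u v + f u v'" for u v v'
    using nct.add[OF nct.mult_left[OF nct_d_add] nct.mult_left[OF \<epsilon>_add], of "\<delta> u" v v' "nct_Alg u" v v']
    by (simp add: f_def algebra_simps)
  have f_scale_left: "f (s c u) v \<approx>\<^bsub>?I\<^esub> pscale c (f u v)" for c u v
    using nct.add[OF nct.mult_right[OF \<delta>_scale] nct.mult_right[OF nct_Alg(2)], of c u "nct_d v" c u "\<epsilon> v"]
    by (simp add: f_def pscale_mult_left pscale_add)
  have f_scale_right: "f u (s c v) \<approx>\<^bsub>?I\<^esub> pscale c (f u v)" for c u v
    using nct.add[OF nct.mult_left[OF nct_d_scale] nct.mult_left[OF \<epsilon>_scale], of "\<delta> u" c v "nct_Alg u" c v]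
    by (simp add: f_def pscale_mult_right pscale_add)
  have f_lact: "f (a * u) v \<approx>\<^bsub>?I\<^esub> \<delta> a * (nct_Alg u * nct_d v) + nct_Alg a * f u v" for a u v
    using nct.add[OF nct.mult_right[OF \<delta>_mult] nct.mult_right[OF nct_Alg(3)], of a u "nct_d v" a u "\<epsilon> v"]
    by (simp add: f_def algebra_simps)
  \<comment> \<open>The surplus \<open>f (u * v) a\<close> spoils right linearity. It disappears
    after summation over an element of \<open>Omega1 s\<close>, where the products
    \<open>u * v\<close> add up to 0 and \<open>f\<close> is additive in its first argument.\<close>
  have f_ract: "f u (v * a) \<approx>\<^bsub>?I\<^esub> f u v * nct_Alg a - nct_Alg u * nct_d v * \<delta> a + f (u * v) a" for u v a
  proof -
    have "f u (v * a) \<approx>\<^bsub>?I\<^esub> \<delta> u * (nct_d v * nct_Alg a + nct_Alg v * nct_d a) +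
        nct_Alg u * (\<epsilon> v * nct_Alg a + nct_Alg v * \<epsilon> a + \<delta> v * nct_d a - nct_d v * \<delta> a)"
      unfolding f_def by (intro nct.add nct.mult_left nct_d_mult \<epsilon>_mult)
    also have "\<dots> = f u v * nct_Alg a - nct_Alg u * nct_d v * \<delta> a +
        ((\<delta> u * nct_Alg v + nct_Alg u * \<delta> v) * nct_d a + (nct_Alg u * nct_Alg v) * \<epsilon> a)"
      by (simp add: f_def algebra_simps)
    also have "\<dots> \<approx>\<^bsub>?I\<^esub> f u v * nct_Alg a - nct_Alg u * nct_d v * \<delta> a + f (u * v) a"
      unfolding f_def[of "u * v"] by (intro nct.add nct.refl nct.mult_right nct.sym[OF \<delta>_mult] nct.sym[OF nct_Alg(3)])
    finally show ?thesis .
  qed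
  have f_0: "f 0 v \<approx>\<^bsub>?I\<^esub> 0" for v
    using f_scale_left[of 0 0 v] by simp
  have \<Phi>_lact: "\<Phi> (lact a p) \<approx>\<^bsub>?I\<^esub> \<delta> a * \<Psi> p + nct_Alg a * \<Phi> p" for a p
  proof (induction p rule: tensor_induct)
    case (tensor u v)
    show ?case by (simp add: lact_simps \<Phi>_simps \<Psi>_simps f_lact)
  next
    case (scale c p)
    from nct_pscale[OF scale, of c] show ?case by (simp add: lact_simps \<Phi>_simps \<Psi>_simps pscale_add pscale_mult_right)
  next
    case (add p q)
    from nct.add[OF add] show ?case by (simp add: lact_simps \<Phi>_simps \<Psi>_simps algebra_simps)
  qed
  have \<Phi>_ract: "\<Phi> (ract p a) \<approx>\<^bsub>?I\<^esub> \<Phi> p * nct_Alg a - \<Psi> p * \<delta> a + lin_ext pscale (\<lambda>(u, v). f (u * v) a) p" for a p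
  proof (induction p rule: tensor_induct)
    case (tensor u v)
    show ?case by (simp add: ract_simps \<Phi>_simps \<Psi>_simps f_ract lin_ext_simps)
  next
    case (scale c p)
    from nct_pscale[OF scale, of c] show ?case
      by (simp add: ract_simps \<Phi>_simps \<Psi>_simps pscale_add pscale_mult_left pscale.scale_right_diff_distrib lin_ext_simps)
  next
    case (add p q)
    from nct.add[OF add] show ?case by (simp add: ract_simps \<Phi>_simps \<Psi>_simps lin_ext_simps algebra_simps)
  qed
  have f_sum: "lin_ext pscale (\<lambda>(u, v). f (u * v) a) p \<approx>\<^bsub>?I\<^esub> 0" if "p \<in> Omega1 s" for a p
  proof -
    have "f (lin_ext s (\<lambda>(u, v). u * v) p) a \<approx>\<^bsub>?I\<^esub> lin_ext pscale (\<lambda>x. f (case x of (u, v) \<Rightarrow> u * v) a) p"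
      by (rule cong_mod_linear_lin_ext[where f = "\<lambda>x. f x a"])
        (auto simp: vector_space_axioms vector_space_pscale nct.add_subgroup_axioms f_add_left f_scale_left
          ideal_pscale[OF nct.two_sided_ideal_axioms])
    moreover have "lin_ext s (\<lambda>(u, v). u * v) p = 0" using that by (simp add: Omega1_def)
    moreover have "(\<lambda>x. f (case x of (u, v) \<Rightarrow> u * v) a) = (\<lambda>(u, v). f (u * v) a)" by auto
    ultimately show ?thesis using nct.trans[OF nct.sym f_0] by metis
  qed
  have \<Phi>_rel: "\<Phi> p \<in> ?I" if "p \<in> tensor_rel s" for p
  proof -
    have "pscale.subspace {p. \<Phi> p \<in> ?I}"
      unfolding pscale.subspace_def
      by (auto simp: \<Phi>_simps nct.add_mem ideal_pscale[OF nct.two_sided_ideal_axioms])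
        (use \<Phi>_simps(3)[of 0 0] nct.zero_mem in simp)
    then have "tensor_rel s \<subseteq> {p. \<Phi> p \<in> ?I}"
      unfolding tensor_rel_def
      by (intro pscale.span_minimal)
        (use f_add_left f_add_right f_scale_left f_scale_right in \<open>auto simp: \<Phi>_simps cong_mod_def diff_diff_eq\<close>)
    then show ?thesis using that by blast
  qed
  have rel: "E (nct_emb r) \<approx>\<^bsub>?I\<^esub> 0" if "r \<in> nc_rel s" for r
    using that unfolding nc_rel_def
  proof (elim UnE CollectE exE conjE singletonE, simp_all only:)
    fix a b :: 'a
    show "E (nct_emb (gen (Alg (a + b)) - gen (Alg a) - gen (Alg b))) \<approx>\<^bsub>?I\<^esub> 0"
      using \<delta>_add[of a b] by (simp add: nct_emb_simps linear_diff[OF lin] linear_add[OF lin] cong_mod_def \<delta>_def diff_diff_eq)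
  next
    fix c :: 'k and a :: 'a
    show "E (nct_emb (gen (Alg (s c a)) - pscale c (gen (Alg a)))) \<approx>\<^bsub>?I\<^esub> 0"
      using \<delta>_scale[of c a] by (simp add: nct_emb_simps linear_diff[OF lin] linear_scale[OF lin] cong_mod_def \<delta>_def)
  next
    fix a b :: 'a
    have "E (nct_Alg a * nct_Alg b) = \<delta> a * nct_Alg b + nct_Alg a * \<delta> b"
      using superderivation_hom[OF E, of "nct_Alg a" 0 "nct_Alg b"] by (simp add: hom_part_gen nct_deg_def \<delta>_def)
    then show "E (nct_emb (gen (Alg (a * b)) - gen (Alg a) * gen (Alg b))) \<approx>\<^bsub>?I\<^esub> 0"
      using \<delta>_mult[of a b] by (simp add: nct_emb_simps linear_diff[OF lin] cong_mod_def \<delta>_def)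
  next
    \<comment> \<open>In the quotient \<open>1 = 1 * 1\<close> forces
      \<open>\<delta> 1 = \<delta> 1 + \<delta> 1\<close>.\<close>
    have "\<delta> 1 \<approx>\<^bsub>?I\<^esub> \<delta> 1 * nct_Alg 1 + nct_Alg 1 * \<delta> 1"
      using \<delta>_mult[of 1 1] by simp
    also have "\<dots> \<approx>\<^bsub>?I\<^esub> \<delta> 1 * 1 + 1 * \<delta> 1"
      by (intro nct.add nct.mult_left nct.mult_right nct_Alg)
    finally have "\<delta> 1 \<approx>\<^bsub>?I\<^esub> \<delta> 1 + \<delta> 1" by simp
    then have "\<delta> 1 \<approx>\<^bsub>?I\<^esub> 0" using nct.minus_mem by (fastforce simp: cong_mod_def)
    then show "E (nct_emb (gen (Alg 1) - 1)) \<approx>\<^bsub>?I\<^esub> 0"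
      by (simp add: nct_emb_simps linear_diff[OF lin] superderivation_1[OF E] \<delta>_def)
  next
    fix p q :: "('k, 'a) tens" assume "p \<in> Omega1 s" "q \<in> Omega1 s"
    then show "E (nct_emb (gen (Form (p + q)) - gen (Form p) - gen (Form q))) \<approx>\<^bsub>?I\<^esub> 0"
      by (simp add: nct_emb_simps linear_diff[OF lin] EF Omega1_closed \<Phi>_simps nct.refl)
  next
    fix c and p :: "('k, 'a) tens" assume "p \<in> Omega1 s"
    then show "E (nct_emb (gen (Form (pscale c p)) - pscale c (gen (Form p)))) \<approx>\<^bsub>?I\<^esub> 0"
      by (simp add: nct_emb_simps linear_diff[OF lin] linear_scale[OF lin] EF Omega1_closed \<Phi>_simps nct.refl)
  next
    fix a and p :: "('k, 'a) tens" assume p: "p \<in> Omega1 s"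
    have "E (nct_Alg a * gen (Some (Form p))) = \<delta> a * gen (Some (Form p)) + nct_Alg a * \<Phi> p"
      using superderivation_hom[OF E, of "nct_Alg a" 0 "gen (Some (Form p))"] p
      by (simp add: hom_part_gen nct_deg_def EF \<delta>_def)
    then have "E (nct_emb (gen (Form (lact a p)) - gen (Alg a) * gen (Form p))) =
        \<Phi> (lact a p) - (\<delta> a * gen (Some (Form p)) + nct_Alg a * \<Phi> p)"
      using p by (simp add: nct_emb_simps linear_diff[OF lin] EF Omega1_closed)
    also have "\<dots> \<approx>\<^bsub>?I\<^esub> (\<delta> a * \<Psi> p + nct_Alg a * \<Phi> p) - (\<delta> a * \<Psi> p + nct_Alg a * \<Phi> p)"
      by (intro nct.diff nct.add nct.refl nct.mult_left \<Phi>_lact \<Psi> p)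
    finally show "E (nct_emb (gen (Form (lact a p)) - gen (Alg a) * gen (Form p))) \<approx>\<^bsub>?I\<^esub> 0" by simp
  next
    fix a and p :: "('k, 'a) tens" assume p: "p \<in> Omega1 s"
    have "E (gen (Some (Form p)) * nct_Alg a) = \<Phi> p * nct_Alg a - gen (Some (Form p)) * \<delta> a"
      using superderivation_hom[OF E, of "gen (Some (Form p))" 1 "nct_Alg a"] p
      by (simp add: hom_part_gen nct_deg_def EF \<delta>_def)
    then have "E (nct_emb (gen (Form (ract p a)) - gen (Form p) * gen (Alg a))) =
        \<Phi> (ract p a) - (\<Phi> p * nct_Alg a - gen (Some (Form p)) * \<delta> a)"
      using p by (simp add: nct_emb_simps linear_diff[OF lin] EF Omega1_closed)
    also have "\<dots> \<approx>\<^bsub>?I\<^esub> (\<Phi> p * nct_Alg a - \<Psi> p * \<delta> a + 0) - (\<Phi> p * nct_Alg a - \<Psi> p * \<delta> a)"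
      by (intro nct.diff nct.refl nct.mult_right \<Psi> p nct.trans[OF \<Phi>_ract] nct.add f_sum)
    finally show "E (nct_emb (gen (Form (ract p a)) - gen (Form p) * gen (Alg a))) \<approx>\<^bsub>?I\<^esub> 0" by simp
  next
    fix p :: "('k, 'a) tens" assume "p \<in> tensor_rel s"
    then show "E (nct_emb (gen (Form p))) \<approx>\<^bsub>?I\<^esub> 0"
      by (simp add: nct_emb_simps EF tensor_rel_Omega1 \<Phi>_rel nct.zero_iff)
  next
    fix p :: "('k, 'a) tens" assume "p \<notin> Omega1 s"
    then show "E (nct_emb (gen (Form p))) \<approx>\<^bsub>?I\<^esub> 0"
      by (simp add: nct_emb_simps Form form_ext_def nct.refl)
  qed
  show ?thesis
    unfolding nct_ideal_def
  proof (rule superderivation_ideal_of[OF E nct_rel_hom])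
    fix r assume "r \<in> nct_emb ` nc_rel s"
    then show "E r \<in> ideal_of (nct_emb ` nc_rel s)"
      using rel by (auto simp: nct.zero_iff simp flip: nct_ideal_def)
  qed (use p in \<open>simp_all add: nct_ideal_def\<close>)
qed

lemma superderivation_nct_differential: "superderivation nct_deg 1 (nct_differential s)"
  and superderivation_i_Delta: "superderivation nct_deg 1 (i_Delta s)"
  unfolding nct_differential_def i_Delta_def by (rule superderivation_superder)+

lemma nct_differential_gen:
  "nct_differential s nct_t = 0" "nct_differential s (nct_Alg a) = nct_d a"
  "nct_differential s (gen (Some (Form p))) = form_ext s pscale (\<lambda>u v. nct_d u * nct_d v) p"
  by (simp_all add: nct_differential_def superder_gen nct_emb_simps form_ext_def lin_ext_linear[OF linear_nct_emb] case_prod_unfold)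

lemma i_Delta_gen:
  "i_Delta s nct_t = 0" "i_Delta s (nct_Alg a) = 0"
  "i_Delta s (gen (Some (Form p))) = form_ext s pscale (\<lambda>u v. nct_Alg u * (nct_t * nct_Alg v - nct_Alg v * nct_t)) p"
  by (simp_all add: i_Delta_def superder_gen i_Delta_gen_def)

text \<open>Since \<open>d (da) = 0\<close>, the map \<epsilon> is 0, and the condition on products
  reads \<open>0 = da db - da db\<close>.\<close>

lemma nct_differential_ideal: "p \<in> nct_ideal s \<Longrightarrow> nct_differential s p \<in> nct_ideal s"
  by (rule superderivation_nct_ideal[OF superderivation_nct_differential, where \<epsilon> = "\<lambda>_. 0"])
    (simp_all add: nct_differential_gen nct_d_add nct_d_scale nct_d_mult nct.refl)

text \<open>Here \<delta> is 0, and the condition on products says that the commutator with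
  \<open>t\<close> is a derivation.\<close>

lemma i_Delta_ideal: "p \<in> nct_ideal s \<Longrightarrow> i_Delta s p \<in> nct_ideal s"
proof (rule superderivation_nct_ideal[OF superderivation_i_Delta, where \<epsilon> = "\<lambda>v. nct_t * nct_Alg v - nct_Alg v * nct_t"])
  fix a b c
  show "nct_t * nct_Alg (a + b) - nct_Alg (a + b) * nct_t \<approx>\<^bsub>nct_ideal s\<^esub>
      nct_t * nct_Alg a - nct_Alg a * nct_t + (nct_t * nct_Alg b - nct_Alg b * nct_t)"
    using nct.diff[OF nct.mult_left[OF nct_Alg(1)] nct.mult_right[OF nct_Alg(1)], of nct_t a b a b nct_t]
    by (simp add: algebra_simps)
  show "nct_t * nct_Alg (s c a) - nct_Alg (s c a) * nct_t \<approx>\<^bsub>nct_ideal s\<^esub>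
      pscale c (nct_t * nct_Alg a - nct_Alg a * nct_t)"
    using nct.diff[OF nct.mult_left[OF nct_Alg(2)] nct.mult_right[OF nct_Alg(2)], of nct_t c a c a nct_t]
    by (simp add: pscale_mult_left pscale_mult_right pscale.scale_right_diff_distrib)
  show "nct_t * nct_Alg (a * b) - nct_Alg (a * b) * nct_t \<approx>\<^bsub>nct_ideal s\<^esub>
      (nct_t * nct_Alg a - nct_Alg a * nct_t) * nct_Alg b + nct_Alg a * (nct_t * nct_Alg b - nct_Alg b * nct_t) +
      i_Delta s (nct_Alg a) * nct_d b - nct_d a * i_Delta s (nct_Alg b)"
    using nct.diff[OF nct.mult_left[OF nct_Alg(3)] nct.mult_right[OF nct_Alg(3)], of nct_t a b a b nct_t]
    by (simp add: i_Delta_gen algebra_simps)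
qed (simp_all add: i_Delta_gen nct.refl)

lemma lin_ext_hom_part:
  fixes f :: "'x \<Rightarrow> ('k, 'y) free_alg"
  shows "(\<And>x. f x \<in> hom_part deg n) \<Longrightarrow> lin_ext pscale f p \<in> hom_part deg n"
  unfolding lin_ext_def by (rule hom_part_sum, rule hom_part_pscale)

lemma form_ext_hom_part:
  fixes f :: "'a \<Rightarrow> 'a \<Rightarrow> ('k, 'y) free_alg"
  shows "(\<And>u v. f u v \<in> hom_part deg n) \<Longrightarrow> form_ext s pscale f p \<in> hom_part deg n"
  unfolding form_ext_def by (auto intro!: lin_ext_hom_part hom_part_0)

lemma nct_gen_hom_part: "nct_Alg a \<in> nct_part 0" "nct_t \<in> nct_part 2" "gen (Some (Form p)) \<in> nct_part 1"
  by (simp_all add: hom_part_gen nct_deg_def)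

lemma nct_differential_hom_part: "p \<in> nct_part n \<Longrightarrow> nct_differential s p \<in> nct_part (Suc n)"
proof (rule superderivation_hom_part[OF superderivation_nct_differential, where k = 1 and l = 0])
  fix x :: "('a, ('k, 'a) tens) nc_gen option" and m assume "nct_deg x + 1 = m + 0"
  moreover have "nct_d u * nct_d v \<in> nct_part 2" for u v :: 'a
    using hom_part_mult[OF nct_gen_hom_part(3) nct_gen_hom_part(3)] by (simp add: numeral_2_eq_2)
  ultimately show "nct_differential s (gen x) \<in> nct_part m"
    by (cases x rule: option.exhaust; cases "the x")
      (auto simp: nct_differential_gen hom_part_0 nct_deg_def hom_part_gen numeral_2_eq_2 intro!: form_ext_hom_part)
qed simp_all

lemma i_Delta_hom_part: "p \<in> nct_part n \<Longrightarrow> i_Delta s p \<in> nct_part (Suc n)"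
proof (rule superderivation_hom_part[OF superderivation_i_Delta, where k = 1 and l = 0])
  fix x :: "('a, ('k, 'a) tens) nc_gen option" and m assume "nct_deg x + 1 = m + 0"
  moreover have "nct_Alg u * (nct_t * nct_Alg v - nct_Alg v * nct_t) \<in> nct_part 2" for u v :: 'a
    using hom_part_mult[OF nct_gen_hom_part(1) hom_part_diff, of "nct_t * nct_Alg v" 2 "nct_Alg v * nct_t" u]
      hom_part_mult[OF nct_gen_hom_part(2,1), of v] hom_part_mult[OF nct_gen_hom_part(1,2), of v] by (simp add: numeral_2_eq_2)
  ultimately show "i_Delta s (gen x) \<in> nct_part m"
    by (cases x rule: option.exhaust; cases "the x")
      (auto simp: i_Delta_gen hom_part_0 nct_deg_def hom_part_gen numeral_2_eq_2 intro!: form_ext_hom_part)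
qed simp_all

text \<open>The representative \<open>tensor 1 u - tensor u 1\<close> of \<open>du\<close> is sent
  to \<open>d1 du - du d1\<close>, and \<open>d1 = 0\<close>.\<close>

lemma nct_differential_d: "nct_differential s (nct_d u) \<approx>\<^bsub>nct_ideal s\<^esub> 0"
proof -
  have "nct_differential s (nct_d u) = nct_d 1 * nct_d u - nct_d u * nct_d 1"
    by (simp add: nct_differential_gen form_ext_def Omega1_dtens lin_ext_simps)
  also have "\<dots> \<approx>\<^bsub>nct_ideal s\<^esub> 0 * nct_d u - nct_d u * 0"
    by (intro nct.diff nct.mult_left nct.mult_right nct_d_1)
  finally show ?thesis by simp
qed

lemma i_Delta_d: "i_Delta s (nct_d u) \<approx>\<^bsub>nct_ideal s\<^esub> nct_t * nct_Alg u - nct_Alg u * nct_t"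
proof -
  have "i_Delta s (nct_d u) = nct_Alg 1 * (nct_t * nct_Alg u - nct_Alg u * nct_t) -
      nct_Alg u * (nct_t * nct_Alg 1 - nct_Alg 1 * nct_t)"
    by (simp add: i_Delta_gen form_ext_def Omega1_dtens lin_ext_simps)
  also have "\<dots> \<approx>\<^bsub>nct_ideal s\<^esub> 1 * (nct_t * nct_Alg u - nct_Alg u * nct_t) - nct_Alg u * (nct_t * 1 - 1 * nct_t)"
    by (intro nct.diff nct.mult_left nct.mult_right nct_Alg nct.refl)
  finally show ?thesis by simp
qed

text \<open>A general 1-form is a combination of forms \<open>u dv\<close> only modulo the ideal, so
  \<open>E\<close> has to preserve the ideal here. In return only \<open>a\<close>,
  \<open>da\<close> and \<open>t\<close> have to be checked.\<close>

lemma superderivation_nct_cong: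
  assumes E: "superderivation nct_deg e E"
    and ideal: "\<And>p. p \<in> nct_ideal s \<Longrightarrow> E p \<in> nct_ideal s"
    and t: "E nct_t \<in> nct_ideal s" and Alg: "\<And>a. E (nct_Alg a) \<in> nct_ideal s" and d: "\<And>a. E (nct_d a) \<in> nct_ideal s"
  shows "E p \<in> nct_ideal s"
proof (rule superderivation_mem_ideal[OF E nct.two_sided_ideal_axioms])
  fix x :: "('a, ('k, 'a) tens) nc_gen option"
  have cong: "E p \<approx>\<^bsub>nct_ideal s\<^esub> E q" if "p \<approx>\<^bsub>nct_ideal s\<^esub> q" for p q
    by (rule linear_cong_mod[OF superderivation_linear[OF E] ideal that])
  have Ad: "E (nct_Alg u * nct_d v) \<in> nct_ideal s" for u v :: 'a
    unfolding superderivation_hom[OF E nct_gen_hom_part(1)]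
    by (intro nct.add_mem nct.mult_left_mem nct.mult_right_mem Alg d)
  have "E (gen (Some (Form p))) \<in> nct_ideal s" for p
  proof (cases "p \<in> Omega1 s")
    case True
    have "E (lin_ext pscale (\<lambda>(u, v). nct_Alg u * nct_d v) p) \<in> nct_ideal s"
      unfolding lin_ext_linear[OF superderivation_linear[OF E]]
      by (rule nct.lin_ext_mem) (auto simp: Ad ideal_pscale[OF nct.two_sided_ideal_axioms])
    then show ?thesis using nct.mem_cong[OF cong[OF nct_Form_expand[OF True]]] by simp
  next
    case False
    then have "gen (Some (Form p)) \<approx>\<^bsub>nct_ideal s\<^esub> nct_emb 0"
      using nct_emb_cong[OF nc_Form_0(2)] by (simp add: nct_emb_gen)
    then show ?thesis by (intro ideal) (simp add: nct_emb_simps nct.zero_iff)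
  qed
  then show "E (gen x) \<in> nct_ideal s"
    using t Alg by (cases x rule: option.exhaust; cases "the x") auto
qed

abbreviation nct_D where "nct_D p \<equiv> nct_differential s p + i_Delta s p"

lemma superderivation_nct_D: "superderivation nct_deg 1 nct_D"
  by (intro superderivation_add superderivation_nct_differential superderivation_i_Delta)

lemma nct_D_ideal: "p \<in> nct_ideal s \<Longrightarrow> nct_D p \<in> nct_ideal s"
  by (intro nct.add_mem nct_differential_ideal i_Delta_ideal)

lemma nct_D_hom_part: "p \<in> nct_part n \<Longrightarrow> nct_D p \<in> nct_part (Suc n)"
  by (intro hom_part_add nct_differential_hom_part i_Delta_hom_part)

lemma superderivation_commutator_even:
  "x \<in> hom_part deg n \<Longrightarrow> even n \<Longrightarrow> superderivation deg 0 (\<lambda>p. x * p - p * x)"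
  unfolding superderivation_def
  by (auto simp: algebra_simps pscale_mult_left pscale_mult_right pscale.scale_right_diff_distrib intro!: linear_pscaleI)

text \<open>Both sides are derivations of degree 0. On generators,
  \<open>D (D a) = D (da) = [t, a]\<close> and \<open>D (D (da)) = D [t, a] = [t, da]\<close>,
  because \<open>D t = 0\<close>.\<close>

lemma nct_D_square: "nct_D (nct_D p) \<approx>\<^bsub>nct_ideal s\<^esub> nct_t * p - p * nct_t"
proof -
  define W where "W p = nct_D (nct_D p) - (nct_t * p - p * nct_t)" for p
  have D_cong: "nct_D p \<approx>\<^bsub>nct_ideal s\<^esub> nct_D q" if "p \<approx>\<^bsub>nct_ideal s\<^esub> q" for p q
    by (rule linear_cong_mod[OF superderivation_linear[OF superderivation_nct_D] nct_D_ideal that])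
  have D_mult: "nct_D (u * v) = nct_D u * v + (- 1) ^ n * (u * nct_D v)" if "u \<in> nct_part n" for u v n
    using superderivation_hom[OF superderivation_nct_D that] by simp
  have DA: "nct_D (nct_Alg a) = nct_d a" and Dt: "nct_D nct_t = 0" for a
    by (simp_all add: nct_differential_gen i_Delta_gen)
  have Dd: "nct_D (nct_d a) \<approx>\<^bsub>nct_ideal s\<^esub> nct_t * nct_Alg a - nct_Alg a * nct_t" for a
    using nct.add[OF nct_differential_d i_Delta_d] by simp
  have "W p \<in> nct_ideal s"
  proof (rule superderivation_nct_cong[where E = W and e = 0])
    show "superderivation nct_deg 0 W"
      unfolding W_def
      using hom_part_parity[OF nct_D_hom_part]
      by (intro superderivation_diff superderivation_square superderivation_nct_D
          superderivation_commutator_even[OF nct_gen_hom_part(2)]) auto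
    show "W p \<in> nct_ideal s" if "p \<in> nct_ideal s" for p
      unfolding W_def using that by (intro nct.diff_mem nct.mult_left_mem nct.mult_right_mem nct_D_ideal)
    show "W nct_t \<in> nct_ideal s"
      unfolding W_def Dt linear_0[OF superderivation_linear[OF superderivation_nct_D]] by (simp add: nct.zero_mem)
    show "W (nct_Alg a) \<in> nct_ideal s" for a
      using Dd[of a] unfolding W_def DA cong_mod_def .
    have "nct_D (nct_D (nct_d a)) \<approx>\<^bsub>nct_ideal s\<^esub> nct_D (nct_t * nct_Alg a - nct_Alg a * nct_t)" for a
      by (rule D_cong[OF Dd])
    also have "nct_D (nct_t * nct_Alg a - nct_Alg a * nct_t) = nct_t * nct_d a - nct_d a * nct_t" for a
      unfolding linear_diff[OF superderivation_linear[OF superderivation_nct_D]]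
        D_mult[OF nct_gen_hom_part(1)] D_mult[OF nct_gen_hom_part(2)] DA Dt by simp
    finally show "W (nct_d a) \<in> nct_ideal s" for a
      unfolding W_def cong_mod_def .
  qed
  then show ?thesis by (simp add: W_def cong_mod_def)
qed


subsection \<open>Supercommutators\<close>

text \<open>The subspace divided out of the extended forms, without the restriction to a single
  degree imposed by \<open>nul\<close>; the correction \<open>q\<close> from the ideal need not be
  homogeneous.\<close>

definition DRt_null :: "('k, 'a) nct_forms set" where
  "DRt_null = {p. \<exists>q\<in>nct_ideal s. p - q \<in> supercommutators}"

lemma DRt_nullI:
  "p \<in> nct_ideal s \<Longrightarrow> p \<in> DRt_null" "p \<in> supercommutators \<Longrightarrow> p \<in> DRt_null"
proof -
  show "p \<in> nct_ideal s \<Longrightarrow> p \<in> DRt_null"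
    unfolding DRt_null_def supercommutators_def using pscale.span_zero by force
  show "p \<in> supercommutators \<Longrightarrow> p \<in> DRt_null"
    unfolding DRt_null_def using nct.zero_mem by force
qed

lemma DRt_null_pscale: "p \<in> DRt_null \<Longrightarrow> pscale c p \<in> DRt_null"
proof -
  assume "p \<in> DRt_null"
  then obtain q where "q \<in> nct_ideal s" "p - q \<in> supercommutators" unfolding DRt_null_def by blast
  then have "pscale c q \<in> nct_ideal s" "pscale c p - pscale c q \<in> supercommutators"
    by (auto simp: supercommutators_def ideal_pscale[OF nct.two_sided_ideal_axioms] simp flip: pscale.scale_right_diff_distrib
        intro: pscale.span_scale)
  then show ?thesis unfolding DRt_null_def by blast
qed

sublocale DRt: add_subgroup DRt_null
proof
  show "0 \<in> DRt_null" by (rule DRt_nullI(1)[OF nct.zero_mem])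
  fix x y assume "x \<in> DRt_null" "y \<in> DRt_null"
  then obtain p q where "p \<in> nct_ideal s" "x - p \<in> supercommutators" "q \<in> nct_ideal s" "y - q \<in> supercommutators"
    unfolding DRt_null_def by blast
  then have "p - q \<in> nct_ideal s" "(x - y) - (p - q) \<in> supercommutators"
    using pscale.span_diff[of "x - p" _ "y - q"] by (auto simp: supercommutators_def nct.diff_mem algebra_simps)
  then show "x - y \<in> DRt_null" unfolding DRt_null_def by blast
qed

lemma DRt_nct: "p \<approx>\<^bsub>nct_ideal s\<^esub> q \<Longrightarrow> p \<approx>\<^bsub>DRt_null\<^esub> q"
  unfolding cong_mod_def by (rule DRt_nullI)

lemma supercommutatorsI:
  "u \<in> nct_part m \<Longrightarrow> v \<in> nct_part n \<Longrightarrow> u * v - (- 1) ^ (m * n) * (v * u) \<in> supercommutators"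
  unfolding supercommutators_def by (rule pscale.span_base) blast

lemma DRt_commute: "u \<in> nct_part m \<Longrightarrow> v \<in> nct_part n \<Longrightarrow> u * v \<approx>\<^bsub>DRt_null\<^esub> (- 1) ^ (m * n) * (v * u)"
  unfolding cong_mod_def by (rule DRt_nullI(2)[OF supercommutatorsI])

lemma DRt_null_induct [consumes 1, case_names ideal commutator scale add]:
  assumes "p \<in> DRt_null"
    and ideal: "\<And>p. p \<in> nct_ideal s \<Longrightarrow> P p"
    and comm: "\<And>u v m n. u \<in> nct_part m \<Longrightarrow> v \<in> nct_part n \<Longrightarrow> P (u * v - (- 1) ^ (m * n) * (v * u))"
    and scale: "\<And>c p. P p \<Longrightarrow> P (pscale c p)" and add: "\<And>p q. P p \<Longrightarrow> P q \<Longrightarrow> P (p + q)"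
  shows "P p"
proof -
  obtain q where q: "q \<in> nct_ideal s" "p - q \<in> supercommutators"
    using assms(1) unfolding DRt_null_def by blast
  from q(2) have "P (p - q)"
    unfolding supercommutators_def
  proof (induction rule: pscale.span_induct_alt)
    case base
    show ?case by (rule ideal[OF nct.zero_mem])
  qed (auto intro: scale add comm)
  then have "P (p - q + q)" by (rule add[OF _ ideal[OF q(1)]])
  then show ?thesis by simp
qed

text \<open>An odd superderivation maps a supercommutator to a sum of supercommutators:
  \<open>D [u, v] = [D u, v] + (-1)^m [u, D v]\<close>.\<close>

lemma nct_D_DRt_null: "p \<in> DRt_null \<Longrightarrow> nct_D p \<in> DRt_null"
proof (induction p rule: DRt_null_induct)
  case (commutator u v m n)
  note lin = superderivation_linear[OF superderivation_nct_D]
  have D_mult: "nct_D (u * v) = nct_D u * v + (- 1) ^ n * (u * nct_D v)" if "u \<in> nct_part n" for u v n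
    using superderivation_hom[OF superderivation_nct_D that] by simp
  have 1: "nct_D u * v - (- 1) ^ (Suc m * n) * (v * nct_D u) \<in> DRt_null"
    and 2: "u * nct_D v - (- 1) ^ (m * Suc n) * (nct_D v * u) \<in> DRt_null"
    using commutator by (auto intro!: DRt_nullI(2) supercommutatorsI nct_D_hom_part simp del: mult_Suc mult_Suc_right)
  have "nct_D (u * v - (- 1) ^ (m * n) * (v * u)) = (nct_D u * v - (- 1) ^ (Suc m * n) * (v * nct_D u)) +
      (- 1) ^ m * (u * nct_D v - (- 1) ^ (m * Suc n) * (nct_D v * u))"
    unfolding linear_diff[OF lin] linear_sign[OF lin] D_mult[OF commutator(1)] D_mult[OF commutator(2)]
    by (cases "even m"; cases "even n") (simp_all add: minus_one_power_iff algebra_simps)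
  also have "\<dots> \<in> DRt_null"
    by (intro DRt.add_mem 1 sign_mem[OF DRt.add_subgroup_axioms 2])
  finally show ?case .
qed (simp_all add: DRt_nullI(1) nct_D_ideal DRt_null_pscale DRt.add_mem
    linear_scale[OF superderivation_linear[OF superderivation_nct_D]]
    linear_add[OF superderivation_linear[OF superderivation_nct_D]])

lemma is_complex_DRt: "is_complex (DRt_complex s)"
proof -
  have "pscale.subspace (nct_part n)" for n :: nat
    by (simp add: pscale.subspace_def hom_part_0 hom_part_add hom_part_pscale)
  moreover have "pscale.subspace {p \<in> nct_part n. p \<in> DRt_null}" for n
    by (simp add: pscale.subspace_def hom_part_0 hom_part_add hom_part_pscale DRt.zero_mem DRt.add_mem DRt_null_pscale)
  moreover have "nct_D (nct_D p) \<in> DRt_null" if "p \<in> nct_part n" for n p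
  proof -
    \<comment> \<open>As \<open>t\<close> has even degree, the commutator \<open>[t, p]\<close> is a
      supercommutator.\<close>
    have "nct_t * p \<approx>\<^bsub>DRt_null\<^esub> (- 1) ^ (2 * n) * (p * nct_t)"
      by (rule DRt_commute[OF nct_gen_hom_part(2) that])
    then have "nct_t * p - p * nct_t \<in> DRt_null" by (simp add: cong_mod_def)
    then show ?thesis using DRt.mem_cong[OF DRt_nct[OF nct_D_square]] by simp
  qed
  moreover have "DRt_complex s = \<lparr>scl = pscale, cyc = nct_part, nul = (\<lambda>n. {p \<in> nct_part n. p \<in> DRt_null}), dif = (\<lambda>n. nct_D)\<rparr>"
    by (simp add: DRt_complex_def DRt_null_def)
  ultimately show ?thesis
    using superderivation_linear[OF superderivation_nct_D] nct_D_hom_part nct_D_DRt_null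
    by (auto simp: is_complex_def vector_space_pscale)
qed

end


section \<open>Derivations of polynomial rings\<close>

lemma poly_der_superset:
  "finite K \<Longrightarrow> Poly_Mapping.keys p \<subseteq> K \<Longrightarrow> poly_der D p = (\<Sum>m\<in>K. \<Sum>x\<in>Poly_Mapping.keys m.
     Poly_Mapping.single (m - Poly_Mapping.single x 1)
       (of_nat (Poly_Mapping.lookup m x) * Poly_Mapping.lookup p m) * D x)"
  unfolding poly_der_def by (rule sum.mono_neutral_left) (auto simp: in_keys_iff)

lemma poly_der_add: "poly_der D (p + q) = poly_der D p + poly_der D q"
proof -
  let ?K = "Poly_Mapping.keys p \<union> Poly_Mapping.keys q"
  show ?thesis
    using poly_der_superset[of ?K "p + q" D] poly_der_superset[of ?K p D] poly_der_superset[of ?K q D]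
      Poly_Mapping.keys_add[of p q]
    by (simp add: lookup_add distrib_left distrib_right single_add sum.distrib)
qed

lemma poly_der_single:
  assumes "finite K" "Poly_Mapping.keys m \<subseteq> K"
  shows "poly_der D (Poly_Mapping.single m c) = (\<Sum>x\<in>K.
     Poly_Mapping.single (m - Poly_Mapping.single x 1) (of_nat (Poly_Mapping.lookup m x) * c) * D x)"
proof -
  have "poly_der D (Poly_Mapping.single m c) = (\<Sum>x\<in>Poly_Mapping.keys m.
     Poly_Mapping.single (m - Poly_Mapping.single x 1) (of_nat (Poly_Mapping.lookup m x) * c) * D x)"
    by (subst poly_der_superset[of "{m}"]) auto
  also have "\<dots> = (\<Sum>x\<in>K.
     Poly_Mapping.single (m - Poly_Mapping.single x 1) (of_nat (Poly_Mapping.lookup m x) * c) * D x)"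
    using assms by (intro sum.mono_neutral_left) (auto simp: in_keys_iff)
  finally show ?thesis .
qed

lemma poly_der_const: "poly_der D (Poly_Mapping.single 0 c) = 0"
  by (subst poly_der_single[of "{}"]) auto

lemma poly_der_pvar: "poly_der D (pvar x) = D x"
  unfolding pvar_def by (subst poly_der_single[of "{x}"]) (auto simp: single_one)

text \<open>The coefficients may be noncommutative: besides the coordinate ring, the lemma serves
  polynomials over the free algebra of forms. This is why the values of \<open>D\<close> have to be
  central.\<close>

lemma poly_der_mult:
  fixes D :: "'x \<Rightarrow> (('x \<Rightarrow>\<^sub>0 nat) \<Rightarrow>\<^sub>0 'r::ring_1)"
  assumes central: "\<And>x q. D x * q = q * D x"
  shows "poly_der D (p * q) = poly_der D p * q + p * poly_der D q"
proof -
  let ?s = "Poly_Mapping.single" and ?l = "Poly_Mapping.lookup"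
  have single: "poly_der D (?s m c * ?s n d) = poly_der D (?s m c) * ?s n d + ?s m c * poly_der D (?s n d)" for m n c d
  proof -
    let ?K = "Poly_Mapping.keys m \<union> Poly_Mapping.keys n"
    have K: "finite ?K" "Poly_Mapping.keys m \<subseteq> ?K" "Poly_Mapping.keys n \<subseteq> ?K" "Poly_Mapping.keys (m + n) \<subseteq> ?K"
      using Poly_Mapping.keys_add[of m n] by auto
    have 1: "?s (m + n - ?s x 1) (of_nat (?l m x) * (c * d)) = ?s (m - ?s x 1) (of_nat (?l m x) * c) * ?s n d" for x
    proof (cases "?l m x = 0")
      case False
      have "m + n - ?s x 1 = m - ?s x 1 + n"
        by (rule poly_mapping_eqI) (use False in \<open>auto simp: lookup_add lookup_minus lookup_single when_def\<close>)
      then show ?thesis by (simp add: mult_single mult.assoc)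
    qed simp
    have 2: "?s (m + n - ?s x 1) (of_nat (?l n x) * (c * d)) = ?s m c * ?s (n - ?s x 1) (of_nat (?l n x) * d)" for x
    proof (cases "?l n x = 0")
      case False
      have "m + n - ?s x 1 = m + (n - ?s x 1)"
        by (rule poly_mapping_eqI) (use False in \<open>auto simp: lookup_add lookup_minus lookup_single when_def\<close>)
      then show ?thesis by (simp add: mult_single mult.assoc) (metis mult.assoc mult_of_nat_commute)
    qed simp
    have "poly_der D (?s m c * ?s n d) = (\<Sum>x\<in>?K. ?s (m + n - ?s x 1) (of_nat (?l m x) * (c * d)) * D x +
        ?s (m + n - ?s x 1) (of_nat (?l n x) * (c * d)) * D x)"
      by (simp add: mult_single poly_der_single[OF K(1,4)] lookup_add distrib_right single_add)
    also have "\<dots> = (\<Sum>x\<in>?K. ?s (m - ?s x 1) (of_nat (?l m x) * c) * ?s n d * D x +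
        ?s m c * ?s (n - ?s x 1) (of_nat (?l n x) * d) * D x)"
      by (simp only: 1 2)
    also have "\<dots> = poly_der D (?s m c) * ?s n d + ?s m c * poly_der D (?s n d)"
      unfolding poly_der_single[OF K(1,2)] poly_der_single[OF K(1,3)]
      by (simp add: sum.distrib sum_distrib_left sum_distrib_right mult.assoc central)
    finally show ?thesis .
  qed
  have "poly_der D (?s m c * q) = poly_der D (?s m c) * q + ?s m c * poly_der D q" for m c
    by (induction q rule: poly_mapping_induct_single_add) (simp_all add: single distrib_left poly_der_add)
  then show ?thesis
    by (induction p rule: poly_mapping_induct_single_add) (simp_all add: distrib_right poly_der_add)
qed

lemma poly_der_cong:
  "(\<And>m x. m \<in> Poly_Mapping.keys p \<Longrightarrow> x \<in> Poly_Mapping.keys m \<Longrightarrow> D x = D' x) \<Longrightarrow> poly_der D p = poly_der D' p"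
  unfolding poly_der_def by (intro sum.cong) auto

lemma poly_der_values:
  "poly_der (\<lambda>x. D x * r) p = poly_der D p * r" "poly_der (\<lambda>x. \<Sum>i\<in>S. E i x) p = (\<Sum>i\<in>S. poly_der (E i) p)"
  "poly_der (\<lambda>x. 0) p = 0"
  unfolding poly_der_def
  by (simp_all add: sum_distrib_right mult.assoc sum_distrib_left)
    (subst (2) sum.swap, subst sum.swap, rule refl)

lemma poly_der_pscale_value: "poly_der (\<lambda>x. pscale c (D x)) p = pscale c (poly_der D p)"
  for p :: "('x \<Rightarrow>\<^sub>0 nat) \<Rightarrow>\<^sub>0 'k::field"
  unfolding poly_der_def by (simp add: pscale_mult_right pscale.scale_sum_right)

lemma linear_poly_der: "Vector_Spaces.linear pscale pscale (poly_der D)"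
  for D :: "'x \<Rightarrow> (('x \<Rightarrow>\<^sub>0 nat) \<Rightarrow>\<^sub>0 'k::field)"
  by (rule linear_pscaleI) (simp_all add: poly_der_add pscale_conv_mult poly_der_mult[OF mult.commute] poly_der_const)

lemma derivation_eq_0:
  fixes f :: "(('x \<Rightarrow>\<^sub>0 nat) \<Rightarrow>\<^sub>0 'k::field) \<Rightarrow> (('x \<Rightarrow>\<^sub>0 nat) \<Rightarrow>\<^sub>0 'k)"
  assumes lin: "Vector_Spaces.linear pscale pscale f" and mult: "\<And>p q. f (p * q) = f p * q + p * f q"
    and var: "\<And>x. f (pvar x) = 0"
  shows "f p = 0"
proof -
  have one: "f 1 = 0" using mult[of 1 1] by simp
  have power: "f (Poly_Mapping.single (Poly_Mapping.single x k) 1) = 0" for x k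
  proof (induction k)
    case (Suc k)
    have "Poly_Mapping.single (Poly_Mapping.single x (Suc k)) (1::'k) =
        pvar x * Poly_Mapping.single (Poly_Mapping.single x k) 1"
      unfolding pvar_def mult_single by (simp flip: single_add)
    then show ?case using Suc by (simp add: mult var)
  qed (simp add: one)
  have monom: "f (Poly_Mapping.single m 1) = 0" for m :: "'x \<Rightarrow>\<^sub>0 nat"
  proof (induction m rule: poly_mapping_induct_single_add)
    case (2 g h)
    have "Poly_Mapping.single (g + h) (1::'k) = Poly_Mapping.single g 1 * Poly_Mapping.single h 1"
      by (simp add: mult_single)
    then show ?case using 2 by (simp add: mult)
  qed (rule power)
  show ?thesis
  proof (induction p rule: poly_mapping_induct_single_add)
    case (1 m c)
    have "Poly_Mapping.single m c = pscale c (Poly_Mapping.single m 1)" by (simp add: pscale_single)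
    then show ?case by (simp add: linear_scale[OF lin] monom)
  qed (simp add: linear_add[OF lin])
qed


section \<open>Vector fields on the representation scheme\<close>

text \<open>The formula of \<open>bracket\<close> for a bare matrix instead of an endomorphism, so
  that matrix units and commutators of matrices can be inserted without realizing them as
  endomorphisms of \<open>V\<close>.\<close>

definition mat_bracket ::
    "'v set \<Rightarrow> ('k \<Rightarrow> 'r \<Rightarrow> 'r) \<Rightarrow> ('v \<Rightarrow> 'v \<Rightarrow> 'k) \<Rightarrow> ('v \<Rightarrow> 'v \<Rightarrow> 'r::ab_group_add) \<Rightarrow> 'v \<Rightarrow> 'v \<Rightarrow> 'r" where
  "mat_bracket Bs sc X M i j = (\<Sum>l\<in>Bs. sc (X i l) (M l j) - sc (X l j) (M i l))"

lemma bracket_conv_mat_bracket: "bracket sV Bs sc x = mat_bracket Bs sc (entry sV Bs x)"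
  by (intro ext) (simp add: bracket_def mat_bracket_def)

lemma linear_mat_bracket:
  "Vector_Spaces.linear s t f \<Longrightarrow> f (mat_bracket Bs s X M i j) = mat_bracket Bs t X (\<lambda>k l. f (M k l)) i j"
  by (simp add: mat_bracket_def linear_sum[of s t f] linear_diff[of s t f] linear_scale[of s t f])

lemma (in vector_space) mat_bracket_jacobi:
  "mat_bracket Bs scale X (mat_bracket Bs scale Y M) i j - mat_bracket Bs scale Y (mat_bracket Bs scale X M) i j =
    mat_bracket Bs scale (mat_bracket Bs (*) X Y) M i j"
proof -
  \<comment> \<open>\<open>?P X Y\<close>, \<open>?Q X Y\<close> and \<open>?R X Y\<close> are the
    entries of \<open>X Y M\<close>, \<open>X M Y\<close> and \<open>M X Y\<close>.\<close>
  let ?P = "\<lambda>X Y. \<Sum>l\<in>Bs. \<Sum>r\<in>Bs. scale (X i l * Y l r) (M r j)"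
  let ?Q = "\<lambda>X Y. \<Sum>l\<in>Bs. \<Sum>r\<in>Bs. scale (X i l * Y r j) (M l r)"
  let ?R = "\<lambda>X Y. \<Sum>l\<in>Bs. \<Sum>r\<in>Bs. scale (X r l * Y l j) (M i r)"
  have Q: "(\<Sum>l\<in>Bs. \<Sum>r\<in>Bs. scale (X l j * Y i r) (M r l)) = ?Q Y X" for X Y
    by (subst sum.swap) (simp add: mult.commute)
  have R: "(\<Sum>l\<in>Bs. \<Sum>r\<in>Bs. scale (X l j * Y r l) (M i r)) = ?R Y X" for X Y
    by (simp add: mult.commute)
  have L: "mat_bracket Bs scale X (mat_bracket Bs scale Y M) i j = ?P X Y - ?Q X Y - (?Q Y X - ?R Y X)" for X Y
    by (simp add: mat_bracket_def scale_sum_right scale_right_diff_distrib sum_subtractf Q R)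
  have "mat_bracket Bs scale (mat_bracket Bs (*) X Y) M i j = (?P X Y - ?P Y X) - (?R X Y - ?R Y X)"
  proof -
    have 1: "(\<Sum>l\<in>Bs. scale (\<Sum>r\<in>Bs. X i r * Y r l) (M l j)) = ?P X Y" for X Y
      by (simp add: scale_sum_left) (rule sum.swap)
    have 2: "(\<Sum>l\<in>Bs. scale (\<Sum>r\<in>Bs. X l r * Y r j) (M i l)) = ?R X Y" for X Y
      by (simp add: scale_sum_left) (rule sum.swap)
    have 3: "(\<Sum>r\<in>Bs. X r l * Y k r) = (\<Sum>r\<in>Bs. Y k r * X r l)" for k l
      by (simp add: mult.commute)
    show ?thesis
      by (simp add: mat_bracket_def sum_subtractf scale_left_diff_distrib 3 1 2)
  qed
  then show ?thesis by (simp add: L)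
qed

definition mat_vec :: "'v set \<Rightarrow> ('v \<Rightarrow> 'v \<Rightarrow> 'k) \<Rightarrow> ('k::field, 'a, 'v) coord_ring \<Rightarrow> ('k, 'a, 'v) coord_ring" where
  "mat_vec Bs X = poly_der (\<lambda>(a, i, j). mat_bracket Bs pscale X (\<lambda>k l. pvar (a, k, l)) i j)"

lemma rep_vec_conv: "rep_vec sV Bs x = mat_vec Bs (entry sV Bs x)"
  by (simp add: rep_vec_def mat_vec_def bracket_conv_mat_bracket)

lemma linear_mat_vec: "Vector_Spaces.linear pscale pscale (mat_vec Bs X)"
  unfolding mat_vec_def by (rule linear_poly_der)

lemma mat_vec_mult: "mat_vec Bs X (p * q) = mat_vec Bs X p * q + p * mat_vec Bs X q"
  unfolding mat_vec_def by (rule poly_der_mult) (rule mult.commute)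

lemma mat_vec_pvar: "mat_vec Bs X (pvar (a, i, j)) = mat_bracket Bs pscale X (\<lambda>k l. pvar (a, k, l)) i j"
  by (simp add: mat_vec_def poly_der_pvar)

text \<open>The matrices are constant while the vector field acts on \<open>\<hat>a\<close>, which reverses the bracket:
  \<open>X (Y \<hat>a) = X [Y, \<hat>a] = [Y, [X, \<hat>a]]\<close>.\<close>

lemma mat_vec_commutator:
  fixes p :: "('k::field, 'a, 'v) coord_ring"
  shows "mat_vec Bs X (mat_vec Bs Y p) - mat_vec Bs Y (mat_vec Bs X p) = - mat_vec Bs (mat_bracket Bs (*) X Y) p"
proof -
  let ?f = "\<lambda>p :: ('k, 'a, 'v) coord_ring. mat_vec Bs X (mat_vec Bs Y p) - mat_vec Bs Y (mat_vec Bs X p) + mat_vec Bs (mat_bracket Bs (*) X Y) p"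
  note lin = linear_mat_vec
  have "?f p = 0"
  proof (rule derivation_eq_0[where f = ?f])
    show "Vector_Spaces.linear pscale pscale ?f"
      by (rule linear_pscaleI) (simp_all add: linear_add[OF lin] linear_scale[OF lin] pscale_add pscale.scale_right_diff_distrib)
    show "?f (p * q) = ?f p * q + p * ?f q" for p q
      by (simp add: mat_vec_mult linear_add[OF lin] algebra_simps)
    show "?f (pvar x) = 0" for x
    proof (cases x)
      case (fields a i j)
      have "mat_vec Bs X (mat_vec Bs Y (pvar (a, i, j))) =
          mat_bracket Bs pscale Y (mat_bracket Bs pscale X (\<lambda>k l. pvar (a, k, l))) i j" for X Y :: "'v \<Rightarrow> 'v \<Rightarrow> 'k"
        by (simp add: mat_vec_pvar linear_mat_bracket[OF lin])
      then show ?thesis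
        by (simp add: fields mat_vec_pvar flip: pscale.mat_bracket_jacobi)
    qed
  qed
  then show ?thesis by (simp add: add_eq_0_iff2)
qed

definition mat_unit :: "'v \<Rightarrow> 'v \<Rightarrow> 'v \<Rightarrow> 'v \<Rightarrow> 'k::zero_neq_one" where
  "mat_unit i j k l = (if k = i \<and> l = j then 1 else 0)"

text \<open>Linearity in \<open>X\<close>, decomposed into matrix units; the support condition
  enters because only units indexed by \<open>Bs\<close> are summed.\<close>

lemma (in vector_space) mat_bracket_expand:
  assumes "finite Bs" and X: "\<And>i j. \<not> (i \<in> Bs \<and> j \<in> Bs) \<Longrightarrow> X i j = 0"
  shows "mat_bracket Bs scale X M k l = (\<Sum>i\<in>Bs. \<Sum>j\<in>Bs. scale (X i j) (mat_bracket Bs scale (mat_unit i j) M k l))"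
proof -
  have "scale (X k r) v = (\<Sum>i\<in>Bs. \<Sum>j\<in>Bs. scale (X i j) (scale (mat_unit i j k r) v))" for k r v
  proof -
    have "(\<Sum>i\<in>Bs. \<Sum>j\<in>Bs. scale (X i j) (scale (mat_unit i j k r) v)) =
        (\<Sum>i\<in>Bs. if i = k then (\<Sum>j\<in>Bs. if j = r then scale (X k r) v else 0) else 0)"
      by (intro sum.cong) (auto simp: mat_unit_def intro!: sum.cong)
    also have "\<dots> = (if k \<in> Bs \<and> r \<in> Bs then scale (X k r) v else 0)"
      using \<open>finite Bs\<close> by (simp add: sum.delta)
    finally show ?thesis using X[of k r] by auto
  qed
  note e = this
  have "mat_bracket Bs scale X M k l = (\<Sum>r\<in>Bs. \<Sum>i\<in>Bs. \<Sum>j\<in>Bs. scale (X i j)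
      (scale (mat_unit i j k r) (M r l) - scale (mat_unit i j r l) (M k r)))"
    unfolding mat_bracket_def by (simp add: e[of k] e[of _ l] sum_subtractf scale_right_diff_distrib)
  also have "\<dots> = (\<Sum>i\<in>Bs. \<Sum>j\<in>Bs. scale (X i j) (mat_bracket Bs scale (mat_unit i j) M k l))"
    unfolding mat_bracket_def scale_sum_right
    by (subst sum.swap) (intro sum.cong HOL.refl sum.swap)
  finally show ?thesis .
qed

lemma mat_vec_expand:
  assumes "finite Bs" and "\<And>i j. \<not> (i \<in> Bs \<and> j \<in> Bs) \<Longrightarrow> X i j = 0"
  shows "mat_vec Bs X p = (\<Sum>i\<in>Bs. \<Sum>j\<in>Bs. pscale (X i j) (mat_vec Bs (mat_unit i j) p))"
proof -
  have *: "(\<lambda>(a, k, l). mat_bracket Bs pscale X (\<lambda>k l. pvar (a, k, l)) k l) = (\<lambda>x.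
      \<Sum>i\<in>Bs. \<Sum>j\<in>Bs. pscale (X i j) (case x of (a, k, l) \<Rightarrow> mat_bracket Bs pscale (mat_unit i j) (\<lambda>k l. pvar (a, k, l)) k l))"
    using pscale.mat_bracket_expand[OF assms] by (auto simp: fun_eq_iff)
  show ?thesis
    unfolding mat_vec_def * by (simp add: poly_der_values poly_der_pscale_value)
qed


section \<open>Differential forms on the representation scheme\<close>

lemma superderivation_parity_cong:
  "even e = even e' \<Longrightarrow> superderivation deg e E \<Longrightarrow> superderivation deg e' E"
  unfolding superderivation_def by (auto simp: minus_one_power_iff)

lemma superderivation_zero: "superderivation deg e (\<lambda>_. 0)"
  by (simp add: superderivation_def linear_iff_additive vector_space_pscale)

definition kd_contract :: "(('k::field, 'a, 'v) coord_ring \<Rightarrow> ('k, 'a, 'v) coord_ring) \<Rightarrow> ('k, 'a, 'v) rep_forms \<Rightarrow> ('k, 'a, 'v) rep_forms" where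
  "kd_contract v = superder 1 kd_deg (case_kd_gen (\<lambda>p. 0) (\<lambda>p. gen (Fn (v p))))"

definition kd_lie :: "(('k::field, 'a, 'v) coord_ring \<Rightarrow> ('k, 'a, 'v) coord_ring) \<Rightarrow> ('k, 'a, 'v) rep_forms \<Rightarrow> ('k, 'a, 'v) rep_forms" where
  "kd_lie v = superder 0 kd_deg (case_kd_gen (\<lambda>p. gen (Fn (v p))) (\<lambda>p. gen (Df (v p))))"

lemma rep_contract_conv: "rep_contract sV Bs x = kd_contract (mat_vec Bs (entry sV Bs x))"
  and rep_lie_conv: "rep_lie sV Bs x = kd_lie (mat_vec Bs (entry sV Bs x))"
  by (simp_all add: rep_contract_def rep_lie_def kd_contract_def kd_lie_def rep_vec_conv)

lemma superderivation_d_DR: "superderivation kd_deg 1 d_DR"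
  and superderivation_contract: "superderivation kd_deg 1 (kd_contract v)"
  and superderivation_lie: "superderivation kd_deg 0 (kd_lie v)"
  unfolding d_DR_def kd_contract_def kd_lie_def by (rule superderivation_superder)+

lemma d_DR_gen: "d_DR (gen (Fn p)) = gen (Df p)" "d_DR (gen (Df p)) = 0"
  by (simp_all add: d_DR_def superder_gen)

lemma contract_gen: "kd_contract v (gen (Fn p)) = 0" "kd_contract v (gen (Df p)) = gen (Fn (v p))"
  by (simp_all add: kd_contract_def superder_gen)

lemma lie_gen: "kd_lie v (gen (Fn p)) = gen (Fn (v p))" "kd_lie v (gen (Df p)) = gen (Df (v p))"
  by (simp_all add: kd_lie_def superder_gen)

lemma kd_gen_hom_part:
  "(gen (Fn p) :: ('k::field, 'a, 'v) rep_forms) \<in> hom_part kd_deg 0"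
  "(gen (Df p) :: ('k::field, 'a, 'v) rep_forms) \<in> hom_part kd_deg 1"
  by (simp_all add: hom_part_gen)

lemma d_DR_hom_part: "p \<in> hom_part kd_deg n \<Longrightarrow> d_DR p \<in> hom_part kd_deg (Suc n)"
  for p :: "('k::field, 'a, 'v) rep_forms"
proof (rule superderivation_hom_part[OF superderivation_d_DR, where k = 1 and l = 0])
  fix x :: "('k, 'a, 'v) coord_ring kd_gen" and m assume "kd_deg x + 1 = m + 0"
  then show "d_DR (gen x :: ('k, 'a, 'v) rep_forms) \<in> hom_part kd_deg m"
    by (cases x) (auto simp: d_DR_gen hom_part_gen hom_part_0)
qed simp_all

lemma contract_hom_part: "p \<in> hom_part kd_deg (Suc n) \<Longrightarrow> kd_contract v p \<in> hom_part kd_deg n"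
  for p :: "('k::field, 'a, 'v) rep_forms"
proof (rule superderivation_hom_part[OF superderivation_contract, where k = 0 and l = 1])
  fix x :: "('k, 'a, 'v) coord_ring kd_gen" and m assume "kd_deg x + 0 = m + 1"
  then show "kd_contract v (gen x :: ('k, 'a, 'v) rep_forms) \<in> hom_part kd_deg m"
    by (cases x) (auto simp: contract_gen hom_part_gen hom_part_0)
next
  fix x :: "('k, 'a, 'v) coord_ring kd_gen" assume "kd_deg x + 0 < 1"
  then show "kd_contract v (gen x :: ('k, 'a, 'v) rep_forms) = 0"
    by (cases x) (auto simp: contract_gen)
qed simp_all

lemma contract_hom_part_0:
  fixes p :: "('k::field, 'a, 'v) rep_forms"
  assumes "p \<in> hom_part kd_deg 0"
  shows "kd_contract v p = 0"
proof -
  note lin = superderivation_linear[OF superderivation_contract]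
  have "kd_contract v (wmon w :: ('k, 'a, 'v) rep_forms) = 0" if "word_deg kd_deg w = 0" for w
    using that
  proof (induction w)
    case (Cons x w)
    then obtain p where "x = Fn p" by (cases x) auto
    with Cons show ?case
      by (simp add: wmon_Cons superderivation_hom[OF superderivation_contract kd_gen_hom_part(1)] contract_gen)
  qed (simp add: wmon_Nil superderivation_1[OF superderivation_contract])
  with assms show ?thesis
    by (induction p rule: hom_part_induct) (simp_all add: linear_add[OF lin] linear_scale[OF lin] linear_0[OF lin])
qed

lemma contract_parity: "p \<in> hom_part kd_deg n \<Longrightarrow> kd_contract v p \<in> parity_part kd_deg (n + 1)"
  for p :: "('k::field, 'a, 'v) rep_forms"
proof (cases n)
  case (Suc m)
  assume "p \<in> hom_part kd_deg n"
  then have "kd_contract v p \<in> parity_part kd_deg m"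
    using Suc contract_hom_part hom_part_parity by blast
  moreover have "parity_part kd_deg (n + 1) = (parity_part kd_deg m :: ('k, 'a, 'v) rep_forms set)"
    by (rule parity_part_even) (simp add: Suc)
  ultimately show ?thesis by simp
qed (simp add: contract_hom_part_0 parity_part_0)

lemma lie_hom_part: "p \<in> hom_part kd_deg n \<Longrightarrow> kd_lie v p \<in> hom_part kd_deg n"
  for p :: "('k::field, 'a, 'v) rep_forms"
proof (rule superderivation_hom_part[OF superderivation_lie, where k = 0 and l = 0])
  fix x :: "('k, 'a, 'v) coord_ring kd_gen" and m assume "kd_deg x + 0 = m + 0"
  then show "kd_lie v (gen x :: ('k, 'a, 'v) rep_forms) \<in> hom_part kd_deg m"
    by (cases x) (auto simp: lie_gen hom_part_gen)
qed simp_all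

lemma d_DR_parity: "p \<in> hom_part kd_deg n \<Longrightarrow> d_DR p \<in> parity_part kd_deg (n + 1)"
  and lie_parity: "p \<in> hom_part kd_deg n \<Longrightarrow> kd_lie v p \<in> parity_part kd_deg (n + 0)"
  for p :: "('k::field, 'a, 'v) rep_forms"
  using hom_part_parity[OF d_DR_hom_part, of p n] hom_part_parity[OF lie_hom_part, of p n v] by simp_all

lemma d_DR_d_DR:
  fixes p :: "('k::field, 'a, 'v) rep_forms"
  shows "d_DR (d_DR p) = 0"
proof (rule superderivation_eqI[where deg = kd_deg and e = 0 and E = "\<lambda>p. d_DR (d_DR p)" and F = "\<lambda>_. 0"])
  fix x :: "('k, 'a, 'v) coord_ring kd_gen"
  show "d_DR (d_DR (gen x :: ('k, 'a, 'v) rep_forms)) = 0"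
    by (cases x) (simp_all add: d_DR_gen linear_0[OF superderivation_linear[OF superderivation_d_DR]])
qed (rule superderivation_zero superderivation_square[OF superderivation_d_DR d_DR_parity], assumption?)+

lemma superderivation_anticommutator:
  assumes "superderivation kd_deg 1 E" "superderivation kd_deg 1 F"
    and "\<And>n p. p \<in> hom_part kd_deg n \<Longrightarrow> E p \<in> parity_part kd_deg (n + 1)"
    and "\<And>n p. p \<in> hom_part kd_deg n \<Longrightarrow> F p \<in> parity_part kd_deg (n + 1)"
  shows "superderivation kd_deg 0 (\<lambda>p. E (F p) + F (E p))"
  using superderivation_parity_cong[of "1 + 1" 0, OF _ superderivation_bracket[OF assms]] by simp

text \<open>Two derivations of degree 0 that agree on the generators. The equality holds for
  representatives already, before the relations of Kaehler forms are imposed and for an arbitrary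
  map \<open>v\<close>.\<close>

lemma cartan:
  fixes p :: "('k::field, 'a, 'v) rep_forms"
  shows "d_DR (kd_contract v p) + kd_contract v (d_DR p) = kd_lie v p"
proof (rule superderivation_eqI[where e = 0 and E = "\<lambda>p. d_DR (kd_contract v p) + kd_contract v (d_DR p)"])
  show "superderivation kd_deg 0 (\<lambda>p :: ('k, 'a, 'v) rep_forms. d_DR (kd_contract v p) + kd_contract v (d_DR p))"
    by (intro superderivation_anticommutator superderivation_d_DR superderivation_contract d_DR_parity contract_parity)
  fix x :: "('k, 'a, 'v) coord_ring kd_gen"
  show "d_DR (kd_contract v (gen x)) + kd_contract v (d_DR (gen x)) = kd_lie v (gen x :: ('k, 'a, 'v) rep_forms)"
    by (cases x) (simp_all add: d_DR_gen contract_gen lie_gen linear_0[OF superderivation_linear[OF superderivation_d_DR]]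
        linear_0[OF superderivation_linear[OF superderivation_contract]])
qed (rule superderivation_lie)

lemma d_DR_lie: "d_DR (kd_lie v p) = kd_lie v (d_DR p)"
  by (simp add: d_DR_d_DR linear_add[OF superderivation_linear[OF superderivation_d_DR]]
      linear_0[OF superderivation_linear[OF superderivation_contract]] flip: cartan)

lemma contract_contract:
  fixes p :: "('k::field, 'a, 'v) rep_forms"
  shows "kd_contract v (kd_contract w p) + kd_contract w (kd_contract v p) = 0"
proof (rule superderivation_eqI[where e = 0 and E = "\<lambda>p. kd_contract v (kd_contract w p) + kd_contract w (kd_contract v p)"
      and F = "\<lambda>_. 0"])
  show "superderivation kd_deg 0 (\<lambda>p. kd_contract v (kd_contract w p) + kd_contract w (kd_contract v p))"
    by (intro superderivation_anticommutator superderivation_contract contract_parity)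
  fix x :: "('k, 'a, 'v) coord_ring kd_gen"
  show "kd_contract v (kd_contract w (gen x)) + kd_contract w (kd_contract v (gen x :: ('k, 'a, 'v) rep_forms)) = 0"
    by (cases x) (simp_all add: contract_gen linear_0[OF superderivation_linear[OF superderivation_contract]])
qed (rule superderivation_zero)

locale rep_setting = assoc_algebra s + V: finite_dimensional_vector_space sV Bs
  for s :: "'k::field_char_0 \<Rightarrow> 'a::{ring, monoid_mult} \<Rightarrow> 'a"
    and sV :: "'k \<Rightarrow> 'v::ab_group_add \<Rightarrow> 'v" and Bs :: "'v set"
begin

sublocale J: two_sided_ideal "rep_ideal s Bs :: ('k, 'a, 'v) coord_ring set"
  unfolding rep_ideal_def by (rule two_sided_ideal_ideal_of)

sublocale K: two_sided_ideal "rep_forms_ideal s Bs"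
  unfolding rep_forms_ideal_def kaehler_ideal_def by (rule two_sided_ideal_ideal_of)

abbreviation J where "J \<equiv> rep_ideal s Bs"
abbreviation K where "K \<equiv> rep_forms_ideal s Bs"

lemma J_rel:
  "i \<in> Bs \<Longrightarrow> j \<in> Bs \<Longrightarrow> pvar (a + b, i, j) \<approx>\<^bsub>J\<^esub> pvar (a, i, j) + pvar (b, i, j)"
  "i \<in> Bs \<Longrightarrow> j \<in> Bs \<Longrightarrow> pvar (s c a, i, j) \<approx>\<^bsub>J\<^esub> pscale c (pvar (a, i, j))"
  "i \<in> Bs \<Longrightarrow> j \<in> Bs \<Longrightarrow> pvar (a * b, i, j) \<approx>\<^bsub>J\<^esub> (\<Sum>l\<in>Bs. pvar (a, i, l) * pvar (b, l, j))"
  "i \<in> Bs \<Longrightarrow> j \<in> Bs \<Longrightarrow> pvar (1, i, j) \<approx>\<^bsub>J\<^esub> (if i = j then 1 else 0)"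
  "\<not> (i \<in> Bs \<and> j \<in> Bs) \<Longrightarrow> pvar (a, i, j) \<approx>\<^bsub>J\<^esub> 0"
  unfolding cong_mod_def diff_diff_eq[symmetric] diff_zero rep_ideal_def
  by (rule ideal_of_base, blast)+

lemma K_rel:
  "gen (Fn (p + q)) \<approx>\<^bsub>K\<^esub> gen (Fn p) + gen (Fn q)"
  "gen (Fn (pscale c p)) \<approx>\<^bsub>K\<^esub> pscale c (gen (Fn p))"
  "gen (Fn (p * q)) \<approx>\<^bsub>K\<^esub> gen (Fn p) * gen (Fn q)"
  "gen (Fn 1) \<approx>\<^bsub>K\<^esub> 1"
  "gen (Df (p + q)) \<approx>\<^bsub>K\<^esub> gen (Df p) + gen (Df q)"
  "gen (Df (pscale c p)) \<approx>\<^bsub>K\<^esub> pscale c (gen (Df p))"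
  "gen (Df (p * q)) \<approx>\<^bsub>K\<^esub> gen (Fn p) * gen (Df q) + gen (Fn q) * gen (Df p)"
  "gen (Fn p) * gen (Df q) \<approx>\<^bsub>K\<^esub> gen (Df q) * gen (Fn p)"
  unfolding cong_mod_def diff_diff_eq[symmetric] rep_forms_ideal_def kaehler_ideal_def
  by (rule ideal_of_base, blast)+

lemma K_Df_Df: "gen (Df p) * gen (Df q) \<approx>\<^bsub>K\<^esub> - (gen (Df q) * gen (Df p))"
  unfolding cong_mod_def diff_minus_eq_add rep_forms_ideal_def kaehler_ideal_def
  by (rule ideal_of_base, blast)

lemma K_J: "p \<in> J \<Longrightarrow> gen (Fn p) \<approx>\<^bsub>K\<^esub> 0" "p \<in> J \<Longrightarrow> gen (Df p) \<approx>\<^bsub>K\<^esub> 0"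
  unfolding cong_mod_def diff_zero rep_forms_ideal_def kaehler_ideal_def
  by (rule ideal_of_base, blast)+

lemma K_Fn_Fn: "gen (Fn p) * gen (Fn q) \<approx>\<^bsub>K\<^esub> gen (Fn q) * gen (Fn p)"
  by (rule K.trans[OF K.sym[OF K_rel(3)] K_rel(3)[of q p, unfolded mult.commute[of q p]]])

lemma K_pscale: "x \<approx>\<^bsub>K\<^esub> y \<Longrightarrow> pscale c x \<approx>\<^bsub>K\<^esub> pscale c y"
  by (rule cong_mod_pscale[OF K.two_sided_ideal_axioms])

lemma K_pscale_mem: "x \<in> K \<Longrightarrow> pscale c x \<in> K"
  by (rule ideal_pscale[OF K.two_sided_ideal_axioms])

text \<open>The hypotheses spell out what the Leibniz rule makes of the defining relations of
  \<open>kaehler_ideal\<close> under \<open>E\<close>. The relation \<open>Fn 1 = 1\<close> needs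
  none of its own, since \<open>F_mult\<close> gives \<open>F 1 = F 1 + F 1\<close> in the
  quotient.\<close>

lemma kaehler_superderivation_ideal:
  fixes E :: "('k, 'a, 'v) rep_forms \<Rightarrow> ('k, 'a, 'v) rep_forms"
  defines "F \<equiv> \<lambda>p. E (gen (Fn p))" and "D \<equiv> \<lambda>p. E (gen (Df p))"
  assumes E: "superderivation kd_deg 1 E"
    and F_add: "\<And>p q. F (p + q) \<approx>\<^bsub>K\<^esub> F p + F q" and F_scale: "\<And>c p. F (pscale c p) \<approx>\<^bsub>K\<^esub> pscale c (F p)"
    and F_mult: "\<And>p q. F (p * q) \<approx>\<^bsub>K\<^esub> F p * gen (Fn q) + gen (Fn p) * F q"
    and F_J: "\<And>p. p \<in> J \<Longrightarrow> F p \<approx>\<^bsub>K\<^esub> 0"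
    and D_add: "\<And>p q. D (p + q) \<approx>\<^bsub>K\<^esub> D p + D q" and D_scale: "\<And>c p. D (pscale c p) \<approx>\<^bsub>K\<^esub> pscale c (D p)"
    and D_mult: "\<And>p q. D (p * q) \<approx>\<^bsub>K\<^esub> F p * gen (Df q) + gen (Fn p) * D q + (F q * gen (Df p) + gen (Fn q) * D p)"
    and D_J: "\<And>p. p \<in> J \<Longrightarrow> D p \<approx>\<^bsub>K\<^esub> 0"
    and FnDf: "\<And>p q. F p * gen (Df q) + gen (Fn p) * D q \<approx>\<^bsub>K\<^esub> D q * gen (Fn p) - gen (Df q) * F p"
    and DfDf: "\<And>p q. D p * gen (Df q) - gen (Df p) * D q \<approx>\<^bsub>K\<^esub> - (D q * gen (Df p) - gen (Df q) * D p)"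
    and p: "p \<in> K"
  shows "E p \<in> K"
proof -
  note lin = superderivation_linear[OF E]
  have m: "E (gen (Fn p) * u) = F p * u + gen (Fn p) * E u" "E (gen (Df p) * u) = D p * u - gen (Df p) * E u" for p u
    using superderivation_hom[OF E kd_gen_hom_part(1), of p u] superderivation_hom[OF E kd_gen_hom_part(2), of p u]
    by (simp_all add: F_def D_def)
  have g: "E (gen (Fn p)) = F p" "E (gen (Df p)) = D p" for p by (simp_all add: F_def D_def)
  have "F 1 \<approx>\<^bsub>K\<^esub> F 1 * gen (Fn 1) + gen (Fn 1) * F 1" using F_mult[of 1 1] by simp
  also have "\<dots> \<approx>\<^bsub>K\<^esub> F 1 * 1 + 1 * F 1"
    by (intro K.add K.mult_left K.mult_right K_rel(4))
  finally have F_1: "F 1 \<approx>\<^bsub>K\<^esub> 0" using K.minus_mem by (fastforce simp: cong_mod_def)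
  show ?thesis
    using p unfolding rep_forms_ideal_def kaehler_ideal_def
  proof (rule superderivation_ideal_of[OF E, rotated 2], fold kaehler_ideal_def rep_forms_ideal_def,
      goal_cases)
    case (1 r)
    have FF: "(gen (Fn p) * gen (Fn q) :: ('k, 'a, 'v) rep_forms) \<in> hom_part kd_deg 0"
      and FD: "(gen (Fn p) * gen (Df q) :: ('k, 'a, 'v) rep_forms) \<in> hom_part kd_deg 1"
      and DF: "(gen (Df q) * gen (Fn p) :: ('k, 'a, 'v) rep_forms) \<in> hom_part kd_deg 1"
      and DD: "(gen (Df p) * gen (Df q) :: ('k, 'a, 'v) rep_forms) \<in> hom_part kd_deg 2"
      for p q :: "('k, 'a, 'v) coord_ring"
      using hom_part_mult[OF kd_gen_hom_part(1) kd_gen_hom_part(1), of p q] hom_part_mult[OF kd_gen_hom_part(1) kd_gen_hom_part(2), of p q]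
        hom_part_mult[OF kd_gen_hom_part(2) kd_gen_hom_part(1), of q p] hom_part_mult[OF kd_gen_hom_part(2) kd_gen_hom_part(2), of p q]
      by (simp_all add: numeral_2_eq_2)
    show ?case
      by (insert 1(1), elim UnE CollectE exE conjE singletonE; simp only:;
          ((rule exI[of _ 0], (intro hom_part_diff hom_part_pscale hom_part_1 kd_gen_hom_part FF; fail)) |
           (rule exI[of _ 1], (intro hom_part_diff hom_part_pscale kd_gen_hom_part FD DF; fail)) |
           (rule exI[of _ 2], (intro hom_part_add DD; fail))))
  next
    case (2 r)
    show ?case
    proof (insert 2(1), elim UnE CollectE exE conjE singletonE; simp only:)
      fix p q :: "('k, 'a, 'v) coord_ring"
      show "E (gen (Fn (p + q)) - gen (Fn p) - gen (Fn q)) \<in> K"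
        using F_add[of p q] by (simp add: linear_diff[OF lin] linear_add[OF lin] g cong_mod_def diff_diff_eq)
      show "E (gen (Fn (p * q)) - gen (Fn p) * gen (Fn q)) \<in> K"
        using F_mult[of p q] by (simp add: linear_diff[OF lin] linear_add[OF lin] g m cong_mod_def diff_diff_eq)
      show "E (gen (Fn 1) - 1) \<in> K"
        using F_1 by (simp add: linear_diff[OF lin] g superderivation_1[OF E] cong_mod_def)
      show "E (gen (Df (p + q)) - gen (Df p) - gen (Df q)) \<in> K"
        using D_add[of p q] by (simp add: linear_diff[OF lin] linear_add[OF lin] g cong_mod_def diff_diff_eq)
      show "E (gen (Df (p * q)) - gen (Fn p) * gen (Df q) - gen (Fn q) * gen (Df p)) \<in> K"
        using D_mult[of p q] by (simp add: linear_diff[OF lin] linear_add[OF lin] g m cong_mod_def diff_diff_eq)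
      show "E (gen (Fn p) * gen (Df q) - gen (Df q) * gen (Fn p)) \<in> K"
        using FnDf[of p q] by (simp add: linear_diff[OF lin] g m cong_mod_def)
      show "E (gen (Df p) * gen (Df q) + gen (Df q) * gen (Df p)) \<in> K"
        using DfDf[of p q] unfolding cong_mod_def diff_minus_eq_add by (simp add: linear_add[OF lin] g m)
      show "E (gen (Fn p)) \<in> K" if "p \<in> J"
        using F_J[OF that] by (simp add: g K.zero_iff)
      show "E (gen (Df p)) \<in> K" if "p \<in> J"
        using D_J[OF that] by (simp add: g K.zero_iff)
      fix c :: 'k
      show "E (gen (Fn (pscale c p)) - pscale c (gen (Fn p))) \<in> K"
        using F_scale[of c p] by (simp add: linear_diff[OF lin] linear_scale[OF lin] g cong_mod_def)
      show "E (gen (Df (pscale c p)) - pscale c (gen (Df p))) \<in> K"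
        using D_scale[of c p] by (simp add: linear_diff[OF lin] linear_scale[OF lin] g cong_mod_def)
    qed
  qed
qed

lemma d_DR_ideal: "p \<in> K \<Longrightarrow> d_DR p \<in> K"
proof (rule kaehler_superderivation_ideal[OF superderivation_d_DR], unfold d_DR_gen)
  fix p q :: "('k, 'a, 'v) coord_ring"
  show "gen (Df (p * q)) \<approx>\<^bsub>K\<^esub> gen (Df p) * gen (Fn q) + gen (Fn p) * gen (Df q)"
    using K.trans[OF K_rel(7)[of p q] K.add[OF K.refl[of "gen (Fn p) * gen (Df q)"] K_rel(8)[of q p]]] by (simp add: add.commute)
  show "0 \<approx>\<^bsub>K\<^esub> gen (Df p) * gen (Df q) + gen (Fn p) * 0 + (gen (Df q) * gen (Df p) + gen (Fn q) * 0)"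
    by (rule K.cong_of_diff[OF K.sym[OF K_Df_Df[of p q]]]) simp
  show "gen (Df p) * gen (Df q) + gen (Fn p) * 0 \<approx>\<^bsub>K\<^esub> 0 * gen (Fn p) - gen (Df q) * gen (Df p)"
    by (simp add: K_Df_Df)
qed (simp_all add: K_rel K_J K.refl)

lemma contract_ideal:
  assumes lin: "Vector_Spaces.linear pscale pscale v" and mult: "\<And>p q. v (p * q) = v p * q + p * v q"
    and J: "\<And>p. p \<in> J \<Longrightarrow> v p \<in> J" and p: "p \<in> K"
  shows "kd_contract v p \<in> K"
  using p
proof (rule kaehler_superderivation_ideal[OF superderivation_contract, rotated -1], unfold contract_gen)
  fix p q :: "('k, 'a, 'v) coord_ring" and c
  show "gen (Fn (v (p + q))) \<approx>\<^bsub>K\<^esub> gen (Fn (v p)) + gen (Fn (v q))"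
    by (simp add: linear_add[OF lin] K_rel)
  show "gen (Fn (v (pscale c p))) \<approx>\<^bsub>K\<^esub> pscale c (gen (Fn (v p)))"
    by (simp add: linear_scale[OF lin] K_rel)
  have "gen (Fn (p * v q + q * v p)) \<approx>\<^bsub>K\<^esub> gen (Fn p) * gen (Fn (v q)) + gen (Fn q) * gen (Fn (v p))"
    by (rule K.trans[OF K_rel(1)]) (intro K.add K_rel)
  then show "gen (Fn (v (p * q))) \<approx>\<^bsub>K\<^esub> 0 * gen (Df q) + gen (Fn p) * gen (Fn (v q)) + (0 * gen (Df p) + gen (Fn q) * gen (Fn (v p)))"
    by (simp add: mult mult.commute[of "v p"] add.commute)
  show "gen (Fn (v p)) \<approx>\<^bsub>K\<^esub> 0" if "p \<in> J"
    by (rule K_J(1)[OF J[OF that]])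
  show "0 * gen (Df q) + gen (Fn p) * gen (Fn (v q)) \<approx>\<^bsub>K\<^esub> gen (Fn (v q)) * gen (Fn p) - gen (Df q) * 0"
    by (simp add: K_Fn_Fn)
  show "gen (Fn (v p)) * gen (Df q) - gen (Df p) * gen (Fn (v q)) \<approx>\<^bsub>K\<^esub>
      - (gen (Fn (v q)) * gen (Df p) - gen (Df q) * gen (Fn (v p)))"
    by (rule K.cong_of_diff2[OF K_rel(8)[of "v p" q] K_rel(8)[of "v q" p]]) simp
qed (simp_all add: K.refl)

lemma J_rel_0: "M \<in> J \<Longrightarrow> pscale c M \<in> J" for M :: "('k, 'a, 'v) coord_ring"
  by (rule ideal_pscale[OF J.two_sided_ideal_axioms])

text \<open>Infinitesimal invariance of the representation scheme under conjugation. Each relation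
  reduces to a property of the commutator: it is linear, a derivation for the matrix product, and
  zero on the identity matrix.\<close>

lemma mat_vec_J:
  assumes X: "\<And>i j. \<not> (i \<in> Bs \<and> j \<in> Bs) \<Longrightarrow> X i j = 0" and p: "p \<in> J"
  shows "mat_vec Bs X p \<in> J"
proof -
  note lin = linear_mat_vec[of Bs X]
  let ?a = "\<lambda>a k l. pvar (a, k, l) :: ('k, 'a, 'v) coord_ring"
  have fin: "finite Bs" by (rule V.finite_Basis)
  have junk: "mat_bracket Bs pscale X (?a a) i j \<approx>\<^bsub>J\<^esub> 0" if "\<not> (i \<in> Bs \<and> j \<in> Bs)" for a i j
  proof -
    have "pscale (X i l) (?a a l j) \<in> J" and "pscale (X l j) (?a a i l) \<in> J" for l
      using that X[of i l] X[of l j] J_rel(5)[of l j a] J_rel(5)[of i l a]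
      by (auto simp: J.zero_iff J.zero_mem intro: J_rel_0)
    then show ?thesis
      unfolding mat_bracket_def J.zero_iff by (intro J.sum_mem J.diff_mem)
  qed
  have br: "mat_bracket Bs pscale X M i j \<approx>\<^bsub>J\<^esub> mat_bracket Bs pscale X N i j"
    if "i \<in> Bs" "j \<in> Bs" "\<And>k l. k \<in> Bs \<Longrightarrow> l \<in> Bs \<Longrightarrow> M k l \<approx>\<^bsub>J\<^esub> N k l" for M N i j
    unfolding mat_bracket_def
    by (intro J.sum J.diff cong_mod_pscale[OF J.two_sided_ideal_axioms] that)
  show ?thesis
  proof (rule ideal_of_induct[OF p[unfolded rep_ideal_def], where P = "\<lambda>p. mat_vec Bs X p \<in> J"], goal_cases)
    case (1 u r v)
    have "mat_vec Bs X r \<in> J"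
    proof (insert 1, elim UnE CollectE exE conjE singletonE; simp only:)
      fix a b i j assume ij: "i \<in> Bs" "j \<in> Bs"
      have "mat_bracket Bs pscale X (?a (a + b)) i j \<approx>\<^bsub>J\<^esub> mat_bracket Bs pscale X (\<lambda>k l. ?a a k l + ?a b k l) i j"
        by (intro br ij J_rel)
      also have "\<dots> = mat_bracket Bs pscale X (?a a) i j + mat_bracket Bs pscale X (?a b) i j"
        by (simp add: mat_bracket_def pscale_add sum.distrib sum_subtractf algebra_simps)
      finally show "mat_vec Bs X (?a (a + b) i j - ?a a i j - ?a b i j) \<in> J"
        by (simp add: linear_diff[OF lin] linear_add[OF lin] mat_vec_pvar cong_mod_def diff_diff_eq)
    next
      fix c a i j assume ij: "i \<in> Bs" "j \<in> Bs"
      have "mat_bracket Bs pscale X (?a (s c a)) i j \<approx>\<^bsub>J\<^esub> mat_bracket Bs pscale X (\<lambda>k l. pscale c (?a a k l)) i j"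
        by (intro br ij J_rel)
      also have "\<dots> = pscale c (mat_bracket Bs pscale X (?a a) i j)"
        by (simp add: mat_bracket_def pscale.scale_sum_right pscale.scale_right_diff_distrib mult.commute)
      finally show "mat_vec Bs X (?a (s c a) i j - pscale c (?a a i j)) \<in> J"
        by (simp add: linear_diff[OF lin] linear_scale[OF lin] mat_vec_pvar cong_mod_def)
    next
      fix a b i j assume ij: "i \<in> Bs" "j \<in> Bs"
      have "mat_bracket Bs pscale X (?a (a * b)) i j \<approx>\<^bsub>J\<^esub> mat_bracket Bs pscale X (\<lambda>k l. \<Sum>r\<in>Bs. ?a a k r * ?a b r l) i j"
        by (intro br ij J_rel)
      also have "\<dots> = (\<Sum>l\<in>Bs. mat_bracket Bs pscale X (?a a) i l * ?a b l j + ?a a i l * mat_bracket Bs pscale X (?a b) l j)"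
      proof -
        \<comment> \<open>\<open>?P\<close>, \<open>?Q\<close> and \<open>?R\<close> are the entries
          of \<open>X a b\<close>, \<open>a b X\<close> and \<open>a X b\<close>, with
          \<open>a\<close> and \<open>b\<close> standing for their generic matrices.\<close>
        let ?P = "\<Sum>l\<in>Bs. \<Sum>r\<in>Bs. pscale (X i l) (?a a l r * ?a b r j)"
        let ?Q = "\<Sum>l\<in>Bs. \<Sum>r\<in>Bs. pscale (X l j) (?a a i r * ?a b r l)"
        let ?R = "\<Sum>l\<in>Bs. \<Sum>r\<in>Bs. pscale (X r l) (?a a i r * ?a b l j)"
        have "mat_bracket Bs pscale X (\<lambda>k l. \<Sum>r\<in>Bs. ?a a k r * ?a b r l) i j = ?P - ?Q"
          by (simp add: mat_bracket_def pscale.scale_sum_right sum_subtractf)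
        moreover have "(\<Sum>l\<in>Bs. mat_bracket Bs pscale X (?a a) i l * ?a b l j) = ?P - ?R"
          by (simp add: mat_bracket_def sum_distrib_right left_diff_distrib sum_subtractf pscale_mult_left)
            (rule sum.swap)
        moreover have "(\<Sum>l\<in>Bs. ?a a i l * mat_bracket Bs pscale X (?a b) l j) = ?R - ?Q"
        proof -
          have "(\<Sum>l\<in>Bs. ?a a i l * mat_bracket Bs pscale X (?a b) l j) =
             (\<Sum>l\<in>Bs. \<Sum>r\<in>Bs. pscale (X l r) (?a a i l * ?a b r j)) - (\<Sum>l\<in>Bs. \<Sum>r\<in>Bs. pscale (X r j) (?a a i l * ?a b l r))"
            by (simp add: mat_bracket_def sum_distrib_left right_diff_distrib sum_subtractf pscale_mult_right)
          also have "\<dots> = ?R - ?Q" by (subst sum.swap, subst (2) sum.swap) (rule refl)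
          finally show ?thesis .
        qed
        ultimately show ?thesis by (simp add: sum.distrib)
      qed
      finally show "mat_vec Bs X (?a (a * b) i j - (\<Sum>l\<in>Bs. ?a a i l * ?a b l j)) \<in> J"
        by (simp add: linear_diff[OF lin] linear_sum[OF lin] mat_vec_mult mat_vec_pvar cong_mod_def)
    next
      fix i j assume ij: "i \<in> Bs" "j \<in> Bs"
      have "mat_bracket Bs pscale X (?a 1) i j \<approx>\<^bsub>J\<^esub> mat_bracket Bs pscale X (\<lambda>k l. if k = l then 1 else 0) i j"
        by (intro br ij J_rel)
      also have "\<dots> = (\<Sum>l\<in>Bs. if l = j then pscale (X i j) 1 else 0) - (\<Sum>l\<in>Bs. if l = i then pscale (X i j) 1 else 0)"
        unfolding mat_bracket_def sum_subtractf by (intro arg_cong2[of _ _ _ _ minus] sum.cong) auto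
      also have "\<dots> = 0" using fin ij by simp
      finally show "mat_vec Bs X (?a 1 i j - (if i = j then 1 else 0)) \<in> J"
        using mat_vec_mult[of Bs X "1 :: ('k, 'a, 'v) coord_ring" 1]
        by (auto simp: linear_diff[OF lin] linear_0[OF lin] mat_vec_pvar J.zero_iff)
    next
      fix a i j assume "\<not> (i \<in> Bs \<and> j \<in> Bs)"
      then show "mat_vec Bs X (?a a i j) \<in> J"
        using junk by (simp add: mat_vec_pvar J.zero_iff)
    qed
    moreover have "r \<in> J" using 1 unfolding rep_ideal_def by (rule ideal_of_base)
    ultimately show ?case by (simp add: mat_vec_mult J.add_mem J.mult_left_mem J.mult_right_mem)
  qed (simp_all add: linear_0[OF lin] linear_add[OF lin] J.zero_mem J.add_mem)
qed

abbreviation supported :: "('v \<Rightarrow> 'v \<Rightarrow> 'k) \<Rightarrow> bool" where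
  "supported X \<equiv> \<forall>i j. \<not> (i \<in> Bs \<and> j \<in> Bs) \<longrightarrow> X i j = 0"

abbreviation \<iota> :: "('v \<Rightarrow> 'v \<Rightarrow> 'k) \<Rightarrow> ('k, 'a, 'v) rep_forms \<Rightarrow> ('k, 'a, 'v) rep_forms" where
  "\<iota> X \<equiv> kd_contract (mat_vec Bs X)"

abbreviation \<L> :: "('v \<Rightarrow> 'v \<Rightarrow> 'k) \<Rightarrow> ('k, 'a, 'v) rep_forms \<Rightarrow> ('k, 'a, 'v) rep_forms" where
  "\<L> X \<equiv> kd_lie (mat_vec Bs X)"

lemma contract_K: "supported X \<Longrightarrow> p \<in> K \<Longrightarrow> \<iota> X p \<in> K"
  by (rule contract_ideal[OF linear_mat_vec mat_vec_mult mat_vec_J]) auto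

lemma lie_K: "supported X \<Longrightarrow> p \<in> K \<Longrightarrow> \<L> X p \<in> K"
  unfolding cartan[symmetric] by (intro K.add_mem d_DR_ideal contract_K)

lemma K_Fn_diff: "gen (Fn (p - q)) \<approx>\<^bsub>K\<^esub> gen (Fn p) - gen (Fn q)"
  by (rule K.cong_of_diff[OF K.sym[OF K_rel(1)[of "p - q" q]]]) simp

lemma K_Fn_0: "gen (Fn 0) \<approx>\<^bsub>K\<^esub> 0"
  using K_Fn_diff[of 0 0] by simp

lemma K_Fn_sum: "gen (Fn (sum f S)) \<approx>\<^bsub>K\<^esub> (\<Sum>i\<in>S. gen (Fn (f i)))"
proof (induction S rule: infinite_finite_induct)
  case (insert x F)
  then show ?case using K.trans[OF K_rel(1) K.add[OF K.refl insert.IH]] by simp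
qed (simp_all add: K_Fn_0)

text \<open>On functions both sides vanish; on \<open>Df p\<close> the claim is
  \<open>mat_vec_commutator\<close>, from which the sign is inherited.\<close>

lemma lie_contract:
  "\<L> X (\<iota> Y p) - \<iota> Y (\<L> X p) \<approx>\<^bsub>K\<^esub> - \<iota> (mat_bracket Bs (*) X Y) p"
proof -
  have "\<L> X (\<iota> Y p) - \<iota> Y (\<L> X p) + \<iota> (mat_bracket Bs (*) X Y) p \<in> K"
  proof (rule superderivation_mem_ideal[where E = "\<lambda>p. \<L> X (\<iota> Y p) - \<iota> Y (\<L> X p) + \<iota> (mat_bracket Bs (*) X Y) p",
        OF _ K.two_sided_ideal_axioms])
    have "superderivation kd_deg (0 + 1) (\<lambda>p. \<L> X (\<iota> Y p) - (- 1) ^ (0 * 1) * \<iota> Y (\<L> X p))"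
      by (intro superderivation_bracket superderivation_lie superderivation_contract lie_parity contract_parity)
    then show "superderivation kd_deg 1 (\<lambda>p. \<L> X (\<iota> Y p) - \<iota> Y (\<L> X p) + \<iota> (mat_bracket Bs (*) X Y) p)"
      by (intro superderivation_add superderivation_contract) simp
    fix x :: "('k, 'a, 'v) coord_ring kd_gen"
    show "\<L> X (\<iota> Y (gen x)) - \<iota> Y (\<L> X (gen x)) + \<iota> (mat_bracket Bs (*) X Y) (gen x) \<in> K"
    proof (cases x)
      case (Df p)
      have "gen (Fn (mat_vec Bs X (mat_vec Bs Y p) - mat_vec Bs Y (mat_vec Bs X p))) \<approx>\<^bsub>K\<^esub>
          gen (Fn (mat_vec Bs X (mat_vec Bs Y p))) - gen (Fn (mat_vec Bs Y (mat_vec Bs X p)))"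
        by (rule K_Fn_diff)
      then have 1: "gen (Fn (0 - mat_vec Bs (mat_bracket Bs (*) X Y) p)) \<approx>\<^bsub>K\<^esub>
          gen (Fn (mat_vec Bs X (mat_vec Bs Y p))) - gen (Fn (mat_vec Bs Y (mat_vec Bs X p)))"
        by (simp add: mat_vec_commutator)
      have "gen (Fn (mat_vec Bs X (mat_vec Bs Y p))) - gen (Fn (mat_vec Bs Y (mat_vec Bs X p))) +
          gen (Fn (mat_vec Bs (mat_bracket Bs (*) X Y) p)) \<approx>\<^bsub>K\<^esub> 0"
        by (rule K.cong_of_diff3[OF K.sym[OF 1] K_Fn_diff[of 0 "mat_vec Bs (mat_bracket Bs (*) X Y) p"] K_Fn_0]) simp
      then show ?thesis by (simp add: Df contract_gen lie_gen K.zero_iff)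
    qed (simp add: contract_gen lie_gen linear_0[OF superderivation_linear[OF superderivation_lie]] K.zero_mem)
  qed
  then show ?thesis by (simp add: cong_mod_def)
qed

text \<open>Linearity in \<open>X\<close> holds only modulo \<open>K\<close>, because among
  representatives \<open>gen (Fn p)\<close> is a separate generator for every
  \<open>p\<close>.\<close>

lemma contract_expand:
  assumes X: "supported X"
  shows "\<iota> X p \<approx>\<^bsub>K\<^esub> (\<Sum>i\<in>Bs. \<Sum>j\<in>Bs. pscale (X i j) (\<iota> (mat_unit i j) p))"
proof -
  have "\<iota> X p - (\<Sum>i\<in>Bs. \<Sum>j\<in>Bs. pscale (X i j) (\<iota> (mat_unit i j) p)) \<in> K"
  proof (rule superderivation_mem_ideal[where E = "\<lambda>p. \<iota> X p - (\<Sum>i\<in>Bs. \<Sum>j\<in>Bs. pscale (X i j) (\<iota> (mat_unit i j) p))",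
        OF _ K.two_sided_ideal_axioms])
    show "superderivation kd_deg 1 (\<lambda>p. \<iota> X p - (\<Sum>i\<in>Bs. \<Sum>j\<in>Bs. pscale (X i j) (\<iota> (mat_unit i j) p)))"
      by (intro superderivation_diff superderivation_sum superderivation_pscale superderivation_contract)
    fix x :: "('k, 'a, 'v) coord_ring kd_gen"
    show "\<iota> X (gen x) - (\<Sum>i\<in>Bs. \<Sum>j\<in>Bs. pscale (X i j) (\<iota> (mat_unit i j) (gen x))) \<in> K"
    proof (cases x)
      case (Df p)
      have "gen (Fn (mat_vec Bs X p)) = gen (Fn (\<Sum>i\<in>Bs. \<Sum>j\<in>Bs. pscale (X i j) (mat_vec Bs (mat_unit i j) p)))"
        using X by (subst mat_vec_expand) (auto simp: V.finite_Basis)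
      also have "\<dots> \<approx>\<^bsub>K\<^esub> (\<Sum>i\<in>Bs. \<Sum>j\<in>Bs. gen (Fn (pscale (X i j) (mat_vec Bs (mat_unit i j) p))))"
        by (rule K.trans[OF K_Fn_sum]) (intro K.sum K_Fn_sum)
      also have "\<dots> \<approx>\<^bsub>K\<^esub> (\<Sum>i\<in>Bs. \<Sum>j\<in>Bs. pscale (X i j) (gen (Fn (mat_vec Bs (mat_unit i j) p))))"
        by (intro K.sum K_rel)
      finally show ?thesis by (simp add: Df contract_gen cong_mod_def)
    qed (simp add: contract_gen K.zero_mem)
  qed
  then show ?thesis by (simp add: cong_mod_def)
qed

lemma K_commute:
  assumes "p \<in> hom_part kd_deg m" "q \<in> hom_part kd_deg n"
  shows "p * q \<approx>\<^bsub>K\<^esub> (- 1) ^ (m * n) * (q * p)"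
proof -
  have gg: "gen x * gen y \<approx>\<^bsub>K\<^esub> (- 1) ^ (kd_deg x * kd_deg y) * (gen y * gen x)" for x y
    using K_Fn_Fn K_rel(8) K.sym[OF K_rel(8)] K_Df_Df by (cases x; cases y) auto
  have wg: "wmon w * gen y \<approx>\<^bsub>K\<^esub> (- 1) ^ (word_deg kd_deg w * kd_deg y) * (gen y * wmon w)" for w y
  proof (induction w)
    case (Cons x w)
    have "wmon (x # w) * gen y = gen x * (wmon w * gen y)" by (simp add: wmon_Cons mult.assoc)
    also have "\<dots> \<approx>\<^bsub>K\<^esub> gen x * ((- 1) ^ (word_deg kd_deg w * kd_deg y) * (gen y * wmon w))"
      by (rule K.mult_left[OF Cons])
    also have "\<dots> = (- 1) ^ (word_deg kd_deg w * kd_deg y) * ((gen x * gen y) * wmon w)"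
      by (simp add: sign_left_commute[of "gen x"] mult.assoc)
    also have "\<dots> \<approx>\<^bsub>K\<^esub> (- 1) ^ (word_deg kd_deg w * kd_deg y) * (((- 1) ^ (kd_deg x * kd_deg y) * (gen y * gen x)) * wmon w)"
      by (intro K.mult_left K.mult_right gg)
    also have "\<dots> = (- 1) ^ (word_deg kd_deg (x # w) * kd_deg y) * (gen y * wmon (x # w))"
      by (simp add: wmon_Cons mult.assoc sign_mult_sign distrib_right add.commute)
    finally show ?case .
  qed (simp add: wmon_Nil K.refl)
  have ww: "wmon u * wmon w \<approx>\<^bsub>K\<^esub> (- 1) ^ (word_deg kd_deg u * word_deg kd_deg w) * (wmon w * wmon u)" for u w
  proof (induction w)
    case (Cons x w)
    have "wmon u * wmon (x # w) = (wmon u * gen x) * wmon w" by (simp add: wmon_Cons mult.assoc)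
    also have "\<dots> \<approx>\<^bsub>K\<^esub> ((- 1) ^ (word_deg kd_deg u * kd_deg x) * (gen x * wmon u)) * wmon w"
      by (rule K.mult_right[OF wg])
    also have "\<dots> = (- 1) ^ (word_deg kd_deg u * kd_deg x) * (gen x * (wmon u * wmon w))"
      by (simp add: mult.assoc)
    also have "\<dots> \<approx>\<^bsub>K\<^esub> (- 1) ^ (word_deg kd_deg u * kd_deg x) * (gen x * ((- 1) ^ (word_deg kd_deg u * word_deg kd_deg w) * (wmon w * wmon u)))"
      by (intro K.mult_left Cons)
    also have "\<dots> = (- 1) ^ (word_deg kd_deg u * word_deg kd_deg (x # w)) * (wmon (x # w) * wmon u)"
      by (simp add: sign_left_commute[of "gen x"] wmon_Cons mult.assoc distrib_left power_add)
    finally show ?case .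
  qed (simp add: wmon_Nil K.refl)
  from assms(1) show ?thesis
  proof (induction p rule: hom_part_induct)
    case (wmon u)
    from assms(2) show ?case
    proof (induction q rule: hom_part_induct)
      case (wmon w)
      with ww[of u w] \<open>word_deg kd_deg u = m\<close> show ?case by simp
    next
      case (scale c q)
      from K_pscale[OF scale, of c] show ?case by (simp add: pscale_mult_left pscale_mult_right)
    next
      case (add q r)
      from K.add[OF add] show ?case by (simp add: distrib_left distrib_right)
    qed (simp add: K.refl)
  next
    case (scale c p)
    from K_pscale[OF scale, of c] show ?case by (simp add: pscale_mult_left pscale_mult_right)
  next
    case (add p r)
    from K.add[OF add] show ?case by (simp add: distrib_left distrib_right)
  qed (simp add: K.refl)
qed


subsection \<open>Basic forms\<close>

lemma supported_entry: "supported (entry sV Bs x)"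
  by (simp add: entry_def)

lemma is_endo_elem_endo: "is_endo sV (elem_endo sV Bs i j)"
proof -
  have "V.independent Bs" "V.span Bs = UNIV" using V.independent_Basis V.span_Basis by auto
  then show ?thesis
    unfolding is_endo_def linear_iff_additive elem_endo_def
    by (auto simp: V.vector_space_axioms V.representation_add V.representation_scale V.scale_left_distrib)
qed

lemma entry_elem_endo:
  assumes "i \<in> Bs" "j \<in> Bs"
  shows "entry sV Bs (elem_endo sV Bs i j) = mat_unit i j"
proof (intro ext)
  fix k l
  have ind: "V.independent Bs" using V.independent_Basis by auto
  show "entry sV Bs (elem_endo sV Bs i j) k l = mat_unit i j k l"
    using assms V.representation_scale[OF ind V.span_base[OF assms(1)], of "if l = j then 1 else 0"]
    by (auto simp: entry_def elem_endo_def mat_unit_def V.representation_basis[OF ind] V.representation_zero)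
qed

lemma rep_contract_elem_endo:
  "i \<in> Bs \<Longrightarrow> j \<in> Bs \<Longrightarrow> rep_contract sV Bs (elem_endo sV Bs i j) = \<iota> (mat_unit i j)"
  by (simp add: rep_contract_conv entry_elem_endo)

text \<open>The Lie derivative commutes with \<open>d_DR\<close>, and Cartan's formula turns the
  contraction of \<open>d_DR p\<close> into \<open>\<L> p - d_DR (\<iota> p)\<close>.\<close>

lemma basic_forms_d_DR: "p \<in> basic_forms s sV Bs n \<Longrightarrow> d_DR p \<in> basic_forms s sV Bs (Suc n)"
proof -
  assume p: "p \<in> basic_forms s sV Bs n"
  have "\<L> (entry sV Bs x) (d_DR p) \<in> K \<and> \<iota> (entry sV Bs x) (d_DR p) \<in> K" if x: "is_endo sV x" for x
  proof -
    have "\<L> (entry sV Bs x) p \<in> K" "\<iota> (entry sV Bs x) p \<in> K"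
      using p x by (auto simp: basic_forms_def rep_contract_conv rep_lie_conv)
    moreover have "\<iota> (entry sV Bs x) (d_DR p) = \<L> (entry sV Bs x) p - d_DR (\<iota> (entry sV Bs x) p)"
      by (simp flip: cartan)
    ultimately show ?thesis
      by (simp add: K.diff_mem d_DR_ideal flip: d_DR_lie)
  qed
  then show "d_DR p \<in> basic_forms s sV Bs (Suc n)"
    using p by (auto simp: basic_forms_def rep_contract_conv rep_lie_conv d_DR_hom_part)
qed

end


section \<open>The equivariant de Rham complex\<close>

lemma lookup_map: "f 0 = 0 \<Longrightarrow> Poly_Mapping.lookup (Poly_Mapping.map f p) m = f (Poly_Mapping.lookup p m)"
  by (transfer, auto simp: when_def)

lemma lookup_escale: "Poly_Mapping.lookup (escale c p) m = pscale c (Poly_Mapping.lookup p m)"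
  unfolding escale_def by (rule lookup_map) simp

lemma vector_space_escale: "vector_space (escale :: 'k::field \<Rightarrow> ('k, 'a, 'v) eq_forms \<Rightarrow> _)"
  by unfold_locales (auto intro!: poly_mapping_eqI simp: lookup_escale lookup_add pscale_add pscale.scale_left_distrib)

interpretation escale: vector_space "escale :: 'k::field \<Rightarrow> ('k, 'a, 'v) eq_forms \<Rightarrow> _"
  by (rule vector_space_escale)

lemma linear_escaleI:
  "(\<And>x y. f (x + y) = f x + f y) \<Longrightarrow> (\<And>c x. f (escale c x) = escale c (f x)) \<Longrightarrow> Vector_Spaces.linear escale escale f"
  by (simp add: linear_iff_additive vector_space_escale)

lemma escale_single: "escale c (Poly_Mapping.single m \<omega>) = Poly_Mapping.single m (pscale c \<omega>)"
  by (rule poly_mapping_eqI) (auto simp: lookup_escale lookup_single when_def)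

lemma escale_mult_left: "escale c p * q = escale c (p * q)"
  and escale_mult_right: "p * escale c q = escale c (p * q)"
proof -
  have "escale c (Poly_Mapping.single m \<omega>) * q = escale c (Poly_Mapping.single m \<omega> * q)" for m \<omega>
    by (induction q rule: poly_mapping_induct_single_add)
      (simp_all add: escale_single mult_single pscale_mult_left distrib_left escale.scale_right_distrib)
  then show "escale c p * q = escale c (p * q)"
    by (induction p rule: poly_mapping_induct_single_add)
      (simp_all add: distrib_right escale.scale_right_distrib)
  have "Poly_Mapping.single m \<omega> * escale c q = escale c (Poly_Mapping.single m \<omega> * q)" for m \<omega>
    by (induction q rule: poly_mapping_induct_single_add)
      (simp_all add: escale_single mult_single pscale_mult_right distrib_left escale.scale_right_distrib)
  then show "p * escale c q = escale c (p * q)"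
    by (induction p rule: poly_mapping_induct_single_add)
      (simp_all add: distrib_right escale.scale_right_distrib)
qed

lemma linear_econst: "Vector_Spaces.linear pscale escale econst"
  by (simp add: linear_iff_additive vector_space_escale vector_space_pscale econst_def single_add escale_single)

lemma econst_mult: "econst (p * q) = econst p * econst q"
  by (simp add: econst_def mult_single)

lemma econst_1: "econst 1 = 1"
  by (simp add: econst_def single_one)

lemma lookup_econst: "Poly_Mapping.lookup (econst \<omega>) m = (if m = 0 then \<omega> else 0)"
  by (simp add: econst_def lookup_single when_def)

lemma map_single: "f 0 = 0 \<Longrightarrow> Poly_Mapping.map f (Poly_Mapping.single m \<omega>) = Poly_Mapping.single m (f \<omega>)"
  by (rule poly_mapping_eqI) (auto simp: lookup_map lookup_single when_def)

lemma map_econst: "f 0 = 0 \<Longrightarrow> Poly_Mapping.map f (econst \<omega>) = econst (f \<omega>)"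
  by (simp add: econst_def map_single)

lemma linear_map:
  assumes "Vector_Spaces.linear pscale pscale f"
  shows "Vector_Spaces.linear escale escale (Poly_Mapping.map f)"
  by (rule linear_escaleI; rule poly_mapping_eqI)
    (simp_all add: lookup_map[where f = f, OF linear_0[OF assms]] lookup_add lookup_escale linear_add[OF assms] linear_scale[OF assms])

lemma pvar_commute: "pvar x * p = p * pvar x" for p :: "('x \<Rightarrow>\<^sub>0 nat) \<Rightarrow>\<^sub>0 'r::ring_1"
  unfolding pvar_def
  by (induction p rule: poly_mapping_induct_single_add) (simp_all add: mult_single distrib_left distrib_right add.commute)

text \<open>What is needed from polynomials in \<open>Y\<close> with coefficients in the ground field.\<close>

definition scalar_poly :: "('k::field, 'a, 'v) eq_forms \<Rightarrow> bool" where
  "scalar_poly r \<longleftrightarrow> (\<forall>q. r * q = q * r) \<and>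
     (\<forall>f :: ('k, 'a, 'v) rep_forms \<Rightarrow> ('k, 'a, 'v) rep_forms. Vector_Spaces.linear pscale pscale f \<longrightarrow>
       (\<forall>p. Poly_Mapping.map f (p * r) = Poly_Mapping.map f p * r))"

lemma scalar_poly_commute: "scalar_poly r \<Longrightarrow> r * q = q * r"
  by (simp add: scalar_poly_def)

lemma scalar_poly_map:
  "scalar_poly r \<Longrightarrow> Vector_Spaces.linear pscale pscale f \<Longrightarrow> Poly_Mapping.map f (p * r) = Poly_Mapping.map f p * r"
  by (simp add: scalar_poly_def)

lemma scalar_poly_pvar: "scalar_poly (pvar x :: ('k::field, 'a, 'v) eq_forms)"
  unfolding scalar_poly_def
proof (intro conjI allI impI)
  fix f :: "('k, 'a, 'v) rep_forms \<Rightarrow> ('k, 'a, 'v) rep_forms" and p assume f: "Vector_Spaces.linear pscale pscale f"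
  show "Poly_Mapping.map f (p * pvar x) = Poly_Mapping.map f p * pvar x"
    unfolding pvar_def
    by (induction p rule: poly_mapping_induct_single_add)
      (simp_all add: mult_single map_single[where f = f, OF linear_0[OF f]] distrib_right linear_add[OF linear_map[OF f]])
qed (rule pvar_commute)

lemma scalar_poly_diff: "scalar_poly r \<Longrightarrow> scalar_poly q \<Longrightarrow> scalar_poly (r - q)"
  unfolding scalar_poly_def
  by (auto simp: right_diff_distrib left_diff_distrib linear_diff[OF linear_map])

lemma scalar_poly_escale: "scalar_poly r \<Longrightarrow> scalar_poly (escale c r)"
  unfolding scalar_poly_def
  by (auto simp: escale_mult_left escale_mult_right linear_scale[OF linear_map])

lemma scalar_poly_sum: "(\<And>i. i \<in> S \<Longrightarrow> scalar_poly (f i)) \<Longrightarrow> scalar_poly (sum f S)"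
proof (induction S rule: infinite_finite_induct)
  case (insert x F)
  then show ?case
    unfolding scalar_poly_def by (auto simp: distrib_left distrib_right linear_add[OF linear_map])
qed (auto simp: scalar_poly_def linear_0[OF linear_map])

definition eq_parity :: "nat \<Rightarrow> ('k::field, 'a, 'v) eq_forms set" where
  "eq_parity n = {p. \<forall>m. Poly_Mapping.lookup p m \<in> parity_part kd_deg n}"

lemma single_sign: "(- 1) ^ n * Poly_Mapping.single m \<omega> = Poly_Mapping.single m ((- 1) ^ n * \<omega>)"
  for \<omega> :: "'r::ring_1" and m :: "'m::monoid_add"
  by (cases "even n") (simp_all add: single_uminus)

lemma map_superderivation:
  assumes f: "superderivation kd_deg e f" and p: "p \<in> eq_parity n"
  shows "Poly_Mapping.map f (p * q) = Poly_Mapping.map f p * q + (- 1) ^ (e * n) * (p * Poly_Mapping.map f q)"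
proof -
  note lin = superderivation_linear[OF f] and lin' = linear_map[OF superderivation_linear[OF f]]
  have s: "Poly_Mapping.map f (Poly_Mapping.single m \<omega> * q) = Poly_Mapping.map f (Poly_Mapping.single m \<omega>) * q +
      (- 1) ^ (e * n) * (Poly_Mapping.single m \<omega> * Poly_Mapping.map f q)"
    if \<omega>: "\<omega> \<in> parity_part kd_deg n" for m \<omega>
  proof (induction q rule: poly_mapping_induct_single_add)
    case (1 m' \<omega>')
    show ?case
      by (simp add: mult_single map_single[where f = f, OF linear_0[OF lin]] superderivation_mult[OF f \<omega>] single_add single_sign)
  next
    case (2 q r)
    then show ?case by (simp add: distrib_left linear_add[OF lin'])
  qed
  show ?thesis
    using p by (intro keys_induct[of p "\<lambda>p. Poly_Mapping.map f (p * q) = Poly_Mapping.map f p * q + (- 1) ^ (e * n) * (p * Poly_Mapping.map f q)"])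
      (auto simp: eq_parity_def s linear_0[OF lin'] linear_add[OF lin'] distrib_left distrib_right)
qed

abbreviation bracket_Y :: "'v set \<Rightarrow> ('v \<Rightarrow> 'v \<Rightarrow> 'k::field) \<Rightarrow> 'v \<Rightarrow> 'v \<Rightarrow> ('k, 'a, 'v) eq_forms" where
  "bracket_Y Bs X \<equiv> mat_bracket Bs escale X (\<lambda>k l. pvar (k, l))"

lemma scalar_poly_bracket_Y: "scalar_poly (bracket_Y Bs X i j)"
  unfolding mat_bracket_def
  by (intro scalar_poly_sum scalar_poly_diff scalar_poly_escale scalar_poly_pvar)

definition Y_vec :: "'v set \<Rightarrow> ('v \<Rightarrow> 'v \<Rightarrow> 'k) \<Rightarrow> ('k::field, 'a, 'v) eq_forms \<Rightarrow> ('k, 'a, 'v) eq_forms" where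
  "Y_vec Bs X = poly_der (\<lambda>(i, j). bracket_Y Bs X i j)"

lemma Y_vec_mult: "Y_vec Bs X (p * q) = Y_vec Bs X p * q + p * Y_vec Bs X q"
  unfolding Y_vec_def by (rule poly_der_mult) (auto simp: scalar_poly_commute[OF scalar_poly_bracket_Y])

lemma Y_vec_pvar: "Y_vec Bs X (pvar (i, j)) = bracket_Y Bs X i j"
  by (simp add: Y_vec_def poly_der_pvar)

lemma Y_vec_econst: "Y_vec Bs X (econst \<omega>) = 0"
  by (simp add: Y_vec_def econst_def poly_der_const)

lemma escale_conv_econst: "escale c p = econst (Poly_Mapping.single 0 c) * p"
  by (induction p rule: poly_mapping_induct_single_add)
    (simp_all add: escale_single econst_def mult_single distrib_left escale.scale_right_distrib pscale_conv_mult)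

lemma linear_Y_vec: "Vector_Spaces.linear escale escale (Y_vec Bs X)"
  by (rule linear_escaleI) (simp_all add: escale_conv_econst Y_vec_mult Y_vec_econst, simp add: Y_vec_def poly_der_add)

text \<open>The map \<open>f\<close> acts on the coefficients and the derivation on the coordinates
  of \<open>g\<close>. They commute because the values \<open>bracket_Y\<close> have scalar
  coefficients, past which a linear \<open>f\<close> can be moved.\<close>

lemma Y_vec_map:
  fixes f :: "('k::field, 'a, 'v) rep_forms \<Rightarrow> ('k, 'a, 'v) rep_forms"
  assumes f: "Vector_Spaces.linear pscale pscale f"
  shows "Y_vec Bs X (Poly_Mapping.map f p) = Poly_Mapping.map f (Y_vec Bs X p)"
proof (induction p rule: poly_mapping_induct_single_add)
  case (1 m \<omega>)
  have "f (of_nat n * \<omega>) = of_nat n * f \<omega>" for n \<omega>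
    by (induction n) (simp_all add: linear_0[OF f] linear_add[OF f] distrib_right)
  moreover have "scalar_poly ((case x of (i, j) \<Rightarrow> bracket_Y Bs X i j) :: ('k, 'a, 'v) eq_forms)" for x
    by (cases x) (simp add: scalar_poly_bracket_Y)
  ultimately show ?case
    unfolding Y_vec_def map_single[where f = f, OF linear_0[OF f]] poly_der_single[OF finite_keys subset_refl]
    by (simp add: linear_sum[OF linear_map[OF f]] scalar_poly_map[OF _ f] map_single[where f = f, OF linear_0[OF f]] del: of_nat_mult)
next
  case (2 p q)
  then show ?case by (simp add: linear_add[OF linear_map[OF f]] linear_add[OF linear_Y_vec])
qed

definition mat_lie :: "'v set \<Rightarrow> ('v \<Rightarrow> 'v \<Rightarrow> 'k) \<Rightarrow> ('k::field, 'a, 'v) eq_forms \<Rightarrow> ('k, 'a, 'v) eq_forms" where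
  "mat_lie Bs X p = Poly_Mapping.map (kd_lie (mat_vec Bs X)) p + Y_vec Bs X p"

lemma eq_lie_conv: "eq_lie sV Bs x = mat_lie Bs (entry sV Bs x)"
  by (intro ext) (simp add: eq_lie_def mat_lie_def rep_lie_conv Y_vec_def bracket_conv_mat_bracket)

lemma linear_mat_lie: "Vector_Spaces.linear escale escale (mat_lie Bs X)"
  unfolding mat_lie_def
  by (rule linear_escaleI) (simp_all add: linear_add[OF linear_Y_vec] linear_scale[OF linear_Y_vec]
      linear_add[OF linear_map[OF superderivation_linear[OF superderivation_lie]]]
      linear_scale[OF linear_map[OF superderivation_linear[OF superderivation_lie]]] escale.scale_right_distrib)

lemma mat_lie_mult: "p \<in> eq_parity n \<Longrightarrow> mat_lie Bs X (p * q) = mat_lie Bs X p * q + p * mat_lie Bs X q"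
  by (simp add: mat_lie_def map_superderivation[OF superderivation_lie] Y_vec_mult algebra_simps)

abbreviation mon_deg :: "('x \<Rightarrow>\<^sub>0 nat) \<Rightarrow> nat" where
  "mon_deg m \<equiv> \<Sum>v\<in>Poly_Mapping.keys m. Poly_Mapping.lookup m v"

lemma mon_deg_add: "mon_deg (m + n) = mon_deg m + mon_deg n"
proof -
  have *: "mon_deg m = sum (Poly_Mapping.lookup m) K" if "finite K" "Poly_Mapping.keys m \<subseteq> K" for m :: "'a \<Rightarrow>\<^sub>0 nat" and K
    using that by (intro sum.mono_neutral_left) (auto simp: in_keys_iff)
  let ?K = "Poly_Mapping.keys m \<union> Poly_Mapping.keys n"
  show ?thesis
    using *[of ?K "m + n"] *[of ?K m] *[of ?K n] Poly_Mapping.keys_add[of m n]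
    by (simp add: lookup_add sum.distrib)
qed

text \<open>Monomials with coefficient 0 satisfy the condition vacuously, so the keys of
  \<open>p\<close> need not be mentioned.\<close>

lemma eq_part_iff:
  "p \<in> eq_part Bs n \<longleftrightarrow> (\<forall>m. \<forall>w\<in>Poly_Mapping.keys (Poly_Mapping.lookup p m).
     Poly_Mapping.keys m \<subseteq> Bs \<times> Bs \<and> word_deg kd_deg (letters w) + 2 * mon_deg m = n)"
proof -
  have "m \<in> Poly_Mapping.keys p \<longleftrightarrow> (\<exists>w. w \<in> Poly_Mapping.keys (Poly_Mapping.lookup p m))" for m
    by (auto simp: in_keys_iff poly_mapping_eq_iff fun_eq_iff)
  then show ?thesis unfolding eq_part_def by blast
qed

lemma eq_part_0: "0 \<in> eq_part Bs n"
  by (simp add: eq_part_iff)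

lemma eq_part_single:
  "Poly_Mapping.keys m \<subseteq> Bs \<times> Bs \<Longrightarrow> \<omega> \<in> hom_part kd_deg k \<Longrightarrow> k + 2 * mon_deg m = n \<Longrightarrow>
    Poly_Mapping.single m \<omega> \<in> eq_part Bs n"
  by (auto simp: eq_part_def hom_part_def)

lemma eq_part_add: "p \<in> eq_part Bs n \<Longrightarrow> q \<in> eq_part Bs n \<Longrightarrow> p + q \<in> eq_part Bs n"
  unfolding eq_part_iff lookup_add by (meson Poly_Mapping.keys_add UnE subsetD)

lemma eq_part_induct [consumes 1, case_names single zero add]:
  fixes p :: "('k::field, 'a, 'v) eq_forms"
  assumes p: "p \<in> eq_part Bs n"
    and single: "\<And>m \<omega> k. Poly_Mapping.keys m \<subseteq> Bs \<times> Bs \<Longrightarrow> \<omega> \<in> hom_part kd_deg k \<Longrightarrow> k + 2 * mon_deg m = n \<Longrightarrow>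
        P (Poly_Mapping.single m \<omega>)"
    and "P 0" and "\<And>p q. P p \<Longrightarrow> P q \<Longrightarrow> P (p + q)"
  shows "P p"
proof (rule keys_induct[of p P])
  fix m assume "m \<in> Poly_Mapping.keys p"
  then obtain w where w: "w \<in> Poly_Mapping.keys (Poly_Mapping.lookup p m)"
    by (auto simp: in_keys_iff poly_mapping_eq_iff fun_eq_iff)
  have *: "Poly_Mapping.keys m \<subseteq> Bs \<times> Bs \<and> word_deg kd_deg (letters w) + 2 * mon_deg m = n"
    if "w \<in> Poly_Mapping.keys (Poly_Mapping.lookup p m)" for w
    using p that unfolding eq_part_iff by blast
  have "Poly_Mapping.lookup p m \<in> hom_part kd_deg (word_deg kd_deg (letters w))"
    unfolding hom_part_def mem_Collect_eq using conjunct2[OF *] w by (metis add_right_cancel)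
  then show "P (Poly_Mapping.single m (Poly_Mapping.lookup p m))"
    using *[OF w] by (intro single[of m _ "word_deg kd_deg (letters w)"]) auto
qed (use assms in auto)

lemma eq_part_sum: "(\<And>i. i \<in> S \<Longrightarrow> f i \<in> eq_part Bs n) \<Longrightarrow> sum f S \<in> eq_part Bs n"
  by (induction S rule: infinite_finite_induct) (auto intro: eq_part_0 eq_part_add)

lemma eq_part_mult:
  assumes "p \<in> eq_part Bs m" "q \<in> eq_part Bs n"
  shows "p * q \<in> eq_part Bs (m + n)"
  using assms(1)
proof (induction p rule: eq_part_induct)
  case (single l \<omega> k)
  note s = this
  from assms(2) show ?case
  proof (induction q rule: eq_part_induct)
    case (single l' \<omega>' k')
    then show ?case
      using s Poly_Mapping.keys_add[of l l'] unfolding mult_single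
      by (intro eq_part_single[of _ _ _ "k + k'"] hom_part_mult) (auto simp: mon_deg_add)
  qed (simp_all add: distrib_left eq_part_0 eq_part_add)
qed (simp_all add: distrib_right eq_part_0 eq_part_add)

lemma eq_part_econst: "\<omega> \<in> hom_part kd_deg n \<Longrightarrow> econst \<omega> \<in> eq_part Bs n"
  unfolding econst_def by (rule eq_part_single[of _ _ _ n]) auto

lemma eq_part_pvar: "i \<in> Bs \<Longrightarrow> j \<in> Bs \<Longrightarrow> pvar (i, j) \<in> eq_part Bs 2"
  unfolding pvar_def by (rule eq_part_single[of _ _ _ 0]) (auto simp: hom_part_1)

lemma eq_part_escale: "p \<in> eq_part Bs n \<Longrightarrow> escale c p \<in> eq_part Bs n"
  using eq_part_mult[OF eq_part_econst, of "Poly_Mapping.single 0 c" 0 p Bs n]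
  by (simp add: escale_conv_econst hom_part_def zero_word_def split: if_splits)

lemma eq_part_diff: "p \<in> eq_part Bs n \<Longrightarrow> q \<in> eq_part Bs n \<Longrightarrow> p - q \<in> eq_part Bs n"
  using eq_part_add[OF _ eq_part_escale, of p Bs n q "- 1"] by simp

lemma eq_part_map:
  assumes f: "Vector_Spaces.linear pscale pscale f" "\<And>k p. p \<in> hom_part kd_deg k \<Longrightarrow> f p \<in> hom_part kd_deg (k + e)"
    and p: "p \<in> eq_part Bs n"
  shows "Poly_Mapping.map f p \<in> eq_part Bs (n + e)"
  using p
proof (induction p rule: eq_part_induct)
  case (single m \<omega> k)
  then show ?case
    unfolding map_single[where f = f, OF linear_0[OF f(1)]] by (intro eq_part_single[of _ _ _ "k + e"] f) auto
qed (simp_all add: linear_0[OF linear_map[OF f(1)]] linear_add[OF linear_map[OF f(1)]] eq_part_0 eq_part_add)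

text \<open>Coordinates of \<open>g\<close> have degree 2, hence the parity is that of the form
  alone.\<close>

lemma eq_part_parity: "p \<in> eq_part Bs n \<Longrightarrow> p \<in> eq_parity n"
proof (induction p rule: eq_part_induct)
  case (single m \<omega> k)
  then have "\<omega> \<in> parity_part kd_deg n"
    using parity_part_even[of k n kd_deg] hom_part_parity by fastforce
  then show ?case by (auto simp: eq_parity_def lookup_single when_def parity_part_0)
qed (auto simp: eq_parity_def lookup_add parity_part_0 parity_part_add)

lemma sum_swap_pairs:
  fixes f :: "'i \<Rightarrow> 'i \<Rightarrow> 'i \<Rightarrow> 'i \<Rightarrow> 'b::comm_monoid_add"
  shows "(\<Sum>i\<in>A. \<Sum>j\<in>A. \<Sum>k\<in>A. \<Sum>l\<in>A. f i j k l) = (\<Sum>k\<in>A. \<Sum>l\<in>A. \<Sum>i\<in>A. \<Sum>j\<in>A. f i j k l)"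
proof -
  have *: "(\<Sum>i\<in>A. \<Sum>j\<in>A. g i j) = (\<Sum>p\<in>A \<times> A. g (fst p) (snd p))" for g :: "'i \<Rightarrow> 'i \<Rightarrow> 'b"
    by (simp add: sum.cartesian_product case_prod_unfold)
  show ?thesis unfolding * by (rule sum.swap)
qed

context rep_setting
begin

abbreviation EZ where "EZ \<equiv> eq_zero s Bs"

lemma EZ_econst: "econst \<omega> \<in> EZ \<longleftrightarrow> \<omega> \<in> K"
  by (auto simp: eq_zero_def lookup_econst K.zero_mem)

lemma EZ_single: "\<omega> \<in> K \<Longrightarrow> Poly_Mapping.single m \<omega> \<in> EZ"
  by (simp add: eq_zero_def lookup_single when_def K.zero_mem)

lemma EZ_add: "p \<in> EZ \<Longrightarrow> q \<in> EZ \<Longrightarrow> p + q \<in> EZ"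
  by (simp add: eq_zero_def lookup_add K.add_mem)

lemma EZ_0: "0 \<in> EZ"
  by (simp add: eq_zero_def K.zero_mem)

lemma EZ_induct [consumes 1, case_names single zero add]:
  assumes "p \<in> EZ" and "\<And>m \<omega>. \<omega> \<in> K \<Longrightarrow> P (Poly_Mapping.single m \<omega>)"
    and "P 0" and "\<And>p q. P p \<Longrightarrow> P q \<Longrightarrow> P (p + q)"
  shows "P p"
  using assms by (intro keys_induct[of p P]) (auto simp: eq_zero_def)

sublocale EZ: two_sided_ideal EZ
proof
  have l: "u * p \<in> EZ" if "p \<in> EZ" for u p
    using that
  proof (induction p rule: EZ_induct)
    case (single m \<omega>)
    then show ?case
      by (induction u rule: poly_mapping_induct_single_add)
        (auto simp: mult_single distrib_right intro: EZ_single EZ_add K.mult_left_mem)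
  qed (auto simp: distrib_left EZ_0 EZ_add)
  have r: "p * u \<in> EZ" if "p \<in> EZ" for u p
    using that
  proof (induction p rule: EZ_induct)
    case (single m \<omega>)
    then show ?case
      by (induction u rule: poly_mapping_induct_single_add)
        (auto simp: mult_single distrib_left intro: EZ_single EZ_add K.mult_right_mem)
  qed (auto simp: distrib_right EZ_0 EZ_add)
  show "is_ideal EZ" unfolding is_ideal_def by (auto intro: EZ_0 EZ_add l r)
qed

lemma EZ_escale: "p \<in> EZ \<Longrightarrow> escale c p \<in> EZ"
  by (simp add: escale_conv_econst EZ.mult_left_mem)

lemma EZ_cong_escale: "p \<approx>\<^bsub>EZ\<^esub> q \<Longrightarrow> escale c p \<approx>\<^bsub>EZ\<^esub> escale c q"
  unfolding cong_mod_def escale.scale_right_diff_distrib[symmetric] by (rule EZ_escale)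

lemma EZ_cong_econst: "\<omega> \<approx>\<^bsub>K\<^esub> \<omega>' \<Longrightarrow> econst \<omega> \<approx>\<^bsub>EZ\<^esub> econst \<omega>'"
  by (simp add: cong_mod_def EZ_econst flip: linear_diff[OF linear_econst])

lemma EZ_map: "f 0 = 0 \<Longrightarrow> (\<And>\<omega>. \<omega> \<in> K \<Longrightarrow> f \<omega> \<in> K) \<Longrightarrow> p \<in> EZ \<Longrightarrow> Poly_Mapping.map f p \<in> EZ"
  by (simp add: eq_zero_def lookup_map[where f = f])

lemma EZ_Y_vec: "p \<in> EZ \<Longrightarrow> Y_vec Bs X p \<in> EZ"
proof (induction p rule: EZ_induct)
  case (single m \<omega>)
  have "Poly_Mapping.single m \<omega> = econst \<omega> * Poly_Mapping.single m 1"
    by (simp add: econst_def mult_single)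
  then show ?case
    using single by (simp add: Y_vec_mult Y_vec_econst EZ.mult_right_mem EZ_econst)
qed (simp_all add: linear_0[OF linear_Y_vec] linear_add[OF linear_Y_vec] EZ_0 EZ_add)

lemma EZ_mat_lie: "supported X \<Longrightarrow> p \<in> EZ \<Longrightarrow> mat_lie Bs X p \<in> EZ"
  unfolding mat_lie_def
  by (intro EZ.add_mem EZ_Y_vec EZ_map lie_K linear_0[OF superderivation_linear[OF superderivation_lie]])

abbreviation \<delta> :: "('k, 'a, 'v) eq_forms \<Rightarrow> ('k, 'a, 'v) eq_forms" where "\<delta> \<equiv> d_g sV Bs"

abbreviation \<iota>\<iota> :: "'v \<Rightarrow> 'v \<Rightarrow> ('k, 'a, 'v) eq_forms \<Rightarrow> ('k, 'a, 'v) eq_forms" where "\<iota>\<iota> i j \<equiv> Poly_Mapping.map (\<iota> (mat_unit i j))"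

abbreviation map_d :: "('k, 'a, 'v) eq_forms \<Rightarrow> ('k, 'a, 'v) eq_forms" where "map_d \<equiv> Poly_Mapping.map d_DR"

lemmas linear_contract = superderivation_linear[OF superderivation_contract]
lemmas linear_lie = superderivation_linear[OF superderivation_lie]
lemmas linear_d_DR = superderivation_linear[OF superderivation_d_DR]

lemma d_g_conv: "\<delta> p = (\<Sum>i\<in>Bs. \<Sum>j\<in>Bs. \<iota>\<iota> i j p * pvar (i, j))"
  unfolding d_g_def by (intro sum.cong refl) (simp add: rep_contract_elem_endo)

lemma linear_d_g: "Vector_Spaces.linear escale escale \<delta>"
  unfolding d_g_conv
  by (rule linear_escaleI) (simp_all add: linear_add[OF linear_map[OF linear_contract]] linear_scale[OF linear_map[OF linear_contract]]
      distrib_right sum.distrib escale_mult_left escale.scale_sum_right)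

lemma EZ_d_g: "p \<in> EZ \<Longrightarrow> \<delta> p \<in> EZ"
  unfolding d_g_conv
  by (intro EZ.sum_mem EZ.mult_right_mem EZ_map contract_K linear_0[OF linear_contract]) (auto simp: mat_unit_def)

lemma EZ_map_d: "p \<in> EZ \<Longrightarrow> map_d p \<in> EZ"
  by (intro EZ_map d_DR_ideal linear_0[OF linear_d_DR])

lemma d_g_mult: "p \<in> eq_parity n \<Longrightarrow> \<delta> (p * q) = \<delta> p * q + (- 1) ^ n * (p * \<delta> q)"
proof -
  assume p: "p \<in> eq_parity n"
  have "\<iota>\<iota> i j (p * q) * pvar (i, j) = \<iota>\<iota> i j p * pvar (i, j) * q + (- 1) ^ n * (p * (\<iota>\<iota> i j q * pvar (i, j)))" for i j
    by (simp add: map_superderivation[OF superderivation_contract p] distrib_right mult.assoc pvar_commute)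
  then show ?thesis
    by (simp add: d_g_conv sum.distrib sum_distrib_left sum_distrib_right)
qed

lemma map_d_mult: "p \<in> eq_parity n \<Longrightarrow> map_d (p * q) = map_d p * q + (- 1) ^ n * (p * map_d q)"
  by (simp add: map_superderivation[OF superderivation_d_DR])

lemma eq_part_map_d: "p \<in> eq_part Bs n \<Longrightarrow> map_d p \<in> eq_part Bs (Suc n)"
  using eq_part_map[OF linear_d_DR, of 1 p Bs n] by (simp add: d_DR_hom_part)

lemma eq_part_d_g: "p \<in> eq_part Bs n \<Longrightarrow> \<delta> p \<in> eq_part Bs (Suc n)"
proof (induction p rule: eq_part_induct)
  case (single m \<omega> k)
  show ?case
  proof (cases k)
    case 0
    with single show ?thesis
      by (simp add: d_g_conv map_single[where f = "\<iota> _", OF linear_0[OF linear_contract]] contract_hom_part_0 eq_part_0)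
  next
    case (Suc k')
    have "Poly_Mapping.single m (\<iota> (mat_unit i j) \<omega>) \<in> eq_part Bs (k' + 2 * mon_deg m)" for i j
      using single Suc by (intro eq_part_single[of _ _ _ k'] contract_hom_part) auto
    then have "Poly_Mapping.single m (\<iota> (mat_unit i j) \<omega>) * pvar (i, j) \<in> eq_part Bs (k' + 2 * mon_deg m + 2)"
      if "i \<in> Bs" "j \<in> Bs" for i j
      using that by (intro eq_part_mult eq_part_pvar)
    moreover have "k' + 2 * mon_deg m + 2 = Suc n" using single Suc by simp
    ultimately show ?thesis
      by (simp add: d_g_conv map_single[where f = "\<iota> _", OF linear_0[OF linear_contract]] eq_part_sum)
  qed
qed (simp_all add: linear_0[OF linear_d_g] linear_add[OF linear_d_g] eq_part_0 eq_part_add)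

text \<open>Contractions anticommute while the coordinates commute, so exchanging the two index
  pairs shows that \<open>\<delta> (\<delta> p)\<close> equals its own negative.\<close>

lemma d_g_d_g: "\<delta> (\<delta> p) = 0"
proof -
  \<comment> \<open>Characteristic 0 enters here: a coefficient with \<open>2 * c = 0\<close> is
    zero.\<close>
  have z: "x = 0" if "x + x = 0" for x :: "('k, 'a, 'v) eq_forms"
  proof (rule poly_mapping_eqI, rule poly_mapping_eqI)
    fix m w
    have "2 * Poly_Mapping.lookup (Poly_Mapping.lookup x m) w = Poly_Mapping.lookup (Poly_Mapping.lookup (x + x) m) w"
      by (simp only: lookup_add mult_2)
    then show "Poly_Mapping.lookup (Poly_Mapping.lookup x m) w = Poly_Mapping.lookup (Poly_Mapping.lookup 0 m) w"
      using that by simp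
  qed
  let ?T = "\<lambda>i j k l. \<iota>\<iota> i j (\<iota>\<iota> k l p) * (pvar (k, l) * pvar (i, j))"
  have S: "\<delta> (\<delta> p) = (\<Sum>i\<in>Bs. \<Sum>j\<in>Bs. \<Sum>k\<in>Bs. \<Sum>l\<in>Bs. ?T i j k l)"
    by (simp add: d_g_conv linear_sum[OF linear_map[OF linear_contract]] scalar_poly_map[OF scalar_poly_pvar linear_contract]
        sum_distrib_right mult.assoc)
  have T: "?T i j k l = - ?T k l i j" for i j k l
  proof -
    have "\<iota>\<iota> i j (\<iota>\<iota> k l p) + \<iota>\<iota> k l (\<iota>\<iota> i j p) = 0"
      by (rule poly_mapping_eqI)
        (simp add: lookup_add lookup_map[where f = "\<iota> _", OF linear_0[OF linear_contract]] contract_contract)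
    then have *: "\<iota>\<iota> i j (\<iota>\<iota> k l p) = - \<iota>\<iota> k l (\<iota>\<iota> i j p)" by (rule iffD2[OF eq_neg_iff_add_eq_0])
    show ?thesis unfolding * mult_minus_left pvar_commute[of "(k, l)" "pvar (i, j)"] ..
  qed
  have "\<delta> (\<delta> p) = (\<Sum>k\<in>Bs. \<Sum>l\<in>Bs. \<Sum>i\<in>Bs. \<Sum>j\<in>Bs. ?T i j k l)"
    unfolding S by (rule sum_swap_pairs)
  also have "\<dots> = (\<Sum>k\<in>Bs. \<Sum>l\<in>Bs. \<Sum>i\<in>Bs. \<Sum>j\<in>Bs. - ?T k l i j)"
    by (intro sum.cong refl T)
  also have "\<dots> = - \<delta> (\<delta> p)"
    unfolding S by (simp only: sum_negf)
  finally have "\<delta> (\<delta> p) = - \<delta> (\<delta> p)" .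
  then show ?thesis by (rule z[OF iffD1[OF eq_neg_iff_add_eq_0]])
qed

lemma map_d_map_d: "map_d (map_d p) = 0"
  by (rule poly_mapping_eqI) (simp add: lookup_map[where f = d_DR, OF linear_0[OF linear_d_DR]] d_DR_d_DR)

text \<open>Cartan's formula multiplied by the coordinates and summed: the right-hand side is the
  action of the generic matrix on the form part only.\<close>

lemma map_d_d_g: "map_d (\<delta> p) + \<delta> (map_d p) =
    (\<Sum>i\<in>Bs. \<Sum>j\<in>Bs. Poly_Mapping.map (\<L> (mat_unit i j)) p * pvar (i, j))"
proof -
  have "map_d (\<iota>\<iota> i j p) + \<iota>\<iota> i j (map_d p) = Poly_Mapping.map (\<L> (mat_unit i j)) p" for i j
    by (rule poly_mapping_eqI)
      (simp add: lookup_add lookup_map[where f = "\<iota> _", OF linear_0[OF linear_contract]]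
        lookup_map[where f = "\<L> _", OF linear_0[OF linear_lie]]
        lookup_map[where f = d_DR, OF linear_0[OF linear_d_DR]] cartan)
  then show ?thesis
    by (simp add: d_g_conv linear_sum[OF linear_map[OF linear_d_DR]] scalar_poly_map[OF scalar_poly_pvar linear_d_DR]
        flip: sum.distrib distrib_right)
qed

text \<open>\<open>\<Sum> y\<^sub>i\<^sub>j e\<^sub>i\<^sub>j\<close> is the generic matrix \<open>Y\<close> itself.\<close>

lemma mat_unit_bracket_sum:
  fixes M :: "'v \<Rightarrow> 'v \<Rightarrow> ('k, 'a, 'v) eq_forms"
  assumes kl: "k \<in> Bs" "l \<in> Bs"
  shows "(\<Sum>i\<in>Bs. \<Sum>j\<in>Bs. mat_bracket Bs escale (mat_unit i j) M k l * pvar (i, j)) =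
    (\<Sum>j\<in>Bs. pvar (k, j) * M j l) - (\<Sum>i\<in>Bs. M k i * pvar (i, l))"
proof -
  have fin: "finite Bs" by (rule V.finite_Basis)
  have "mat_bracket Bs escale (mat_unit i j) M k l = (if k = i then M j l else 0) - (if l = j then M k i else 0)"
    if "i \<in> Bs" "j \<in> Bs" for i j
  proof -
    have "(\<Sum>r\<in>Bs. escale (mat_unit i j k r) (M r l)) = (\<Sum>r\<in>Bs. if r = j then if k = i then M j l else 0 else 0)"
      "(\<Sum>r\<in>Bs. escale (mat_unit i j r l) (M k r)) = (\<Sum>r\<in>Bs. if r = i then if l = j then M k i else 0 else 0)"
      by (intro sum.cong; auto simp: mat_unit_def)+
    then show ?thesis using that fin by (simp add: mat_bracket_def sum_subtractf)
  qed
  then have "(\<Sum>i\<in>Bs. \<Sum>j\<in>Bs. mat_bracket Bs escale (mat_unit i j) M k l * pvar (i, j)) =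
     (\<Sum>i\<in>Bs. \<Sum>j\<in>Bs. (if k = i then M j l * pvar (i, j) else 0) - (if l = j then M k i * pvar (i, j) else 0))"
    by (intro sum.cong refl) (simp add: left_diff_distrib)
  also have "\<dots> = (\<Sum>j\<in>Bs. M j l * pvar (k, j)) - (\<Sum>i\<in>Bs. M k i * pvar (i, l))"
  proof -
    have "(\<Sum>i\<in>Bs. \<Sum>j\<in>Bs. if k = i then M j l * pvar (i, j) else 0) = (\<Sum>j\<in>Bs. M j l * pvar (k, j))"
      using fin kl by (subst sum.swap) (simp add: sum.delta')
    moreover have "(\<Sum>i\<in>Bs. \<Sum>j\<in>Bs. if l = j then M k i * pvar (i, j) else 0) = (\<Sum>i\<in>Bs. M k i * pvar (i, l))"
      using fin kl by (simp add: sum.delta')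
    ultimately show ?thesis by (simp add: sum_subtractf)
  qed
  finally show ?thesis by (simp add: pvar_commute)
qed

text \<open>Homogeneity serves to ensure that only coordinates with indices in \<open>Bs\<close>
  occur in \<open>p\<close>; for these the sum over \<open>Bs\<close> computes an entry of the
  commutator of \<open>Y\<close> with itself.\<close>

lemma Y_vec_generic:
  fixes p :: "('k, 'a, 'v) eq_forms"
  assumes p: "p \<in> eq_part Bs n"
  shows "(\<Sum>i\<in>Bs. \<Sum>j\<in>Bs. Y_vec Bs (mat_unit i j) p * pvar (i, j)) = 0"
proof -
  have 0: "(\<Sum>i\<in>Bs. \<Sum>j\<in>Bs. bracket_Y Bs (mat_unit i j) k l * pvar (i, j)) = (0 :: ('k, 'a, 'v) eq_forms)"
    if "k \<in> Bs" "l \<in> Bs" for k l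
    by (simp add: mat_unit_bracket_sum[OF that])
  have "(\<Sum>i\<in>Bs. \<Sum>j\<in>Bs. Y_vec Bs (mat_unit i j) p * pvar (i, j)) =
      poly_der (\<lambda>x. \<Sum>i\<in>Bs. \<Sum>j\<in>Bs. (case x of (k, l) \<Rightarrow> bracket_Y Bs (mat_unit i j) k l) * pvar (i, j)) p"
    by (simp add: poly_der_values Y_vec_def)
  also have "\<dots> = poly_der (\<lambda>x. 0) p"
  proof (rule poly_der_cong)
    fix m x assume "m \<in> Poly_Mapping.keys p" "x \<in> Poly_Mapping.keys m"
    then have "x \<in> Bs \<times> Bs" using p unfolding eq_part_def by blast
    then obtain k l where "x = (k, l)" "k \<in> Bs" "l \<in> Bs" by blast
    with 0 show "(\<Sum>i\<in>Bs. \<Sum>j\<in>Bs. (case x of (k, l) \<Rightarrow> bracket_Y Bs (mat_unit i j) k l) * pvar (i, j)) = (0 :: ('k, 'a, 'v) eq_forms)" by simp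
  qed
  finally show ?thesis by (simp add: poly_der_values)
qed

lemma mat_lie_map_d:
  fixes X :: "'v \<Rightarrow> 'v \<Rightarrow> 'k"
  shows "mat_lie Bs X (map_d p) = map_d (mat_lie Bs X p)"
proof -
  have "Poly_Mapping.map (\<L> X) (map_d p) = map_d (Poly_Mapping.map (\<L> X) p)"
    by (rule poly_mapping_eqI)
      (simp add: lookup_map[where f = "\<L> _", OF linear_0[OF linear_lie]]
        lookup_map[where f = d_DR, OF linear_0[OF linear_d_DR]] d_DR_lie)
  then show ?thesis
    by (simp add: mat_lie_def Y_vec_map[OF linear_d_DR] linear_add[OF linear_map[OF linear_d_DR]])
qed

lemma supported_bracket: "supported X \<Longrightarrow> supported Y \<Longrightarrow> supported (mat_bracket Bs (*) X Y)"
  unfolding mat_bracket_def by (auto intro!: sum.neutral)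

text \<open>\<open>d_g\<close> contracts with the canonical element \<open>\<Sum> e_ij y_ij\<close>,
  where \<open>e_ij\<close> are the matrix units and \<open>y_ij\<close> the coordinates. This
  element is invariant: the change of the contraction, governed by \<open>[X, e_ij]\<close>, cancels
  the change of the coordinates.\<close>

lemma mat_lie_d_g:
  assumes X: "supported X"
  shows "mat_lie Bs X (\<delta> p) \<approx>\<^bsub>EZ\<^esub> \<delta> (mat_lie Bs X p)"
proof -
  have fin: "finite Bs" by (rule V.finite_Basis)
  let ?y = "\<lambda>i j. pvar (i, j) :: ('k, 'a, 'v) eq_forms"
  let ?c = "\<lambda>i j. mat_bracket Bs (*) X (mat_unit i j)"
  let ?L = "Poly_Mapping.map (\<L> X)"
  \<comment> \<open>The coefficients of \<open>[X, e_ij]\<close> summed against \<open>y_ij\<close>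
    give the entry of \<open>[X, Y]\<close> at \<open>(k, l)\<close>, which is also the derivative
    of \<open>y_kl\<close> along \<open>X\<close>.\<close>
  have c: "(\<Sum>i\<in>Bs. \<Sum>j\<in>Bs. escale (?c i j k l) (?y i j)) = bracket_Y Bs X k l" if kl: "k \<in> Bs" "l \<in> Bs" for k l
  proof -
    have "?c i j k l = (if l = j then X k i else 0) - (if k = i then X j l else 0)" if "i \<in> Bs" "j \<in> Bs" for i j
    proof -
      have "(\<Sum>r\<in>Bs. X k r * mat_unit i j r l) = (\<Sum>r\<in>Bs. if r = i then if l = j then X k i else 0 else 0)"
        "(\<Sum>r\<in>Bs. X r l * mat_unit i j k r) = (\<Sum>r\<in>Bs. if r = j then if k = i then X j l else 0 else 0)"
        by (intro sum.cong; auto simp: mat_unit_def)+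
      then show ?thesis using that fin by (simp add: mat_bracket_def sum_subtractf)
    qed
    then have "(\<Sum>i\<in>Bs. \<Sum>j\<in>Bs. escale (?c i j k l) (?y i j)) =
        (\<Sum>i\<in>Bs. \<Sum>j\<in>Bs. (if l = j then escale (X k i) (?y i j) else 0) - (if k = i then escale (X j l) (?y i j) else 0))"
      by (intro sum.cong refl) (simp add: escale.scale_left_diff_distrib)
    also have "\<dots> = (\<Sum>i\<in>Bs. escale (X k i) (?y i l)) - (\<Sum>j\<in>Bs. escale (X j l) (?y k j))"
    proof -
      have "(\<Sum>i\<in>Bs. \<Sum>j\<in>Bs. if l = j then escale (X k i) (?y i j) else 0) = (\<Sum>i\<in>Bs. escale (X k i) (?y i l))"
        using fin kl by (simp add: sum.delta')
      moreover have "(\<Sum>i\<in>Bs. \<Sum>j\<in>Bs. if k = i then escale (X j l) (?y i j) else 0) = (\<Sum>j\<in>Bs. escale (X j l) (?y k j))"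
        using fin kl by (subst sum.swap) (simp add: sum.delta')
      ultimately show ?thesis by (simp add: sum_subtractf)
    qed
    finally show ?thesis by (simp add: mat_bracket_def sum_subtractf)
  qed
  \<comment> \<open>\<open>lie_contract\<close> for a matrix unit, with the resulting commutator
    expanded into matrix units again.\<close>
  have L\<iota>: "?L (\<iota>\<iota> i j p) - \<iota>\<iota> i j (?L p) \<approx>\<^bsub>EZ\<^esub> - (\<Sum>k\<in>Bs. \<Sum>l\<in>Bs. escale (?c i j k l) (\<iota>\<iota> k l p))"
    if ij: "i \<in> Bs" "j \<in> Bs" for i j
  proof -
    have "\<L> X (\<iota> (mat_unit i j) \<omega>) - \<iota> (mat_unit i j) (\<L> X \<omega>) \<approx>\<^bsub>K\<^esub>
        - (\<Sum>k\<in>Bs. \<Sum>l\<in>Bs. pscale (?c i j k l) (\<iota> (mat_unit k l) \<omega>))" for \<omega>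
      using ij by (intro K.trans[OF lie_contract] K.minus contract_expand supported_bracket X) (auto simp: mat_unit_def)
    then show ?thesis
      unfolding cong_mod_def eq_zero_def mem_Collect_eq
      by (simp add: lookup_minus lookup_add lookup_sum lookup_escale lookup_map[where f = "\<iota> _", OF linear_0[OF linear_contract]]
          lookup_map[where f = "\<L> _", OF linear_0[OF linear_lie]])
  qed
  have 1: "mat_lie Bs X (\<delta> p) = (\<Sum>i\<in>Bs. \<Sum>j\<in>Bs. ?L (\<iota>\<iota> i j p) * ?y i j + Y_vec Bs X (\<iota>\<iota> i j p) * ?y i j +
      \<iota>\<iota> i j p * bracket_Y Bs X i j)"
    by (simp add: d_g_conv mat_lie_def linear_sum[OF linear_map[OF linear_lie]] linear_sum[OF linear_Y_vec]
        scalar_poly_map[OF scalar_poly_pvar linear_lie] Y_vec_mult Y_vec_pvar sum.distrib add.assoc)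
  have 2: "\<delta> (mat_lie Bs X p) = (\<Sum>i\<in>Bs. \<Sum>j\<in>Bs. \<iota>\<iota> i j (?L p) * ?y i j + Y_vec Bs X (\<iota>\<iota> i j p) * ?y i j)"
    by (simp add: d_g_conv mat_lie_def linear_add[OF linear_map[OF linear_contract]] Y_vec_map[OF linear_contract] distrib_right)
  have 3: "mat_lie Bs X (\<delta> p) - \<delta> (mat_lie Bs X p) =
      (\<Sum>i\<in>Bs. \<Sum>j\<in>Bs. (?L (\<iota>\<iota> i j p) - \<iota>\<iota> i j (?L p)) * ?y i j) + (\<Sum>i\<in>Bs. \<Sum>j\<in>Bs. \<iota>\<iota> i j p * bracket_Y Bs X i j)"
    unfolding 1 2 by (simp add: left_diff_distrib sum.distrib sum_subtractf)
  have 4: "(\<Sum>i\<in>Bs. \<Sum>j\<in>Bs. (?L (\<iota>\<iota> i j p) - \<iota>\<iota> i j (?L p)) * ?y i j) \<approx>\<^bsub>EZ\<^esub>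
      (\<Sum>i\<in>Bs. \<Sum>j\<in>Bs. - (\<Sum>k\<in>Bs. \<Sum>l\<in>Bs. escale (?c i j k l) (\<iota>\<iota> k l p)) * ?y i j)"
    by (rule EZ.sum, rule EZ.sum, rule EZ.mult_right, rule L\<iota>)
  have "(\<Sum>i\<in>Bs. \<Sum>j\<in>Bs. - (\<Sum>k\<in>Bs. \<Sum>l\<in>Bs. escale (?c i j k l) (\<iota>\<iota> k l p)) * ?y i j) =
      - (\<Sum>i\<in>Bs. \<Sum>j\<in>Bs. \<Sum>k\<in>Bs. \<Sum>l\<in>Bs. \<iota>\<iota> k l p * escale (?c i j k l) (?y i j))"
    by (simp add: sum_negf sum_distrib_right escale_mult_left escale_mult_right)
  also have "\<dots> = - (\<Sum>k\<in>Bs. \<Sum>l\<in>Bs. \<Sum>i\<in>Bs. \<Sum>j\<in>Bs. \<iota>\<iota> k l p * escale (?c i j k l) (?y i j))"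
    by (rule arg_cong[of _ _ uminus], rule sum_swap_pairs)
  also have "\<dots> = - (\<Sum>k\<in>Bs. \<Sum>l\<in>Bs. \<iota>\<iota> k l p * bracket_Y Bs X k l)"
    by (intro arg_cong[of _ _ uminus] sum.cong refl) (simp only: c flip: sum_distrib_left)
  finally have 5: "(\<Sum>i\<in>Bs. \<Sum>j\<in>Bs. - (\<Sum>k\<in>Bs. \<Sum>l\<in>Bs. escale (?c i j k l) (\<iota>\<iota> k l p)) * ?y i j) =
      - (\<Sum>k\<in>Bs. \<Sum>l\<in>Bs. \<iota>\<iota> k l p * bracket_Y Bs X k l)" .
  show ?thesis
    using 4 unfolding 5 cong_mod_def 3 diff_minus_eq_add .
qed

lemma is_complex_basic: "is_complex (basic_complex s sV Bs)"
proof -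
  have sub: "escale.subspace (econst ` S)" if "pscale.subspace S" for S :: "('k, 'a, 'v) rep_forms set"
    using that unfolding pscale.subspace_def escale.subspace_def
    by (auto simp flip: linear_add[OF linear_econst] linear_scale[OF linear_econst] linear_0[OF linear_econst])
  have 1: "pscale.subspace (basic_forms s sV Bs n)" for n
    unfolding pscale.subspace_def basic_forms_def rep_contract_conv rep_lie_conv
    by (auto simp: hom_part_0 hom_part_add hom_part_pscale linear_0[OF linear_lie] linear_0[OF linear_contract]
        linear_add[OF linear_lie] linear_add[OF linear_contract] linear_scale[OF linear_lie] linear_scale[OF linear_contract]
        K.zero_mem K.add_mem K_pscale_mem)
  have 2: "pscale.subspace (hom_part kd_deg n \<inter> K)" for n
    unfolding pscale.subspace_def by (auto simp: hom_part_0 hom_part_add hom_part_pscale K.zero_mem K.add_mem K_pscale_mem)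
  have 3: "hom_part kd_deg n \<inter> K \<subseteq> basic_forms s sV Bs n" for n
    by (auto simp: basic_forms_def rep_contract_conv rep_lie_conv intro!: lie_K contract_K supported_entry)
  have d: "escale (of_nat m) (map_d (econst \<omega>)) = econst (pscale (of_nat m) (d_DR \<omega>))" for m \<omega>
    by (simp add: map_econst[where f = d_DR, OF linear_0[OF linear_d_DR]] linear_scale[OF linear_econst])
  have 4: "Vector_Spaces.linear escale escale (\<lambda>p. escale (of_nat m) (map_d p))" for m
    by (rule linear_escaleI) (simp_all add: linear_add[OF linear_map[OF linear_d_DR]] linear_scale[OF linear_map[OF linear_d_DR]]
        escale.scale_right_distrib mult.commute)
  have 5: "pscale c (d_DR \<omega>) \<in> basic_forms s sV Bs (Suc n)" if "\<omega> \<in> basic_forms s sV Bs n" for c \<omega> n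
    using 1 basic_forms_d_DR[OF that] by (auto simp: pscale.subspace_def)
  have 6: "pscale c (d_DR \<omega>) \<in> hom_part kd_deg (Suc n) \<inter> K" if "\<omega> \<in> hom_part kd_deg n \<inter> K" for c \<omega> n
    using that by (auto intro: hom_part_pscale d_DR_hom_part K_pscale_mem d_DR_ideal)
  have 7: "econst (pscale c (d_DR (pscale c' (d_DR \<omega>)))) = econst 0" for c c' and \<omega> :: "('k, 'a, 'v) rep_forms"
    by (simp add: linear_scale[OF linear_d_DR] d_DR_d_DR)
  have 8: "0 \<in> hom_part kd_deg n \<inter> K" for n using 2 by (simp add: pscale.subspace_def)
  show ?thesis
    unfolding is_complex_def basic_complex_def sq_complex.simps
    using 3 by (auto simp: vector_space_escale sub 1 2 4 d 7 simp del: of_nat_add intro!: imageI 5 6 8 simp del: of_nat_Suc)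
qed

lemma is_complex_equivariant: "is_complex (equivariant_complex s sV Bs)"
proof -
  let ?C = "\<lambda>n. {p \<in> eq_part Bs n. \<forall>x. is_endo sV x \<longrightarrow> eq_lie sV Bs x p \<in> EZ}"
  let ?D = "\<lambda>p. map_d p + \<delta> p"
  have lin: "Vector_Spaces.linear escale escale ?D"
    by (rule linear_escaleI) (simp_all add: linear_add[OF linear_map[OF linear_d_DR]] linear_scale[OF linear_map[OF linear_d_DR]]
        linear_add[OF linear_d_g] linear_scale[OF linear_d_g] escale.scale_right_distrib)
  have 1: "escale.subspace (?C n)" for n
    unfolding escale.subspace_def eq_lie_conv
    by (auto simp: eq_part_0 eq_part_add eq_part_escale linear_0[OF linear_mat_lie] linear_add[OF linear_mat_lie]
        linear_scale[OF linear_mat_lie] EZ.zero_mem EZ.add_mem EZ_escale)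
  have 2: "escale.subspace (eq_part Bs n \<inter> EZ)" for n
    unfolding escale.subspace_def by (auto simp: eq_part_0 eq_part_add eq_part_escale EZ.zero_mem EZ.add_mem EZ_escale)
  have 3: "eq_part Bs n \<inter> EZ \<subseteq> ?C n" for n
    by (auto simp: eq_lie_conv intro!: EZ_mat_lie supported_entry)
  have 4: "?D p \<in> ?C (Suc n)" if p: "p \<in> ?C n" for p n
  proof -
    have "mat_lie Bs (entry sV Bs x) (?D p) \<in> EZ" if "is_endo sV x" for x
    proof -
      have *: "mat_lie Bs (entry sV Bs x) (?D p) \<approx>\<^bsub>EZ\<^esub> ?D (mat_lie Bs (entry sV Bs x) p)"
        unfolding linear_add[OF linear_mat_lie] mat_lie_map_d
        by (rule EZ.add[OF EZ.refl mat_lie_d_g[OF supported_entry]])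
      have "mat_lie Bs (entry sV Bs x) p \<in> EZ" using p that by (simp add: eq_lie_conv)
      then show ?thesis
        unfolding EZ.mem_cong[OF *] by (intro EZ.add_mem EZ_map_d EZ_d_g)
    qed
    moreover have "?D p \<in> eq_part Bs (Suc n)" using p by (blast intro: eq_part_add eq_part_map_d eq_part_d_g)
    ultimately show ?thesis unfolding eq_lie_conv by blast
  qed
  have 5: "?D p \<in> eq_part Bs (Suc n) \<inter> EZ" if "p \<in> eq_part Bs n \<inter> EZ" for p n
    using that by (auto intro: eq_part_add eq_part_map_d eq_part_d_g EZ.add_mem EZ_map_d EZ_d_g)
  have 6: "?D (?D p) \<in> eq_part Bs (Suc (Suc n)) \<inter> EZ" if p: "p \<in> ?C n" for p n
  proof -
    have "?D (?D p) = map_d (\<delta> p) + \<delta> (map_d p)"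
      by (simp add: linear_add[OF linear_map[OF linear_d_DR]] linear_add[OF linear_d_g] map_d_map_d d_g_d_g)
    \<comment> \<open>The added sum is zero. It supplies the part of \<open>mat_lie\<close> that
      differentiates the coordinates of \<open>g\<close>, so that the invariance of \<open>p\<close>
      becomes applicable.\<close>
    also have "\<dots> = (\<Sum>i\<in>Bs. \<Sum>j\<in>Bs. Poly_Mapping.map (\<L> (mat_unit i j)) p * pvar (i, j)) +
        (\<Sum>i\<in>Bs. \<Sum>j\<in>Bs. Y_vec Bs (mat_unit i j) p * pvar (i, j))"
    proof -
      have "p \<in> eq_part Bs n" using p by blast
      then show ?thesis by (simp only: map_d_d_g Y_vec_generic add_0_right)
    qed
    also have "\<dots> = (\<Sum>i\<in>Bs. \<Sum>j\<in>Bs. mat_lie Bs (mat_unit i j) p * pvar (i, j))"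
      by (simp add: mat_lie_def distrib_right sum.distrib)
    also have "\<dots> \<in> EZ"
    proof (intro EZ.sum_mem EZ.mult_right_mem)
      fix i j assume ij: "i \<in> Bs" "j \<in> Bs"
      have "eq_lie sV Bs (elem_endo sV Bs i j) p \<in> EZ" using p is_endo_elem_endo by blast
      then show "mat_lie Bs (mat_unit i j) p \<in> EZ"
        by (simp only: eq_lie_conv entry_elem_endo[OF ij])
    qed
    finally have "?D (?D p) \<in> EZ" .
    moreover have "?D (?D p) \<in> eq_part Bs (Suc (Suc n))" using 4[OF 4[OF p]] by blast
    ultimately show ?thesis by blast
  qed
  show ?thesis
    unfolding is_complex_def equivariant_complex_def sq_complex.simps
    by (intro conjI allI ballI image_subsetI vector_space_escale 1 2 3 lin 4 5 6)
qed

end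


section \<open>Evaluation\<close>

text \<open>The Leibniz rule \<open>[X, A] B + A [X, B] = [X, A B]\<close>, for any compatible
  scalar multiplication so as to cover both \<open>pscale\<close> and \<open>escale\<close>.\<close>

lemma mat_bracket_mult:
  fixes A B :: "'v \<Rightarrow> 'v \<Rightarrow> 'r::ring"
  assumes add: "\<And>c x y. sc c (x + y) = sc c x + sc c y"
    and left: "\<And>c x y. sc c x * y = sc c (x * y)" and right: "\<And>c x y. x * sc c y = sc c (x * y)"
  shows "(\<Sum>l\<in>Bs. mat_bracket Bs sc X A i l * B l j + A i l * mat_bracket Bs sc X B l j) =
    mat_bracket Bs sc X (\<lambda>k l. \<Sum>r\<in>Bs. A k r * B r l) i j"
proof -
  have sum: "sc c (\<Sum>r\<in>S. f r) = (\<Sum>r\<in>S. sc c (f r))" for c f and S :: "'v set"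
  proof (induction S rule: infinite_finite_induct)
    case (infinite S)
    then show ?case using add[of c 0 0] by simp
  next
    case empty
    then show ?case using add[of c 0 0] by simp
  qed (simp add: add)
  let ?P = "\<Sum>l\<in>Bs. \<Sum>r\<in>Bs. sc (X i l) (A l r * B r j)"
  let ?Q = "\<Sum>l\<in>Bs. \<Sum>r\<in>Bs. sc (X l j) (A i r * B r l)"
  let ?R = "\<Sum>l\<in>Bs. \<Sum>r\<in>Bs. sc (X r l) (A i r * B l j)"
  have "mat_bracket Bs sc X (\<lambda>k l. \<Sum>r\<in>Bs. A k r * B r l) i j = ?P - ?Q"
    by (simp add: mat_bracket_def sum sum_subtractf)
  moreover have "(\<Sum>l\<in>Bs. mat_bracket Bs sc X A i l * B l j) = ?P - ?R"
    by (simp add: mat_bracket_def sum_distrib_right left_diff_distrib sum_subtractf left) (rule sum.swap)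
  moreover have "(\<Sum>l\<in>Bs. A i l * mat_bracket Bs sc X B l j) = ?R - ?Q"
  proof -
    have "(\<Sum>l\<in>Bs. A i l * mat_bracket Bs sc X B l j) =
       (\<Sum>l\<in>Bs. \<Sum>r\<in>Bs. sc (X l r) (A i l * B r j)) - (\<Sum>l\<in>Bs. \<Sum>r\<in>Bs. sc (X r j) (A i l * B l r))"
      by (simp add: mat_bracket_def sum_distrib_left right_diff_distrib sum_subtractf right)
    also have "\<dots> = ?R - ?Q" by (subst sum.swap, subst (2) sum.swap) (rule refl)
    finally show ?thesis .
  qed
  ultimately show ?thesis by (simp add: sum.distrib)
qed

lemma mat_bracket_trace: "(\<Sum>i\<in>Bs. mat_bracket Bs sc X M i i) = 0"
  unfolding mat_bracket_def sum_subtractf by (subst (2) sum.swap) simp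

lemma nct_gen_cases: obtains "x = None" | a where "x = Some (Alg a)" | p where "x = Some (Form p)"
  by (cases x rule: option.exhaust; cases "the x") auto

lemma superderivation_gen: "superderivation deg e E \<Longrightarrow> E (gen x * u) = E (gen x) * u + (- 1) ^ (e * deg x) * (gen x * E u)"
  by (rule superderivation_hom) (simp_all add: hom_part_gen)

context rep_setting
begin

lemma fin: "finite Bs" by (rule V.finite_Basis)

abbreviation evM where "evM \<equiv> ev_Omega s Bs"

lemma linear_evM: "Vector_Spaces.linear pscale escale (\<lambda>p. evM p i j)"
  unfolding ev_Omega_def by (rule escale.linear_lin_ext)

lemma evM_wmon: "evM (wmon w) i j = ev_word s Bs w i j"
  by (simp add: ev_Omega_def wmon_def escale.lin_ext_single)

lemma evM_1: "evM 1 i j = (if i = j then 1 else 0)"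
  using evM_wmon[of "[]"] by (simp add: wmon_Nil)

lemma evM_gen: "j \<in> Bs \<Longrightarrow> evM (gen x) i j = ev_gen s Bs x i j"
proof -
  assume j: "j \<in> Bs"
  have "(\<Sum>l\<in>Bs. ev_gen s Bs x i l * (if l = j then 1 else 0)) = (\<Sum>l\<in>Bs. if l = j then ev_gen s Bs x i l else 0)"
    by (intro sum.cong) auto
  then show ?thesis using j fin by (simp add: gen_conv_wmon evM_wmon)
qed

lemma ev_word_append:
  "i \<in> Bs \<Longrightarrow> ev_word s Bs (u @ v) i j = (\<Sum>l\<in>Bs. ev_word s Bs u i l * ev_word s Bs v l j)"
proof (induction u arbitrary: i)
  case Nil
  have "(\<Sum>l\<in>Bs. (if i = l then 1 else 0) * ev_word s Bs v l j) = (\<Sum>l\<in>Bs. if i = l then ev_word s Bs v l j else 0)"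
    by (intro sum.cong) auto
  then show ?case using Nil fin by simp
next
  case (Cons x u)
  have "ev_word s Bs ((x # u) @ v) i j = (\<Sum>l\<in>Bs. \<Sum>r\<in>Bs. ev_gen s Bs x i l * ev_word s Bs u l r * ev_word s Bs v r j)"
    using Cons.IH by (simp add: sum_distrib_left mult.assoc)
  also have "\<dots> = (\<Sum>r\<in>Bs. ev_word s Bs (x # u) i r * ev_word s Bs v r j)"
    by (subst sum.swap) (simp add: sum_distrib_right)
  finally show ?case .
qed

lemma evM_mult: "i \<in> Bs \<Longrightarrow> evM (p * q) i j = (\<Sum>l\<in>Bs. evM p i l * evM q l j)"
proof (induction p rule: free_alg_induct)
  case (wmon u)
  show ?case
  proof (induction q rule: free_alg_induct)
    case (wmon v)
    show ?case using \<open>i \<in> Bs\<close> by (simp add: evM_wmon ev_word_append flip: wmon_append)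
  qed (simp_all add: distrib_left pscale_mult_right linear_add[OF linear_evM] linear_scale[OF linear_evM]
      sum.distrib escale_mult_right escale.scale_sum_right)
qed (simp_all add: distrib_right pscale_mult_left linear_add[OF linear_evM] linear_scale[OF linear_evM]
      sum.distrib escale_mult_left escale.scale_sum_right)

abbreviation h :: "'a \<Rightarrow> 'v \<Rightarrow> 'v \<Rightarrow> ('k, 'a, 'v) rep_forms" where "h \<equiv> rep_hat"
abbreviation dh :: "'a \<Rightarrow> 'v \<Rightarrow> 'v \<Rightarrow> ('k, 'a, 'v) rep_forms" where "dh a i j \<equiv> gen (Df (pvar (a, i, j)))"

text \<open>The value that multiplicativity of the evaluation forces on \<open>u dv\<close>.\<close>

definition h_dh :: "'a \<Rightarrow> 'a \<Rightarrow> 'v \<Rightarrow> 'v \<Rightarrow> ('k, 'a, 'v) rep_forms" where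
  "h_dh u v i j = (\<Sum>l\<in>Bs. h u i l * dh v l j)"

lemma d_DR_h: "d_DR (h a i j) = dh a i j"
  by (simp add: rep_hat_def d_DR_gen)

lemma h_hom_part: "h a i j \<in> hom_part kd_deg 0" "dh a i j \<in> hom_part kd_deg 1" "h_dh u v i j \<in> hom_part kd_deg 1"
proof -
  show *: "h a i j \<in> hom_part kd_deg 0" "dh a i j \<in> hom_part kd_deg 1" for a i j
    by (simp_all only: rep_hat_def kd_gen_hom_part)
  show "h_dh u v i j \<in> hom_part kd_deg 1"
    unfolding h_dh_def using hom_part_mult[OF *] by (intro hom_part_sum) simp
qed

lemma ev_gen_simps:
  "ev_gen s Bs None i j = pvar (i, j)"
  "ev_gen s Bs (Some (Alg a)) i j = econst (h a i j)"
  "ev_gen s Bs (Some (Form p)) i j = form_ext s escale (\<lambda>u v. econst (h_dh u v i j)) p"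
  by (simp_all add: ev_gen_def h_dh_def d_DR_h)

lemma form_ext_econst: "form_ext s escale (\<lambda>u v. econst (f u v)) p = econst (form_ext s pscale f p)"
  by (simp add: form_ext_def lin_ext_linear[OF linear_econst] linear_0[OF linear_econst] case_prod_unfold)

lemma ev_gen_part: "i \<in> Bs \<Longrightarrow> j \<in> Bs \<Longrightarrow> ev_gen s Bs x i j \<in> eq_part Bs (nct_deg x)"
  by (cases x rule: nct_gen_cases)
    (auto simp: ev_gen_simps nct_deg_def form_ext_econst intro!: eq_part_pvar eq_part_econst h_hom_part form_ext_hom_part
      simp flip: One_nat_def)

lemma evM_part: "p \<in> nct_part n \<Longrightarrow> i \<in> Bs \<Longrightarrow> j \<in> Bs \<Longrightarrow> evM p i j \<in> eq_part Bs n"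
proof (induction p rule: hom_part_induct)
  case (wmon w)
  have "ev_word s Bs w i j \<in> eq_part Bs (word_deg nct_deg w)"
    using wmon(2,3)
  proof (induction w arbitrary: i)
    case (Cons x w)
    then show ?case
      by (auto intro!: eq_part_sum eq_part_mult ev_gen_part)
  qed (auto simp: eq_part_0 econst_1[symmetric] intro!: eq_part_econst hom_part_1)
  then show ?case using wmon by (simp add: evM_wmon)
qed (simp_all add: linear_add[OF linear_evM] linear_scale[OF linear_evM] linear_0[OF linear_evM] eq_part_0 eq_part_add eq_part_escale)

lemma evM_emb_econst: "p \<in> nc_part n \<Longrightarrow> \<exists>\<omega>\<in>hom_part kd_deg n. evM (nct_emb p) i j = econst \<omega>"
proof (induction p rule: hom_part_induct)
  case (wmon w)
  have "\<exists>\<omega>\<in>hom_part kd_deg (word_deg nc_deg w). ev_word s Bs (map Some w) i j = econst \<omega>" for i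
  proof (induction w arbitrary: i)
    case Nil
    have "(0 :: ('k, 'a, 'v) rep_forms) \<in> hom_part kd_deg 0" "(1 :: ('k, 'a, 'v) rep_forms) \<in> hom_part kd_deg 0"
      by (rule hom_part_0 hom_part_1)+
    then show ?case
      by (auto simp: econst_1[symmetric] linear_0[OF linear_econst, symmetric])
  next
    case (Cons x w)
    obtain \<omega> where \<omega>: "\<And>i. \<omega> i \<in> hom_part kd_deg (word_deg nc_deg w)" "\<And>i. ev_word s Bs (map Some w) i j = econst (\<omega> i)"
      using Cons by metis
    obtain \<eta> where \<eta>: "\<And>l. \<eta> l \<in> hom_part kd_deg (nc_deg x)" "\<And>l. ev_gen s Bs (Some x) i l = econst (\<eta> l)"
    proof (cases x)
      case (Alg a)
      show ?thesis by (rule that[of "\<lambda>l. h a i l"]) (simp_all add: Alg ev_gen_simps h_hom_part)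
    next
      case (Form p)
      show ?thesis
        by (rule that[of "\<lambda>l. form_ext s pscale (\<lambda>u v. h_dh u v i l) p"])
          (simp_all add: Form ev_gen_simps form_ext_econst form_ext_hom_part h_hom_part[unfolded One_nat_def])
    qed
    have "ev_word s Bs (map Some (x # w)) i j = econst (\<Sum>l\<in>Bs. \<eta> l * \<omega> l)"
      by (simp add: \<eta> \<omega> linear_sum[OF linear_econst] econst_mult)
    moreover have "(\<Sum>l\<in>Bs. \<eta> l * \<omega> l) \<in> hom_part kd_deg (word_deg nc_deg (x # w))"
      by (auto intro!: hom_part_sum hom_part_mult \<eta> \<omega>)
    ultimately show ?case by blast
  qed
  with wmon show ?case by (simp add: nct_emb_wmon evM_wmon)
next
  case (scale c p)
  then show ?case
    by (auto simp: nct_emb_linear linear_scale[OF linear_evM] linear_scale[OF linear_econst, symmetric] intro: hom_part_pscale)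
next
  case zero
  have "econst 0 = evM (nct_emb 0) i j" by (simp add: nct_emb_linear linear_0[OF linear_evM] linear_0[OF linear_econst])
  then show ?case using hom_part_0 by metis
next
  case (add p q)
  then show ?case
    by (auto simp: nct_emb_linear linear_add[OF linear_evM] linear_add[OF linear_econst, symmetric] intro: hom_part_add)
qed

section \<open>Evaluation respects the relations of the noncommutative forms\<close>

lemma K_Fn_J: "p \<approx>\<^bsub>J\<^esub> q \<Longrightarrow> gen (Fn p) \<approx>\<^bsub>K\<^esub> gen (Fn q)"
  by (rule K.cong_of_diff2[OF K.sym[OF K_Fn_diff[of p q]] K_J(1)[of "p - q"]]) (simp_all add: cong_mod_def)

lemma h_rel:
  "i \<in> Bs \<Longrightarrow> j \<in> Bs \<Longrightarrow> h (a + b) i j \<approx>\<^bsub>K\<^esub> h a i j + h b i j"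
  "i \<in> Bs \<Longrightarrow> j \<in> Bs \<Longrightarrow> h (s c a) i j \<approx>\<^bsub>K\<^esub> pscale c (h a i j)"
  "i \<in> Bs \<Longrightarrow> j \<in> Bs \<Longrightarrow> h (a * b) i j \<approx>\<^bsub>K\<^esub> (\<Sum>l\<in>Bs. h a i l * h b l j)"
  "i \<in> Bs \<Longrightarrow> j \<in> Bs \<Longrightarrow> h 1 i j \<approx>\<^bsub>K\<^esub> (if i = j then 1 else 0)"
proof -
  assume ij: "i \<in> Bs" "j \<in> Bs"
  show "h (a + b) i j \<approx>\<^bsub>K\<^esub> h a i j + h b i j"
    unfolding rep_hat_def by (rule K.trans[OF K_Fn_J[OF J_rel(1)[OF ij]] K_rel(1)])
  show "h (s c a) i j \<approx>\<^bsub>K\<^esub> pscale c (h a i j)"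
    unfolding rep_hat_def by (rule K.trans[OF K_Fn_J[OF J_rel(2)[OF ij]] K_rel(2)])
  show "h (a * b) i j \<approx>\<^bsub>K\<^esub> (\<Sum>l\<in>Bs. h a i l * h b l j)"
    unfolding rep_hat_def
    by (rule K.trans[OF K_Fn_J[OF J_rel(3)[OF ij]] K.trans[OF K_Fn_sum]]) (intro K.sum K_rel(3))
  show "h 1 i j \<approx>\<^bsub>K\<^esub> (if i = j then 1 else 0)"
    unfolding rep_hat_def
    by (rule K.trans[OF K_Fn_J[OF J_rel(4)[OF ij]]]) (simp add: K_rel(4) K_Fn_0)
qed

lemma d_DR_cong: "p \<approx>\<^bsub>K\<^esub> q \<Longrightarrow> d_DR p \<approx>\<^bsub>K\<^esub> d_DR q"
  by (rule linear_cong_mod[OF linear_d_DR d_DR_ideal])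

lemma d_DR_h_mult: "d_DR (h a i j * p) = dh a i j * p + h a i j * d_DR p"
  using superderivation_hom[OF superderivation_d_DR h_hom_part(1), of a i j p] by (simp add: d_DR_h)

lemma d_DR_1: "d_DR 1 = 0"
  by (rule superderivation_1[OF superderivation_d_DR])

lemma dh_rel:
  "i \<in> Bs \<Longrightarrow> j \<in> Bs \<Longrightarrow> dh (a + b) i j \<approx>\<^bsub>K\<^esub> dh a i j + dh b i j"
  "i \<in> Bs \<Longrightarrow> j \<in> Bs \<Longrightarrow> dh (s c a) i j \<approx>\<^bsub>K\<^esub> pscale c (dh a i j)"
  "i \<in> Bs \<Longrightarrow> j \<in> Bs \<Longrightarrow> dh (a * b) i j \<approx>\<^bsub>K\<^esub> (\<Sum>l\<in>Bs. dh a i l * h b l j + h a i l * dh b l j)"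
  "i \<in> Bs \<Longrightarrow> j \<in> Bs \<Longrightarrow> dh 1 i j \<approx>\<^bsub>K\<^esub> 0"
  using d_DR_cong[OF h_rel(1), of i j a b] d_DR_cong[OF h_rel(2), of i j c a] d_DR_cong[OF h_rel(3), of i j a b]
    d_DR_cong[OF h_rel(4), of i j]
  by (simp_all add: d_DR_h linear_add[OF linear_d_DR] linear_scale[OF linear_d_DR] linear_sum[OF linear_d_DR] d_DR_h_mult
      d_DR_1 linear_0[OF linear_d_DR] split: if_splits)

lemma h_dh_rel:
  assumes ij: "i \<in> Bs" "j \<in> Bs"
  shows "h_dh (u + u') v i j \<approx>\<^bsub>K\<^esub> h_dh u v i j + h_dh u' v i j"
    and "h_dh u (v + v') i j \<approx>\<^bsub>K\<^esub> h_dh u v i j + h_dh u v' i j"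
    and "h_dh (s c u) v i j \<approx>\<^bsub>K\<^esub> pscale c (h_dh u v i j)"
    and "h_dh u (s c v) i j \<approx>\<^bsub>K\<^esub> pscale c (h_dh u v i j)"
    and "h_dh (a * u) v i j \<approx>\<^bsub>K\<^esub> (\<Sum>l\<in>Bs. h a i l * h_dh u v l j)"
    and "h_dh u (v * a) i j \<approx>\<^bsub>K\<^esub> (\<Sum>l\<in>Bs. h_dh u v i l * h a l j) + h_dh (u * v) a i j"
    and "h_dh 1 v i j \<approx>\<^bsub>K\<^esub> dh v i j" and "h_dh u 1 i j \<approx>\<^bsub>K\<^esub> 0"
proof -
  have "h_dh (u + u') v i j \<approx>\<^bsub>K\<^esub> (\<Sum>l\<in>Bs. (h u i l + h u' i l) * dh v l j)"
    unfolding h_dh_def by (intro K.sum K.mult_right h_rel ij)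
  then show "h_dh (u + u') v i j \<approx>\<^bsub>K\<^esub> h_dh u v i j + h_dh u' v i j"
    by (simp add: h_dh_def distrib_right sum.distrib)
  have "h_dh u (v + v') i j \<approx>\<^bsub>K\<^esub> (\<Sum>l\<in>Bs. h u i l * (dh v l j + dh v' l j))"
    unfolding h_dh_def by (intro K.sum K.mult_left dh_rel ij)
  then show "h_dh u (v + v') i j \<approx>\<^bsub>K\<^esub> h_dh u v i j + h_dh u v' i j"
    by (simp add: h_dh_def distrib_left sum.distrib)
  have "h_dh (s c u) v i j \<approx>\<^bsub>K\<^esub> (\<Sum>l\<in>Bs. pscale c (h u i l) * dh v l j)"
    unfolding h_dh_def by (intro K.sum K.mult_right h_rel ij)
  then show "h_dh (s c u) v i j \<approx>\<^bsub>K\<^esub> pscale c (h_dh u v i j)"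
    by (simp add: h_dh_def pscale_mult_left pscale.scale_sum_right)
  have "h_dh u (s c v) i j \<approx>\<^bsub>K\<^esub> (\<Sum>l\<in>Bs. h u i l * pscale c (dh v l j))"
    unfolding h_dh_def by (intro K.sum K.mult_left dh_rel ij)
  then show "h_dh u (s c v) i j \<approx>\<^bsub>K\<^esub> pscale c (h_dh u v i j)"
    by (simp add: h_dh_def pscale_mult_right pscale.scale_sum_right)
  have hh: "(\<Sum>l\<in>Bs. (\<Sum>r\<in>Bs. A r * B r l) * C l) = (\<Sum>r\<in>Bs. A r * (\<Sum>l\<in>Bs. B r l * C l))"
    for A C :: "'v \<Rightarrow> ('k, 'a, 'v) rep_forms" and B :: "'v \<Rightarrow> 'v \<Rightarrow> ('k, 'a, 'v) rep_forms"
    by (simp add: sum_distrib_left sum_distrib_right mult.assoc) (rule sum.swap)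
  have "h_dh (a * u) v i j \<approx>\<^bsub>K\<^esub> (\<Sum>l\<in>Bs. (\<Sum>r\<in>Bs. h a i r * h u r l) * dh v l j)"
    unfolding h_dh_def by (intro K.sum K.mult_right h_rel ij)
  then show "h_dh (a * u) v i j \<approx>\<^bsub>K\<^esub> (\<Sum>l\<in>Bs. h a i l * h_dh u v l j)"
    by (simp add: h_dh_def hh)
  have 1: "h_dh u (v * a) i j \<approx>\<^bsub>K\<^esub> (\<Sum>l\<in>Bs. h u i l * (\<Sum>r\<in>Bs. dh v l r * h a r j + h v l r * dh a r j))"
    unfolding h_dh_def by (intro K.sum K.mult_left dh_rel ij)
  have 2: "(\<Sum>l\<in>Bs. h u i l * (\<Sum>r\<in>Bs. dh v l r * h a r j + h v l r * dh a r j)) =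
      (\<Sum>r\<in>Bs. h_dh u v i r * h a r j) + (\<Sum>r\<in>Bs. (\<Sum>l\<in>Bs. h u i l * h v l r) * dh a r j)"
    by (simp add: h_dh_def hh sum.distrib distrib_left)
  have 3: "(\<Sum>r\<in>Bs. (\<Sum>l\<in>Bs. h u i l * h v l r) * dh a r j) \<approx>\<^bsub>K\<^esub> h_dh (u * v) a i j"
    unfolding h_dh_def by (intro K.sum K.mult_right K.sym[OF h_rel(3)] ij)
  show "h_dh u (v * a) i j \<approx>\<^bsub>K\<^esub> (\<Sum>l\<in>Bs. h_dh u v i l * h a l j) + h_dh (u * v) a i j"
    by (rule K.trans[OF 1[unfolded 2] K.add[OF K.refl 3]])
  have "h_dh 1 v i j \<approx>\<^bsub>K\<^esub> (\<Sum>l\<in>Bs. (if i = l then 1 else 0) * dh v l j)"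
    unfolding h_dh_def by (intro K.sum K.mult_right h_rel ij)
  moreover have "(\<Sum>l\<in>Bs. (if i = l then 1 else 0) * dh v l j) = (\<Sum>l\<in>Bs. if i = l then dh v l j else 0)"
    by (intro sum.cong) auto
  ultimately show "h_dh 1 v i j \<approx>\<^bsub>K\<^esub> dh v i j" using ij fin by simp
  have "h_dh u 1 i j \<approx>\<^bsub>K\<^esub> (\<Sum>l\<in>Bs. h u i l * 0)"
    unfolding h_dh_def by (intro K.sum K.mult_left dh_rel ij)
  then show "h_dh u 1 i j \<approx>\<^bsub>K\<^esub> 0" by simp
qed

definition h_dh_ext :: "('k, 'a) tens \<Rightarrow> 'v \<Rightarrow> 'v \<Rightarrow> ('k, 'a, 'v) rep_forms" where
  "h_dh_ext p i j = lin_ext pscale (\<lambda>(u, v). h_dh u v i j) p"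

lemma h_dh_ext_simps:
  "h_dh_ext (p + q) i j = h_dh_ext p i j + h_dh_ext q i j" "h_dh_ext (p - q) i j = h_dh_ext p i j - h_dh_ext q i j"
  "h_dh_ext (pscale c p) i j = pscale c (h_dh_ext p i j)" "h_dh_ext (tensor u v) i j = h_dh u v i j"
  by (simp_all add: h_dh_ext_def lin_ext_simps)

lemma ev_gen_Form: "ev_gen s Bs (Some (Form p)) i j = (if p \<in> Omega1 s then econst (h_dh_ext p i j) else 0)"
  by (simp add: ev_gen_simps form_ext_econst form_ext_def h_dh_ext_def linear_0[OF linear_econst]
      lin_ext_linear[OF linear_econst] case_prod_unfold)

lemma h_dh_ext_lact:
  assumes ij: "i \<in> Bs" "j \<in> Bs"
  shows "h_dh_ext (lact a p) i j \<approx>\<^bsub>K\<^esub> (\<Sum>l\<in>Bs. h a i l * h_dh_ext p l j)"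
proof (induction p rule: tensor_induct)
  case (tensor u v)
  show ?case using h_dh_rel(5)[OF ij] by (simp add: lact_simps h_dh_ext_simps)
next
  case (scale c p)
  from K_pscale[OF scale, of c] show ?case
    by (simp add: lact_simps h_dh_ext_simps pscale.scale_sum_right pscale_mult_right)
next
  case (add p q)
  from K.add[OF add] show ?case by (simp add: lact_simps h_dh_ext_simps distrib_left sum.distrib)
qed

text \<open>By \<open>d (v a) = dv a + v da\<close> each term \<open>u dv\<close> leaves a surplus
  \<open>h_dh (u * v) a\<close>. These add up to 0 because the products \<open>u * v\<close> do,
  which is where \<open>p \<in> Omega1 s\<close> enters.\<close>

lemma h_dh_ext_ract:
  assumes ij: "i \<in> Bs" "j \<in> Bs" and p: "p \<in> Omega1 s"
  shows "h_dh_ext (ract p a) i j \<approx>\<^bsub>K\<^esub> (\<Sum>l\<in>Bs. h_dh_ext p i l * h a l j)"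
proof -
  have "h_dh_ext (ract p a) i j \<approx>\<^bsub>K\<^esub> (\<Sum>l\<in>Bs. h_dh_ext p i l * h a l j) + lin_ext pscale (\<lambda>(u, v). h_dh (u * v) a i j) p"
    for p :: "('k, 'a) tens"
  proof (induction p rule: tensor_induct)
    case (tensor u v)
    show ?case using h_dh_rel(6)[OF ij] by (simp add: ract_simps h_dh_ext_simps lin_ext_simps)
  next
    case (scale c p)
    from K_pscale[OF scale, of c] show ?case
      by (simp add: ract_simps h_dh_ext_simps lin_ext_simps pscale.scale_sum_right pscale_mult_left pscale_add)
  next
    case (add p q)
    from K.add[OF add] show ?case
      by (simp add: ract_simps h_dh_ext_simps lin_ext_simps distrib_right sum.distrib algebra_simps)
  qed
  note 1 = this[of p]
  have 2: "h_dh (lin_ext s (\<lambda>(u, v). u * v) p) a i j \<approx>\<^bsub>K\<^esub> lin_ext pscale (\<lambda>x. h_dh (case x of (u, v) \<Rightarrow> u * v) a i j) p"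
    by (rule cong_mod_linear_lin_ext[where f = "\<lambda>x. h_dh x a i j"])
      (auto simp: vector_space_axioms vector_space_pscale K.add_subgroup_axioms h_dh_rel(1,3)[OF ij] K_pscale_mem)
  have 3: "(\<lambda>x. h_dh (case x of (u, v) \<Rightarrow> u * v) a i j) = (\<lambda>(u, v). h_dh (u * v) a i j)" by auto
  have 4: "lin_ext s (\<lambda>(u, v). u * v) p = 0" using p by (simp add: Omega1_def)
  have 5: "h_dh 0 a i j \<approx>\<^bsub>K\<^esub> 0" using h_dh_rel(3)[OF ij, of 0 0 a] by simp
  have "lin_ext pscale (\<lambda>(u, v). h_dh (u * v) a i j) p \<approx>\<^bsub>K\<^esub> 0"
    by (rule K.trans[OF K.sym[OF 2[unfolded 3 4]] 5])
  from K.trans[OF 1 K.add[OF K.refl this]] show ?thesis by simp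
qed

lemma h_dh_ext_rel:
  assumes ij: "i \<in> Bs" "j \<in> Bs" and p: "p \<in> tensor_rel s"
  shows "h_dh_ext p i j \<in> K"
proof -
  have "pscale.subspace {p. h_dh_ext p i j \<in> K}"
    unfolding pscale.subspace_def
    by (auto simp: h_dh_ext_simps K.add_mem K_pscale_mem) (use h_dh_ext_simps(3)[of 0 0 i j] K.zero_mem in simp)
  then have "tensor_rel s \<subseteq> {p. h_dh_ext p i j \<in> K}"
    unfolding tensor_rel_def
    by (intro pscale.span_minimal)
      (use h_dh_rel(1-4)[OF ij] in \<open>auto simp: h_dh_ext_simps cong_mod_def diff_diff_eq\<close>)
  then show ?thesis using p by blast
qed

lemma econst_simps:
  "econst (x + y) = econst x + econst y" "econst (x - y) = econst x - econst y" "econst (pscale c x) = escale c (econst x)"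
  "econst (sum f S) = (\<Sum>i\<in>S. econst (f i))" "econst (x * y) = econst x * econst y" "econst 0 = 0" "econst 1 = 1"
  by (simp_all add: linear_add[OF linear_econst] linear_diff[OF linear_econst] linear_scale[OF linear_econst]
      linear_sum[OF linear_econst] linear_0[OF linear_econst] econst_mult econst_1)

lemma EZ_econstI: "x \<approx>\<^bsub>K\<^esub> y \<Longrightarrow> econst x - econst y \<in> EZ"
  using EZ_cong_econst by (simp add: cong_mod_def)

lemma evM_rel:
  assumes r: "r \<in> nc_rel s" and ij: "i \<in> Bs" "j \<in> Bs"
  shows "evM (nct_emb r) i j \<in> EZ"
proof -
  note simps = nct_emb_simps linear_diff[OF linear_evM] linear_add[OF linear_evM] linear_scale[OF linear_evM] evM_gen[OF ij(2)] ev_gen_simps(2) ev_gen_Form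
    evM_mult[OF ij(1)] evM_1
  have F0: "0 - 0 \<in> EZ" by (simp add: EZ.zero_mem)
  show ?thesis
  proof (insert r, unfold nc_rel_def, elim UnE CollectE exE conjE singletonE; simp only:)
    fix a b
    show "evM (nct_emb (gen (Alg (a + b)) - gen (Alg a) - gen (Alg b))) i j \<in> EZ"
      using EZ_econstI[OF h_rel(1)[OF ij, of a b]] by (simp add: simps econst_simps diff_diff_eq)
    show "evM (nct_emb (gen (Alg (a * b)) - gen (Alg a) * gen (Alg b))) i j \<in> EZ"
      using EZ_econstI[OF h_rel(3)[OF ij, of a b]] ij by (simp add: simps evM_gen econst_simps)
  next
    fix c a
    show "evM (nct_emb (gen (Alg (s c a)) - pscale c (gen (Alg a)))) i j \<in> EZ"
      using EZ_econstI[OF h_rel(2)[OF ij, of c a]] by (simp add: simps econst_simps)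
  next
    show "evM (nct_emb (gen (Alg 1) - 1)) i j \<in> EZ"
      using EZ_econstI[OF h_rel(4)[OF ij]] by (simp add: simps econst_simps split: if_splits)
  next
    fix p q :: "('k, 'a) tens" assume pq: "p \<in> Omega1 s" "q \<in> Omega1 s"
    then show "evM (nct_emb (gen (Form (p + q)) - gen (Form p) - gen (Form q))) i j \<in> EZ"
      by (simp add: simps Omega1_closed h_dh_ext_simps econst_simps EZ.zero_mem)
  next
    fix c and p :: "('k, 'a) tens" assume p: "p \<in> Omega1 s"
    then show "evM (nct_emb (gen (Form (pscale c p)) - pscale c (gen (Form p)))) i j \<in> EZ"
      by (simp add: simps Omega1_closed h_dh_ext_simps econst_simps EZ.zero_mem)
  next
    fix a and p :: "('k, 'a) tens" assume p: "p \<in> Omega1 s"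
    show "evM (nct_emb (gen (Form (lact a p)) - gen (Alg a) * gen (Form p))) i j \<in> EZ"
      using EZ_econstI[OF h_dh_ext_lact[OF ij, of a p]] p ij by (simp add: simps evM_gen Omega1_closed econst_simps)
  next
    fix a and p :: "('k, 'a) tens" assume p: "p \<in> Omega1 s"
    show "evM (nct_emb (gen (Form (ract p a)) - gen (Form p) * gen (Alg a))) i j \<in> EZ"
      using EZ_econstI[OF h_dh_ext_ract[OF ij p, of a]] p ij by (simp add: simps evM_gen ev_gen_simps(2) ev_gen_Form Omega1_closed econst_simps)
  next
    fix p :: "('k, 'a) tens" assume p: "p \<in> tensor_rel s"
    show "evM (nct_emb (gen (Form p))) i j \<in> EZ"
      using h_dh_ext_rel[OF ij p] tensor_rel_Omega1[OF p] by (simp add: simps EZ_econst)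
  next
    fix p :: "('k, 'a) tens" assume p: "p \<notin> Omega1 s"
    show "evM (nct_emb (gen (Form p))) i j \<in> EZ"
      using p by (simp add: simps EZ.zero_mem)
  qed
qed

lemma evM_ideal:
  assumes p: "p \<in> nct_ideal s" and ij: "i \<in> Bs" "j \<in> Bs"
  shows "evM p i j \<in> EZ"
proof -
  have "\<forall>i\<in>Bs. \<forall>j\<in>Bs. evM p i j \<in> EZ"
    using p unfolding nct_ideal_def
  proof (induction p rule: ideal_of_induct)
    case (base u r v)
    have "evM (u * r) i j \<in> EZ" if "i \<in> Bs" "j \<in> Bs" for i j
      unfolding evM_mult[OF that(1)] using base that(2) by (auto intro!: EZ.sum_mem EZ.mult_left_mem evM_rel)
    then show ?case
      by (auto simp: evM_mult[of _ "u * r"] intro!: EZ.sum_mem EZ.mult_right_mem)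
  qed (simp_all add: linear_0[OF linear_evM] linear_add[OF linear_evM] EZ.zero_mem EZ.add_mem)
  with ij show ?thesis by blast
qed

text \<open>A word evaluates to a matrix product with one factor per letter, and the entries of the
  factor of \<open>x\<close> have the parity of \<open>nct_deg x\<close>. The Leibniz signs on both
  sides therefore agree letter by letter.\<close>

lemma evM_superderivation:
  assumes D: "superderivation nct_deg 1 D" and lin: "Vector_Spaces.linear escale escale E"
    and mult: "\<And>n p q. p \<in> eq_parity n \<Longrightarrow> E (p * q) = E p * q + (- 1) ^ n * (p * E q)"
    and gen: "\<And>x i j. i \<in> Bs \<Longrightarrow> j \<in> Bs \<Longrightarrow> E (ev_gen s Bs x i j) \<approx>\<^bsub>EZ\<^esub> evM (D (gen x)) i j"
    and ij: "i \<in> Bs" "j \<in> Bs"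
  shows "E (evM p i j) \<approx>\<^bsub>EZ\<^esub> evM (D p) i j"
  using ij
proof (induction p arbitrary: i j rule: free_alg_induct)
  case (wmon w)
  then show ?case
  proof (induction w arbitrary: i)
    case Nil
    have "(1 :: ('k, 'a, 'v) eq_forms) \<in> eq_parity 0"
      using eq_part_parity[OF eq_part_econst[OF hom_part_1]] by (simp add: econst_1)
    from mult[OF this, of 1] have "E 1 = 0" by simp
    then show ?case
      by (simp add: wmon_Nil evM_1 superderivation_1[OF D] linear_0[OF linear_evM] linear_0[OF lin] EZ.refl)
  next
    case (Cons x w)
    have g: "ev_gen s Bs x i l \<in> eq_parity (nct_deg x)" if "l \<in> Bs" for l
      by (rule eq_part_parity[OF ev_gen_part[OF Cons.prems(1) that]])
    have "E (evM (wmon (x # w)) i j) =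
        (\<Sum>l\<in>Bs. E (ev_gen s Bs x i l) * evM (wmon w) l j + (- 1) ^ nct_deg x * (ev_gen s Bs x i l * E (evM (wmon w) l j)))"
      by (simp add: evM_wmon linear_sum[OF lin] mult[OF g])
    moreover have "\<dots> \<approx>\<^bsub>EZ\<^esub> (\<Sum>l\<in>Bs. evM (D (gen x)) i l * evM (wmon w) l j +
        (- 1) ^ nct_deg x * (ev_gen s Bs x i l * evM (D (wmon w)) l j))"
      using Cons by (intro EZ.sum EZ.add EZ.mult_left EZ.mult_right gen) auto
    moreover have "\<dots> = evM (D (wmon (x # w))) i j"
      using Cons.prems
      by (simp add: wmon_Cons superderivation_gen[OF D] linear_add[OF linear_evM] linear_sign[OF linear_evM] evM_mult evM_gen
          sum.distrib sum_distrib_left)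
    ultimately show ?case by simp
  qed
next
  case (scale c p)
  from EZ_cong_escale[OF scale(1)[OF scale(2,3)], of c] show ?case
    by (simp add: linear_scale[OF linear_evM] linear_scale[OF superderivation_linear[OF D]] linear_scale[OF lin])
next
  case (add p q)
  from EZ.add[OF add(1)[OF add(3,4)] add(2)[OF add(3,4)]] show ?case
    by (simp add: linear_add[OF linear_evM] linear_add[OF superderivation_linear[OF D]] linear_add[OF lin])
qed

lemma evM_nct_d:
  assumes ij: "i \<in> Bs" "j \<in> Bs"
  shows "evM (nct_d u) i j \<approx>\<^bsub>EZ\<^esub> econst (dh u i j)"
proof -
  have "evM (nct_d u) i j = econst (h_dh 1 u i j - h_dh u 1 i j)"
    by (simp add: evM_gen[OF ij(2)] ev_gen_Form Omega1_dtens h_dh_ext_def lin_ext_simps)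
  then show ?thesis
    using EZ_cong_econst[OF K.diff[OF h_dh_rel(7,8)[OF ij]], of u u] by simp
qed

lemma lin_ext_EZ: "(\<And>u v. f u v \<approx>\<^bsub>EZ\<^esub> g u v) \<Longrightarrow>
    lin_ext escale (\<lambda>(u, v). f u v) p \<approx>\<^bsub>EZ\<^esub> lin_ext escale (\<lambda>(u, v). g u v) p"
  by (rule cong_mod_lin_ext) (auto simp: vector_space_escale EZ.add_subgroup_axioms EZ_escale)

lemma evM_form_ext: "evM (form_ext s pscale f p) i j = form_ext s escale (\<lambda>u v. evM (f u v) i j) p"
  by (simp add: form_ext_def lin_ext_linear[OF linear_evM] linear_0[OF linear_evM] case_prod_unfold)

lemma linear_form_ext:
  assumes "Vector_Spaces.linear escale escale E" "\<And>u v. E (f u v) \<approx>\<^bsub>EZ\<^esub> g u v"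
  shows "E (form_ext s escale f p) \<approx>\<^bsub>EZ\<^esub> form_ext s escale g p"
  using lin_ext_EZ[of "\<lambda>u v. E (f u v)" g p] assms(2)
  by (simp add: form_ext_def lin_ext_linear[OF assms(1)] linear_0[OF assms(1)] EZ.refl case_prod_unfold)

lemma map_pvar: "f 0 = 0 \<Longrightarrow> f 1 = 0 \<Longrightarrow> Poly_Mapping.map f (pvar x) = 0"
  by (simp add: pvar_def map_single[where f = f])

lemma ev_d_DR:
  assumes ij: "i \<in> Bs" "j \<in> Bs"
  shows "map_d (evM p i j) \<approx>\<^bsub>EZ\<^esub> evM (nct_differential s p) i j"
proof (rule evM_superderivation[OF superderivation_nct_differential linear_map[OF linear_d_DR] map_d_mult _ ij])
  fix x i j assume ij: "i \<in> Bs" "j \<in> Bs"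
  have me: "map_d (econst \<omega>) = econst (d_DR \<omega>)" for \<omega>
    by (rule map_econst[where f = d_DR, OF linear_0[OF linear_d_DR]])
  show "map_d (ev_gen s Bs x i j) \<approx>\<^bsub>EZ\<^esub> evM (nct_differential s (gen x)) i j"
  proof (cases x rule: nct_gen_cases)
    case 1
    then show ?thesis
      by (simp add: ev_gen_simps map_pvar[where f = d_DR, OF linear_0[OF linear_d_DR] d_DR_1] nct_differential_gen linear_0[OF linear_evM] EZ.refl)
  next
    case (2 a)
    then show ?thesis
      using evM_nct_d[OF ij] by (simp add: ev_gen_simps me d_DR_h nct_differential_gen EZ.sym)
  next
    case (3 p)
    have d: "map_d (econst (h_dh u v i j)) \<approx>\<^bsub>EZ\<^esub> evM (nct_d u * nct_d v) i j" for u v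
    proof -
      have "map_d (econst (h_dh u v i j)) = (\<Sum>l\<in>Bs. econst (dh u i l) * econst (dh v l j))"
        unfolding me by (simp add: h_dh_def linear_sum[OF linear_d_DR] d_DR_h_mult d_DR_gen econst_simps)
      then show ?thesis
        unfolding evM_mult[OF ij(1)] using ij by (auto intro!: EZ.sum EZ.mult EZ.sym[OF evM_nct_d])
    qed
    show ?thesis
      unfolding 3 ev_gen_simps nct_differential_gen evM_form_ext
      by (rule linear_form_ext[OF linear_map[OF linear_d_DR] d])
  qed
qed

lemma h_bracket: "gen (Fn (mat_bracket Bs pscale X (\<lambda>k l. pvar (a, k, l)) i j)) \<approx>\<^bsub>K\<^esub> mat_bracket Bs pscale X (h a) i j"
  unfolding mat_bracket_def rep_hat_def
  by (rule K.trans[OF K_Fn_sum], rule K.sum, rule K.trans[OF K_Fn_diff], rule K.diff[OF K_rel(2) K_rel(2)])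

lemma econst_bracket: "econst (mat_bracket Bs pscale X M i j) = mat_bracket Bs escale X (\<lambda>k l. econst (M k l)) i j"
  by (rule linear_mat_bracket[OF linear_econst])

lemma d_g_econst: "\<delta> (econst \<omega>) = (\<Sum>i\<in>Bs. \<Sum>j\<in>Bs. econst (\<iota> (mat_unit i j) \<omega>) * pvar (i, j))"
  by (simp add: d_g_conv map_econst[where f = "\<iota> _", OF linear_0[OF linear_contract]])

lemma d_g_dh:
  assumes kl: "k \<in> Bs" "l \<in> Bs"
  shows "\<delta> (econst (dh a k l)) \<approx>\<^bsub>EZ\<^esub> (\<Sum>r\<in>Bs. pvar (k, r) * econst (h a r l)) - (\<Sum>r\<in>Bs. econst (h a k r) * pvar (r, l))"
proof -
  have "\<delta> (econst (dh a k l)) \<approx>\<^bsub>EZ\<^esub>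
      (\<Sum>i\<in>Bs. \<Sum>j\<in>Bs. mat_bracket Bs escale (mat_unit i j) (\<lambda>k l. econst (h a k l)) k l * pvar (i, j))"
    unfolding d_g_econst contract_gen mat_vec_pvar econst_bracket[symmetric]
    by (intro EZ.sum EZ.mult_right EZ_cong_econst h_bracket)
  then show ?thesis by (simp only: mat_unit_bracket_sum[OF kl])
qed

lemma ev_i_Delta:
  assumes ij: "i \<in> Bs" "j \<in> Bs"
  shows "\<delta> (evM p i j) \<approx>\<^bsub>EZ\<^esub> evM (i_Delta s p) i j"
proof (rule evM_superderivation[OF superderivation_i_Delta linear_d_g d_g_mult _ ij])
  fix x i j assume ij: "i \<in> Bs" "j \<in> Bs"
  have h0: "\<delta> (econst (h a k l)) = 0" for a k l
    by (simp add: d_g_econst rep_hat_def contract_gen econst_simps)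
  show "\<delta> (ev_gen s Bs x i j) \<approx>\<^bsub>EZ\<^esub> evM (i_Delta s (gen x)) i j"
  proof (cases x rule: nct_gen_cases)
    case 1
    then show ?thesis
      by (simp add: ev_gen_simps d_g_conv map_pvar[where f = "\<iota> _", OF linear_0[OF linear_contract] superderivation_1[OF superderivation_contract]]
          i_Delta_gen linear_0[OF linear_evM] EZ.refl)
  next
    case (2 a)
    then show ?thesis
      by (simp add: ev_gen_simps h0 i_Delta_gen linear_0[OF linear_evM] EZ.refl)
  next
    case (3 p)
    have d: "\<delta> (econst (h_dh u v i j)) \<approx>\<^bsub>EZ\<^esub> evM (nct_Alg u * (nct_t * nct_Alg v - nct_Alg v * nct_t)) i j" for u v
    proof -
      have par: "econst (h u i l) \<in> eq_parity 0" for l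
        by (rule eq_part_parity[OF eq_part_econst[OF h_hom_part(1)]])
      have 1: "\<delta> (econst (h_dh u v i j)) = (\<Sum>l\<in>Bs. econst (h u i l) * \<delta> (econst (dh v l j)))"
        by (simp add: h_dh_def econst_simps linear_sum[OF linear_d_g] d_g_mult[OF par] h0)
      have 2: "evM (nct_Alg u * (nct_t * nct_Alg v - nct_Alg v * nct_t)) i j = (\<Sum>l\<in>Bs. econst (h u i l) *
          ((\<Sum>r\<in>Bs. pvar (l, r) * econst (h v r j)) - (\<Sum>r\<in>Bs. econst (h v l r) * pvar (r, j))))"
        using ij by (simp add: evM_mult linear_diff[OF linear_evM] evM_gen ev_gen_simps)
      show ?thesis
        unfolding 1 2 using ij by (intro EZ.sum EZ.mult_left d_g_dh) auto
    qed
    show ?thesis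
      unfolding 3 ev_gen_simps i_Delta_gen evM_form_ext
      by (rule linear_form_ext[OF linear_d_g d])
  qed
qed

lemma mat_lie_econst: "mat_lie Bs X (econst \<omega>) = econst (\<L> X \<omega>)"
  by (simp add: mat_lie_def Y_vec_econst map_econst[where f = "\<L> _", OF linear_0[OF linear_lie]])

lemma mat_lie_h: "\<L> X (h a i j) \<approx>\<^bsub>K\<^esub> mat_bracket Bs pscale X (h a) i j"
  using h_bracket by (simp add: rep_hat_def lie_gen mat_vec_pvar)

lemma mat_lie_dh: "\<L> X (dh a i j) \<approx>\<^bsub>K\<^esub> mat_bracket Bs pscale X (dh a) i j"
  using d_DR_cong[OF mat_lie_h, of X a i j]
  by (simp add: d_DR_lie d_DR_h linear_mat_bracket[OF linear_d_DR])

text \<open>Equivariance of the evaluation under conjugation, in infinitesimal form. The vector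
  field acts on the matrices of \<open>a\<close>, \<open>da\<close> and \<open>t\<close> by the
  commutator with \<open>X\<close>; words follow by the Leibniz rule, and the empty word because the
  identity matrix commutes with \<open>X\<close>.\<close>

lemma ev_lie:
  assumes ij: "i \<in> Bs" "j \<in> Bs"
  shows "mat_lie Bs X (evM p i j) \<approx>\<^bsub>EZ\<^esub> mat_bracket Bs escale X (evM p) i j"
  using ij
proof (induction p arbitrary: i j rule: free_alg_induct)
  case (scale c p)
  from EZ_cong_escale[OF scale(1)[OF scale(2,3)], of c] show ?case
    by (simp add: linear_scale[OF linear_evM] linear_scale[OF linear_mat_lie] mat_bracket_def escale.scale_sum_right
        escale.scale_right_diff_distrib mult.commute)
next
  case (add p q)
  from EZ.add[OF add(1)[OF add(3,4)] add(2)[OF add(3,4)]] show ?case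
    by (simp add: linear_add[OF linear_evM] linear_add[OF linear_mat_lie] mat_bracket_def escale.scale_right_distrib
        sum_subtractf sum.distrib algebra_simps)
next
  case (wmon w)
  note mm = mat_bracket_mult[where sc = escale, OF escale.scale_right_distrib escale_mult_left escale_mult_right]
  have gen: "mat_lie Bs X (ev_gen s Bs x i j) \<approx>\<^bsub>EZ\<^esub> mat_bracket Bs escale X (ev_gen s Bs x) i j"
    if ij: "i \<in> Bs" "j \<in> Bs" for x i j
  proof (cases x rule: nct_gen_cases)
    case 1
    then show ?thesis
      by (simp add: ev_gen_simps mat_lie_def map_pvar[where f = "\<L> _", OF linear_0[OF linear_lie] superderivation_1[OF superderivation_lie]] Y_vec_pvar EZ.refl
          mat_bracket_def)
  next
    case (2 a)
    then show ?thesis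
      using EZ_cong_econst[OF mat_lie_h, of X a i j] by (simp add: mat_bracket_def ev_gen_simps mat_lie_econst econst_simps)
  next
    case (3 p)
    have d: "mat_lie Bs X (econst (h_dh u v i j)) \<approx>\<^bsub>EZ\<^esub> econst (mat_bracket Bs pscale X (h_dh u v) i j)" for u v
    proof -
      have "\<L> X (h_dh u v i j) = (\<Sum>l\<in>Bs. \<L> X (h u i l) * dh v l j + h u i l * \<L> X (dh v l j))"
        by (simp add: h_dh_def linear_sum[OF linear_lie] superderivation_hom[OF superderivation_lie h_hom_part(1)])
      moreover have "\<dots> \<approx>\<^bsub>K\<^esub> (\<Sum>l\<in>Bs. mat_bracket Bs pscale X (h u) i l * dh v l j + h u i l * mat_bracket Bs pscale X (dh v) l j)"
        by (intro K.sum K.add K.mult_left K.mult_right mat_lie_h mat_lie_dh)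
      moreover have "\<dots> = mat_bracket Bs pscale X (h_dh u v) i j"
        unfolding h_dh_def
        by (rule mat_bracket_mult[where sc = pscale and A = "h u" and B = "dh v", OF pscale_add pscale_mult_left pscale_mult_right])
      ultimately show ?thesis by (simp add: mat_lie_econst EZ_cong_econst)
    qed
    have "mat_lie Bs X (form_ext s escale (\<lambda>u v. econst (h_dh u v i j)) p) \<approx>\<^bsub>EZ\<^esub>
        form_ext s escale (\<lambda>u v. econst (mat_bracket Bs pscale X (h_dh u v) i j)) p"
      by (rule linear_form_ext[OF linear_mat_lie d])
    moreover have "form_ext s escale (\<lambda>u v. econst (mat_bracket Bs pscale X (h_dh u v) i j)) p =
        mat_bracket Bs escale X (\<lambda>k l. form_ext s escale (\<lambda>u v. econst (h_dh u v k l)) p) i j"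
    proof -
      have "lin_ext pscale (\<lambda>x. mat_bracket Bs pscale X (g x) i j) p = mat_bracket Bs pscale X (\<lambda>k l. lin_ext pscale (\<lambda>x. g x k l) p) i j"
        for g :: "'a \<times> 'a \<Rightarrow> 'v \<Rightarrow> 'v \<Rightarrow> ('k, 'a, 'v) rep_forms"
        by (induction p rule: poly_mapping_induct_single_add)
          (simp_all add: pscale.lin_ext_single pscale.lin_ext_add mat_bracket_def pscale.scale_sum_right pscale.scale_right_diff_distrib
            mult.commute pscale_add sum_subtractf sum.distrib algebra_simps)
      then have *: "form_ext s pscale (\<lambda>u v. mat_bracket Bs pscale X (h_dh u v) i j) p =
          mat_bracket Bs pscale X (\<lambda>k l. form_ext s pscale (\<lambda>u v. h_dh u v k l) p) i j"
        by (simp add: form_ext_def case_prod_unfold) (simp add: mat_bracket_def)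
      show ?thesis unfolding form_ext_econst unfolding * by (rule econst_bracket)
    qed
    ultimately show ?thesis by (simp add: 3 ev_gen_simps mat_bracket_def)
  qed
  from wmon show ?case
  proof (induction w arbitrary: i)
    case Nil
    have "mat_bracket Bs escale X (evM 1) i j = (\<Sum>l\<in>Bs. if l = j then escale (X i j) 1 else 0) - (\<Sum>l\<in>Bs. if l = i then escale (X i j) 1 else 0)"
      unfolding mat_bracket_def sum_subtractf evM_1 by (intro arg_cong2[of _ _ _ _ minus] sum.cong) auto
    also have "\<dots> = 0" using fin Nil by simp
    finally have "mat_bracket Bs escale X (evM 1) i j = 0" .
    moreover have "mat_lie Bs X (evM 1 i j) = 0"
      using mat_lie_econst[of X 1] mat_lie_econst[of X 0]
      by (simp add: evM_1 econst_simps superderivation_1[OF superderivation_lie] linear_0[OF linear_mat_lie])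
    ultimately show ?case by (simp add: wmon_Nil EZ.refl)
  next
    case (Cons x w)
    have g: "ev_gen s Bs x i l \<in> eq_parity (nct_deg x)" if "l \<in> Bs" for l
      by (rule eq_part_parity[OF ev_gen_part[OF Cons.prems(1) that]])
    have "mat_lie Bs X (evM (wmon (x # w)) i j) =
        (\<Sum>l\<in>Bs. mat_lie Bs X (ev_gen s Bs x i l) * evM (wmon w) l j + ev_gen s Bs x i l * mat_lie Bs X (evM (wmon w) l j))"
      by (simp add: evM_wmon linear_sum[OF linear_mat_lie] mat_lie_mult[OF g])
    moreover have "\<dots> \<approx>\<^bsub>EZ\<^esub> (\<Sum>l\<in>Bs. mat_bracket Bs escale X (ev_gen s Bs x) i l * evM (wmon w) l j +
        ev_gen s Bs x i l * mat_bracket Bs escale X (evM (wmon w)) l j)"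
      using Cons by (intro EZ.sum EZ.add EZ.mult_left EZ.mult_right gen) auto
    moreover have "\<dots> = mat_bracket Bs escale X (evM (wmon (x # w))) i j"
      unfolding mm by (simp add: mat_bracket_def evM_wmon)
    ultimately show ?case by simp
  qed
qed

abbreviation "evT \<equiv> ev s Bs"

lemma linear_ev: "Vector_Spaces.linear pscale escale evT"
  by (simp add: ev_def[abs_def] linear_iff_additive vector_space_pscale vector_space_escale linear_add[OF linear_evM]
      linear_scale[OF linear_evM] sum.distrib escale.scale_sum_right)

lemma ev_part: "p \<in> nct_part n \<Longrightarrow> evT p \<in> eq_part Bs n"
  unfolding ev_def by (intro eq_part_sum evM_part)

lemma ev_differential: "map_d (evT p) \<approx>\<^bsub>EZ\<^esub> evT (nct_differential s p)"
  unfolding ev_def linear_sum[OF linear_map[OF linear_d_DR]] by (intro EZ.sum ev_d_DR)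

lemma ev_contraction: "\<delta> (evT p) \<approx>\<^bsub>EZ\<^esub> evT (i_Delta s p)"
  unfolding ev_def linear_sum[OF linear_d_g] by (intro EZ.sum ev_i_Delta)

text \<open>The trace of a commutator vanishes; the entries of \<open>X\<close> are scalars, so this
  holds for matrices of forms without any sign.\<close>

lemma ev_invariant: "mat_lie Bs X (evT p) \<in> EZ"
proof -
  have "mat_lie Bs X (evT p) \<approx>\<^bsub>EZ\<^esub> (\<Sum>i\<in>Bs. mat_bracket Bs escale X (evM p) i i)"
    unfolding ev_def linear_sum[OF linear_mat_lie] by (intro EZ.sum ev_lie)
  then show ?thesis by (simp add: mat_bracket_trace EZ.zero_iff)
qed

lemma EZ_commute:
  assumes "p \<in> eq_part Bs m" "q \<in> eq_part Bs n"
  shows "p * q \<approx>\<^bsub>EZ\<^esub> (- 1) ^ (m * n) * (q * p)"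
  using assms(1)
proof (induction p rule: eq_part_induct)
  case (single l \<omega> k)
  note s = this
  from assms(2) show ?case
  proof (induction q rule: eq_part_induct)
    case (single l' \<omega>' k')
    \<comment> \<open>The coordinates contribute even numbers to \<open>m\<close> and
      \<open>n\<close>, so \<open>k * k'\<close> and \<open>m * n\<close> have the same
      parity.\<close>
    have "(- 1) ^ (k * k') = ((- 1) ^ (m * n) :: ('k, 'a, 'v) rep_forms)"
      using s single by (auto simp: minus_one_power_iff)
    then have "\<omega> * \<omega>' - (- 1) ^ (m * n) * (\<omega>' * \<omega>) \<in> K"
      using K_commute[OF s(2) single(2)] by (simp add: cong_mod_def)
    then have "Poly_Mapping.single (l + l') (\<omega> * \<omega>' - (- 1) ^ (m * n) * (\<omega>' * \<omega>)) \<in> EZ"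
      by (rule EZ_single)
    then show ?case
      by (simp add: cong_mod_def mult_single single_sign single_diff add.commute)
  next
    case (add q r)
    from EZ.add[OF add] show ?case by (simp add: distrib_left distrib_right)
  qed (simp add: EZ.refl)
next
  case (add p r)
  from EZ.add[OF add] show ?case by (simp add: distrib_left distrib_right)
qed (simp add: EZ.refl)

lemma ev_commute:
  assumes u: "u \<in> nct_part m" and v: "v \<in> nct_part n"
  shows "evT (u * v) \<approx>\<^bsub>EZ\<^esub> (- 1) ^ (m * n) * evT (v * u)"
proof -
  have "(\<Sum>i\<in>Bs. \<Sum>l\<in>Bs. evM u i l * evM v l i) \<approx>\<^bsub>EZ\<^esub> (\<Sum>i\<in>Bs. \<Sum>l\<in>Bs. (- 1) ^ (m * n) * (evM v l i * evM u i l))"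
    by (intro EZ.sum EZ_commute evM_part u v)
  moreover have "(\<Sum>i\<in>Bs. \<Sum>l\<in>Bs. (- 1) ^ (m * n) * (evM v l i * evM u i l)) = (- 1) ^ (m * n) * evT (v * u)"
    by (subst sum.swap) (simp add: ev_def evM_mult sum_distrib_left)
  ultimately show ?thesis by (simp add: ev_def evM_mult)
qed

lemma ev_DRt_null: "p \<in> DRt_null \<Longrightarrow> evT p \<in> EZ"
proof (induction p rule: DRt_null_induct)
  case (ideal p)
  then show ?case unfolding ev_def by (intro EZ.sum_mem evM_ideal)
next
  case (commutator u v m n)
  then show ?case
    using ev_commute[OF commutator] by (simp add: linear_diff[OF linear_ev] linear_sign[OF linear_ev] cong_mod_def)
qed (simp_all add: linear_scale[OF linear_ev] linear_add[OF linear_ev] EZ_escale EZ.add_mem)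

lemma ev_cong: "p \<approx>\<^bsub>DRt_null\<^esub> q \<Longrightarrow> evT p \<approx>\<^bsub>EZ\<^esub> evT q"
  by (rule linear_cong_mod[OF linear_ev ev_DRt_null])

lemma induces_morphism_DRt: "induces_morphism (DRt_complex s) (equivariant_complex s sV Bs) evT"
proof -
  have "evT p \<in> eq_part Bs n \<and> (\<forall>x. is_endo sV x \<longrightarrow> eq_lie sV Bs x (evT p) \<in> EZ)" if "p \<in> nct_part n" for p n
    using that by (simp add: ev_part eq_lie_conv ev_invariant)
  moreover have "evT p \<in> eq_part Bs n \<inter> EZ" if "p \<in> nct_part n" "p \<in> DRt_null" for p n
    using that by (simp add: ev_part ev_DRt_null)
  moreover have "evT (nct_D p) - (map_d (evT p) + \<delta> (evT p)) \<in> eq_part Bs (Suc n) \<inter> EZ" if p: "p \<in> nct_part n" for p n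
  proof -
    have "map_d (evT p) + \<delta> (evT p) \<approx>\<^bsub>EZ\<^esub> evT (nct_D p)"
      unfolding linear_add[OF linear_ev] by (intro EZ.add ev_differential ev_contraction)
    moreover have "evT (nct_D p) - (map_d (evT p) + \<delta> (evT p)) \<in> eq_part Bs (Suc n)"
      using p by (intro eq_part_diff eq_part_add eq_part_map_d eq_part_d_g ev_part nct_D_hom_part)
    ultimately show ?thesis
      using EZ.sym by (auto simp: cong_mod_def)
  qed
  moreover have "DRt_complex s = \<lparr>scl = pscale, cyc = nct_part, nul = (\<lambda>n. {p \<in> nct_part n. p \<in> DRt_null}), dif = (\<lambda>n. nct_D)\<rparr>"
    by (simp add: DRt_complex_def DRt_null_def)
  ultimately show ?thesis
    unfolding induces_morphism_def
    using is_complex_DRt is_complex_equivariant linear_ev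
    by (auto simp: equivariant_complex_def)
qed

end


section \<open>The Hochschild complex\<close>

context assoc_algebra
begin

lemma nct_differential_square: "nct_differential s (nct_differential s p) \<in> nct_ideal s"
proof (rule superderivation_nct_cong[where e = 0 and E = "\<lambda>p. nct_differential s (nct_differential s p)"])
  note lin = superderivation_linear[OF superderivation_nct_differential]
  show "superderivation nct_deg 0 (\<lambda>p. nct_differential s (nct_differential s p))"
    using hom_part_parity[OF nct_differential_hom_part]
    by (intro superderivation_square superderivation_nct_differential) auto
  show "nct_differential s (nct_differential s nct_t) \<in> nct_ideal s"
    by (simp add: nct_differential_gen linear_0[OF lin] nct.zero_mem)
  show "nct_differential s (nct_differential s (nct_Alg a)) \<in> nct_ideal s" for a
    using nct_differential_d by (simp add: nct_differential_gen(2) nct.zero_iff)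
  show "nct_differential s (nct_differential s (nct_d a)) \<in> nct_ideal s" for a
    using nct_differential_ideal nct_differential_d by (simp add: nct.zero_iff)
qed (intro nct_differential_ideal)

lemma nct_emb_sign: "nct_emb ((- 1) ^ n) = (- 1) ^ n"
  by (cases "even n") (simp_all add: nct_emb_simps)

text \<open>The differential on forms without \<open>t\<close>. Its properties are pulled back from
  \<open>nct_differential\<close> along \<open>nct_emb\<close>, by means of
  \<open>nct_emb_ideal_iff\<close>.\<close>

definition nc_diff :: "('k, 'a) nc_forms \<Rightarrow> ('k, 'a) nc_forms" where
  "nc_diff = superder 1 nc_deg (nc_d_gen s)"

lemma superderivation_nc_diff: "superderivation nc_deg 1 nc_diff"
  unfolding nc_diff_def by (rule superderivation_superder)

lemmas linear_nc_diff = superderivation_linear[OF superderivation_nc_diff]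

lemma nc_diff_gen: "nc_diff (gen x) = nc_d_gen s x"
  by (simp add: nc_diff_def superder_gen)

lemma nct_emb_diff: "nct_emb (nc_diff p) = nct_differential s (nct_emb p)"
proof -
  note lin = superderivation_linear[OF superderivation_nct_differential]
  have "nct_emb (nc_diff (wmon w)) = nct_differential s (nct_emb (wmon w))" for w
  proof (induction w)
    case (Cons x w)
    have "nct_differential s (gen (Some x)) = nct_emb (nc_d_gen s x)"
      by (simp add: nct_differential_def superder_gen)
    with Cons show ?case
      by (simp add: wmon_Cons superderivation_gen[OF superderivation_nc_diff] superderivation_gen[OF superderivation_nct_differential]
          nc_diff_gen nct_emb_simps nct_deg_def nct_emb_sign)
  qed (simp add: wmon_Nil nct_emb_simps superderivation_1[OF superderivation_nc_diff] superderivation_1[OF superderivation_nct_differential])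
  then show ?thesis
    by (induction p rule: free_alg_induct)
      (simp_all add: nct_emb_linear linear_add[OF linear_nc_diff] linear_scale[OF linear_nc_diff] linear_add[OF lin] linear_scale[OF lin])
qed

end

text \<open>The homomorphism that sends \<open>t\<close> to 0, a left inverse of
  \<open>nct_emb\<close>. It maps one ideal into the other, so no form becomes zero upon adjoining
  \<open>t\<close>.\<close>

definition nct_retract :: "('k::field, 'a) nct_forms \<Rightarrow> ('k, 'a) nc_forms" where
  "nct_retract = lin_ext pscale (\<lambda>w. if None \<in> set (letters w) then 0 else wmon (map the (letters w)))"

lemma linear_nct_retract: "Vector_Spaces.linear pscale pscale nct_retract"
  unfolding nct_retract_def by (rule pscale.linear_lin_ext)

lemma nct_retract_wmon: "nct_retract (wmon w) = (if None \<in> set w then 0 else wmon (map the w))"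
  by (simp add: nct_retract_def wmon_def pscale.lin_ext_single pscale_single)

lemma nct_retract_mult: "nct_retract (p * q) = nct_retract p * nct_retract q"
proof (induction p rule: free_alg_induct)
  case (wmon u)
  show ?case
    by (induction q rule: free_alg_induct)
      (simp_all add: nct_retract_wmon distrib_left linear_add[OF linear_nct_retract] linear_scale[OF linear_nct_retract]
        pscale_mult_right flip: wmon_append)
qed (simp_all add: distrib_right linear_add[OF linear_nct_retract] linear_scale[OF linear_nct_retract] pscale_mult_left)

lemma nct_retract_emb: "nct_retract (nct_emb p) = p"
  by (induction p rule: free_alg_induct)
    (simp_all add: nct_emb_wmon nct_retract_wmon nct_emb_linear linear_add[OF linear_nct_retract] linear_scale[OF linear_nct_retract]
      comp_def image_iff)

lemma (in assoc_algebra) nct_emb_ideal_iff: "nct_emb p \<in> nct_ideal s \<longleftrightarrow> p \<in> nc_ideal s"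
proof
  have "nct_retract q \<in> nc_ideal s" if "q \<in> nct_ideal s" for q
    using that unfolding nct_ideal_def
  proof (induction q rule: ideal_of_induct)
    case (base u r v)
    then obtain r' where "r = nct_emb r'" "r' \<in> nc_rel s" by blast
    then show ?case by (simp add: nct_retract_mult nct_retract_emb nc_relI nc.mult_left_mem nc.mult_right_mem)
  qed (simp_all add: linear_add[OF linear_nct_retract] linear_0[OF linear_nct_retract] nc.zero_mem nc.add_mem)
  then show "nct_emb p \<in> nct_ideal s \<Longrightarrow> p \<in> nc_ideal s"
    using nct_retract_emb by metis
qed (rule nct_emb_ideal)

text \<open>The linear part in \<open>t\<close> of \<open>\<Omega>\<^sub>t A\<close> is \<open>\<Omega> A \<otimes> \<Omega> A\<close>; the map below sends \<open>u t v\<close> to \<open>v u\<close> when \<open>v\<close>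
  has degree 0, and to 0 otherwise. It extracts the Hochschild differential from \<open>i\<^sub>\<Delta>\<close>, because the
  summand of \<open>i\<^sub>\<Delta> (\<alpha> da)\<close> with no form to the right of \<open>t\<close> is \<open>\<plusminus> \<alpha> (t a - a t)\<close>.\<close>

definition cyclic_cut :: "('k::field, 'a) nct_forms \<Rightarrow> ('k, 'a) nc_forms" where
  "cyclic_cut = lin_ext pscale (\<lambda>w. let u = takeWhile (\<lambda>x. x \<noteq> None) (letters w); v = dropWhile (\<lambda>x. x \<noteq> None) (letters w) in
     if v \<noteq> [] \<and> None \<notin> set (tl v) \<and> word_deg nc_deg (map the (tl v)) = 0 then wmon (map the (tl v) @ map the u) else 0)"

lemma linear_cyclic_cut: "Vector_Spaces.linear pscale pscale cyclic_cut"
  unfolding cyclic_cut_def by (rule pscale.linear_lin_ext)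

lemmas cyclic_cut_linear = linear_add[OF linear_cyclic_cut] linear_diff[OF linear_cyclic_cut] linear_scale[OF linear_cyclic_cut]
  linear_0[OF linear_cyclic_cut] linear_minus[OF linear_cyclic_cut] linear_sign[OF linear_cyclic_cut]

lemma no_None: "None \<notin> set w \<Longrightarrow> \<exists>u. w = map Some u"
proof (induction w)
  case (Cons x w)
  then obtain y u where "x = Some y" "w = map Some u" by (cases x) auto
  then have "x # w = map Some (y # u)" by simp
  then show ?case by (rule exI)
qed simp

lemma list_None_cases:
  obtains u where "w = map Some u" | u v where "w = map Some u @ None # v"
proof (cases "None \<in> set w")
  case True
  then obtain u v where "w = u @ None # v" "None \<notin> set u" using split_list_first by fast
  then show ?thesis using no_None[of u] that(2) by blast
next
  case False
  then show ?thesis using no_None[of w] that(1) by blast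
qed

lemma cyclic_cut_wmon:
  "cyclic_cut (wmon (map Some u)) = 0"
  "cyclic_cut (wmon (map Some u @ None # v)) =
     (if None \<notin> set v \<and> word_deg nc_deg (map the v) = 0 then wmon (map the v @ u) else 0)"
proof -
  have *: "takeWhile (\<lambda>x. x \<noteq> None) (map Some u @ None # v) = map Some u" "dropWhile (\<lambda>x. x \<noteq> None) (map Some u @ None # v) = None # v"
    for u :: "'x list" and v by (induction u) auto
  have "dropWhile (\<lambda>x. x \<noteq> None) (map Some u) = []" by (induction u) auto
  then show "cyclic_cut (wmon (map Some u)) = 0"
    by (simp add: cyclic_cut_def wmon_def pscale.lin_ext_single Let_def)
  show "cyclic_cut (wmon (map Some u @ None # v)) =
     (if None \<notin> set v \<and> word_deg nc_deg (map the v) = 0 then wmon (map the v @ u) else 0)"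
    by (simp only: cyclic_cut_def wmon_def pscale.lin_ext_single Let_def word.sel *)
      (simp add: pscale_single comp_def)
qed

lemma cyclic_cut_emb: "cyclic_cut (nct_emb p) = 0"
  by (induction p rule: free_alg_induct) (simp_all add: nct_emb_wmon cyclic_cut_wmon nct_emb_linear cyclic_cut_linear)

lemma cyclic_cut_t:
  assumes "y \<in> nc_part n"
  shows "cyclic_cut (nct_emb x * (nct_t * nct_emb y)) = (if n = 0 then y * x else 0)"
proof (induction x rule: free_alg_induct)
  case (wmon u)
  from assms show ?case
  proof (induction y rule: hom_part_induct)
    case (wmon v)
    have *: "nct_emb (wmon u) * (nct_t * nct_emb (wmon v)) = wmon (map Some u @ None # map Some v)"
      by (simp add: nct_emb_wmon wmon_append wmon_Cons)
    show ?case using wmon unfolding * cyclic_cut_wmon by (auto simp: comp_def wmon_append image_iff)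
  qed (simp_all add: nct_emb_linear cyclic_cut_linear distrib_left distrib_right pscale_mult_left pscale_mult_right)
qed (simp_all add: nct_emb_linear cyclic_cut_linear distrib_left distrib_right pscale_mult_left pscale_mult_right)

text \<open>The last letter stands to the right of every \<open>t\<close>, and a form of positive
  degree there is discarded.\<close>

lemma cyclic_cut_Form: "cyclic_cut (p * gen (Some (Form q))) = 0"
proof (induction p rule: free_alg_induct)
  case (wmon w)
  have *: "wmon w * gen (Some (Form q)) = wmon (w @ [Some (Form q)])" by (simp add: wmon_append gen_conv_wmon)
  show ?case unfolding *
  proof (cases w rule: list_None_cases)
    case (1 u)
    then show "cyclic_cut (wmon (w @ [Some (Form q)])) = 0"
      using cyclic_cut_wmon(1)[of "u @ [Form q]"] by simp
  next
    case (2 u v)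
    then show "cyclic_cut (wmon (w @ [Some (Form q)])) = 0"
      using cyclic_cut_wmon(2)[of u "v @ [Some (Form q)]"] by simp
  qed
qed (simp_all add: distrib_right pscale_mult_left cyclic_cut_linear)

lemma cyclic_cut_hom_part:
  assumes "p \<in> nct_part m"
  shows "cyclic_cut p \<in> {0} \<union> nc_part (m - 2)" and "m < 2 \<Longrightarrow> cyclic_cut p = 0"
proof -
  have *: "cyclic_cut (wmon w) = 0 \<or> (2 \<le> m \<and> cyclic_cut (wmon w) \<in> nc_part (m - 2))"
    if w: "word_deg nct_deg w = m" for w :: "('a, ('b, 'a) tens) nc_gen option list"
  proof (cases w rule: list_None_cases)
    case (2 u v)
    show ?thesis
    proof (cases "None \<notin> set v")
      case True
      then obtain v' where "v = map Some v'" using no_None by blast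
      then show ?thesis
        using w 2 by (auto simp: cyclic_cut_wmon hom_part_wmon nct_deg_def comp_def)
    qed (simp add: 2 cyclic_cut_wmon)
  qed (simp add: cyclic_cut_wmon)
  have "cyclic_cut p = 0 \<or> (2 \<le> m \<and> cyclic_cut p \<in> nc_part (m - 2))"
    using assms
    by (induction p rule: hom_part_induct)
      (use * in \<open>auto simp: cyclic_cut_linear intro: hom_part_pscale hom_part_add\<close>)
  then show "cyclic_cut p \<in> {0} \<union> nc_part (m - 2)" and "m < 2 \<Longrightarrow> cyclic_cut p = 0" by auto
qed

section \<open>The Hochschild differential obtained from \<open>i_Delta\<close>\<close>

context assoc_algebra
begin

text \<open>The cut only exchanges the two sides of \<open>t\<close>, so a relation on either side
  remains a factor of the result. To the right of \<open>t\<close> the relation has to be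
  homogeneous, so that its terms are kept or discarded together.\<close>

lemma cyclic_cut_ideal: "p \<in> nct_ideal s \<Longrightarrow> cyclic_cut p \<in> nc_ideal s"
proof -
  \<comment> \<open>Words with two letters \<open>t\<close> are mapped to 0, whatever is inserted
    between \<open>u\<close> and \<open>v\<close>.\<close>
  have two: "cyclic_cut (wmon u * (nct_emb x * wmon v)) = 0"
    if "length (filter (\<lambda>x. x = None) (u @ v)) \<ge> 2" for u v and x :: "('k, 'a) nc_forms"
  proof (induction x rule: free_alg_induct)
    case (wmon w)
    have *: "wmon u * (nct_emb (wmon w) * wmon v) = wmon (u @ map Some w @ v)"
      by (simp add: nct_emb_wmon wmon_append)
    show ?case
    proof (cases "u @ map Some w @ v" rule: list_None_cases)
      case (1 z)
      have "filter (\<lambda>x. x = None) (u @ map Some w @ v) = []" unfolding 1 by simp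
      with that show ?thesis by simp
    next
      case (2 y z)
      have "length (filter (\<lambda>x. x = None) (u @ map Some w @ v)) \<ge> 2" using that by simp
      then have "filter (\<lambda>x. x = None) z \<noteq> []" unfolding 2 by auto
      then have "None \<in> set z" by (auto simp: filter_empty_conv)
      then show ?thesis unfolding * 2 by (simp add: cyclic_cut_wmon)
    qed
  qed (simp_all add: nct_emb_linear distrib_left distrib_right pscale_mult_left pscale_mult_right cyclic_cut_linear)
  have words: "cyclic_cut (wmon u * (nct_emb r * wmon v)) \<in> nc_ideal s" if r: "r \<in> nc_rel s" for u v r
  proof -
    have rI: "r \<in> nc_ideal s" by (rule nc_relI[OF r])
    obtain n where n: "r \<in> nc_part n" using nc_rel_hom[OF r] by blast
    show ?thesis
    proof (cases u rule: list_None_cases)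
      case u: (1 u')
      show ?thesis
      proof (cases v rule: list_None_cases)
        case (1 v')
        have "wmon u * (nct_emb r * wmon v) = nct_emb (wmon u' * (r * wmon v'))"
          by (simp add: u 1 nct_emb_mult nct_emb_wmon)
        then show ?thesis by (simp add: cyclic_cut_emb nc.zero_mem)
      next
        case (2 v1 v2)
        show ?thesis
        proof (cases v2 rule: list_None_cases)
          case v2: (1 v2')
          have "wmon u * (nct_emb r * wmon v) = nct_emb (wmon u' * (r * wmon v1)) * (nct_t * nct_emb (wmon v2'))"
            by (simp add: u 2 v2 nct_emb_mult nct_emb_wmon wmon_append wmon_Cons mult.assoc)
          then show ?thesis
            using cyclic_cut_t[of "wmon v2'" "word_deg nc_deg v2'" "wmon u' * (r * wmon v1)"] rI
            by (simp add: hom_part_wmon nc.zero_mem nc.mult_left_mem nc.mult_right_mem)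
        qed (use two[of u v] 2 nc.zero_mem in auto)
      qed
    next
      case u: (2 u1 u2)
      show ?thesis
      proof (cases "None \<in> set u2 \<or> None \<in> set v")
        case True
        then have "filter (\<lambda>x. x = None) (u2 @ v) \<noteq> []" by (auto simp: filter_empty_conv)
        then have "length (filter (\<lambda>x. x = None) (u @ v)) \<ge> 2"
          by (cases "filter (\<lambda>x. x = None) (u2 @ v)") (auto simp: u)
        then show ?thesis using two nc.zero_mem by simp
      next
        case False
        then obtain u2' v' where uv: "u2 = map Some u2'" "v = map Some v'"
          using no_None[of u2] no_None[of v] by blast
        let ?y = "wmon u2' * (r * wmon v')"
        have "?y \<in> nc_part (word_deg nc_deg u2' + (n + word_deg nc_deg v'))"
          by (intro hom_part_mult n) (simp_all add: hom_part_wmon)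
        moreover have "wmon u * (nct_emb r * wmon v) = nct_emb (wmon u1) * (nct_t * nct_emb ?y)"
          by (simp add: u uv nct_emb_mult nct_emb_wmon wmon_append wmon_Cons mult.assoc)
        ultimately show ?thesis
          using rI by (simp add: cyclic_cut_t nc.zero_mem nc.mult_left_mem nc.mult_right_mem)
      qed
    qed
  qed
  show "p \<in> nct_ideal s \<Longrightarrow> cyclic_cut p \<in> nc_ideal s"
    unfolding nct_ideal_def
  proof (induction p rule: ideal_of_induct)
    case (base u r v)
    then obtain r' where r: "r = nct_emb r'" "r' \<in> nc_rel s" by blast
    have "cyclic_cut (u * (r * v)) \<in> nc_ideal s"
    proof (induction u rule: free_alg_induct)
      case (wmon u)
      show ?case
        by (induction v rule: free_alg_induct)
          (simp_all add: r words distrib_left pscale_mult_right cyclic_cut_linear nc.add_mem ideal_pscale[OF nc.two_sided_ideal_axioms])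
    qed (simp_all add: distrib_right pscale_mult_left cyclic_cut_linear nc.add_mem ideal_pscale[OF nc.two_sided_ideal_axioms])
    then show ?case by (simp add: mult.assoc)
  qed (simp_all add: cyclic_cut_linear nc.zero_mem nc.add_mem)
qed

text \<open>The sign corrects the order of the factors: the cut of
  \<open>\<alpha> (t a - a t)\<close> is \<open>a \<alpha> - \<alpha> a\<close>. Being defined on
  all representatives and composed of maps that respect the ideals, \<open>hb\<close> needs no
  separate argument that it descends.\<close>

definition hb :: "('k, 'a) nc_forms \<Rightarrow> ('k, 'a) nc_forms" where
  "hb z = - cyclic_cut (i_Delta s (nct_emb z))"

lemma linear_hb: "Vector_Spaces.linear pscale pscale hb"
  unfolding hb_def
  by (rule linear_pscaleI) (simp_all add: nct_emb_linear linear_add[OF superderivation_linear[OF superderivation_i_Delta]]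
      linear_scale[OF superderivation_linear[OF superderivation_i_Delta]] cyclic_cut_linear)

lemma hb_ideal: "z \<in> nc_ideal s \<Longrightarrow> hb z \<in> nc_ideal s"
  unfolding hb_def by (intro nc.minus_mem cyclic_cut_ideal i_Delta_ideal nct_emb_ideal)

lemma hb_cong: "x \<approx>\<^bsub>nc_ideal s\<^esub> y \<Longrightarrow> hb x \<approx>\<^bsub>nc_ideal s\<^esub> hb y"
  by (rule linear_cong_mod[OF linear_hb hb_ideal])

lemma hb_hom_part: "z \<in> nc_part (Suc n) \<Longrightarrow> hb z \<in> nc_part n"
  using cyclic_cut_hom_part(1)[OF i_Delta_hom_part[OF nct_emb_hom_part, of z "Suc n"]]
  by (auto simp: hb_def hom_part_0 hom_part_minus)

lemma hb_0: "z \<in> nc_part 0 \<Longrightarrow> hb z = 0"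
  using cyclic_cut_hom_part(2)[OF i_Delta_hom_part[OF nct_emb_hom_part, of z 0]] by (simp add: hb_def)

lemma cyclic_cut_cong: "x \<approx>\<^bsub>nct_ideal s\<^esub> y \<Longrightarrow> cyclic_cut x \<approx>\<^bsub>nc_ideal s\<^esub> cyclic_cut y"
  by (rule linear_cong_mod[OF linear_cyclic_cut cyclic_cut_ideal])

lemma hb_d:
  assumes \<alpha>: "\<alpha> \<in> nc_part n"
  shows "hb (\<alpha> * nc_d a) \<approx>\<^bsub>nc_ideal s\<^esub> (- 1) ^ n * (\<alpha> * gen (Alg a) - gen (Alg a) * \<alpha>)"
proof -
  have A: "gen (Alg a) \<in> nc_part 0" and 1: "1 \<in> nc_part 0" by (simp_all add: hom_part_gen hom_part_1)
  have "i_Delta s (nct_emb (\<alpha> * nc_d a)) = i_Delta s (nct_emb \<alpha>) * nct_d a + (- 1) ^ n * (nct_emb \<alpha> * i_Delta s (nct_d a))"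
    using superderivation_hom[OF superderivation_i_Delta nct_emb_hom_part[OF \<alpha>]] by (simp add: nct_emb_simps)
  \<comment> \<open>The first summand ends in the form \<open>da\<close> and is removed by the
    cut.\<close>
  then have "cyclic_cut (i_Delta s (nct_emb (\<alpha> * nc_d a))) = (- 1) ^ n * cyclic_cut (nct_emb \<alpha> * i_Delta s (nct_d a))"
    by (simp add: cyclic_cut_linear cyclic_cut_Form)
  moreover have "cyclic_cut (nct_emb \<alpha> * i_Delta s (nct_d a)) \<approx>\<^bsub>nc_ideal s\<^esub>
      cyclic_cut (nct_emb \<alpha> * (nct_t * nct_Alg a - nct_Alg a * nct_t))"
    by (intro cyclic_cut_cong nct.mult_left i_Delta_d)
  moreover have "nct_emb \<alpha> * (nct_t * nct_Alg a - nct_Alg a * nct_t) =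
      nct_emb \<alpha> * (nct_t * nct_emb (gen (Alg a))) - nct_emb (\<alpha> * gen (Alg a)) * (nct_t * nct_emb 1)"
    by (simp add: nct_emb_simps right_diff_distrib mult.assoc)
  ultimately have "hb (\<alpha> * nc_d a) \<approx>\<^bsub>nc_ideal s\<^esub> - ((- 1) ^ n * (gen (Alg a) * \<alpha> - \<alpha> * gen (Alg a)))"
    unfolding hb_def by (simp only: cyclic_cut_linear cyclic_cut_t[OF A] cyclic_cut_t[OF 1])
      (simp add: nc.minus cong_mod_sign[OF nc.add_subgroup_axioms])
  then show ?thesis by (simp add: right_diff_distrib)
qed

lemma is_hochschild_b_hb: "is_hochschild_b s hb"
  unfolding is_hochschild_b_def
  using linear_hb hb_ideal hb_hom_part hb_0 hb_d nc.zero_mem by (auto simp: cong_mod_def)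

lemma is_hochschild_b: "is_hochschild_b s (hochschild_b s)"
  unfolding hochschild_b_def by (rule someI[of "is_hochschild_b s", OF is_hochschild_b_hb])

section \<open>Spanning families of noncommutative forms\<close>

abbreviation nc_ds :: "'a list \<Rightarrow> ('k, 'a) nc_forms" where
  "nc_ds as \<equiv> prod_list (map nc_d as)"

abbreviation nc_std :: "'a \<Rightarrow> 'a list \<Rightarrow> ('k, 'a) nc_forms" where
  "nc_std a as \<equiv> gen (Alg a) * nc_ds as"

lemma nc_ds_hom_part: "nc_ds as \<in> nc_part (length as)"
proof (induction as)
  case (Cons a as)
  have "nc_d a \<in> nc_part 1" by (simp add: hom_part_gen)
  from hom_part_mult[OF this Cons] show ?case by simp
qed (simp add: hom_part_1)

lemma nc_Alg_hom_part: "gen (Alg a) \<in> nc_part 0"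
  by (simp add: hom_part_gen)

lemma nc_std_hom_part: "nc_std a as \<in> nc_part (length as)"
  using hom_part_mult[OF nc_Alg_hom_part nc_ds_hom_part] by simp

text \<open>Predicates that can be tested on a spanning set of the quotient. The value at 0 is not
  listed, as it follows from scaling whenever some element is known to satisfy
  \<open>P\<close>.\<close>

definition nc_closed :: "(('k, 'a) nc_forms \<Rightarrow> bool) \<Rightarrow> bool" where
  "nc_closed P \<longleftrightarrow> (\<forall>x y. x \<approx>\<^bsub>nc_ideal s\<^esub> y \<longrightarrow> P y \<longrightarrow> P x) \<and> (\<forall>c x. P x \<longrightarrow> P (pscale c x)) \<and>
     (\<forall>x y. P x \<longrightarrow> P y \<longrightarrow> P (x + y))"

text \<open>The forms \<open>a_0 da_1 ... da_n\<close> span: multiplication by \<open>a\<close> from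
  the left is absorbed into \<open>a_0\<close>, and multiplication by \<open>dv\<close> is brought
  back to this shape by \<open>dv a_0 = d (v a_0) - v da_0\<close>. Linear independence is not
  claimed.\<close>

lemma nc_std_induct:
  assumes P: "nc_closed P" and std: "\<And>a as. length as = n \<Longrightarrow> P (nc_std a as)" and z: "z \<in> nc_part n"
  shows "P z"
proof -
  have wmon: "P (wmon w)" if "nc_closed P" "\<And>a as. length as = word_deg nc_deg w \<Longrightarrow> P (nc_std a as)" for w P
    using that
  proof (induction w arbitrary: P)
    case Nil
    have "wmon [] \<approx>\<^bsub>nc_ideal s\<^esub> nc_std 1 []"
      using nc.sym[OF nc_Alg(4)] by (simp add: wmon_Nil)
    moreover have "P (nc_std 1 [])" by (rule Nil(2)) simp
    ultimately show ?case using Nil(1) unfolding nc_closed_def by blast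
  next
    case (Cons x w)
    have cong: "P y \<Longrightarrow> P x" if "x \<approx>\<^bsub>nc_ideal s\<^esub> y" for x y using Cons.prems(1) that unfolding nc_closed_def by blast
    have scale: "P x \<Longrightarrow> P (pscale c x)" for c x using Cons.prems(1) unfolding nc_closed_def by blast
    have add: "P x \<Longrightarrow> P y \<Longrightarrow> P (x + y)" for x y using Cons.prems(1) unfolding nc_closed_def by blast
    \<comment> \<open>The induction hypothesis is used for \<open>P\<close> precomposed with left
      multiplication by the letter \<open>x\<close>; this is why \<open>P\<close> is kept
      arbitrary.\<close>
    have "P (gen x * wmon w)"
    proof (rule Cons.IH[of "\<lambda>z. P (gen x * z)"])
      show "nc_closed (\<lambda>z. P (gen x * z))"
        unfolding nc_closed_def
        by (auto simp: distrib_left pscale_mult_right intro: scale add cong[OF nc.mult_left])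
      fix a and as :: "'a list" assume len: "length as = word_deg nc_deg w"
      \<comment> \<open>Lists of every length exist, so there is a standard form of the required
        degree to be scaled by 0.\<close>
      have P0: "P 0"
      proof -
        obtain bs :: "'a list" where "length bs = word_deg nc_deg (x # w)" using Ex_list_of_length by blast
        from scale[OF Cons.prems(2)[OF this], of 0] show ?thesis by simp
      qed
      show "P (gen x * nc_std a as)"
      proof (cases x)
        case (Alg c)
        have "gen x * nc_std a as \<approx>\<^bsub>nc_ideal s\<^esub> nc_std (c * a) as"
          using nc.mult_right[OF nc.sym[OF nc_Alg(3)]] by (simp add: Alg mult.assoc)
        then show ?thesis by (rule cong) (rule Cons.prems(2), simp add: Alg len)
      next
        case (Form p)
        show ?thesis
        proof (cases "p \<in> Omega1 s")
          case False
          then have "gen x * nc_std a as \<approx>\<^bsub>nc_ideal s\<^esub> 0"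
            using nc.mult_right[OF nc_Form_0(2)] by (simp add: Form)
          then show ?thesis by (rule cong) (rule P0)
        next
          case True
          have uv: "P (gen (Alg u) * nc_d v * nc_std a as)" for u v
          proof -
            have "gen (Alg u) * (nc_d v * gen (Alg a)) * nc_ds as \<approx>\<^bsub>nc_ideal s\<^esub>
                gen (Alg u) * (nc_d (v * a) - gen (Alg v) * nc_d a) * nc_ds as"
              by (intro nc.mult_left nc.mult_right nc.cong_of_diff[OF nc.sym[OF nc_d_mult[of v a]]]) simp
            also have "\<dots> = gen (Alg u) * nc_ds ((v * a) # as) - (gen (Alg u) * gen (Alg v)) * nc_ds (a # as)"
              by (simp add: algebra_simps)
            also have "\<dots> \<approx>\<^bsub>nc_ideal s\<^esub> gen (Alg u) * nc_ds ((v * a) # as) - gen (Alg (u * v)) * nc_ds (a # as)"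
              by (intro nc.diff nc.refl nc.mult_right nc.sym[OF nc_Alg(3)])
            also have "\<dots> = nc_std u ((v * a) # as) + pscale (- 1) (nc_std (u * v) (a # as))"
              by simp
            finally have *: "gen (Alg u) * nc_d v * nc_std a as \<approx>\<^bsub>nc_ideal s\<^esub>
                nc_std u ((v * a) # as) + pscale (- 1) (nc_std (u * v) (a # as))"
              by (simp add: mult.assoc)
            show ?thesis
              by (rule cong[OF *]) (intro add scale Cons.prems(2); simp add: Form len)
          qed
          have sum: "P (\<Sum>y\<in>S. g y)" if "\<And>y. P (g y)" for g :: "'a \<times> 'a \<Rightarrow> ('k, 'a) nc_forms" and S
            using that by (induction S rule: infinite_finite_induct) (auto intro: P0 add)
          have "gen x * nc_std a as \<approx>\<^bsub>nc_ideal s\<^esub> lin_ext pscale (\<lambda>(u, v). gen (Alg u) * nc_d v) p * nc_std a as"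
            unfolding Form by (intro nc.mult_right nc_Form_expand True)
          moreover have "P (lin_ext pscale (\<lambda>(u, v). gen (Alg u) * nc_d v) p * nc_std a as)"
            unfolding lin_ext_def sum_distrib_right pscale_mult_left
            by (intro sum scale) (simp add: case_prod_unfold uv)
          ultimately show ?thesis by (rule cong)
        qed
      qed
    qed
    then show ?case by (simp add: wmon_Cons)
  qed
  have scale: "P x \<Longrightarrow> P (pscale c x)" and add: "P x \<Longrightarrow> P y \<Longrightarrow> P (x + y)" for c x y
    using P unfolding nc_closed_def by blast+
  obtain bs :: "'a list" where "length bs = n" using Ex_list_of_length by blast
  from scale[OF std[OF this], of 0] have P0: "P 0" by simp
  from z show ?thesis
    by (induction z rule: hom_part_induct) (auto intro: wmon P std P0 scale add)
qed

text \<open>The shape \<open>\<alpha> da\<close> in which \<open>b\<close> and Karoubi's operator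
  are given explicitly.\<close>

lemma nc_snoc_induct:
  assumes P: "nc_closed P" and snoc: "\<And>\<alpha> a. \<alpha> \<in> nc_part n \<Longrightarrow> P (\<alpha> * nc_d a)" and z: "z \<in> nc_part (Suc n)"
  shows "P z"
proof (rule nc_std_induct[OF P _ z])
  fix a and as :: "'a list" assume "length as = Suc n"
  then obtain bs b where as: "as = bs @ [b]" "length bs = n" by (metis length_Suc_conv_rev)
  have "P (nc_std a bs * nc_d b)" by (rule snoc) (use nc_std_hom_part[of a bs] as in simp)
  then show "P (nc_std a as)" by (simp add: as mult.assoc)
qed

lemma nc_closed_linear:
  assumes "Vector_Spaces.linear pscale pscale f" "\<And>z. z \<in> nc_ideal s \<Longrightarrow> f z \<in> nc_ideal s"
  shows "nc_closed (\<lambda>z. f z \<in> nc_ideal s)"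
  unfolding nc_closed_def
  using nc.mem_cong[OF linear_cong_mod[OF assms]]
  by (auto simp: linear_add[OF assms(1)] linear_scale[OF assms(1)] nc.add_mem ideal_pscale[OF nc.two_sided_ideal_axioms])

lemma nc_closed_linear_DRt:
  assumes "Vector_Spaces.linear pscale pscale f" "\<And>z. z \<in> nc_ideal s \<Longrightarrow> f z \<in> DRt_null"
  shows "nc_closed (\<lambda>z. f z \<in> DRt_null)"
  unfolding nc_closed_def
  using DRt.mem_cong[OF linear_cong_mod[OF assms]]
  by (auto simp: linear_add[OF assms(1)] linear_scale[OF assms(1)] DRt.add_mem DRt_null_pscale)

section \<open>The operators \<open>d\<close> and \<open>b\<close> on noncommutative forms, and
  Karoubi's operator\<close>

lemma nc_diff_ideal: "p \<in> nc_ideal s \<Longrightarrow> nc_diff p \<in> nc_ideal s"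
  unfolding nct_emb_ideal_iff[symmetric] nct_emb_diff by (rule nct_differential_ideal)

lemma nc_diff_diff: "nc_diff (nc_diff p) \<in> nc_ideal s"
  unfolding nct_emb_ideal_iff[symmetric] nct_emb_diff by (rule nct_differential_square)

lemma nc_diff_cong: "x \<approx>\<^bsub>nc_ideal s\<^esub> y \<Longrightarrow> nc_diff x \<approx>\<^bsub>nc_ideal s\<^esub> nc_diff y"
  by (rule linear_cong_mod[OF linear_nc_diff nc_diff_ideal])

lemma nc_diff_hom_part: "p \<in> nc_part n \<Longrightarrow> nc_diff p \<in> nc_part (Suc n)"
proof (rule superderivation_hom_part[OF superderivation_nc_diff, where k = 1 and l = 0])
  fix x :: "('a, ('k, 'a) tens) nc_gen" and m assume "nc_deg x + 1 = m + 0"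
  moreover have "(nc_d u * nc_d v :: ('k, 'a) nc_forms) \<in> nc_part 2" for u v :: 'a
    using nc_ds_hom_part[of "[u, v]"] by (simp add: numeral_2_eq_2)
  ultimately show "nc_diff (gen x) \<in> nc_part m"
    by (cases x) (auto simp: nc_diff_gen hom_part_gen numeral_2_eq_2 intro!: form_ext_hom_part)
qed simp_all

lemma nc_diff_Alg: "nc_diff (gen (Alg a)) = nc_d a"
  by (simp add: nc_diff_gen)

lemma nc_diff_d: "nc_diff (nc_d a) \<in> nc_ideal s"
  using nc_diff_diff[of "gen (Alg a)"] by (simp add: nc_diff_Alg)

lemma nc_diff_mult: "u \<in> nc_part n \<Longrightarrow> nc_diff (u * v) = nc_diff u * v + (- 1) ^ n * (u * nc_diff v)"
  using superderivation_hom[OF superderivation_nc_diff, of u n v] by simp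

lemma nc_diff_ds: "nc_diff (nc_ds as) \<in> nc_ideal s"
proof (induction as)
  case (Cons a as)
  have "nc_diff (nc_d a * nc_ds as) = nc_diff (nc_d a) * nc_ds as + (- 1) ^ 1 * (nc_d a * nc_diff (nc_ds as))"
    by (rule nc_diff_mult) (simp add: hom_part_gen)
  then show ?case
    using Cons by (simp add: nc.add_mem nc.diff_mem nc.mult_right_mem nc.mult_left_mem nc_diff_d)
qed (simp add: superderivation_1[OF superderivation_nc_diff] nc.zero_mem)

lemma nc_diff_std: "nc_diff (nc_std a as) \<approx>\<^bsub>nc_ideal s\<^esub> nc_ds (a # as)"
  using nc_diff_mult[OF nc_Alg_hom_part, of a "nc_ds as"] nc.mult_left_mem[OF nc_diff_ds[of as], of "gen (Alg a)"]
  by (simp add: nc_diff_Alg cong_mod_def)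

text \<open>By linearity it suffices to treat \<open>\<alpha> da dc\<close>. After
  \<open>da c\<close> is rewritten as \<open>d (a c) - a dc\<close>, only commutators with \<alpha>
  and its multiples are left, and they cancel. In degrees 0 and 1 the reason is that
  \<open>hb\<close> vanishes on 0-forms.\<close>

lemma hb_hb:
  assumes z: "z \<in> nc_part n"
  shows "hb (hb z) \<in> nc_ideal s"
proof (cases n)
  case 0
  then show ?thesis using z by (simp add: hb_0 linear_0[OF linear_hb] nc.zero_mem)
next
  case (Suc n')
  show ?thesis
  proof (cases n')
    case 0
    then show ?thesis using z Suc by (simp add: hb_0[OF hb_hom_part] nc.zero_mem)
  next
    case Suc': (Suc m)
    have "hb (hb (\<alpha> * nc_d a * nc_d c)) \<in> nc_ideal s" if \<alpha>: "\<alpha> \<in> nc_part m" for \<alpha> a c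
    proof -
      let ?A = "gen (Alg a)" and ?C = "gen (Alg c)"
      have A: "\<alpha> * gen (Alg b) \<in> nc_part m" "gen (Alg b) * \<alpha> \<in> nc_part m" for b
        using hom_part_mult[OF \<alpha> nc_Alg_hom_part, of b] hom_part_mult[OF nc_Alg_hom_part \<alpha>, of b] by simp_all
      have \<alpha>a: "\<alpha> * nc_d a \<in> nc_part (Suc m)"
        using hom_part_mult[OF \<alpha> nc_ds_hom_part[of "[a]"]] by simp
      have "hb (hb (\<alpha> * nc_d a * nc_d c)) \<approx>\<^bsub>nc_ideal s\<^esub> hb ((- 1) ^ Suc m * (\<alpha> * nc_d a * ?C - ?C * (\<alpha> * nc_d a)))"
        by (rule hb_cong[OF hb_d[OF \<alpha>a]])
      also have "\<dots> = (- 1) ^ Suc m * hb (\<alpha> * (nc_d a * ?C) - ?C * \<alpha> * nc_d a)"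
        by (simp only: linear_sign[OF linear_hb] mult.assoc)
      also have "\<dots> \<approx>\<^bsub>nc_ideal s\<^esub> (- 1) ^ Suc m * hb (\<alpha> * (nc_d (a * c) - ?A * nc_d c) - ?C * \<alpha> * nc_d a)"
        by (intro nc.mult_left hb_cong nc.diff nc.refl nc.cong_of_diff[OF nc.sym[OF nc_d_mult[of a c]]]) simp
      also have "\<dots> = (- 1) ^ Suc m * (hb (\<alpha> * nc_d (a * c)) - hb (\<alpha> * ?A * nc_d c) - hb (?C * \<alpha> * nc_d a))"
        by (simp add: linear_diff[OF linear_hb] right_diff_distrib mult.assoc)
      also have "\<dots> \<approx>\<^bsub>nc_ideal s\<^esub> (- 1) ^ Suc m * ((- 1) ^ m * (\<alpha> * gen (Alg (a * c)) - gen (Alg (a * c)) * \<alpha>) -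
          (- 1) ^ m * (\<alpha> * ?A * ?C - ?C * (\<alpha> * ?A)) - (- 1) ^ m * (?C * \<alpha> * ?A - ?A * (?C * \<alpha>)))"
        by (intro nc.mult_left nc.diff hb_d \<alpha> A)
      also have "\<dots> \<approx>\<^bsub>nc_ideal s\<^esub> (- 1) ^ Suc m * ((- 1) ^ m * (\<alpha> * (?A * ?C) - (?A * ?C) * \<alpha>) -
          (- 1) ^ m * (\<alpha> * ?A * ?C - ?C * (\<alpha> * ?A)) - (- 1) ^ m * (?C * \<alpha> * ?A - ?A * (?C * \<alpha>)))"
        by (intro nc.mult_left nc.diff nc.refl nc.mult_right nc_Alg(3))
      also have "\<dots> = 0"
        by (cases "even m") (simp_all add: algebra_simps)
      finally show ?thesis by (simp add: nc.zero_iff)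
    qed
    note base = this
    have lin2: "Vector_Spaces.linear pscale pscale (\<lambda>z. hb (hb z))" by (rule linear_compose[OF linear_hb linear_hb])
    have lin3: "Vector_Spaces.linear pscale pscale (\<lambda>\<beta> :: ('k, 'a) nc_forms. hb (hb (\<beta> * nc_d c)))" for c :: 'a
      by (rule linear_pscaleI) (simp_all add: distrib_right pscale_mult_left linear_add[OF linear_hb] linear_scale[OF linear_hb])
    show ?thesis
    proof (rule nc_snoc_induct[OF nc_closed_linear[OF lin2]])
      show "z \<in> nc_part (Suc (Suc m))" using z Suc Suc' by simp
      fix \<beta> :: "('k, 'a) nc_forms" and c :: 'a assume "\<beta> \<in> nc_part (Suc m)"
      then show "hb (hb (\<beta> * nc_d c)) \<in> nc_ideal s"
        by (rule nc_snoc_induct[OF nc_closed_linear[OF lin3], rotated 2]) (auto intro: base hb_ideal nc.mult_right_mem)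
    qed (auto intro: hb_ideal)
  qed
qed

text \<open>Karoubi's operator, which is \<open>\<alpha> da \<mapsto> (-1)\<^bsup>|\<alpha>|\<^esup> da \<alpha>\<close> in positive degree.\<close>

definition karoubi :: "('k, 'a) nc_forms \<Rightarrow> ('k, 'a) nc_forms" where
  "karoubi z = z - hb (nc_diff z) - nc_diff (hb z)"

lemma linear_karoubi: "Vector_Spaces.linear pscale pscale karoubi"
  unfolding karoubi_def
  by (rule linear_pscaleI) (simp_all add: linear_add[OF linear_hb] linear_scale[OF linear_hb] linear_add[OF linear_nc_diff]
      linear_scale[OF linear_nc_diff] pscale.scale_right_diff_distrib)

lemma karoubi_ideal: "z \<in> nc_ideal s \<Longrightarrow> karoubi z \<in> nc_ideal s"
  unfolding karoubi_def by (intro nc.diff_mem hb_ideal nc_diff_ideal)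

lemma karoubi_hom_part: "z \<in> nc_part n \<Longrightarrow> karoubi z \<in> nc_part n"
proof -
  assume z: "z \<in> nc_part n"
  have "nc_diff (hb z) \<in> nc_part n"
  proof (cases n)
    case 0
    then show ?thesis using z by (simp add: hb_0 linear_0[OF linear_nc_diff] hom_part_0)
  next
    case (Suc m)
    then show ?thesis using z by (auto intro: nc_diff_hom_part hb_hom_part)
  qed
  then show ?thesis
    unfolding karoubi_def by (intro hom_part_diff z hb_hom_part nc_diff_hom_part)
qed

text \<open>In \<open>b d + d b\<close> the terms containing \<open>d \<alpha>\<close> cancel,
  leaving \<open>\<alpha> da - (-1)^n da \<alpha>\<close>.\<close>

lemma karoubi_d:
  assumes \<alpha>: "\<alpha> \<in> nc_part n"
  shows "karoubi (\<alpha> * nc_d a) \<approx>\<^bsub>nc_ideal s\<^esub> (- 1) ^ n * (nc_d a * \<alpha>)"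
proof -
  let ?A = "gen (Alg a)" and ?d = nc_diff
  have "?d (\<alpha> * nc_d a) \<approx>\<^bsub>nc_ideal s\<^esub> ?d \<alpha> * nc_d a + (- 1) ^ n * (\<alpha> * 0)"
    unfolding nc_diff_mult[OF \<alpha>] by (intro nc.add nc.refl nc.mult_left) (simp add: nc.zero_iff nc_diff_d)
  then have 1: "hb (?d (\<alpha> * nc_d a)) \<approx>\<^bsub>nc_ideal s\<^esub> (- 1) ^ Suc n * (?d \<alpha> * ?A - ?A * ?d \<alpha>)"
    using nc.trans[OF hb_cong hb_d[OF nc_diff_hom_part[OF \<alpha>]]] by simp
  have "?d (hb (\<alpha> * nc_d a)) \<approx>\<^bsub>nc_ideal s\<^esub> ?d ((- 1) ^ n * (\<alpha> * ?A - ?A * \<alpha>))"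
    by (rule nc_diff_cong[OF hb_d[OF \<alpha>]])
  also have "\<dots> = (- 1) ^ n * (?d \<alpha> * ?A + (- 1) ^ n * (\<alpha> * nc_d a) - (nc_d a * \<alpha> + ?A * ?d \<alpha>))"
    unfolding linear_sign[OF linear_nc_diff] linear_diff[OF linear_nc_diff] nc_diff_mult[OF \<alpha>] nc_diff_mult[OF nc_Alg_hom_part] nc_diff_Alg
    by simp
  finally have 2: "?d (hb (\<alpha> * nc_d a)) \<approx>\<^bsub>nc_ideal s\<^esub>
      (- 1) ^ n * (?d \<alpha> * ?A + (- 1) ^ n * (\<alpha> * nc_d a) - (nc_d a * \<alpha> + ?A * ?d \<alpha>))" .
  have "karoubi (\<alpha> * nc_d a) \<approx>\<^bsub>nc_ideal s\<^esub> \<alpha> * nc_d a - (- 1) ^ Suc n * (?d \<alpha> * ?A - ?A * ?d \<alpha>) -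
      (- 1) ^ n * (?d \<alpha> * ?A + (- 1) ^ n * (\<alpha> * nc_d a) - (nc_d a * \<alpha> + ?A * ?d \<alpha>))"
    unfolding karoubi_def by (intro nc.diff nc.refl 1 2)
  also have "\<dots> = (- 1) ^ n * (nc_d a * \<alpha>)"
    by (cases "even n") (simp_all add: algebra_simps)
  finally show ?thesis .
qed

text \<open>The two sides differ by \<open>d b b - b b d\<close>.\<close>

lemma karoubi_hb: "z \<in> nc_part n \<Longrightarrow> hb (karoubi z) \<approx>\<^bsub>nc_ideal s\<^esub> karoubi (hb z)"
proof -
  assume z: "z \<in> nc_part n"
  have "hb (hb (nc_diff z)) \<in> nc_ideal s" "nc_diff (hb (hb z)) \<in> nc_ideal s"
    using hb_hb[OF nc_diff_hom_part[OF z]] nc_diff_ideal[OF hb_hb[OF z]] by simp_all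
  then have "nc_diff (hb (hb z)) - hb (hb (nc_diff z)) \<in> nc_ideal s" by (rule nc.diff_mem[rotated])
  then show ?thesis
    by (simp add: karoubi_def linear_diff[OF linear_hb] linear_add[OF linear_hb] cong_mod_def algebra_simps)
qed

lemma karoubi_diff: "nc_diff (karoubi z) \<approx>\<^bsub>nc_ideal s\<^esub> karoubi (nc_diff z)"
proof -
  have "hb (nc_diff (nc_diff z)) - nc_diff (nc_diff (hb z)) \<in> nc_ideal s"
    by (intro nc.diff_mem hb_ideal nc_diff_diff)
  then show ?thesis
    by (simp add: karoubi_def linear_diff[OF linear_nc_diff] linear_add[OF linear_nc_diff] cong_mod_def algebra_simps)
qed

section \<open>Powers of Karoubi's operator and the construction of \<open>B\<close>\<close>

lemma linear_karoubi_pow: "Vector_Spaces.linear pscale pscale (karoubi ^^ i)"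
proof (induction i)
  case (Suc i)
  show ?case using linear_compose[OF Suc linear_karoubi] by (simp add: comp_def)
qed (simp add: linear_iff_additive vector_space_pscale)

lemma karoubi_pow_ideal: "z \<in> nc_ideal s \<Longrightarrow> (karoubi ^^ i) z \<in> nc_ideal s"
  by (induction i) (auto intro: karoubi_ideal)

lemma karoubi_pow_cong: "x \<approx>\<^bsub>nc_ideal s\<^esub> y \<Longrightarrow> (karoubi ^^ i) x \<approx>\<^bsub>nc_ideal s\<^esub> (karoubi ^^ i) y"
  by (rule linear_cong_mod[OF linear_karoubi_pow karoubi_pow_ideal])

lemma karoubi_cong: "x \<approx>\<^bsub>nc_ideal s\<^esub> y \<Longrightarrow> karoubi x \<approx>\<^bsub>nc_ideal s\<^esub> karoubi y"
  by (rule linear_cong_mod[OF linear_karoubi karoubi_ideal])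

lemma karoubi_pow_hom_part: "z \<in> nc_part n \<Longrightarrow> (karoubi ^^ i) z \<in> nc_part n"
  by (induction i) (auto intro: karoubi_hom_part)

lemma karoubi_pow_hb: "z \<in> nc_part n \<Longrightarrow> hb ((karoubi ^^ i) z) \<approx>\<^bsub>nc_ideal s\<^esub> (karoubi ^^ i) (hb z)"
proof (induction i)
  case (Suc i)
  show ?case
    using nc.trans[OF karoubi_hb[OF karoubi_pow_hom_part[OF Suc.prems]] karoubi_cong[OF Suc.IH[OF Suc.prems]]] by simp
qed (simp add: nc.refl)

lemma karoubi_pow_diff: "nc_diff ((karoubi ^^ i) z) \<approx>\<^bsub>nc_ideal s\<^esub> (karoubi ^^ i) (nc_diff z)"
proof (induction i)
  case (Suc i)
  show ?case
    using nc.trans[OF karoubi_diff karoubi_cong[OF Suc.IH]] by simp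
qed (simp add: nc.refl)

text \<open>Each application moves the last factor \<open>da\<close> past a form of degree
  \<open>n\<close>, one less than the total degree, at the cost of the sign
  \<open>(-1)^n\<close>.\<close>

lemma karoubi_pow_ds:
  "w \<in> nc_part m \<Longrightarrow> m + length as = Suc n \<Longrightarrow>
    (karoubi ^^ length as) (w * nc_ds as) \<approx>\<^bsub>nc_ideal s\<^esub> (- 1) ^ (n * length as) * (nc_ds as * w)"
proof (induction as arbitrary: w m rule: rev_induct)
  case (snoc a as)
  have w: "w * nc_ds as \<in> nc_part n"
    using hom_part_mult[OF snoc.prems(1) nc_ds_hom_part, of as] snoc.prems(2) by simp
  have dw: "nc_d a * w \<in> nc_part (Suc m)"
    using hom_part_mult[OF nc_ds_hom_part[of "[a]"] snoc.prems(1)] by simp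
  have "(karoubi ^^ length (as @ [a])) (w * nc_ds (as @ [a])) = (karoubi ^^ length as) (karoubi (w * nc_ds as * nc_d a))"
    by (simp add: funpow_swap1 mult.assoc)
  also have "\<dots> \<approx>\<^bsub>nc_ideal s\<^esub> (karoubi ^^ length as) ((- 1) ^ n * (nc_d a * (w * nc_ds as)))"
    by (rule karoubi_pow_cong[OF karoubi_d[OF w]])
  also have "\<dots> = (- 1) ^ n * (karoubi ^^ length as) ((nc_d a * w) * nc_ds as)"
    by (simp add: linear_sign[OF linear_karoubi_pow] mult.assoc)
  also have "\<dots> \<approx>\<^bsub>nc_ideal s\<^esub> (- 1) ^ n * ((- 1) ^ (n * length as) * (nc_ds as * (nc_d a * w)))"
    using snoc.prems(2) by (intro nc.mult_left snoc.IH[OF dw]) simp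
  also have "\<dots> = (- 1) ^ (n * length (as @ [a])) * (nc_ds (as @ [a]) * w)"
    by (simp add: sign_mult_sign mult.assoc)
  finally show ?case .
qed (simp add: nc.refl)

text \<open>The number of summands \<open>\<kappa>^i d\<close> depends on the degree, so the
  operator is defined on words and extended linearly; \<open>cB_eq\<close> gives the formula on
  homogeneous forms.\<close>

definition cB :: "('k, 'a) nc_forms \<Rightarrow> ('k, 'a) nc_forms" where
  "cB = lin_ext pscale (\<lambda>w. \<Sum>i\<le>word_deg nc_deg (letters w). (karoubi ^^ i) (nc_diff (wmon (letters w))))"

lemma linear_cB: "Vector_Spaces.linear pscale pscale cB"
  unfolding cB_def by (rule pscale.linear_lin_ext)

lemma cB_eq: "z \<in> nc_part n \<Longrightarrow> cB z = (\<Sum>i\<le>n. (karoubi ^^ i) (nc_diff z))"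
proof (induction z rule: hom_part_induct)
  case (wmon w)
  then show ?case by (simp add: cB_def wmon_def pscale.lin_ext_single)
qed (simp_all add: linear_scale[OF linear_cB] linear_add[OF linear_cB] linear_0[OF linear_cB] linear_scale[OF linear_nc_diff]
    linear_add[OF linear_nc_diff] linear_0[OF linear_nc_diff] linear_scale[OF linear_karoubi_pow] linear_add[OF linear_karoubi_pow]
    linear_0[OF linear_karoubi_pow] pscale.scale_sum_right sum.distrib)

lemma cB_hom_part: "z \<in> nc_part n \<Longrightarrow> cB z \<in> nc_part (Suc n)"
  by (simp add: cB_eq) (intro hom_part_sum karoubi_pow_hom_part nc_diff_hom_part)

text \<open>Multiples of a relation by words are homogeneous, so \<open>cB_eq\<close> applies to
  them although not to every element of the ideal.\<close>

lemma cB_ideal: "p \<in> nc_ideal s \<Longrightarrow> cB p \<in> nc_ideal s"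
proof -
  have words: "cB (wmon u * (r * wmon v)) \<in> nc_ideal s" if r: "r \<in> nc_rel s" for u v r
  proof -
    obtain n where "r \<in> nc_part n" using nc_rel_hom[OF r] by blast
    then have "wmon u * (r * wmon v) \<in> nc_part (word_deg nc_deg u + (n + word_deg nc_deg v))"
      by (intro hom_part_mult) (simp_all add: hom_part_wmon)
    moreover have "wmon u * (r * wmon v) \<in> nc_ideal s"
      by (intro nc.mult_left_mem nc.mult_right_mem nc_relI r)
    ultimately show ?thesis
      by (simp add: cB_eq nc.sum_mem karoubi_pow_ideal nc_diff_ideal)
  qed
  assume p: "p \<in> nc_ideal s"
  show "cB p \<in> nc_ideal s"
  proof (rule ideal_of_induct[OF p[unfolded nc_ideal_def], where P = "\<lambda>p. cB p \<in> nc_ideal s"], goal_cases)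
    case (1 u r v)
    have "cB (u * (r * v)) \<in> nc_ideal s"
    proof (induction u rule: free_alg_induct)
      case (wmon u)
      show ?case
        by (induction v rule: free_alg_induct)
          (simp_all add: 1 words distrib_left pscale_mult_right linear_add[OF linear_cB] linear_scale[OF linear_cB] nc.add_mem
            ideal_pscale[OF nc.two_sided_ideal_axioms])
    qed (simp_all add: distrib_right pscale_mult_left linear_add[OF linear_cB] linear_scale[OF linear_cB] nc.add_mem
        ideal_pscale[OF nc.two_sided_ideal_axioms])
    then show ?case by (simp add: mult.assoc)
  qed (simp_all add: linear_add[OF linear_cB] linear_0[OF linear_cB] nc.zero_mem nc.add_mem)
qed

lemma cB_cong: "x \<approx>\<^bsub>nc_ideal s\<^esub> y \<Longrightarrow> cB x \<approx>\<^bsub>nc_ideal s\<^esub> cB y"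
  by (rule linear_cong_mod[OF linear_cB cB_ideal])

text \<open>\<open>\<kappa>\<close> rotates a product of exact forms to the right, whereas the formula for \<open>B\<close> rotates to the left; the
  two sums agree because \<open>\<kappa>\<^bsup>n+1\<^esup> = 1\<close> on products of \<open>n + 1\<close> exact forms.\<close>

lemma cB_std:
  "cB (nc_std a as) \<approx>\<^bsub>nc_ideal s\<^esub> (\<Sum>i\<le>length as. (- 1) ^ (length as * i) * nc_ds (rotate i (a # as)))"
proof -
  define n where "n = length as"
  define c where "c = a # as"
  have len: "length c = Suc n" by (simp add: c_def n_def)
  let ?f = "\<lambda>i. (karoubi ^^ i) (nc_ds c)"
  \<comment> \<open>A full turn carries no sign, because \<open>n * Suc n\<close> is even.\<close>
  have per: "(karoubi ^^ Suc n) (nc_ds b) \<approx>\<^bsub>nc_ideal s\<^esub> nc_ds b" if "length b = Suc n" for b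
  proof -
    have "(karoubi ^^ length b) (1 * nc_ds b) \<approx>\<^bsub>nc_ideal s\<^esub> (- 1) ^ (n * length b) * (nc_ds b * 1)"
      by (rule karoubi_pow_ds[OF hom_part_1]) (simp add: that)
    moreover have "(- 1) ^ (n * Suc n) = (1 :: ('k, 'a) nc_forms)" by (subst minus_one_power_iff) simp
    ultimately show ?thesis by (simp only: that mult_1 mult_1_right)
  qed
  \<comment> \<open>\<open>\<kappa>^i\<close> undoes the rotation by \<open>i\<close> up to sign.
    Applying the remaining \<open>n + 1 - i\<close> powers completes a full turn and expresses the
    rotated product through the original one.\<close>
  have rot: "?f (Suc n - i) \<approx>\<^bsub>nc_ideal s\<^esub> (- 1) ^ (n * i) * nc_ds (rotate i c)" if i: "i \<le> n" for i
  proof -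
    have r: "rotate i c = drop i c @ take i c" using i len by (simp add: rotate_drop_take)
    have "length (drop i c) + length (take i c) = Suc n" "length (take i c) = i" using i len by auto
    then have "(karoubi ^^ i) (nc_ds (rotate i c)) \<approx>\<^bsub>nc_ideal s\<^esub> (- 1) ^ (n * i) * nc_ds c"
      using karoubi_pow_ds[OF nc_ds_hom_part[of "drop i c"], of "take i c" n] unfolding r
      by (simp flip: prod_list.append map_append)
    then have 1: "(karoubi ^^ (Suc n - i)) ((- 1) ^ (n * i) * (karoubi ^^ i) (nc_ds (rotate i c))) \<approx>\<^bsub>nc_ideal s\<^esub>
        (karoubi ^^ (Suc n - i)) ((- 1) ^ (n * i) * ((- 1) ^ (n * i) * nc_ds c))"
      by (intro karoubi_pow_cong nc.mult_left)
    have 2: "(- 1) ^ (n * i) * ((- 1) ^ (n * i) * nc_ds c) = nc_ds c"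
      by (cases "even (n * i)") simp_all
    have 3: "(karoubi ^^ (Suc n - i)) ((- 1) ^ (n * i) * (karoubi ^^ i) (nc_ds (rotate i c))) =
        (- 1) ^ (n * i) * (karoubi ^^ Suc n) (nc_ds (rotate i c))"
    proof -
      have "(karoubi ^^ (Suc n - i)) ((karoubi ^^ i) x) = (karoubi ^^ Suc n) x" for x
        using funpow_add[of "Suc n - i" i karoubi] i by simp
      then show ?thesis by (simp only: linear_sign[OF linear_karoubi_pow])
    qed
    have 4: "(- 1) ^ (n * i) * (karoubi ^^ Suc n) (nc_ds (rotate i c)) \<approx>\<^bsub>nc_ideal s\<^esub> (- 1) ^ (n * i) * nc_ds (rotate i c)"
      by (intro nc.mult_left per) (simp add: len)
    show ?thesis by (rule nc.trans[OF nc.sym[OF 1[unfolded 2 3]] 4])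
  qed
  have "cB (nc_std a as) = (\<Sum>i\<le>n. (karoubi ^^ i) (nc_diff (nc_std a as)))"
    unfolding n_def by (rule cB_eq[OF nc_std_hom_part])
  also have "\<dots> \<approx>\<^bsub>nc_ideal s\<^esub> (\<Sum>i\<le>n. ?f i)"
    unfolding c_def by (intro nc.sum karoubi_pow_cong nc_diff_std)
  \<comment> \<open>The terms at \<open>0\<close> and \<open>n + 1\<close> agree, so the sum may be
    shifted by one; reversing its order then matches the rotations of the formula for
    \<open>B\<close>.\<close>
  also have "\<dots> = (\<Sum>i\<le>n. ?f (Suc i)) + ?f 0 - ?f (Suc n)"
    using sum.atMost_Suc_shift[of ?f n] sum.atMost_Suc[of ?f n] by (simp add: algebra_simps)
  also have "\<dots> \<approx>\<^bsub>nc_ideal s\<^esub> (\<Sum>i\<le>n. ?f (Suc i)) + ?f 0 - ?f 0"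
    by (intro nc.diff nc.refl) (use per[OF len] in simp)
  also have "\<dots> = (\<Sum>i\<le>n. ?f (Suc n - i))"
  proof -
    have "(\<Sum>i<Suc n. ?f (Suc i)) = (\<Sum>i<Suc n. ?f (Suc (Suc n - Suc i)))"
      by (rule sum.nat_diff_reindex[symmetric])
    also have "\<dots> = (\<Sum>i<Suc n. ?f (Suc n - i))"
      by (intro sum.cong refl) (simp only: lessThan_iff Suc_diff_Suc)
    finally show ?thesis by (simp only: lessThan_Suc_atMost add_diff_cancel_right')
  qed
  also have "\<dots> \<approx>\<^bsub>nc_ideal s\<^esub> (\<Sum>i\<le>n. (- 1) ^ (n * i) * nc_ds (rotate i c))"
    by (rule nc.sum) (simp add: rot)
  finally show ?thesis unfolding n_def c_def .
qed

lemma is_connes_B_cB: "is_connes_B s cB"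
  unfolding is_connes_B_def
  by (intro conjI allI image_subsetI linear_cB cB_ideal cB_hom_part cB_std[unfolded cong_mod_def])

lemma is_connes_B: "is_connes_B s (connes_B s)"
  unfolding connes_B_def by (rule someI[of "is_connes_B s", OF is_connes_B_cB])

section \<open>Agreement of the chosen operators with the constructed ones\<close>

lemma
  shows linear_hochschild_b: "Vector_Spaces.linear pscale pscale (hochschild_b s)"
    and hochschild_b_ideal: "z \<in> nc_ideal s \<Longrightarrow> hochschild_b s z \<in> nc_ideal s"
    and hochschild_b_hom_part: "z \<in> nc_part (Suc n) \<Longrightarrow> hochschild_b s z \<in> nc_part n"
    and hochschild_b_0: "z \<in> nc_part 0 \<Longrightarrow> hochschild_b s z \<in> nc_ideal s"
    and hochschild_b_d: "\<alpha> \<in> nc_part n \<Longrightarrow>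
      hochschild_b s (\<alpha> * nc_d a) \<approx>\<^bsub>nc_ideal s\<^esub> (- 1) ^ n * (\<alpha> * gen (Alg a) - gen (Alg a) * \<alpha>)"
  using is_hochschild_b by (simp_all add: is_hochschild_b_def cong_mod_def image_subset_iff)

lemma
  shows linear_connes_B: "Vector_Spaces.linear pscale pscale (connes_B s)"
    and connes_B_ideal: "z \<in> nc_ideal s \<Longrightarrow> connes_B s z \<in> nc_ideal s"
    and connes_B_hom_part: "z \<in> nc_part n \<Longrightarrow> connes_B s z \<in> nc_part (Suc n)"
    and connes_B_std: "connes_B s (nc_std a as) \<approx>\<^bsub>nc_ideal s\<^esub>
      (\<Sum>i\<le>length as. (- 1) ^ (length as * i) * nc_ds (rotate i (a # as)))"
  using is_connes_B by (simp_all only: is_connes_B_def cong_mod_def image_subset_iff)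

lemma hochschild_b_cong: "x \<approx>\<^bsub>nc_ideal s\<^esub> y \<Longrightarrow> hochschild_b s x \<approx>\<^bsub>nc_ideal s\<^esub> hochschild_b s y"
  by (rule linear_cong_mod[OF linear_hochschild_b hochschild_b_ideal])

text \<open>Only the class of \<open>hochschild_b s z\<close> modulo the ideal is determined, and
  that by the values on forms \<open>\<alpha> da\<close>, which span in positive degree.\<close>

lemma hochschild_b_eq:
  assumes z: "z \<in> nc_part n"
  shows "hochschild_b s z \<approx>\<^bsub>nc_ideal s\<^esub> hb z"
proof (cases n)
  case 0
  then show ?thesis using hochschild_b_0 hb_0 z by (simp add: nc.zero_iff)
next
  case (Suc m)
  have "hochschild_b s z - hb z \<in> nc_ideal s"
  proof (rule nc_snoc_induct[OF nc_closed_linear[where f = "(\<lambda>z. hochschild_b s z - hb z)"]])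
    show "Vector_Spaces.linear pscale pscale (\<lambda>z. hochschild_b s z - hb z)"
      by (rule linear_pscaleI) (simp_all add: linear_add[OF linear_hochschild_b] linear_scale[OF linear_hochschild_b]
          linear_add[OF linear_hb] linear_scale[OF linear_hb] pscale.scale_right_diff_distrib)
    show "hochschild_b s z - hb z \<in> nc_ideal s" if "z \<in> nc_ideal s" for z
      using that by (intro nc.diff_mem hochschild_b_ideal hb_ideal)
    show "z \<in> nc_part (Suc m)" using z Suc by simp
    fix \<alpha> :: "('k, 'a) nc_forms" and a :: 'a assume \<alpha>: "\<alpha> \<in> nc_part m"
    from nc.trans[OF hochschild_b_d[OF \<alpha>] nc.sym[OF hb_d[OF \<alpha>]]]
    show "hochschild_b s (\<alpha> * nc_d a) - hb (\<alpha> * nc_d a) \<in> nc_ideal s" by (simp add: cong_mod_def)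
  qed
  then show ?thesis by (simp add: cong_mod_def)
qed

lemma connes_B_eq:
  assumes z: "z \<in> nc_part n"
  shows "connes_B s z \<approx>\<^bsub>nc_ideal s\<^esub> cB z"
proof -
  have "connes_B s z - cB z \<in> nc_ideal s"
  proof (rule nc_std_induct[OF nc_closed_linear[where f = "(\<lambda>z. connes_B s z - cB z)"] _ z])
    show "Vector_Spaces.linear pscale pscale (\<lambda>z. connes_B s z - cB z)"
      by (rule linear_pscaleI) (simp_all add: linear_add[OF linear_connes_B] linear_scale[OF linear_connes_B]
          linear_add[OF linear_cB] linear_scale[OF linear_cB] pscale.scale_right_diff_distrib)
    show "connes_B s z - cB z \<in> nc_ideal s" if "z \<in> nc_ideal s" for z
      using that by (intro nc.diff_mem connes_B_ideal cB_ideal)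
    fix a :: 'a and as :: "'a list"
    from nc.trans[OF connes_B_std nc.sym[OF cB_std]]
    show "connes_B s (nc_std a as) - cB (nc_std a as) \<in> nc_ideal s" by (simp add: cong_mod_def)
  qed
  then show ?thesis by (simp add: cong_mod_def)
qed

text \<open>The identity \<open>\<kappa>^n = 1 + b \<kappa>^n d\<close> of Cuntz and Quillen. For a
  product \<open>D\<close> of \<open>n\<close> exact forms, \<open>\<kappa>^n (a D) = D a\<close>,
  while \<open>b \<kappa>^n d (a D)\<close> is the commutator \<open>D a - a D\<close>.\<close>

lemma karoubi_pow_degree:
  assumes z: "z \<in> nc_part n"
  shows "(karoubi ^^ n) z - hb ((karoubi ^^ n) (nc_diff z)) \<approx>\<^bsub>nc_ideal s\<^esub> z"
proof -
  have "(karoubi ^^ n) z - hb ((karoubi ^^ n) (nc_diff z)) - z \<in> nc_ideal s"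
  proof (rule nc_std_induct[OF nc_closed_linear[where f = "(\<lambda>z. (karoubi ^^ n) z - hb ((karoubi ^^ n) (nc_diff z)) - z)"] _ z])
    show "Vector_Spaces.linear pscale pscale (\<lambda>z. (karoubi ^^ n) z - hb ((karoubi ^^ n) (nc_diff z)) - z)"
      by (rule linear_pscaleI) (simp_all add: linear_add[OF linear_karoubi_pow] linear_scale[OF linear_karoubi_pow]
          linear_add[OF linear_hb] linear_scale[OF linear_hb] linear_add[OF linear_nc_diff] linear_scale[OF linear_nc_diff]
          pscale.scale_right_diff_distrib)
    show "(karoubi ^^ n) z - hb ((karoubi ^^ n) (nc_diff z)) - z \<in> nc_ideal s" if "z \<in> nc_ideal s" for z
      using that by (intro nc.diff_mem hb_ideal karoubi_pow_ideal nc_diff_ideal)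
    fix a :: 'a and as :: "'a list" assume len: "length as = n"
    let ?D = "nc_ds as" and ?A = "gen (Alg a)"
    have D: "?D \<in> nc_part n" using nc_ds_hom_part[of as] len by simp
    have 1: "(karoubi ^^ n) (nc_std a as) \<approx>\<^bsub>nc_ideal s\<^esub> ?D * ?A"
    proof (cases n)
      case 0
      then show ?thesis using len by (simp add: nc.refl)
    next
      case (Suc m)
      \<comment> \<open>Each of the \<open>n\<close> rotations contributes \<open>(-1)^m\<close>
        with \<open>m = n - 1\<close>, in total no sign.\<close>
      have "even (m * n)" using Suc by simp
      then show ?thesis using karoubi_pow_ds[OF nc_Alg_hom_part, of as m a] len Suc by simp
    qed
    have d: "(nc_d a :: ('k, 'a) nc_forms) \<in> nc_part 1" using nc_ds_hom_part[of "[a]"] by simp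
    have "(karoubi ^^ n) (nc_diff (nc_std a as)) \<approx>\<^bsub>nc_ideal s\<^esub> (- 1) ^ n * (?D * nc_d a)"
    proof -
      have "(karoubi ^^ n) (nc_diff (nc_std a as)) \<approx>\<^bsub>nc_ideal s\<^esub> (karoubi ^^ n) (nc_d a * ?D)"
        using karoubi_pow_cong[OF nc_diff_std] by simp
      moreover have "(karoubi ^^ n) (nc_d a * ?D) \<approx>\<^bsub>nc_ideal s\<^esub> (- 1) ^ n * (?D * nc_d a)"
        using karoubi_pow_ds[OF d, of as n] len by (simp add: minus_one_power_iff)
      ultimately show ?thesis by (rule nc.trans)
    qed
    then have "hb ((karoubi ^^ n) (nc_diff (nc_std a as))) \<approx>\<^bsub>nc_ideal s\<^esub> hb ((- 1) ^ n * (?D * nc_d a))"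
      by (rule hb_cong)
    also have "\<dots> = (- 1) ^ n * hb (?D * nc_d a)" by (simp add: linear_sign[OF linear_hb])
    also have "\<dots> \<approx>\<^bsub>nc_ideal s\<^esub> (- 1) ^ n * ((- 1) ^ n * (?D * ?A - ?A * ?D))"
      by (intro nc.mult_left hb_d D)
    also have "\<dots> = ?D * ?A - ?A * ?D" by (cases "even n") simp_all
    finally have 2: "hb ((karoubi ^^ n) (nc_diff (nc_std a as))) \<approx>\<^bsub>nc_ideal s\<^esub> ?D * ?A - ?A * ?D" .
    have "(karoubi ^^ n) (nc_std a as) - hb ((karoubi ^^ n) (nc_diff (nc_std a as))) \<approx>\<^bsub>nc_ideal s\<^esub> nc_std a as"
      using nc.diff[OF 1 2] by simp
    then show "(karoubi ^^ n) (nc_std a as) - hb ((karoubi ^^ n) (nc_diff (nc_std a as))) - nc_std a as \<in> nc_ideal s"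
      by (simp add: cong_mod_def)
  qed
  then show ?thesis by (simp add: cong_mod_def)
qed

text \<open>By \<open>b d + d b = 1 - \<kappa>\<close> the sum telescopes to
  \<open>1 - \<kappa>^n\<close>. Since \<open>B\<close> has one summand fewer on \<open>b z\<close>
  than on \<open>z\<close>, the term \<open>b \<kappa>^n d z\<close> has no partner;
  \<open>karoubi_pow_degree\<close> accounts for it.\<close>

lemma hb_cB:
  assumes z: "z \<in> nc_part n"
  shows "hb (cB z) + cB (hb z) \<approx>\<^bsub>nc_ideal s\<^esub> 0"
proof -
  have dz: "nc_diff z \<in> nc_part (Suc n)" by (rule nc_diff_hom_part[OF z])
  have 1: "hb (cB z) \<approx>\<^bsub>nc_ideal s\<^esub> (\<Sum>i<n. (karoubi ^^ i) (hb (nc_diff z))) + hb ((karoubi ^^ n) (nc_diff z))"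
  proof -
    have "hb (cB z) = (\<Sum>i<n. hb ((karoubi ^^ i) (nc_diff z))) + hb ((karoubi ^^ n) (nc_diff z))"
      by (simp add: cB_eq[OF z] linear_sum[OF linear_hb] linear_add[OF linear_hb] flip: lessThan_Suc_atMost)
    then show ?thesis
      by (simp only:) (intro nc.add nc.refl nc.sum karoubi_pow_hb[OF dz])
  qed
  have 2: "cB (hb z) = (\<Sum>i<n. (karoubi ^^ i) (nc_diff (hb z)))"
  proof (cases n)
    case 0
    then show ?thesis using z by (simp add: hb_0 linear_0[OF linear_cB])
  next
    case (Suc m)
    then show ?thesis using z cB_eq[OF hb_hom_part, of z m] by (simp only: lessThan_Suc_atMost)
  qed
  have 3: "(\<Sum>i<n. (karoubi ^^ i) (hb (nc_diff z))) + (\<Sum>i<n. (karoubi ^^ i) (nc_diff (hb z))) = z - (karoubi ^^ n) z"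
  proof -
    have "hb (nc_diff z) + nc_diff (hb z) = z - karoubi z" by (simp add: karoubi_def)
    then have "(karoubi ^^ i) (hb (nc_diff z)) + (karoubi ^^ i) (nc_diff (hb z)) = (karoubi ^^ i) z - (karoubi ^^ Suc i) z" for i
      by (simp add: linear_add[OF linear_karoubi_pow, symmetric] linear_diff[OF linear_karoubi_pow] funpow_swap1)
    then have "(\<Sum>i<n. (karoubi ^^ i) (hb (nc_diff z))) + (\<Sum>i<n. (karoubi ^^ i) (nc_diff (hb z))) =
        (\<Sum>i<n. (karoubi ^^ i) z - (karoubi ^^ Suc i) z)"
      by (simp only: sum.distrib[symmetric])
    also have "\<dots> = z - (karoubi ^^ n) z"
      using sum_lessThan_telescope'[of "\<lambda>i. (karoubi ^^ i) z" n] by simp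
    finally show ?thesis .
  qed
  have "hb (cB z) + cB (hb z) \<approx>\<^bsub>nc_ideal s\<^esub>
      (\<Sum>i<n. (karoubi ^^ i) (hb (nc_diff z))) + hb ((karoubi ^^ n) (nc_diff z)) + (\<Sum>i<n. (karoubi ^^ i) (nc_diff (hb z)))"
    unfolding 2 by (intro nc.add 1 nc.refl)
  also have "\<dots> = z - ((karoubi ^^ n) z - hb ((karoubi ^^ n) (nc_diff z)))"
    using 3 by (simp add: algebra_simps)
  also have "\<dots> \<approx>\<^bsub>nc_ideal s\<^esub> z - z"
    by (intro nc.diff nc.refl karoubi_pow_degree[OF z])
  finally show ?thesis by simp
qed

text \<open>\<open>d\<close> commutes with \<kappa> modulo the ideal, so
  \<open>d \<kappa>^i d = \<kappa>^i d d = 0\<close>.\<close>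

lemma cB_cB:
  assumes z: "z \<in> nc_part n"
  shows "cB (cB z) \<in> nc_ideal s"
proof -
  have "nc_diff ((karoubi ^^ i) (nc_diff z)) \<in> nc_ideal s" for i
    using nc.mem_cong[OF karoubi_pow_diff] karoubi_pow_ideal[OF nc_diff_diff] by blast
  then have "nc_diff (cB z) \<in> nc_ideal s"
    by (simp add: cB_eq[OF z] linear_sum[OF linear_nc_diff] nc.sum_mem)
  then show ?thesis
    unfolding cB_eq[OF cB_hom_part[OF z]] by (intro nc.sum_mem karoubi_pow_ideal)
qed

lemma is_complex_hochschild: "is_complex (hochschild_complex s)"
proof -
  let ?b = "hochschild_b s" and ?B = "connes_B s" and ?I = "nc_ideal s"
  let ?Z = "\<lambda>n. {z \<in> nc_part n. ?b z \<in> ?I}" and ?N = "\<lambda>n. {z \<in> nc_part n. \<exists>y\<in>nc_part (Suc n). z - ?b y \<in> ?I}"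
  have bb: "?b (?b y) \<in> ?I" if y: "y \<in> nc_part (Suc n)" for y n
  proof -
    have "?b (?b y) \<approx>\<^bsub>?I\<^esub> hb (?b y)" by (rule hochschild_b_eq[OF hochschild_b_hom_part[OF y]])
    also have "\<dots> \<approx>\<^bsub>?I\<^esub> hb (hb y)" by (rule hb_cong[OF hochschild_b_eq[OF y]])
    also have "\<dots> \<approx>\<^bsub>?I\<^esub> 0" by (simp add: nc.zero_iff hb_hb[OF y])
    finally show ?thesis by (simp add: nc.zero_iff)
  qed
  have bB: "?b (?B z) \<approx>\<^bsub>?I\<^esub> - cB (hb z)" if z: "z \<in> nc_part n" for z n
  proof -
    have "?b (?B z) \<approx>\<^bsub>?I\<^esub> hb (?B z)" by (rule hochschild_b_eq[OF connes_B_hom_part[OF z]])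
    also have "\<dots> \<approx>\<^bsub>?I\<^esub> hb (cB z)" by (rule hb_cong[OF connes_B_eq[OF z]])
    also have "\<dots> \<approx>\<^bsub>?I\<^esub> - cB (hb z)" by (rule nc.cong_of_diff[OF hb_cB[OF z]]) simp
    finally show ?thesis .
  qed
  have 1: "pscale.subspace (?Z n)" for n
    unfolding pscale.subspace_def
    by (auto simp: hom_part_0 hom_part_add hom_part_pscale linear_0[OF linear_hochschild_b] linear_add[OF linear_hochschild_b]
        linear_scale[OF linear_hochschild_b] nc.zero_mem nc.add_mem ideal_pscale[OF nc.two_sided_ideal_axioms])
  have 2: "pscale.subspace (?N n)" for n
    unfolding pscale.subspace_def
  proof (intro conjI ballI allI)
    show "0 \<in> ?N n"
      using hom_part_0[of nc_deg] nc.zero_mem by (auto intro!: bexI[of _ 0] simp: linear_0[OF linear_hochschild_b])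
    fix x assume "x \<in> ?N n"
    then obtain x' where x: "x \<in> nc_part n" "x' \<in> nc_part (Suc n)" "x - ?b x' \<in> ?I" by blast
    show "pscale c x \<in> ?N n" for c
      using x ideal_pscale[OF nc.two_sided_ideal_axioms x(3), of c]
      by (auto intro!: hom_part_pscale bexI[of _ "pscale c x'"]
          simp: linear_scale[OF linear_hochschild_b] pscale.scale_right_diff_distrib)
    fix y assume "y \<in> ?N n"
    then obtain y' where y: "y \<in> nc_part n" "y' \<in> nc_part (Suc n)" "y - ?b y' \<in> ?I" by blast
    show "x + y \<in> ?N n"
      using x y nc.add_mem[OF x(3) y(3)]
      by (auto intro!: hom_part_add bexI[of _ "x' + y'"] simp: linear_add[OF linear_hochschild_b] algebra_simps)
  qed
  have 3: "?N n \<subseteq> ?Z n" for n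
  proof
    fix z assume "z \<in> ?N n"
    then obtain y where y: "z \<in> nc_part n" "y \<in> nc_part (Suc n)" "z \<approx>\<^bsub>?I\<^esub> ?b y" by (auto simp: cong_mod_def)
    then show "z \<in> ?Z n" using nc.mem_cong[OF hochschild_b_cong[OF y(3)]] bb[OF y(2)] by simp
  qed
  have 4: "?B z \<in> ?Z (Suc n)" if "z \<in> ?Z n" for z n
  proof -
    have z: "z \<in> nc_part n" "?b z \<in> ?I" using that by auto
    then have "hb z \<in> ?I" using nc.mem_cong[OF hochschild_b_eq[OF z(1)]] by simp
    then have "?b (?B z) \<in> ?I" using nc.mem_cong[OF bB[OF z(1)]] by (simp add: nc.minus_mem cB_ideal)
    then show ?thesis using connes_B_hom_part[OF z(1)] by simp
  qed
  have 5: "?B z \<in> ?N (Suc n)" if "z \<in> ?N n" for z n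
  proof -
    obtain y where y: "z \<in> nc_part n" "y \<in> nc_part (Suc n)" "z \<approx>\<^bsub>?I\<^esub> ?b y" using \<open>z \<in> ?N n\<close> by (auto simp: cong_mod_def)
    have "z \<approx>\<^bsub>?I\<^esub> hb y" by (rule nc.trans[OF y(3) hochschild_b_eq[OF y(2)]])
    then have "?B z \<approx>\<^bsub>?I\<^esub> cB (hb y)" by (rule nc.trans[OF connes_B_eq[OF y(1)] cB_cong])
    \<comment> \<open>Boundaries stay boundaries because \<open>B b y = - b B y\<close>; this gives
      the witness \<open>- B y\<close>.\<close>
    then have "?B z \<approx>\<^bsub>?I\<^esub> ?b (- ?B y)"
      using nc.trans[OF _ nc.minus[OF nc.sym[OF bB[OF y(2)]]]] by (simp add: linear_minus[OF linear_hochschild_b])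
    moreover have "- ?B y \<in> nc_part (Suc (Suc n))" by (rule hom_part_minus[OF connes_B_hom_part[OF y(2)]])
    ultimately show ?thesis using connes_B_hom_part[OF y(1)] unfolding cong_mod_def by blast
  qed
  have 6: "?B (?B z) \<in> ?N (Suc (Suc n))" if "z \<in> ?Z n" for z n
  proof -
    have z: "z \<in> nc_part n" using that by simp
    have "?B (?B z) \<approx>\<^bsub>?I\<^esub> cB (?B z)" by (rule connes_B_eq[OF connes_B_hom_part[OF z]])
    also have "\<dots> \<approx>\<^bsub>?I\<^esub> cB (cB z)" by (rule cB_cong[OF connes_B_eq[OF z]])
    also have "\<dots> \<approx>\<^bsub>?I\<^esub> ?b 0" by (simp add: nc.zero_iff cB_cB[OF z] linear_0[OF linear_hochschild_b])
    finally have "?B (?B z) - ?b 0 \<in> ?I" by (simp add: cong_mod_def)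
    then show ?thesis using connes_B_hom_part[OF connes_B_hom_part[OF z]] hom_part_0 by blast
  qed
  show ?thesis
    unfolding is_complex_def hochschild_complex_def sq_complex.simps
    by (intro conjI allI ballI image_subsetI vector_space_pscale 1 2 3 linear_connes_B 4 5 6)
qed


subsection \<open>Hochschild classes in the extended de Rham complex\<close>

text \<open>\<open>i_Delta\<close> of a product is the sum of the contributions of its factors. The
  induction moves the factors \<open>da\<close> one by one into \<open>u\<close> and splits off
  their contributions; modulo supercommutators each is \<open>- t b \<kappa>^j\<close> of the whole
  product, where \<open>\<kappa>^j\<close> turns it until the factor in question stands
  last.\<close>

lemma i_Delta_ds:
  assumes "u \<in> nc_part m"
  shows "i_Delta s (nct_emb u) * nct_emb (nc_ds as) \<approx>\<^bsub>DRt_null\<^esub>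
    i_Delta s (nct_emb (u * nc_ds as)) + nct_t * nct_emb (\<Sum>j<length as. hb ((karoubi ^^ j) (u * nc_ds as)))"
  using assms
proof (induction as arbitrary: u m)
  case Nil
  show ?case by (simp add: nct_emb_simps DRt.refl)
next
  case (Cons a as)
  let ?D = "nc_ds as" and ?A = "gen (Alg a)" and ?q = "length as"
  note u = Cons.prems
  have da: "(nc_d a :: ('k, 'a) nc_forms) \<in> nc_part 1" using nc_ds_hom_part[of "[a]"] by simp
  have uda: "u * nc_d a \<in> nc_part (Suc m)" using hom_part_mult[OF u da] by simp
  have eu: "nct_emb u \<in> nct_part m" by (rule nct_emb_hom_part[OF u])
  have A: "nct_Alg a \<in> nct_part 0" "nct_t \<in> nct_part 2" by (simp_all add: hom_part_gen nct_deg_def)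
  have D: "nct_emb ?D \<in> nct_part ?q" by (rule nct_emb_hom_part[OF nc_ds_hom_part])
  have uD: "?D * u \<in> nc_part (?q + m)" by (rule hom_part_mult[OF nc_ds_hom_part u])
  have IH: "i_Delta s (nct_emb (u * nc_d a)) * nct_emb ?D \<approx>\<^bsub>DRt_null\<^esub>
      i_Delta s (nct_emb (u * nc_d a * ?D)) + nct_t * nct_emb (\<Sum>j<?q. hb ((karoubi ^^ j) (u * nc_d a * ?D)))"
    by (rule Cons.IH[OF uda])
  have 1: "i_Delta s (nct_emb (u * nc_d a)) = i_Delta s (nct_emb u) * nct_d a + (- 1) ^ m * (nct_emb u * i_Delta s (nct_d a))"
    using superderivation_hom[OF superderivation_i_Delta eu] by (simp add: nct_emb_simps)
  have tA: "nct_t * nct_Alg a * nct_emb ?D \<in> nct_part (2 + ?q)" "nct_t * nct_emb ?D \<in> nct_part (2 + ?q)"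
    using hom_part_mult[OF hom_part_mult[OF A(2) A(1)] D] hom_part_mult[OF A(2) D] by simp_all
  have uA: "nct_emb u * nct_Alg a \<in> nct_part m" using hom_part_mult[OF eu A(1)] by simp
  have sgn: "(- 1) ^ (m * (2 + ?q)) = ((- 1) ^ (m * ?q) :: ('k, 'a) nct_forms)"
    by (simp add: minus_one_power_iff)
  have "(- 1) ^ m * (nct_emb u * i_Delta s (nct_d a) * nct_emb ?D) \<approx>\<^bsub>DRt_null\<^esub>
      (- 1) ^ m * (nct_emb u * (nct_t * nct_Alg a - nct_Alg a * nct_t) * nct_emb ?D)"
    by (intro DRt_nct nct.mult_left nct.mult_right i_Delta_d)
  also have "\<dots> = (- 1) ^ m * (nct_emb u * (nct_t * nct_Alg a * nct_emb ?D) - (nct_emb u * nct_Alg a) * (nct_t * nct_emb ?D))"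
    by (simp add: algebra_simps)
  \<comment> \<open>The factor \<open>u\<close> is carried around to the right end, so that
    \<open>t\<close> comes first. As \<open>t\<close> is even, only the degree of \<open>?D\<close>
    matters for the sign.\<close>
  also have "\<dots> \<approx>\<^bsub>DRt_null\<^esub> (- 1) ^ m * ((- 1) ^ (m * (2 + ?q)) * ((nct_t * nct_Alg a * nct_emb ?D) * nct_emb u) -
      (- 1) ^ (m * (2 + ?q)) * ((nct_t * nct_emb ?D) * (nct_emb u * nct_Alg a)))"
    by (intro cong_mod_sign[OF DRt.add_subgroup_axioms] DRt.diff DRt_commute eu uA tA)
  also have "\<dots> = - (nct_t * nct_emb ((- 1) ^ (m + m * ?q) * (?D * u * ?A - ?A * (?D * u))))"
  proof -
    have "(- 1) ^ m * ((- 1) ^ (m * ?q) * ((nct_t * nct_Alg a * nct_emb ?D) * nct_emb u) -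
        (- 1) ^ (m * ?q) * ((nct_t * nct_emb ?D) * (nct_emb u * nct_Alg a))) =
        (- 1) ^ (m + m * ?q) * (nct_t * (nct_Alg a * (nct_emb ?D * nct_emb u) - nct_emb ?D * nct_emb u * nct_Alg a))"
      by (simp only: right_diff_distrib[symmetric] sign_mult_sign mult.assoc)
    also have "\<dots> = - (nct_t * ((- 1) ^ (m + m * ?q) * (nct_emb ?D * nct_emb u * nct_Alg a - nct_Alg a * (nct_emb ?D * nct_emb u))))"
      unfolding sign_left_commute[of nct_t] by (simp add: right_diff_distrib)
    finally show ?thesis
      unfolding sgn by (simp only: nct_emb_mult nct_emb_sign nct_emb_linear nct_emb_gen)
  qed
  \<comment> \<open>After \<open>?q\<close> rotations the product ends in \<open>da\<close>, and
    there \<open>b\<close> is the commutator with \<open>a\<close>.\<close>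
  also have "\<dots> \<approx>\<^bsub>DRt_null\<^esub> - (nct_t * nct_emb (hb ((karoubi ^^ ?q) (u * nc_d a * ?D))))"
  proof -
    have "(karoubi ^^ ?q) (u * nc_d a * ?D) \<approx>\<^bsub>nc_ideal s\<^esub> (- 1) ^ ((m + ?q) * ?q) * (?D * (u * nc_d a))"
      by (rule karoubi_pow_ds[OF uda]) simp
    then have "hb ((karoubi ^^ ?q) (u * nc_d a * ?D)) \<approx>\<^bsub>nc_ideal s\<^esub> hb ((- 1) ^ ((m + ?q) * ?q) * (?D * (u * nc_d a)))"
      by (rule hb_cong)
    also have "\<dots> = (- 1) ^ ((m + ?q) * ?q) * hb (?D * u * nc_d a)"
      by (simp add: linear_sign[OF linear_hb] mult.assoc)
    also have "\<dots> \<approx>\<^bsub>nc_ideal s\<^esub> (- 1) ^ ((m + ?q) * ?q) * ((- 1) ^ (?q + m) * (?D * u * ?A - ?A * (?D * u)))"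
      by (intro nc.mult_left hb_d uD)
    also have "\<dots> = (- 1) ^ (m + m * ?q) * (?D * u * ?A - ?A * (?D * u))"
    proof -
      \<comment> \<open>The two exponents differ by \<open>?q * ?q + ?q\<close>, which is
        even.\<close>
      have *: "even ((m + ?q) * ?q + (?q + m)) = even (m + m * ?q)"
        by (cases "even ?q"; cases "even m") (simp_all only: even_add even_mult_iff simp_thms)
      have "(- 1) ^ ((m + ?q) * ?q + (?q + m)) = ((- 1) ^ (m + m * ?q) :: ('k, 'a) nc_forms)"
        by (simp only: minus_one_power_iff *)
      then show ?thesis by (simp only: sign_mult_sign)
    qed
    finally show ?thesis
      by (rule DRt_nct[OF nct.minus[OF nct.mult_left[OF nct_emb_cong[OF nc.sym]]]])
  qed
  finally have 2: "(- 1) ^ m * (nct_emb u * i_Delta s (nct_d a) * nct_emb ?D) \<approx>\<^bsub>DRt_null\<^esub>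
      - (nct_t * nct_emb (hb ((karoubi ^^ ?q) (u * nc_d a * ?D))))" .
  have "i_Delta s (nct_emb u) * nct_emb (nc_ds (a # as)) =
      i_Delta s (nct_emb (u * nc_d a)) * nct_emb ?D - (- 1) ^ m * (nct_emb u * i_Delta s (nct_d a) * nct_emb ?D)"
    unfolding 1 by (simp add: nct_emb_simps distrib_right mult.assoc)
  also have "\<dots> \<approx>\<^bsub>DRt_null\<^esub>
      i_Delta s (nct_emb (u * nc_d a * ?D)) + nct_t * nct_emb (\<Sum>j<?q. hb ((karoubi ^^ j) (u * nc_d a * ?D))) -
      - (nct_t * nct_emb (hb ((karoubi ^^ ?q) (u * nc_d a * ?D))))"
    by (rule DRt.diff[OF IH 2])
  also have "\<dots> = i_Delta s (nct_emb (u * nc_ds (a # as))) +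
      nct_t * nct_emb (\<Sum>j<length (a # as). hb ((karoubi ^^ j) (u * nc_ds (a # as))))"
    by (simp add: nct_emb_linear distrib_left mult.assoc)
  finally show ?case .
qed

text \<open>\<open>i_Delta_ds\<close> with \<open>u = a\<close>, for which the left-hand side
  vanishes as \<open>i_Delta\<close> kills \<open>a\<close>.\<close>

lemma i_Delta_hb:
  assumes z: "z \<in> nc_part n"
  shows "i_Delta s (nct_emb z) + nct_t * nct_emb (\<Sum>j<n. hb ((karoubi ^^ j) z)) \<in> DRt_null"
proof (rule nc_std_induct[OF nc_closed_linear_DRt[where f = "(\<lambda>z. i_Delta s (nct_emb z) + nct_t * nct_emb (\<Sum>j<n. hb ((karoubi ^^ j) z)))"] _ z])
  note lin = superderivation_linear[OF superderivation_i_Delta]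
  show "Vector_Spaces.linear pscale pscale (\<lambda>z. i_Delta s (nct_emb z) + nct_t * nct_emb (\<Sum>j<n. hb ((karoubi ^^ j) z)))"
    by (rule linear_pscaleI) (simp_all add: nct_emb_linear linear_add[OF lin] linear_scale[OF lin] linear_add[OF linear_karoubi_pow]
        linear_scale[OF linear_karoubi_pow] linear_add[OF linear_hb] linear_scale[OF linear_hb] sum.distrib distrib_left
        pscale_mult_right pscale_add flip: pscale.scale_sum_right)
  show "i_Delta s (nct_emb z) + nct_t * nct_emb (\<Sum>j<n. hb ((karoubi ^^ j) z)) \<in> DRt_null" if "z \<in> nc_ideal s" for z
    using that by (intro DRt_nullI(1) nct.add_mem nct.mult_left_mem i_Delta_ideal nct_emb_ideal nc.sum_mem hb_ideal karoubi_pow_ideal)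
  fix a :: 'a and as :: "'a list" assume "length as = n"
  then show "i_Delta s (nct_emb (nc_std a as)) + nct_t * nct_emb (\<Sum>j<n. hb ((karoubi ^^ j) (nc_std a as))) \<in> DRt_null"
    using DRt.sym[OF i_Delta_ds[OF nc_Alg_hom_part, of a as]] by (simp add: nct_emb_simps i_Delta_gen DRt.zero_iff)
qed

lemma i_Delta_cycle:
  assumes z: "z \<in> nc_part n" and cyc: "hochschild_b s z \<in> nc_ideal s"
  shows "i_Delta s (nct_emb z) \<in> DRt_null"
proof -
  have "hb z \<in> nc_ideal s" using nc.mem_cong[OF hochschild_b_eq[OF z]] cyc by simp
  then have "hb ((karoubi ^^ j) z) \<in> nc_ideal s" for j
    using nc.mem_cong[OF karoubi_pow_hb[OF z]] karoubi_pow_ideal by blast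
  then have "nct_t * nct_emb (\<Sum>j<n. hb ((karoubi ^^ j) z)) \<in> DRt_null"
    by (intro DRt_nullI(1) nct.mult_left_mem nct_emb_ideal nc.sum_mem)
  from DRt.diff_mem[OF i_Delta_hb[OF z] this] show ?thesis by simp
qed

text \<open>Up to sign \<open>b (\<alpha> da)\<close> is \<open>[\<alpha>, a]\<close>, a
  supercommutator because \<open>a\<close> has degree 0. Hochschild boundaries therefore evaluate to
  zero.\<close>

lemma hb_DRt_null:
  assumes z: "z \<in> nc_part (Suc n)"
  shows "nct_emb (hb z) \<in> DRt_null"
proof (rule nc_snoc_induct[OF nc_closed_linear_DRt[where f = "(\<lambda>z. nct_emb (hb z))"] _ z])
  show "Vector_Spaces.linear pscale pscale (\<lambda>z. nct_emb (hb z))" by (rule linear_compose[OF linear_hb linear_nct_emb])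
  show "nct_emb (hb z) \<in> DRt_null" if "z \<in> nc_ideal s" for z
    using that by (intro DRt_nullI(1) nct_emb_ideal hb_ideal)
  fix \<alpha> :: "('k, 'a) nc_forms" and a :: 'a assume \<alpha>: "\<alpha> \<in> nc_part n"
  have "nct_emb \<alpha> * nct_Alg a \<approx>\<^bsub>DRt_null\<^esub> (- 1) ^ (n * 0) * (nct_Alg a * nct_emb \<alpha>)"
    by (intro DRt_commute nct_emb_hom_part \<alpha>) (simp add: hom_part_gen nct_deg_def)
  then have "(- 1) ^ n * (nct_emb \<alpha> * nct_Alg a - nct_Alg a * nct_emb \<alpha>) \<in> DRt_null"
    by (intro sign_mem[OF DRt.add_subgroup_axioms]) (simp add: cong_mod_def)
  moreover have "nct_emb (hb (\<alpha> * nc_d a)) \<approx>\<^bsub>DRt_null\<^esub> (- 1) ^ n * (nct_emb \<alpha> * nct_Alg a - nct_Alg a * nct_emb \<alpha>)"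
    using DRt_nct[OF nct_emb_cong[OF hb_d[OF \<alpha>, of a]]] by (simp add: nct_emb_simps nct_emb_sign)
  ultimately show "nct_emb (hb (\<alpha> * nc_d a)) \<in> DRt_null" using DRt.mem_cong by blast
qed

lemma karoubi_DRt:
  assumes z: "z \<in> nc_part (Suc n)"
  shows "nct_emb (karoubi z) \<approx>\<^bsub>DRt_null\<^esub> nct_emb z"
proof -
  have "nct_emb (karoubi z) - nct_emb z \<in> DRt_null"
  proof (rule nc_snoc_induct[OF nc_closed_linear_DRt[where f = "(\<lambda>z. nct_emb (karoubi z) - nct_emb z)"] _ z])
    show "Vector_Spaces.linear pscale pscale (\<lambda>z. nct_emb (karoubi z) - nct_emb z)"
      by (rule linear_pscaleI) (simp_all add: nct_emb_linear linear_add[OF linear_karoubi] linear_scale[OF linear_karoubi]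
          pscale.scale_right_diff_distrib)
    show "nct_emb (karoubi z) - nct_emb z \<in> DRt_null" if "z \<in> nc_ideal s" for z
      using that by (intro DRt_nullI(1) nct.diff_mem nct_emb_ideal karoubi_ideal)
    fix \<alpha> :: "('k, 'a) nc_forms" and a :: 'a assume \<alpha>: "\<alpha> \<in> nc_part n"
    have k: "nct_emb (karoubi (\<alpha> * nc_d a)) \<approx>\<^bsub>DRt_null\<^esub> (- 1) ^ n * (nct_d a * nct_emb \<alpha>)"
      using DRt_nct[OF nct_emb_cong[OF karoubi_d[OF \<alpha>, of a]]] by (simp add: nct_emb_simps nct_emb_sign)
    have "nct_emb \<alpha> * nct_d a \<approx>\<^bsub>DRt_null\<^esub> (- 1) ^ (n * 1) * (nct_d a * nct_emb \<alpha>)"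
      by (intro DRt_commute nct_emb_hom_part \<alpha>) (simp add: hom_part_gen nct_deg_def)
    then have c: "nct_emb (\<alpha> * nc_d a) \<approx>\<^bsub>DRt_null\<^esub> (- 1) ^ n * (nct_d a * nct_emb \<alpha>)"
      by (simp add: nct_emb_simps)
    show "nct_emb (karoubi (\<alpha> * nc_d a)) - nct_emb (\<alpha> * nc_d a) \<in> DRt_null"
      using DRt.trans[OF k DRt.sym[OF c]] by (simp only: cong_mod_def)
  qed
  then show ?thesis by (simp add: cong_mod_def)
qed

lemma connes_B_DRt:
  assumes z: "z \<in> nc_part n"
  shows "nct_emb (connes_B s z) \<approx>\<^bsub>DRt_null\<^esub> (\<Sum>i\<le>n. nct_differential s (nct_emb z))"
proof -
  have dz: "nc_diff z \<in> nc_part (Suc n)" by (rule nc_diff_hom_part[OF z])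
  have k: "nct_emb ((karoubi ^^ i) (nc_diff z)) \<approx>\<^bsub>DRt_null\<^esub> nct_emb (nc_diff z)" for i
  proof (induction i)
    case (Suc i)
    show ?case using DRt.trans[OF karoubi_DRt[OF karoubi_pow_hom_part[OF dz]] Suc] by simp
  qed (simp add: DRt.refl)
  have "nct_emb (connes_B s z) \<approx>\<^bsub>DRt_null\<^esub> nct_emb (cB z)"
    by (rule DRt_nct[OF nct_emb_cong[OF connes_B_eq[OF z]]])
  also have "nct_emb (cB z) = (\<Sum>i\<le>n. nct_emb ((karoubi ^^ i) (nc_diff z)))"
    by (simp add: cB_eq[OF z] linear_sum[OF linear_nct_emb])
  also have "\<dots> \<approx>\<^bsub>DRt_null\<^esub> (\<Sum>i\<le>n. nct_emb (nc_diff z))"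
    by (intro DRt.sum k)
  finally show ?thesis by (simp only: nct_emb_diff)
qed

end

context rep_setting
begin

lemma ev_emb_econst:
  assumes z: "z \<in> nc_part n"
  obtains \<omega> where "\<omega> \<in> hom_part kd_deg n" "evT (nct_emb z) = econst \<omega>"
proof -
  have "\<forall>i. \<exists>\<omega>. \<omega> \<in> hom_part kd_deg n \<and> evM (nct_emb z) i i = econst \<omega>"
    using evM_emb_econst[OF z] by blast
  from choice[OF this] obtain \<omega> where
    \<omega>: "\<And>i. \<omega> i \<in> hom_part kd_deg n" "\<And>i. evM (nct_emb z) i i = econst (\<omega> i)"
    by blast
  show thesis
    by (rule that[of "\<Sum>i\<in>Bs. \<omega> i"]) (simp_all add: ev_def \<omega> linear_sum[OF linear_econst] hom_part_sum)
qed

text \<open>The contraction with a matrix unit is the coefficient of the corresponding coordinate in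
  \<open>\<delta> (econst \<omega>)\<close>, and membership in \<open>EZ\<close> is tested
  coefficientwise.\<close>

lemma EZ_d_g_econst:
  assumes \<omega>: "\<delta> (econst \<omega>) \<in> EZ" and ij: "i \<in> Bs" "j \<in> Bs"
  shows "\<iota> (mat_unit i j) \<omega> \<in> K"
proof -
  have inj: "Poly_Mapping.single x (Suc 0) = Poly_Mapping.single y (Suc 0) \<longleftrightarrow> x = y" for x y :: "'v \<times> 'v"
    by (metis lookup_single_eq lookup_single_not_eq nat.distinct(1))
  have "Poly_Mapping.lookup (econst \<eta> * pvar x) (Poly_Mapping.single y 1) = (if x = y then \<eta> else 0)"
    for \<eta> :: "('k, 'a, 'v) rep_forms" and x y :: "'v \<times> 'v"
    by (simp add: econst_def pvar_def mult_single lookup_single when_def inj)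
  then have "Poly_Mapping.lookup (\<delta> (econst \<omega>)) (Poly_Mapping.single (i, j) 1) =
      (\<Sum>k\<in>Bs. \<Sum>l\<in>Bs. if (k, l) = (i, j) then \<iota> (mat_unit k l) \<omega> else 0)"
    by (simp add: d_g_econst lookup_sum)
  also have "\<dots> = (\<Sum>k\<in>Bs. if k = i then (\<Sum>l\<in>Bs. if l = j then \<iota> (mat_unit i j) \<omega> else 0) else 0)"
    by (intro sum.cong) (auto intro!: sum.cong)
  also have "\<dots> = \<iota> (mat_unit i j) \<omega>" using fin ij by simp
  finally show ?thesis using \<omega> by (metis (no_types, lifting) eq_zero_def mem_Collect_eq)
qed

text \<open>Lie derivatives vanish on every trace. The cycle condition is used for the contractions:
  it makes \<open>\<delta>\<close> of the trace zero, hence the contractions with matrix units, and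
  by \<open>contract_expand\<close> those with all endomorphisms.\<close>

lemma ev_cycle_basic:
  assumes z: "z \<in> nc_part n" and cyc: "hochschild_b s z \<in> nc_ideal s"
  shows "evT (nct_emb z) \<in> econst ` basic_forms s sV Bs n"
proof -
  obtain \<omega> where \<omega>: "\<omega> \<in> hom_part kd_deg n" "evT (nct_emb z) = econst \<omega>" by (rule ev_emb_econst[OF z])
  have "\<L> (entry sV Bs x) \<omega> \<in> K" for x
    using ev_invariant[of "entry sV Bs x" "nct_emb z"] by (simp add: \<omega> mat_lie_econst EZ_econst)
  moreover have "\<iota> (entry sV Bs x) \<omega> \<in> K" for x
  proof -
    have "\<delta> (econst \<omega>) \<in> EZ"
      using ev_contraction[of "nct_emb z"] ev_DRt_null[OF i_Delta_cycle[OF z cyc]] EZ.mem_cong unfolding \<omega> by blast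
    then have "(\<Sum>i\<in>Bs. \<Sum>j\<in>Bs. pscale (entry sV Bs x i j) (\<iota> (mat_unit i j) \<omega>)) \<in> K"
      by (intro K.sum_mem K_pscale_mem EZ_d_g_econst)
    then show ?thesis using K.mem_cong[OF contract_expand[OF supported_entry]] by blast
  qed
  ultimately show ?thesis
    using \<omega> by (auto simp: basic_forms_def rep_contract_conv rep_lie_conv)
qed

lemma induces_morphism_hochschild:
  "induces_morphism (hochschild_complex s) (basic_complex s sV Bs) (\<lambda>z. evT (nct_emb z))"
proof -
  have econst_mem: "econst \<omega> \<in> econst ` (hom_part kd_deg n \<inter> K)" if "\<omega> \<in> hom_part kd_deg n" "econst \<omega> \<in> EZ" for \<omega> n
    using that by (simp add: EZ_econst)
  have 1: "evT (nct_emb z) \<in> econst ` (hom_part kd_deg n \<inter> K)"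
    if z: "z \<in> nc_part n" and y: "y \<in> nc_part (Suc n)" "z - hochschild_b s y \<in> nc_ideal s" for z y n
  proof -
    obtain \<omega> where \<omega>: "\<omega> \<in> hom_part kd_deg n" "evT (nct_emb z) = econst \<omega>" by (rule ev_emb_econst[OF z])
    have "z \<approx>\<^bsub>nc_ideal s\<^esub> hb y"
      using nc.trans[OF _ hochschild_b_eq[OF y(1)]] y(2) by (simp add: cong_mod_def)
    then have "nct_emb z \<in> DRt_null"
      using DRt.mem_cong[OF DRt_nct[OF nct_emb_cong]] hb_DRt_null[OF y(1)] by blast
    then have "econst \<omega> \<in> EZ" unfolding \<omega>(2)[symmetric] by (rule ev_DRt_null)
    then show ?thesis unfolding \<omega>(2) by (rule econst_mem[OF \<omega>(1)])
  qed
  have 2: "evT (nct_emb (connes_B s z)) - escale (of_nat (n + 1)) (map_d (evT (nct_emb z))) \<in>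
      econst ` (hom_part kd_deg (Suc n) \<inter> K)" if z: "z \<in> nc_part n" for z n
  proof -
    obtain \<omega> where \<omega>: "\<omega> \<in> hom_part kd_deg n" "evT (nct_emb z) = econst \<omega>" by (rule ev_emb_econst[OF z])
    obtain \<eta> where \<eta>: "\<eta> \<in> hom_part kd_deg (Suc n)" "evT (nct_emb (connes_B s z)) = econst \<eta>"
      by (rule ev_emb_econst[OF connes_B_hom_part[OF z]])
    have eq: "evT (nct_emb (connes_B s z)) - escale (of_nat (n + 1)) (map_d (evT (nct_emb z))) =
        econst (\<eta> - pscale (of_nat (n + 1)) (d_DR \<omega>))"
      unfolding \<omega> \<eta> econst_simps map_econst[where f = d_DR, OF linear_0[OF linear_d_DR]] ..
    have "evT (nct_emb (connes_B s z)) \<approx>\<^bsub>EZ\<^esub> evT (\<Sum>i\<le>n. nct_differential s (nct_emb z))"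
      by (rule ev_cong[OF connes_B_DRt[OF z]])
    also have "\<dots> = (\<Sum>i\<le>n. evT (nct_differential s (nct_emb z)))" by (rule linear_sum[OF linear_ev])
    also have "\<dots> \<approx>\<^bsub>EZ\<^esub> (\<Sum>i\<le>n. map_d (evT (nct_emb z)))"
      by (intro EZ.sum EZ.sym[OF ev_differential])
    also have "\<dots> = escale (of_nat (n + 1)) (map_d (evT (nct_emb z)))"
    proof -
      have of_nat: "(of_nat (n + 1) :: 'k) = (\<Sum>i\<le>n. 1)" by simp
      show ?thesis unfolding of_nat by (simp only: escale.scale_sum_left escale.scale_one)
    qed
    finally have "econst (\<eta> - pscale (of_nat (n + 1)) (d_DR \<omega>)) \<in> EZ"
      unfolding cong_mod_def eq .
    then show ?thesis
      unfolding eq by (intro econst_mem hom_part_diff hom_part_pscale d_DR_hom_part \<omega> \<eta>)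
  qed
  have "Vector_Spaces.linear pscale escale (\<lambda>z. evT (nct_emb z))"
    by (rule linear_compose[OF linear_nct_emb linear_ev])
  then show ?thesis
    unfolding induces_morphism_def
    using is_complex_hochschild is_complex_basic ev_cycle_basic 1 2
    by (auto simp: hochschild_complex_def basic_complex_def)
qed

end

theorem theorem6p2p5:
  fixes s :: "'k::field_char_0 \<Rightarrow> 'a::{ring, monoid_mult} \<Rightarrow> 'a"
    and sV :: "'k \<Rightarrow> 'v::ab_group_add \<Rightarrow> 'v"
    and Bs :: "'v set"
  assumes "assoc_algebra s"
    and "finitely_presented s"
    and "finite_dimensional_vector_space sV Bs"
    and "rep_scheme_nonempty s Bs"
  shows "induces_morphism (hochschild_complex s) (basic_complex s sV Bs) (\<lambda>z. ev s Bs (nct_emb z)) \<and>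
    induces_morphism (DRt_complex s) (equivariant_complex s sV Bs) (ev s Bs)"
proof -
  interpret rep_setting s sV Bs
    using assms(1,3) by (simp add: rep_setting_def)
  show ?thesis using induces_morphism_hochschild induces_morphism_DRt by blast
qed

end
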